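(* Suppose that, for a given external force $t(x)$ on $\Gamma_t$, $\tau\in\mathcal T_a$ is a statically admissible shear force field. If $\tau(x)$ is not identically zero over the domain $\Omega$, the canonical dual problem $(\mathcal P_2^d)$ has at most three solutions $\bar\zeta_i(x)$ $(i=1,2,3)$, defined analytically by $$\bar\zeta_1=-\frac{\alpha}{3c}+\frac{2^{4/3}\alpha^2}{3c\,\psi}+\frac{\psi}{3\cdot2^{4/3}c},$$ $$\bar\zeta_2=-\frac{\alpha}{3c}-\frac{2^{1/3}\alpha^2(1-i\sqrt3)}{3c\,\psi}-\frac{(1+i\sqrt3)\,\psi}{12\cdot2^{1/3}c},$$ $$\bar\zeta_3=-\frac{\alpha}{3c}-\frac{2^{1/3}\alpha^2(1+i\sqrt3)}{3c\,\psi}-\frac{(1-i\sqrt3)\,\psi}{12\cdot2^{1/3}c},$$ where $$\psi=\Big(-16\alpha^3+27c^2|\tau|^2+3\sqrt3\,|\tau|\sqrt{-32\alpha^3c^2+27c^4|\tau|^2}\Big)^{1/3},$$ and $$\bar u_i=\int_{x_0}^{x}(2\bar\zeta_i(x))^{-1}\tau\cdot dx,\qquad i=1,2,3,$$ are the critical solutions to $(\mathcal P_2)$: $\min\{\Pi_2(u)\mid u\in\mathcal U_a\}$. In particular, $\bar\zeta_1(x)$ is a global maximizer of $\Pi_2^d$ over $\mathcal S_a^+$, the associated $\bar u_1$ is a global minimizer of $\Pi_2$ on $\mathcal U_a$, and $$\Pi_2(\bar u_1)=\min_{u\in\mathcal U_a}\Pi_2(u)=\max_{\zeta\in\mathcal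 S_a^+}\Pi_2^d(\zeta)=\Pi_2^d(\bar\zeta_1).$$ If $|\tau(x)|^2<\eta$ for all $x\in\Omega$, then $\bar\zeta_3(x)$ and the associated $\bar u_3$ are local maximizers of $\Pi_2^d$ and $\Pi_2$, respectively, and $$\Pi_2(\bar u_3)=\max_{u\in\mathcal U_3}\Pi_2(u)=\max_{-\alpha\beta<\zeta<-2\alpha\beta/3}\Pi_2^d(\zeta)=\Pi_2^d(\bar\zeta_3).$$ If $|\tau(x)|^2<\eta$ for all $x\in\Omega\subset\mathbb R$ (one-dimensional domain), then $\bar\zeta_2(x)$ and the associated $\bar u_2$ are local minimizers of $\Pi_2^d$ and $\Pi_2$, respectively, and $$\Pi_2(\bar u_2)=\min_{u\in\mathcal U_2}\Pi_2(u)=\min_{-2\alpha\beta/3<\zeta<0}\Pi_2^d(\zeta)=\Pi_2^d(\bar\zeta_2).$$ Here $\mathcal U_2$ and $\mathcal U_3$ are neighborhoods of $\bar u_2$ and $\bar u_3$, respectively. If $|\tau(x)|^2>\eta>0$ for all $x\in\Omega$, the canonical dual problem $(\mathcal P_2^d)$ has a unique solution $\bar\zeta_1(x)$ over $\Omega$ and the primal solution $\bar u_1$ is a unique smooth global minimizer of $\Pi_2(u)$ over $\mathcal U_a$.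
   Context: $\Omega\subset\mathbb R^2$ is a sufficiently nice region (in the double-min statement, $\Omega\subset\mathbb R$) with boundary $\partial\Omega$ divided into $\Gamma_u$ and $\Gamma_t=\partial\Omega\setminus\Gamma_u$; $n$ is the unit outward normal; $t$ is a given scalar function (shear force) on $\Gamma_t$; $x_0\in\Gamma_u$; $|\tau|$ is the Euclidean norm of $\tau(x)$. Constants (the case $p=2$ of the power-law material): $\mu,b>0$, $\alpha=\epsilon-2/b\in\mathbb R$ with $\epsilon\in\mathbb R$ a given internal parameter, $\beta=\mu b/4$, $\beta_o=\mu/(2b)$, $c=4/(\mu b)$, and $\eta=\frac{16\alpha^3}{27c^2}$. Admissible spaces: $\mathcal U_a=\{u\in C[\bar\Omega;\mathbb R]\mid\nabla u\in L^{4}[\bar\Omega;\mathbb R^2],\ u(x)=0\ \forall x\in\Gamma_u\}$; $\mathcal T_a=\{\tau\in C[\bar\Omega;\mathbb R^2]\mid\nabla\cdot\tau(x)=0\ \forall x\in\Omega,\ n\cdot\tau(x)=t\ \forall x\in\Gamma_t\}$; $\mathcal E_a^*=\{\zeta\in L^{2}\mid\zeta(x)\ge-\alpha\beta\ \forall x\in\Omega\}$; $\mathcal S_a^+=\{\zeta\in\mathcal E_a^*\mid\zeta(x)\ge0\ \forall x\in\Omega,\ |\tau|^2/\zeta\in L\}$, where $L$ denotes the Lebesgue integrable functions. Primal functional: $\Pi_2(u)=\int_\Omega\big[\tfrac12\beta(|\nabla u|^2-\alpha)^2-\beta_o\big]d\Omega-\int_{\Gamma_t}t\,u\,d\Gamma$.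 Dual functional: $\Pi_2^d(\zeta)=-\int_\Omega\Big[\frac{|\tau|^2}{4\zeta}+\tfrac12c\,\zeta^2+\alpha\zeta+\beta_o\Big]d\Omega$. The canonical dual problem $(\mathcal P_2^d)$ is to maximize $\Pi_2^d$; its "solutions" here means critical points of $\Pi_2^d$, whose criticality condition is the dual algebraic equation $4\zeta^2(c\zeta+\alpha)=|\tau|^2$ at each point of $\Omega$. "Critical solutions" of $(\mathcal P_2)$ means critical points of $\Pi_2$.
   Formalization: ψ has 2|τ|² in place of |τ|²; claims on ū_i assume the line integral is well defined (ζ̄_i real, nonzero), continuous and zero on Γ_u; U_2, U_3 are gradient neighborhoods (fine for U_3); where τ has zeros, ζ̄_3 is maximal over −αβ≤ζ and the open range has only a supremum. *)

theory Defs
  imports "HOL-Analysis.Analysis"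
begin

text \<open>
  \<open>hausdorff k\<close> is the \<open>k\<close>-dimensional Hausdorff measure on the Borel sets: arc length for
  \<open>k = 1\<close> and counting measure for \<open>k = 0\<close>. Covers consist of nonempty sets, so that with
  \<open>0 ^ 0 = 1\<close> the case \<open>k = 0\<close> counts the members of a cover.
\<close>

definition hausdorff_pre :: "nat \<Rightarrow> real \<Rightarrow> 'a::euclidean_space set \<Rightarrow> ennreal" where
  "hausdorff_pre k \<delta> A =
     (INF C \<in> {C. countable C \<and> (\<forall>S\<in>C. S \<noteq> {} \<and> bounded S \<and> diameter S \<le> \<delta>) \<and> A \<subseteq> \<Union>C}.
        \<integral>\<^sup>+ S. ennreal (unit_ball_vol (real k) * (diameter S / 2) ^ k) \<partial>count_space C)"

definition hausdorff :: "nat \<Rightarrow> 'a::euclidean_space measure" where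
  "hausdorff k = measure_of UNIV (sets borel) (\<lambda>A. SUP \<delta>\<in>{0<..}. hausdorff_pre k \<delta> A)"

abbreviation surface_measure :: "'a::euclidean_space measure" where
  "surface_measure \<equiv> hausdorff (DIM('a) - 1)"

definition divergence :: "('a::euclidean_space \<Rightarrow> 'a) \<Rightarrow> 'a \<Rightarrow> real" where
  "divergence F x = (\<Sum>b\<in>Basis. frechet_derivative F (at x) b \<bullet> b)"

definition C1_map :: "('a::euclidean_space \<Rightarrow> 'b::euclidean_space) \<Rightarrow> bool" where
  "C1_map F \<longleftrightarrow> (\<forall>x. F differentiable (at x)) \<and>
     (\<forall>h. continuous_on UNIV (\<lambda>x. frechet_derivative F (at x) h))"

text \<open>
  A ``sufficiently nice'' region with outward unit normal \<open>N\<close>: a bounded domain whose boundary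
  has finite length and for which the classical divergence theorem holds for vector fields that
  are \<open>C\<^sup>1\<close> on the whole space. The last clause determines \<open>N\<close> almost everywhere on the
  boundary. In dimension one, regions are the bounded open intervals and \<open>N\<close> is \<open>-1\<close> and \<open>1\<close> at
  the left and right end point.
\<close>

definition nice_region :: "'a::euclidean_space set \<Rightarrow> ('a \<Rightarrow> 'a) \<Rightarrow> bool" where
  "nice_region \<Omega> N \<longleftrightarrow>
     open \<Omega> \<and> connected \<Omega> \<and> bounded \<Omega> \<and> \<Omega> \<noteq> {} \<and>
     emeasure surface_measure (frontier \<Omega>) < \<infinity> \<and>
     N \<in> borel_measurable borel \<and>
     (AE x in surface_measure. x \<in> frontier \<Omega> \<longrightarrow> norm (N x) = 1) \<and>
     (\<forall>F::'a \<Rightarrow> 'a. C1_map F \<longrightarrow>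
        (LINT x|lebesgue_on \<Omega>. divergence F x) =
        (LINT x:frontier \<Omega>|surface_measure. F x \<bullet> N x))"

definition test_function :: "'a::euclidean_space set \<Rightarrow> ('a \<Rightarrow> real) \<Rightarrow> bool" where
  "test_function \<Omega> \<phi> \<longleftrightarrow> C1_map \<phi> \<and> (\<exists>K. compact K \<and> K \<subseteq> \<Omega> \<and> (\<forall>x. x \<notin> K \<longrightarrow> \<phi> x = 0))"

definition has_weak_gradient ::
  "'a::euclidean_space set \<Rightarrow> ('a \<Rightarrow> real) \<Rightarrow> ('a \<Rightarrow> 'a) \<Rightarrow> bool" where
  "has_weak_gradient \<Omega> u g \<longleftrightarrow>
     g \<in> borel_measurable (lebesgue_on \<Omega>) \<and>
     (\<forall>K. compact K \<and> K \<subseteq> \<Omega> \<longrightarrow> integrable (lebesgue_on K) g) \<and>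
     (\<forall>\<phi> h. test_function \<Omega> \<phi> \<longrightarrow>
        (LINT x|lebesgue_on \<Omega>. u x * frechet_derivative \<phi> (at x) h) =
        - (LINT x|lebesgue_on \<Omega>. (g x \<bullet> h) * \<phi> x))"

text \<open>The weak gradient is unique up to null sets, so the choice below is harmless.\<close>

definition weak_gradient :: "'a::euclidean_space set \<Rightarrow> ('a \<Rightarrow> real) \<Rightarrow> 'a \<Rightarrow> 'a" where
  "weak_gradient \<Omega> u = (SOME g. has_weak_gradient \<Omega> u g)"

definition U_adm :: "'a::euclidean_space set \<Rightarrow> 'a set \<Rightarrow> ('a \<Rightarrow> real) set" where
  "U_adm \<Omega> \<Gamma>u = {u. continuous_on (closure \<Omega>) u \<and>
     (\<exists>g. has_weak_gradient \<Omega> u g \<and> integrable (lebesgue_on \<Omega>) (\<lambda>x. norm (g x) ^ 4)) \<and>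
     (\<forall>x\<in>\<Gamma>u. u x = 0)}"

text \<open>
  The traction condition is imposed almost everywhere on the loaded part of the boundary, since
  the normal does not exist at corners.
\<close>

definition T_adm ::
  "'a::euclidean_space set \<Rightarrow> ('a \<Rightarrow> 'a) \<Rightarrow> 'a set \<Rightarrow> ('a \<Rightarrow> real) \<Rightarrow> ('a \<Rightarrow> 'a) set" where
  "T_adm \<Omega> N \<Gamma>u t = {\<tau>. continuous_on (closure \<Omega>) \<tau> \<and>
     (\<forall>x\<in>\<Omega>. \<tau> differentiable (at x) \<and> divergence \<tau> x = 0) \<and>
     (AE x in surface_measure. x \<in> frontier \<Omega> - \<Gamma>u \<longrightarrow> N x \<bullet> \<tau> x = t x)}"

definition L2_fun :: "'a::euclidean_space set \<Rightarrow> ('a \<Rightarrow> real) set" where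
  "L2_fun \<Omega> = {\<zeta>. \<zeta> \<in> borel_measurable (lebesgue_on \<Omega>) \<and>
     integrable (lebesgue_on \<Omega>) (\<lambda>x. (\<zeta> x)\<^sup>2)}"

text \<open>
  \<open>|\<tau>|\<^sup>2 / \<zeta>\<close> is Lebesgue integrable, where the quotient is infinite if \<open>\<zeta> = 0 \<noteq> \<tau>\<close> and
  \<open>0\<close> if \<open>\<zeta> = 0 = \<tau>\<close>. The first conjunct is needed because division by zero yields \<open>0\<close> in HOL.
\<close>

definition quotient_integrable ::
  "'a::euclidean_space set \<Rightarrow> ('a \<Rightarrow> 'a) \<Rightarrow> ('a \<Rightarrow> real) \<Rightarrow> bool" where
  "quotient_integrable \<Omega> \<tau> \<zeta> \<longleftrightarrow>
     (AE x in lebesgue_on \<Omega>. \<zeta> x = 0 \<longrightarrow> \<tau> x = 0) \<and>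
     integrable (lebesgue_on \<Omega>) (\<lambda>x. (norm (\<tau> x))\<^sup>2 / \<zeta> x)"

definition E_adm :: "'a::euclidean_space set \<Rightarrow> real \<Rightarrow> real \<Rightarrow> ('a \<Rightarrow> real) set" where
  "E_adm \<Omega> \<alpha> \<beta> = {\<zeta> \<in> L2_fun \<Omega>. \<forall>x\<in>\<Omega>. - \<alpha> * \<beta> \<le> \<zeta> x}"

definition S_adm ::
  "'a::euclidean_space set \<Rightarrow> ('a \<Rightarrow> 'a) \<Rightarrow> real \<Rightarrow> real \<Rightarrow> ('a \<Rightarrow> real) set" where
  "S_adm \<Omega> \<tau> \<alpha> \<beta> = {\<zeta> \<in> E_adm \<Omega> \<alpha> \<beta>. (\<forall>x\<in>\<Omega>. 0 \<le> \<zeta> x) \<and> quotient_integrable \<Omega> \<tau> \<zeta>}"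

text \<open>The functions at which the dual functional is finite.\<close>

definition dual_domain :: "'a::euclidean_space set \<Rightarrow> ('a \<Rightarrow> 'a) \<Rightarrow> ('a \<Rightarrow> real) set" where
  "dual_domain \<Omega> \<tau> = {\<zeta> \<in> L2_fun \<Omega>. quotient_integrable \<Omega> \<tau> \<zeta>}"

definition primal_functional ::
  "'a::euclidean_space set \<Rightarrow> 'a set \<Rightarrow> ('a \<Rightarrow> real) \<Rightarrow> real \<Rightarrow> real \<Rightarrow> real \<Rightarrow> ('a \<Rightarrow> real) \<Rightarrow> real"
  where
  "primal_functional \<Omega> \<Gamma>u t \<alpha> \<beta> \<beta>o u =
     (LINT x|lebesgue_on \<Omega>. 1/2 * \<beta> * ((norm (weak_gradient \<Omega> u x))\<^sup>2 - \<alpha>)\<^sup>2 - \<beta>o)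
     - (LINT x:(frontier \<Omega> - \<Gamma>u)|surface_measure. t x * u x)"

definition dual_functional ::
  "'a::euclidean_space set \<Rightarrow> ('a \<Rightarrow> 'a) \<Rightarrow> real \<Rightarrow> real \<Rightarrow> real \<Rightarrow> ('a \<Rightarrow> real) \<Rightarrow> real" where
  "dual_functional \<Omega> \<tau> \<alpha> c \<beta>o \<zeta> =
     - (LINT x|lebesgue_on \<Omega>.
          (norm (\<tau> x))\<^sup>2 / (4 * \<zeta> x) + 1/2 * c * (\<zeta> x)\<^sup>2 + \<alpha> * \<zeta> x + \<beta>o)"

definition primal_critical ::
  "(('a \<Rightarrow> real) \<Rightarrow> real) \<Rightarrow> ('a \<Rightarrow> real) set \<Rightarrow> ('a \<Rightarrow> real) \<Rightarrow> bool" where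
  "primal_critical P U u \<longleftrightarrow> u \<in> U \<and>
     (\<forall>\<phi>\<in>U. ((\<lambda>s::real. P (\<lambda>x. u x + s * \<phi> x)) has_real_derivative 0) (at 0))"

text \<open>
  The variations are restricted to \<open>|v| \<le> |\<zeta>|\<close> (by homogeneity, to \<open>|v| \<le> k |\<zeta>|\<close> for
  some \<open>k\<close>): these are the directions in which \<open>\<zeta> + s v\<close> does not leave the domain of the
  dual functional, which has a singularity where its argument vanishes, for small \<open>s\<close>.
\<close>

definition dual_critical ::
  "'a::euclidean_space set \<Rightarrow> ('a \<Rightarrow> 'a) \<Rightarrow> (('a \<Rightarrow> real) \<Rightarrow> real) \<Rightarrow> ('a \<Rightarrow> real) \<Rightarrow> bool" where
  "dual_critical \<Omega> \<tau> D \<zeta> \<longleftrightarrow> \<zeta> \<in> dual_domain \<Omega> \<tau> \<and>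
     (\<forall>v \<in> borel_measurable (lebesgue_on \<Omega>). (\<forall>x\<in>\<Omega>. \<bar>v x\<bar> \<le> \<bar>\<zeta> x\<bar>) \<longrightarrow>
        ((\<lambda>s::real. D (\<lambda>x. \<zeta> x + s * v x)) has_real_derivative 0) (at 0))"

text \<open>
  A neighbourhood of \<open>u\<close> with respect to the uniform distance of gradients (the topology of weak
  local extrema in the calculus of variations) if \<open>\<delta>\<close> is a positive constant, and with respect
  to the fine (Whitney) version of that topology if \<open>\<delta>\<close> is a positive continuous function.
\<close>

definition gradient_nbhd ::
  "'a::euclidean_space set \<Rightarrow> 'a set \<Rightarrow> ('a \<Rightarrow> real) \<Rightarrow> ('a \<Rightarrow> real) \<Rightarrow> ('a \<Rightarrow> real) set" where
  "gradient_nbhd \<Omega> \<Gamma>u \<delta> u = {v \<in> U_adm \<Omega> \<Gamma>u.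
     AE x in lebesgue_on \<Omega>. norm (weak_gradient \<Omega> v x - weak_gradient \<Omega> u x) < \<delta> x}"

text \<open>
  Roots and powers are principal complex ones. With \<open>\<psi> = cubic_psi \<alpha> c s\<close>, Cardano's formulas
  \<open>cubic_root1\<close>, \<open>cubic_root2\<close>, \<open>cubic_root3\<close> give the roots of \<open>8 z\<^sup>2 (c z + \<alpha>) = s\<^sup>2\<close>. The
  roots of the dual algebraic equation \<open>4 z\<^sup>2 (c z + \<alpha>) = |\<tau>|\<^sup>2\<close>, whose discriminant changes
  sign at \<open>|\<tau>|\<^sup>2 = 16 \<alpha>\<^sup>3 / (27 c\<^sup>2)\<close>, are therefore obtained with \<open>s = sqrt 2 * |\<tau>|\<close>.
\<close>

definition cubic_psi :: "real \<Rightarrow> real \<Rightarrow> real \<Rightarrow> complex" where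
  "cubic_psi \<alpha> c s =
     (complex_of_real (- 16 * \<alpha>^3 + 27 * c\<^sup>2 * s\<^sup>2)
      + 3 * complex_of_real (sqrt 3 * s)
          * csqrt (complex_of_real (- 32 * \<alpha>^3 * c\<^sup>2 + 27 * c^4 * s\<^sup>2))) powr (1/3)"

definition cubic_root1 :: "real \<Rightarrow> real \<Rightarrow> real \<Rightarrow> complex" where
  "cubic_root1 \<alpha> c s = (let \<psi> = cubic_psi \<alpha> c s in
     - of_real (\<alpha> / (3 * c))
     + of_real (2 powr (4/3) * \<alpha>\<^sup>2) / (3 * of_real c * \<psi>)
     + \<psi> / of_real (3 * 2 powr (4/3) * c))"

definition cubic_root2 :: "real \<Rightarrow> real \<Rightarrow> real \<Rightarrow> complex" where
  "cubic_root2 \<alpha> c s = (let \<psi> = cubic_psi \<alpha> c s in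
     - of_real (\<alpha> / (3 * c))
     - of_real (2 powr (1/3) * \<alpha>\<^sup>2) * (1 - \<i> * of_real (sqrt 3)) / (3 * of_real c * \<psi>)
     - (1 + \<i> * of_real (sqrt 3)) * \<psi> / of_real (12 * 2 powr (1/3) * c))"

definition cubic_root3 :: "real \<Rightarrow> real \<Rightarrow> real \<Rightarrow> complex" where
  "cubic_root3 \<alpha> c s = (let \<psi> = cubic_psi \<alpha> c s in
     - of_real (\<alpha> / (3 * c))
     - of_real (2 powr (1/3) * \<alpha>\<^sup>2) * (1 + \<i> * of_real (sqrt 3)) / (3 * of_real c * \<psi>)
     - (1 - \<i> * of_real (sqrt 3)) * \<psi> / of_real (12 * 2 powr (1/3) * c))"

text \<open>
  \<open>line_integral_from \<Omega> x0 F u\<close> says that \<open>u x\<close> is the line integral of \<open>F\<close> from \<open>x0\<close> to \<open>x\<close>,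
  well defined in the sense of being independent of the path. Since \<open>x0\<close> and \<open>x\<close> may lie on the
  boundary, only the interior of a path is required to run in the region.
\<close>

definition path_in :: "'a::euclidean_space set \<Rightarrow> 'a \<Rightarrow> 'a \<Rightarrow> (real \<Rightarrow> 'a) \<Rightarrow> bool" where
  "path_in \<Omega> x y \<gamma> \<longleftrightarrow> valid_path \<gamma> \<and> pathstart \<gamma> = x \<and> pathfinish \<gamma> = y \<and> \<gamma> ` {0<..<1} \<subseteq> \<Omega>"

definition line_integral_from ::
  "'a::euclidean_space set \<Rightarrow> 'a \<Rightarrow> ('a \<Rightarrow> 'a) \<Rightarrow> ('a \<Rightarrow> real) \<Rightarrow> bool" where
  "line_integral_from \<Omega> x0 F u \<longleftrightarrow>
     (\<forall>x\<in>\<Omega>. \<exists>\<gamma>. path_in \<Omega> x0 x \<gamma>) \<and>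
     (\<forall>x\<in>closure \<Omega>. \<forall>\<gamma>. path_in \<Omega> x0 x \<gamma> \<longrightarrow>
        ((\<lambda>s. F (\<gamma> s) \<bullet> vector_derivative \<gamma> (at s within {0..1})) has_integral u x) {0..1})"

text \<open>
  \<open>u\<close> is the displacement \<open>\<integral> (2 Z)\<^sup>-\<^sup>1 \<tau> \<bullet> dx\<close> belonging to the root field \<open>Z\<close>: the
  integrand makes sense as a real vector field on the region, the line integral is well defined,
  and \<open>u\<close> is continuous up to the boundary and meets the boundary condition of \<open>U_adm\<close>.
\<close>

definition dual_displacement ::
  "'a::euclidean_space set \<Rightarrow> 'a set \<Rightarrow> 'a \<Rightarrow> ('a \<Rightarrow> 'a) \<Rightarrow> ('a \<Rightarrow> complex) \<Rightarrow> ('a \<Rightarrow> real) \<Rightarrow> bool"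
  where
  "dual_displacement \<Omega> \<Gamma>u x0 \<tau> Z u \<longleftrightarrow>
     (\<forall>x\<in>\<Omega>. Z x \<in> \<real> \<and> Z x \<noteq> 0) \<and>
     line_integral_from \<Omega> x0 (\<lambda>x. inverse (2 * Re (Z x)) *\<^sub>R \<tau> x) u \<and>
     continuous_on (closure \<Omega>) u \<and> (\<forall>x\<in>\<Gamma>u. u x = 0)"

end

theory Submission
  imports Defs
begin

text \<open>
  Write \<open>h(z) = |\<tau>|\<^sup>2 / (4 z) + c z\<^sup>2 / 2 + \<alpha> z\<close> for the density of the dual functional at one
  point. If \<open>r\<close> solves the dual algebraic equation \<open>4 r\<^sup>2 (c r + \<alpha>) = |\<tau>|\<^sup>2\<close>, then
  \<open>h(z) - h(r) = (z - r)\<^sup>2 (2 \<alpha> + 2 c r + c z) / (2 z)\<close> (lemma \<open>dual_density_diff\<close>), and the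
  sign of the last factor decides whether \<open>r\<close> minimizes or maximizes \<open>h\<close> over a given range. The
  dual extrema are therefore pointwise facts about the three roots. Cardano's formulas are
  placed in the ranges \<open>z \<ge> max 0 (- \<alpha> / c)\<close>, \<open>- 2 \<alpha> / (3 c) \<le> z \<le> 0\<close> and
  \<open>- \<alpha> / c \<le> z \<le> - 2 \<alpha> / (3 c)\<close>: with real cube roots where the discriminant allows it, and
  otherwise through \<open>cubic_roots_trigonometric\<close>. On each range the cubic is injective, so each
  branch depends continuously on \<open>|\<tau>|\<close>. Above the local maximum of the cubic on the negative
  axis only the positive root is left.

  For the primal functional the load is first removed: the Gauss-Green formula turns \<open>\<integral> t v\<close>
  over the loaded boundary into \<open>\<integral> \<nabla>v \<bullet> \<tau>\<close>, so that the primal functional is the integral of a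
  function of \<open>\<nabla>v\<close> alone. If \<open>\<nabla>u = \<tau> / (2 \<zeta>)\<close> for a root field \<open>\<zeta>\<close>, then, with \<open>g = \<nabla>u\<close> and
  \<open>w = \<nabla>v - \<nabla>u\<close>, the difference of the functional at \<open>v\<close> and at \<open>u\<close> is the integral of
  \<open>\<zeta> |w|\<^sup>2 + \<beta> (2 g \<bullet> w + |w|\<^sup>2)\<^sup>2 / 2\<close> (lemma \<open>primal_diff\<close>). There is no term linear in \<open>w\<close>,
  so \<open>u\<close> is critical. If \<open>\<zeta> > 0\<close>, the integrand is nonnegative and vanishes only for \<open>w = 0\<close>, so
  \<open>u\<close> is the unique global minimizer. If \<open>\<zeta> < 0\<close>, the integrand is nonpositive as long as
  \<open>|w| \<le> sqrt (- 2 \<zeta> / \<beta>) - 2 |g|\<close>, and in dimension one, where \<open>|g \<bullet> w| = |g| |w|\<close>, it is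
  nonnegative as long as \<open>|w| \<le> 2 |g| - sqrt (- 2 \<zeta> / \<beta>)\<close>. Because \<open>|g|\<^sup>2 = c \<zeta> + \<alpha>\<close> and
  \<open>\<beta> c = 1\<close>, the first bound is positive for \<open>\<zeta> < - 2 \<alpha> / (3 c)\<close> and the second for
  \<open>\<zeta> > - 2 \<alpha> / (3 c)\<close>; these are the ranges of the third and of the second branch. That primal
  and dual values agree is the pointwise identity \<open>dual_density_at_root\<close>.

  The analytic work lies in the Gauss-Green formula \<open>\<integral> \<nabla>u \<bullet> \<tau> = \<integral> u \<tau> \<bullet> n\<close> (theorem
  \<open>Gauss_Green\<close>), where \<open>u\<close> and \<open>\<tau>\<close> are merely continuous up to the boundary, \<open>u\<close> has a weak
  gradient, \<open>\<tau>\<close> is differentiable without any continuity of its derivative, and the divergence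
  theorem is known only for fields that are \<open>C\<^sup>1\<close> on the whole space. Inside the region,
  Goursat's bisection argument shows that the flux of \<open>\<tau>\<close> through small squares vanishes, so the
  averages of \<open>\<tau>\<close> over small squares are divergence-free \<open>C\<^sup>1\<close> fields near \<open>\<tau>\<close>; on the line \<open>\<tau>\<close>
  is constant. This gives the product rule for \<open>u \<tau>\<close> against test functions. Near the boundary,
  \<open>u \<tau>\<close> is replaced by a polynomial field \<open>P\<close> that is uniformly close to it, and the difference
  is tested with cutoff functions \<open>\<phi>\<close> that vanish near the boundary. The error is at most
  \<open>|P - u \<tau>|\<close> times \<open>\<integral> |\<nabla>\<phi>|\<close>, and finiteness of the Hausdorff measure of the boundary provides
  cutoffs for which this last integral stays bounded.
\<close>

section \<open>Continuously differentiable maps\<close>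

lemma C1_mapI:
  assumes "\<And>x. (F has_derivative F' x) (at x)" and "\<And>h. continuous_on UNIV (\<lambda>x. F' x h)"
  shows "C1_map F"
proof -
  have "frechet_derivative F (at x) = F' x" for x
    using frechet_derivative_at[OF assms(1)] by simp
  then show ?thesis
    using assms by (auto simp: C1_map_def differentiable_def)
qed

lemma C1_map_has_derivative:
  "C1_map F \<Longrightarrow> (F has_derivative frechet_derivative F (at x)) (at x)"
  by (simp add: C1_map_def frechet_derivative_works)

lemma C1_map_continuous_derivative:
  "C1_map F \<Longrightarrow> continuous_on UNIV (\<lambda>x. frechet_derivative F (at x) h)"
  by (simp add: C1_map_def)

lemma C1_map_continuous_on: "C1_map F \<Longrightarrow> continuous_on S F"
  by (meson C1_map_has_derivative continuous_at_imp_continuous_on has_derivative_continuous)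

lemma C1_map_const [simp]: "C1_map (\<lambda>x. k)"
  by (rule C1_mapI[where F' = "\<lambda>x h. 0"]) auto

lemma C1_map_bounded_linear: "bounded_linear f \<Longrightarrow> C1_map f"
  by (rule C1_mapI[where F' = "\<lambda>x. f"]) (auto simp: bounded_linear_imp_has_derivative)

lemma C1_map_add: "C1_map F \<Longrightarrow> C1_map G \<Longrightarrow> C1_map (\<lambda>x. F x + G x)"
  by (rule C1_mapI[where F' = "\<lambda>x h. frechet_derivative F (at x) h + frechet_derivative G (at x) h"])
     (auto intro!: has_derivative_add C1_map_has_derivative continuous_intros C1_map_continuous_derivative)

lemma C1_map_scaleR:
  fixes f :: "'a::euclidean_space \<Rightarrow> real"
  assumes "C1_map f" "C1_map F"
  shows "C1_map (\<lambda>x. f x *\<^sub>R F x)"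
  by (rule C1_mapI[where F' = "\<lambda>x h. f x *\<^sub>R frechet_derivative F (at x) h
        + frechet_derivative f (at x) h *\<^sub>R F x"])
     (use assms in \<open>intro has_derivative_scaleR C1_map_has_derivative continuous_intros
        C1_map_continuous_derivative C1_map_continuous_on; simp\<close>)+

lemma C1_map_mult:
  fixes f g :: "'a::euclidean_space \<Rightarrow> real"
  shows "C1_map f \<Longrightarrow> C1_map g \<Longrightarrow> C1_map (\<lambda>x. f x * g x)"
  using C1_map_scaleR[of f g] by simp

lemma C1_map_diff:
  assumes "C1_map F" "C1_map G" shows "C1_map (\<lambda>x. F x - G x)"
proof -
  have "C1_map (\<lambda>x. F x + (-1) *\<^sub>R G x)"
    by (intro C1_map_add C1_map_scaleR C1_map_const assms)
  then show ?thesis by simp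
qed

lemma C1_map_sum: "(\<And>i. i \<in> I \<Longrightarrow> C1_map (F i)) \<Longrightarrow> C1_map (\<lambda>x. \<Sum>i\<in>I. F i x)"
  by (induction I rule: infinite_finite_induct) (auto intro!: C1_map_add)

lemma C1_map_prod:
  fixes f :: "'i \<Rightarrow> 'a::euclidean_space \<Rightarrow> real"
  shows "(\<And>i. i \<in> I \<Longrightarrow> C1_map (f i)) \<Longrightarrow> C1_map (\<lambda>x. \<Prod>i\<in>I. f i x)"
  by (induction I rule: infinite_finite_induct) (auto intro!: C1_map_mult)

lemma C1_map_inner_left: "C1_map (\<lambda>x. x \<bullet> k)"
  by (intro C1_map_bounded_linear bounded_linear_inner_left)

lemma C1_map_inner_const:
  assumes "C1_map F" shows "C1_map (\<lambda>x. F x \<bullet> k)"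
  by (rule C1_mapI[where F' = "\<lambda>x h. frechet_derivative F (at x) h \<bullet> k"])
     (use assms in \<open>auto intro!: has_derivative_inner_left C1_map_has_derivative continuous_intros
        C1_map_continuous_derivative\<close>)

lemma C1_map_chain_real:
  fixes f :: "'a::euclidean_space \<Rightarrow> real"
  assumes "\<And>s. (r has_real_derivative r' s) (at s)" "continuous_on UNIV r'" "C1_map f"
  shows "C1_map (\<lambda>x. r (f x))"
proof (rule C1_mapI[where F' = "\<lambda>x h. r' (f x) * frechet_derivative f (at x) h"])
  show "((\<lambda>x. r (f x)) has_derivative (\<lambda>h. r' (f x) * frechet_derivative f (at x) h)) (at x)" for x
    using has_derivative_compose[OF C1_map_has_derivative[OF assms(3)]
        assms(1)[unfolded has_field_derivative_def]] by simp
  show "continuous_on UNIV (\<lambda>x. r' (f x) * frechet_derivative f (at x) h)" for h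
    by (intro continuous_intros continuous_on_compose2[OF assms(2)] C1_map_continuous_on
        C1_map_continuous_derivative assms) auto
qed

lemma C1_map_real_polynomial_function:
  fixes f :: "'a::euclidean_space \<Rightarrow> real"
  shows "real_polynomial_function f \<Longrightarrow> C1_map f"
  by (induction rule: real_polynomial_function.induct)
     (auto intro: C1_map_bounded_linear C1_map_add C1_map_mult)

lemma C1_map_polynomial_function:
  fixes F :: "'a::euclidean_space \<Rightarrow> 'b::euclidean_space"
  assumes "polynomial_function F" shows "C1_map F"
proof -
  have "C1_map (\<lambda>x. \<Sum>b\<in>Basis. (F x \<bullet> b) *\<^sub>R b)"
  proof (intro C1_map_sum C1_map_scaleR C1_map_const C1_map_real_polynomial_function)
    show "real_polynomial_function (\<lambda>x. F x \<bullet> b)" for b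
      using assms bounded_linear_inner_left[of b] unfolding polynomial_function_def o_def by blast
  qed
  then show ?thesis by (simp add: euclidean_representation)
qed

text \<open>
  Off the closed set \<open>K\<close> the map is locally zero, so there the two candidates for the derivative
  agree; the open sets \<open>\<Omega>\<close> and \<open>- K\<close> cover the space.
\<close>

lemma C1_map_zero_extension:
  assumes "open \<Omega>" "closed K" "K \<subseteq> \<Omega>" "\<And>x. x \<notin> K \<Longrightarrow> F x = 0"
    and "\<And>x. x \<in> \<Omega> \<Longrightarrow> (F has_derivative F' x) (at x)" "\<And>h. continuous_on \<Omega> (\<lambda>x. F' x h)"
  shows "C1_map F"
proof (rule C1_mapI[where F' = "\<lambda>x h. if x \<in> \<Omega> then F' x h else 0"])
  have off: "(F has_derivative (\<lambda>h. 0)) (at x)" if "x \<notin> K" for x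
    by (rule has_derivative_transform_within_open[of "\<lambda>x. 0" _ _ _ "- K"])
       (use assms that in auto)
  show "(F has_derivative (\<lambda>h. if x \<in> \<Omega> then F' x h else 0)) (at x)" for x
    using assms(3) assms(5)[of x] off[of x] by (cases "x \<in> \<Omega>") auto
  show "continuous_on UNIV (\<lambda>x. if x \<in> \<Omega> then F' x h else 0)" for h
  proof -
    have "continuous_on \<Omega> (\<lambda>x. if x \<in> \<Omega> then F' x h else 0)"
      using assms(6)[of h] by (rule continuous_on_eq) auto
    moreover have "F' x h = 0" if "x \<in> \<Omega>" "x \<notin> K" for x
      using has_derivative_unique[OF off[OF that(2)] assms(5)[OF that(1)]] by (simp add: fun_eq_iff)
    then have "continuous_on (- K) (\<lambda>x. if x \<in> \<Omega> then F' x h else 0)"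
      by (intro continuous_on_eq[OF continuous_on_const[of _ 0]]) auto
    moreover have "\<Omega> \<union> - K = UNIV" using assms(3) by auto
    ultimately show ?thesis
      using continuous_on_open_Un[OF assms(1) open_Compl[OF assms(2)]] by metis
  qed
qed

section \<open>Divergence\<close>

lemma divergence_eq:
  "(F has_derivative F') (at x) \<Longrightarrow> divergence F x = (\<Sum>b\<in>Basis. F' b \<bullet> b)"
  by (simp add: divergence_def flip: frechet_derivative_at)

lemma divergence_scaleR:
  fixes \<phi> :: "'a::euclidean_space \<Rightarrow> real"
  assumes "\<phi> differentiable (at x)" "F differentiable (at x)"
  shows "divergence (\<lambda>x. \<phi> x *\<^sub>R F x) x
    = frechet_derivative \<phi> (at x) (F x) + \<phi> x * divergence F x"
proof -
  have d: "((\<lambda>x. \<phi> x *\<^sub>R F x) has_derivative (\<lambda>h. \<phi> x *\<^sub>R frechet_derivative F (at x) h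
        + frechet_derivative \<phi> (at x) h *\<^sub>R F x)) (at x)"
    using assms by (intro has_derivative_scaleR) (simp_all flip: frechet_derivative_works)
  have "linear (frechet_derivative \<phi> (at x))"
    by (rule linear_frechet_derivative[OF assms(1)])
  then have "frechet_derivative \<phi> (at x) (\<Sum>b\<in>Basis. (F x \<bullet> b) *\<^sub>R b)
      = (\<Sum>b\<in>Basis. (F x \<bullet> b) * frechet_derivative \<phi> (at x) b)"
    by (simp add: linear_sum linear_scale)
  then show ?thesis
    by (simp add: divergence_eq[OF d] divergence_def[of F] inner_add_left sum.distrib sum_distrib_left
        euclidean_representation mult.commute)
qed

lemma continuous_on_divergence: "C1_map F \<Longrightarrow> continuous_on S (divergence F)"
  unfolding divergence_def
  by (intro continuous_intros continuous_on_subset[OF C1_map_continuous_derivative]) auto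

lemma frechet_derivative_eq_0_outside:
  assumes "closed K" "\<And>x. x \<notin> K \<Longrightarrow> F x = 0" "x \<notin> K"
  shows "frechet_derivative F (at x) = (\<lambda>h. 0)"
proof -
  have "(F has_derivative (\<lambda>h. 0)) (at x)"
    by (rule has_derivative_transform_within_open[of "\<lambda>x. 0" _ _ _ "- K"]) (use assms in auto)
  then show ?thesis by (rule frechet_derivative_at[symmetric])
qed

section \<open>A continuously differentiable step\<close>

definition pos_square :: "real \<Rightarrow> real" where "pos_square t = (max 0 t)\<^sup>2"

text \<open>
  The square of the positive part has a continuous derivative; nesting two copies of it gives a
  \<open>C\<^sup>1\<close> transition from \<open>0\<close> (for \<open>t \<le> 0\<close>) to \<open>1\<close> (for \<open>t \<ge> 1\<close>), out of which all test functions
  and cutoffs below are built.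
\<close>

definition smooth_step :: "real \<Rightarrow> real" where "smooth_step t = 1 - pos_square (1 - pos_square t)"

definition smooth_step' :: "real \<Rightarrow> real" where
  "smooth_step' t = 4 * max 0 (1 - pos_square t) * max 0 t"

lemma pos_square_has_real_derivative: "(pos_square has_real_derivative 2 * max 0 t) (at t)"
proof (cases t "0::real" rule: linorder_cases)
  case less
  have "((\<lambda>s. 0) has_real_derivative 0) (at t)" by simp
  then have "(pos_square has_real_derivative 0) (at t)"
    by (rule has_field_derivative_transform_within_open[where S="{..<0}"])
       (use less in \<open>auto simp: pos_square_def\<close>)
  then show ?thesis using less by (simp add: max_def)
next
  case greater
  have "((\<lambda>s. s\<^sup>2) has_real_derivative 2 * t) (at t)"
    by (auto intro!: derivative_eq_intros)
  then have "(pos_square has_real_derivative 2 * t) (at t)"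
    by (rule has_field_derivative_transform_within_open[where S="{0<..}"])
       (use greater in \<open>auto simp: pos_square_def\<close>)
  then show ?thesis using greater by (simp add: max_def)
next
  case equal
  have "((\<lambda>h. (pos_square (0 + h) - pos_square 0) / h) \<longlongrightarrow> 0) (at 0)"
  proof (rule Lim_null_comparison)
    show "\<forall>\<^sub>F h in at 0. norm ((pos_square (0 + h) - pos_square 0) / h) \<le> \<bar>h\<bar>"
      by (rule always_eventually) (auto simp: pos_square_def max_def power2_eq_square)
    show "((\<lambda>h. \<bar>h\<bar>) \<longlongrightarrow> 0) (at (0::real))"
      by (rule tendsto_eq_intros refl | simp)+
  qed
  then show ?thesis using equal by (simp add: DERIV_def)
qed

lemma continuous_on_pos_square [continuous_intros]:
  "continuous_on S f \<Longrightarrow> continuous_on S (\<lambda>x. pos_square (f x))"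
  unfolding pos_square_def by (intro continuous_intros)

lemma smooth_step_has_real_derivative: "(smooth_step has_real_derivative smooth_step' t) (at t)"
  unfolding smooth_step_def smooth_step'_def
  by (auto intro!: derivative_eq_intros DERIV_chain2[OF pos_square_has_real_derivative])

lemma continuous_on_smooth_step': "continuous_on S smooth_step'"
  unfolding smooth_step'_def by (intro continuous_intros)

lemma smooth_step_eq_0: "t \<le> 0 \<Longrightarrow> smooth_step t = 0"
  by (simp add: smooth_step_def pos_square_def)

lemma smooth_step_eq_1: "1 \<le> t \<Longrightarrow> smooth_step t = 1"
  by (simp add: smooth_step_def pos_square_def max_def power2_eq_square) (simp add: mult_ge1_I antisym)

lemma smooth_step_pos: "0 < t \<Longrightarrow> 0 < smooth_step t"
  by (auto simp: smooth_step_def pos_square_def max_def abs_square_less_1)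

lemma smooth_step_bounds: "0 \<le> smooth_step t" "smooth_step t \<le> 1"
proof -
  have "0 \<le> max 0 (1 - pos_square t)" "max 0 (1 - pos_square t) \<le> 1"
    by (auto simp: pos_square_def)
  then show "0 \<le> smooth_step t" "smooth_step t \<le> 1"
    unfolding smooth_step_def pos_square_def[of "1 - _"] by (auto simp: power_le_one)
qed

lemma smooth_step'_bounds: "0 \<le> smooth_step' t" "smooth_step' t \<le> 4"
proof -
  show "0 \<le> smooth_step' t" by (simp add: smooth_step'_def)
  show "smooth_step' t \<le> 4"
  proof (cases "t \<le> 1")
    case True
    have "max 0 (1 - pos_square t) * max 0 t \<le> 1 * 1"
      by (rule mult_mono) (use True in \<open>auto simp: pos_square_def\<close>)
    then show ?thesis by (simp add: smooth_step'_def)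
  next
    case False
    then have "1 \<le> pos_square t" by (simp add: pos_square_def max_def)
    then show ?thesis by (simp add: smooth_step'_def)
  qed
qed

lemma C1_map_smooth_step:
  "C1_map f \<Longrightarrow> C1_map (\<lambda>x. smooth_step (f x))"
  by (rule C1_map_chain_real[OF smooth_step_has_real_derivative continuous_on_smooth_step'])

section \<open>The fundamental lemma of the calculus of variations\<close>

text \<open>
  The Borel sets over which \<open>f\<close> integrates to zero form a Dynkin system. It contains the boxes,
  which are closed under intersection and generate the Borel sets.
\<close>

lemma AE_zero_if_box_integrals_zero:
  fixes f :: "'a::euclidean_space \<Rightarrow> real"
  assumes f: "integrable lborel f" and off: "\<And>x. x \<notin> box p q \<Longrightarrow> f x = 0"
    and box0: "\<And>a b. (LINT x:box a b|lborel. f x) = 0"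
  shows "AE x in lborel. f x = 0"
proof (rule sigma_finite_measure.density_zero[OF sigma_finite_lborel f])
  have all: "set_integrable lborel A f" if "A \<in> sets borel" for A
    unfolding set_integrable_def using f that by (intro integrable_mult_indicator) auto
  have full: "(LINT x:UNIV|lborel. f x) = 0"
  proof -
    have "(LINT x:UNIV|lborel. f x) = (LINT x:box p q|lborel. f x)"
      unfolding set_lebesgue_integral_def using off
      by (intro Bochner_Integration.integral_cong) (auto simp: indicator_def)
    then show ?thesis using box0 by simp
  qed
  fix A :: "'a set" assume "A \<in> sets lborel"
  then have A: "A \<in> sigma_sets UNIV (range (\<lambda>(a, b). box a b))"
    by (simp add: borel_eq_box)
  have sb: "X \<in> sets borel" if "X \<in> sigma_sets UNIV (range (\<lambda>(a, b). box a b :: 'a set))" for X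
    using that by (simp add: borel_eq_box)
  have "Int_stable (range (\<lambda>(a, b). box a b :: 'a set))"
    by (auto simp: Int_stable_def box_Int_box)
  moreover have "range (\<lambda>(a, b). box a b :: 'a set) \<subseteq> Pow UNIV" by auto
  ultimately show "(LINT x:A|lborel. f x) = 0"
    using A
  proof (induction rule: sigma_sets_induct_disjoint)
    case (basic A) then show ?case using box0 by auto
  next
    case empty then show ?case by (simp add: set_lebesgue_integral_def)
  next
    case (compl A)
    have "(LINT x:UNIV|lborel. f x) = (LINT x:A \<union> (UNIV - A)|lborel. f x)" by simp
    also have "\<dots> = (LINT x:A|lborel. f x) + (LINT x:(UNIV - A)|lborel. f x)"
      by (rule set_integral_Un) (use all sb[OF compl(1)] in auto)
    finally show ?case using full compl by simp
  next
    case (union A)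
    have Ai: "A i \<in> sets borel" for i using union(2) sb by blast
    then have "(\<Union>i. A i) \<in> sets borel" by blast
    note this[THEN all]
    have "(LINT x:(\<Union>i. A i)|lborel. f x) = (\<Sum>i. LINT x:A i|lborel. f x)"
      by (rule lebesgue_integral_countable_add)
         (use union Ai \<open>set_integrable lborel (\<Union>i. A i) f\<close> in \<open>auto simp: disjoint_family_on_def\<close>)
    then show ?case using union by simp
  qed
qed

lemma test_function_box:
  assumes "cbox a b \<subseteq> \<Omega>"
  shows "test_function \<Omega> (\<lambda>x. \<Prod>i\<in>Basis.
    smooth_step (real n * (x \<bullet> i - a \<bullet> i)) * smooth_step (real n * (b \<bullet> i - x \<bullet> i)))"
    (is "test_function _ ?\<phi>")
  unfolding test_function_def
proof (intro conjI exI[of _ "cbox a b"] allI impI)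
  show "C1_map ?\<phi>"
    by (intro C1_map_prod C1_map_mult C1_map_smooth_step C1_map_diff C1_map_inner_left C1_map_const)
  fix x assume "x \<notin> cbox a b"
  then obtain i where i: "i \<in> Basis" "x \<bullet> i \<le> a \<bullet> i \<or> b \<bullet> i \<le> x \<bullet> i"
    by (auto simp: mem_box not_le less_le)
  then have "smooth_step (real n * (x \<bullet> i - a \<bullet> i)) * smooth_step (real n * (b \<bullet> i - x \<bullet> i)) = 0"
    by (auto intro!: smooth_step_eq_0 mult_nonneg_nonpos)
  then show "?\<phi> x = 0"
    using i(1) by (intro prod_zero) auto
qed (use assms in auto)

text \<open>
  Products of such rescaled steps are test functions that converge to the indicator of an open
  box.
\<close>

lemma smooth_step_multiple_tendsto:
  "(\<lambda>n. smooth_step (real n * t)) \<longlonglongrightarrow> (if 0 < t then 1 else 0)"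
proof (cases "0 < t")
  case True
  then obtain m :: nat where m: "1 < real m * t" using reals_Archimedean3 by blast
  have "\<forall>\<^sub>F n in sequentially. smooth_step (real n * t) = 1"
    using eventually_ge_at_top[of m]
  proof eventually_elim
    case (elim n)
    then have "real m * t \<le> real n * t" using True by (intro mult_right_mono) auto
    then show ?case using m by (intro smooth_step_eq_1) auto
  qed
  then show ?thesis using True by (auto intro: tendsto_eventually)
next
  case False
  then have "smooth_step (real n * t) = 0" for n
    by (auto intro!: smooth_step_eq_0 mult_nonneg_nonpos)
  then show ?thesis using False by simp
qed

text \<open>
  By dominated convergence the hypothesis passes from test functions to indicators of boxes
  whose closure lies in \<open>\<Omega>\<close>; the open set \<open>\<Omega>\<close> is a countable union of closed boxes.
\<close>

lemma AE_zero_if_test_integrals_zero: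
  fixes g :: "'a::euclidean_space \<Rightarrow> real"
  assumes \<Omega>: "open \<Omega>"
    and meas: "g \<in> borel_measurable (lebesgue_on \<Omega>)"
    and loc: "\<And>K. compact K \<Longrightarrow> K \<subseteq> \<Omega> \<Longrightarrow> integrable (lebesgue_on K) g"
    and test: "\<And>\<phi>. test_function \<Omega> \<phi> \<Longrightarrow> (LINT x|lebesgue_on \<Omega>. g x * \<phi> x) = 0"
  shows "AE x in lebesgue_on \<Omega>. g x = 0"
proof -
  have \<Omega>m: "\<Omega> \<in> sets lebesgue" using \<Omega> by auto
  have g_int: "integrable lebesgue (\<lambda>x. indicator A x * g x)"
    if "cbox p q \<subseteq> \<Omega>" "A \<subseteq> cbox p q" "A \<in> sets borel" for p q A
  proof -
    have "integrable lebesgue (\<lambda>x. if x \<in> cbox p q then g x else 0)"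
      using loc[of "cbox p q"] that(1) by (subst Lebesgue_Measure.integrable_restrict_UNIV) auto
    from integrable_mult_indicator[OF _ this, of A] that show ?thesis
      by (auto elim!: Bochner_Integration.integrable_cong[THEN iffD1, rotated 2] simp: indicator_def)
  qed
  have box0: "(LINT x|lebesgue. indicator (box a b) x * g x) = 0" if sub: "cbox a b \<subseteq> \<Omega>" for a b
  proof -
    define \<phi> where "\<phi> n x = (\<Prod>i\<in>Basis. smooth_step (real n * (x \<bullet> i - a \<bullet> i))
      * smooth_step (real n * (b \<bullet> i - x \<bullet> i)))" for n :: nat and x :: 'a
    have tf: "test_function \<Omega> (\<phi> n)" for n
      unfolding \<phi>_def by (rule test_function_box[OF sub])
    have \<phi>01: "0 \<le> \<phi> n x" "\<phi> n x \<le> 1" for n x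
      unfolding \<phi>_def
      by (auto intro!: prod_nonneg prod_le_1 mult_le_one mult_nonneg_nonneg smooth_step_bounds)
    have \<phi>off: "\<phi> n x = 0" if xout: "x \<notin> cbox a b" for n x
    proof -
      obtain i where i: "i \<in> Basis" "x \<bullet> i \<le> a \<bullet> i \<or> b \<bullet> i \<le> x \<bullet> i"
        using xout by (auto simp: mem_box not_le less_le)
      then have "smooth_step (real n * (x \<bullet> i - a \<bullet> i)) * smooth_step (real n * (b \<bullet> i - x \<bullet> i)) = 0"
        by (auto intro!: smooth_step_eq_0 mult_nonneg_nonpos)
      then show ?thesis unfolding \<phi>_def using i(1) by (intro prod_zero) auto
    qed
    have \<phi>lim: "(\<lambda>n. \<phi> n x) \<longlonglongrightarrow> indicator (box a b) x" for x
    proof -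
      have "(\<lambda>n. \<phi> n x) \<longlonglongrightarrow>
          (\<Prod>i\<in>Basis. (if 0 < x \<bullet> i - a \<bullet> i then 1 else 0) * (if 0 < b \<bullet> i - x \<bullet> i then 1 else 0))"
        unfolding \<phi>_def by (intro tendsto_prod tendsto_mult smooth_step_multiple_tendsto)
      also have "(\<Prod>i\<in>Basis. (if 0 < x \<bullet> i - a \<bullet> i then 1 else 0)
          * (if 0 < b \<bullet> i - x \<bullet> i then 1 else 0)) = (indicator (box a b) x :: real)"
      proof (cases "x \<in> box a b")
        case True then show ?thesis by (auto simp: mem_box intro!: prod.neutral)
      next
        case False
        then obtain i where "i \<in> Basis" "\<not> (a \<bullet> i < x \<bullet> i \<and> x \<bullet> i < b \<bullet> i)"
          by (auto simp: mem_box)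
        then show ?thesis using False by (auto intro!: prod_zero bexI[of _ i])
      qed
      finally show ?thesis .
    qed
    have "(\<lambda>n. LINT x|lebesgue. \<phi> n x * (indicator (cbox a b) x * g x))
        \<longlonglongrightarrow> (LINT x|lebesgue. indicator (box a b) x * (indicator (cbox a b) x * g x))"
    proof (rule integral_dominated_convergence[where w = "\<lambda>x. \<bar>indicator (cbox a b) x * g x\<bar>"])
      have m: "(\<lambda>x. indicator (cbox a b) x * g x) \<in> borel_measurable lebesgue"
        using g_int[OF sub order_refl] by auto
      show "(\<lambda>x. \<phi> n x * (indicator (cbox a b) x * g x)) \<in> borel_measurable lebesgue" for n
      proof (rule borel_measurable_times[OF _ m])
        have "continuous_on UNIV (\<phi> n)"
          using tf[of n] by (auto simp: test_function_def intro: C1_map_continuous_on)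
        then show "\<phi> n \<in> borel_measurable lebesgue"
          by (intro measurable_completion) (auto intro: borel_measurable_continuous_onI)
      qed
      show "(\<lambda>x. indicator (box a b) x * (indicator (cbox a b) x * g x)) \<in> borel_measurable lebesgue"
        by (rule borel_measurable_times[OF borel_measurable_indicator m]) simp
      show "integrable lebesgue (\<lambda>x. \<bar>indicator (cbox a b) x * g x\<bar>)"
        by (intro integrable_abs g_int[OF sub]) auto
      show "AE x in lebesgue. (\<lambda>n. \<phi> n x * (indicator (cbox a b) x * g x))
          \<longlonglongrightarrow> indicator (box a b) x * (indicator (cbox a b) x * g x)"
        by (intro AE_I2 tendsto_intros \<phi>lim)
      show "AE x in lebesgue. norm (\<phi> n x * (indicator (cbox a b) x * g x))
          \<le> \<bar>indicator (cbox a b) x * g x\<bar>" for n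
        using \<phi>01 by (auto simp: abs_mult intro!: mult_left_le_one_le)
    qed
    moreover have "(LINT x|lebesgue. \<phi> n x * (indicator (cbox a b) x * g x)) = 0" for n
    proof -
      have "(LINT x|lebesgue. \<phi> n x * (indicator (cbox a b) x * g x))
          = (LINT x|lebesgue. (if x \<in> \<Omega> then g x * \<phi> n x else 0))"
        using sub \<phi>off by (intro Bochner_Integration.integral_cong) (auto simp: indicator_def)
      then show ?thesis
        using test[OF tf[of n]] by (simp add: Lebesgue_Measure.integral_restrict_UNIV[OF \<Omega>m])
    qed
    moreover have "indicator (box a b) x * (indicator (cbox a b) x * g x) = indicator (box a b) x * g x" for x
      using box_subset_cbox[of a b] by (auto simp: indicator_def)
    ultimately show ?thesis by (simp add: LIMSEQ_const_iff)
  qed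
  have AE_box: "AE x in lebesgue. x \<in> cbox p q \<longrightarrow> g x = 0" if sub: "cbox p q \<subseteq> \<Omega>" for p q
  proof -
    let ?G = "\<lambda>x. indicator (box p q) x * g x"
    have G: "integrable lebesgue ?G"
      by (rule g_int[OF sub]) (auto simp: box_subset_cbox)
    then have "?G \<in> borel_measurable lebesgue" by auto
    \<comment> \<open>The statement about boxes concerns Borel functions, so \<open>g\<close> is replaced by a Borel
      representative.\<close>
    then obtain f' where f': "f' \<in> borel_measurable lborel" "AE x in lborel. ?G x = f' x"
      using completion_ex_borel_measurable_real by blast
    define f where "f x = indicator (box p q) x * f' x" for x
    have fm: "f \<in> borel_measurable lborel" unfolding f_def using f'(1) by measurable
    have fG: "AE x in lebesgue. f x = ?G x"
      using AE_completion[OF f'(2)] by eventually_elim (auto simp: f_def indicator_def)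
    have "integrable lebesgue f"
    proof (rule integrable_cong_AE_imp[OF G])
      show "f \<in> borel_measurable lebesgue" using fm by (rule measurable_completion)
      show "AE x in lebesgue. ?G x = f x" using fG by eventually_elim simp
    qed
    then have fi: "integrable lborel f"
      using fm integrable_completion by blast
    have "AE x in lborel. f x = 0"
    proof (rule AE_zero_if_box_integrals_zero[OF fi])
      show "f x = 0" if "x \<notin> box p q" for x using that by (simp add: f_def)
      fix a b
      obtain c d where cd: "box a b \<inter> box p q = box c d" using box_Int_box by blast
      have "(LINT x:box a b|lborel. f x) = (LINT x|lebesgue. indicator (box a b) x * f x)"
        unfolding set_lebesgue_integral_def using fm by (subst integral_completion) auto
      also have "\<dots> = (LINT x|lebesgue. indicator (box c d) x * g x)"
      proof (rule integral_cong_AE)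
        show "AE x in lebesgue. indicator (box a b) x * f x = indicator (box c d) x * g x"
          using fG by eventually_elim (auto simp: indicator_def simp flip: cd)
        show "(\<lambda>x. indicator (box a b) x * f x) \<in> borel_measurable lebesgue"
          using fm by (intro borel_measurable_times measurable_completion) auto
        show "(\<lambda>x. indicator (box c d) x * g x) \<in> borel_measurable lebesgue"
          using g_int[OF sub, of "box c d"] cd box_subset_cbox[of p q] by auto
      qed
      also have "\<dots> = 0"
      proof (cases "box c d = {}")
        case True then show ?thesis by simp
      next
        case False
        then have "cbox c d = closure (box c d)" by simp
        also have "\<dots> \<subseteq> closure (cbox p q)"
          using cd box_subset_cbox[of p q] by (intro closure_mono) auto
        finally show ?thesis using box0[of c d] sub by auto
      qed
      finally show "(LINT x:box a b|lborel. f x) = 0" .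
    qed
    then have "AE x in lebesgue. f x = 0" by (rule AE_completion)
    moreover have "AE x in lebesgue. x \<notin> cbox p q - box p q"
      using negligible_frontier_interval[of p q] by (intro AE_not_in) (simp add: negligible_iff_null_sets)
    ultimately show ?thesis using fG
      by eventually_elim (auto simp: indicator_def)
  qed
  obtain \<D> where D: "countable \<D>" "\<D> \<subseteq> Pow \<Omega>" "\<And>X. X \<in> \<D> \<Longrightarrow> \<exists>a b. X = cbox a b" "\<Union>\<D> = \<Omega>"
    using open_countable_Union_open_cbox[OF \<Omega>] by metis
  have "AE x in lebesgue. \<forall>X\<in>\<D>. x \<in> X \<longrightarrow> g x = 0"
  proof (subst AE_ball_countable[OF D(1)], intro ballI)
    fix X assume "X \<in> \<D>"
    then show "AE x in lebesgue. x \<in> X \<longrightarrow> g x = 0"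
      using D(2,3) AE_box by blast
  qed
  then have "AE x in lebesgue. x \<in> \<Omega> \<longrightarrow> g x = 0"
    by eventually_elim (use D(4) in blast)
  then show ?thesis by (simp add: AE_restrict_space_iff \<Omega>m)
qed

section \<open>Weak gradients\<close>

lemma bounded_if_continuous_compact_support:
  fixes \<phi> :: "'a::euclidean_space \<Rightarrow> real"
  assumes "compact K" "continuous_on UNIV \<phi>" "\<And>x. x \<notin> K \<Longrightarrow> \<phi> x = 0"
  obtains B where "0 \<le> B" "\<And>x. \<bar>\<phi> x\<bar> \<le> B"
proof -
  have "bounded (\<phi> ` K)"
    by (intro compact_imp_bounded compact_continuous_image assms continuous_on_subset[OF assms(2)]) auto
  then obtain B where "\<forall>y\<in>\<phi> ` K. norm y \<le> B" by (auto simp: bounded_iff)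
  then have "\<bar>\<phi> x\<bar> \<le> max 0 B" for x using assms(3)[of x] by (cases "x \<in> K") force+
  then show ?thesis by (intro that[of "max 0 B"]) auto
qed

lemma continuous_imp_lebesgue_measurable:
  fixes f :: "'a::euclidean_space \<Rightarrow> 'b::euclidean_space"
  shows "continuous_on UNIV f \<Longrightarrow> f \<in> borel_measurable lebesgue"
  by (intro measurable_completion) (auto intro: borel_measurable_continuous_onI)

lemma integrable_mult_compact_support:
  fixes g :: "'a::euclidean_space \<Rightarrow> 'b::euclidean_space" and \<phi> :: "'a \<Rightarrow> real"
  assumes \<Omega>: "\<Omega> \<in> sets lebesgue" and K: "compact K" "K \<subseteq> \<Omega>"
    and g: "integrable (lebesgue_on K) g"
    and \<phi>: "continuous_on UNIV \<phi>" "\<And>x. x \<notin> K \<Longrightarrow> \<phi> x = 0"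
  shows "integrable (lebesgue_on \<Omega>) (\<lambda>x. \<phi> x *\<^sub>R g x)"
proof -
  obtain B where B: "0 \<le> B" "\<And>x. \<bar>\<phi> x\<bar> \<le> B"
    using bounded_if_continuous_compact_support[OF K(1) \<phi>] by blast
  have Km: "K \<in> sets lebesgue" using K(1) by (simp add: borel_compact)
  have G: "integrable lebesgue (\<lambda>x. if x \<in> K then g x else 0)"
    using g by (simp add: Lebesgue_Measure.integrable_restrict_UNIV[OF Km])
  have "integrable lebesgue (\<lambda>x. \<phi> x *\<^sub>R (if x \<in> K then g x else 0))"
  proof (rule Bochner_Integration.integrable_bound)
    show "integrable lebesgue (\<lambda>x. B *\<^sub>R (if x \<in> K then g x else 0))" using G by auto
    show "(\<lambda>x. \<phi> x *\<^sub>R (if x \<in> K then g x else 0)) \<in> borel_measurable lebesgue"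
      using G continuous_imp_lebesgue_measurable[OF \<phi>(1)] by (intro borel_measurable_scaleR) auto
    show "AE x in lebesgue. norm (\<phi> x *\<^sub>R (if x \<in> K then g x else 0))
        \<le> norm (B *\<^sub>R (if x \<in> K then g x else 0))"
      using B by (auto intro!: mult_right_mono)
  qed
  also have "(\<lambda>x. \<phi> x *\<^sub>R (if x \<in> K then g x else 0)) = (\<lambda>x. if x \<in> \<Omega> then \<phi> x *\<^sub>R g x else 0)"
    using K(2) \<phi>(2) by (intro ext) auto
  finally show ?thesis by (simp add: Lebesgue_Measure.integrable_restrict_UNIV[OF \<Omega>])
qed

lemma continuous_on_imp_integrable_compact:
  fixes f :: "'a::euclidean_space \<Rightarrow> 'b::euclidean_space"
  assumes "compact K" "continuous_on K f" shows "integrable (lebesgue_on K) f"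
proof -
  have "integrable lborel (\<lambda>x. indicator K x *\<^sub>R f x)"
    by (rule borel_integrable_compact[OF assms])
  then have "integrable lebesgue (\<lambda>x. indicator K x *\<^sub>R f x)"
    using integrable_completion by (metis borel_measurable_integrable)
  then show ?thesis
    using assms(1) by (subst integrable_restrict_space) (auto simp: borel_compact)
qed

lemma test_function_derivative_integrable:
  fixes u :: "'a::euclidean_space \<Rightarrow> real"
  assumes "open \<Omega>" "continuous_on \<Omega> u" "test_function \<Omega> \<phi>"
  shows "integrable (lebesgue_on \<Omega>) (\<lambda>x. u x * frechet_derivative \<phi> (at x) h)"
proof -
  obtain K where K: "compact K" "K \<subseteq> \<Omega>" "\<And>x. x \<notin> K \<Longrightarrow> \<phi> x = 0"
    using assms(3) by (auto simp: test_function_def)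
  have C1: "C1_map \<phi>" using assms(3) by (simp add: test_function_def)
  have "integrable (lebesgue_on \<Omega>) (\<lambda>x. frechet_derivative \<phi> (at x) h *\<^sub>R u x)"
  proof (rule integrable_mult_compact_support[OF _ K(1,2)])
    show "integrable (lebesgue_on K) u"
      by (intro continuous_on_imp_integrable_compact K continuous_on_subset[OF assms(2)])
    show "frechet_derivative \<phi> (at x) h = 0" if "x \<notin> K" for x
      using frechet_derivative_eq_0_outside[OF compact_imp_closed[OF K(1)] K(3) that] by simp
  qed (use assms(1) C1_map_continuous_derivative[OF C1] in auto)
  then show ?thesis by (simp add: mult.commute)
qed

lemma has_weak_gradient_test_integrable:
  assumes "open \<Omega>" "has_weak_gradient \<Omega> u g" "test_function \<Omega> \<phi>"
  shows "integrable (lebesgue_on \<Omega>) (\<lambda>x. (g x \<bullet> h) * \<phi> x)"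
proof -
  obtain K where K: "compact K" "K \<subseteq> \<Omega>" "\<And>x. x \<notin> K \<Longrightarrow> \<phi> x = 0"
    using assms(3) by (auto simp: test_function_def)
  have "integrable (lebesgue_on \<Omega>) (\<lambda>x. \<phi> x *\<^sub>R g x)"
    by (rule integrable_mult_compact_support[OF _ K(1,2) _ C1_map_continuous_on K(3)])
       (use assms K in \<open>auto simp: has_weak_gradient_def test_function_def\<close>)
  from integrable_inner_left[OF this, of h] show ?thesis
    by (simp add: mult.commute)
qed

lemma weak_gradient_unique:
  assumes \<Omega>: "open \<Omega>" and g: "has_weak_gradient \<Omega> u g" and g': "has_weak_gradient \<Omega> u g'"
  shows "AE x in lebesgue_on \<Omega>. g x = g' x"
proof -
  have "AE x in lebesgue_on \<Omega>. (g x - g' x) \<bullet> b = 0" for b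
  proof (rule AE_zero_if_test_integrals_zero[OF \<Omega>])
    show "(\<lambda>x. (g x - g' x) \<bullet> b) \<in> borel_measurable (lebesgue_on \<Omega>)"
      using g g' by (auto simp: has_weak_gradient_def)
    show "integrable (lebesgue_on K) (\<lambda>x. (g x - g' x) \<bullet> b)" if "compact K" "K \<subseteq> \<Omega>" for K
      using g g' that by (auto simp: has_weak_gradient_def)
    fix \<phi> assume \<phi>: "test_function \<Omega> \<phi>"
    have "(LINT x|lebesgue_on \<Omega>. ((g x - g' x) \<bullet> b) * \<phi> x)
        = (LINT x|lebesgue_on \<Omega>. (g x \<bullet> b) * \<phi> x - (g' x \<bullet> b) * \<phi> x)"
      by (simp add: inner_diff_left left_diff_distrib)
    also have "\<dots> = (LINT x|lebesgue_on \<Omega>. (g x \<bullet> b) * \<phi> x) - (LINT x|lebesgue_on \<Omega>. (g' x \<bullet> b) * \<phi> x)"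
      by (intro Bochner_Integration.integral_diff has_weak_gradient_test_integrable[OF \<Omega> g \<phi>]
          has_weak_gradient_test_integrable[OF \<Omega> g' \<phi>])
    also have "\<dots> = 0" using g g' \<phi> by (simp add: has_weak_gradient_def equation_minus_iff)
    finally show "(LINT x|lebesgue_on \<Omega>. ((g x - g' x) \<bullet> b) * \<phi> x) = 0" .
  qed
  then have "AE x in lebesgue_on \<Omega>. \<forall>b\<in>Basis. (g x - g' x) \<bullet> b = 0"
    by (subst AE_ball_countable) (auto intro: countable_finite)
  then show ?thesis
    by eventually_elim (metis eq_iff_diff_eq_0 euclidean_all_zero_iff)
qed

lemma has_weak_gradient_weak_gradient:
  "has_weak_gradient \<Omega> u g \<Longrightarrow> has_weak_gradient \<Omega> u (weak_gradient \<Omega> u)"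
  unfolding weak_gradient_def by (rule someI[of "has_weak_gradient \<Omega> u"])

lemma weak_gradient_eq:
  "open \<Omega> \<Longrightarrow> has_weak_gradient \<Omega> u g \<Longrightarrow> AE x in lebesgue_on \<Omega>. weak_gradient \<Omega> u x = g x"
  using weak_gradient_unique[OF _ has_weak_gradient_weak_gradient] by blast

lemma has_weak_gradient_add_scaled:
  assumes \<Omega>: "open \<Omega>" and cont: "continuous_on \<Omega> u" "continuous_on \<Omega> v"
    and g: "has_weak_gradient \<Omega> u g" and g': "has_weak_gradient \<Omega> v g'"
  shows "has_weak_gradient \<Omega> (\<lambda>x. u x + s * v x) (\<lambda>x. g x + s *\<^sub>R g' x)"
  unfolding has_weak_gradient_def
proof (intro conjI allI impI)
  show "(\<lambda>x. g x + s *\<^sub>R g' x) \<in> borel_measurable (lebesgue_on \<Omega>)"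
    using g g' by (auto simp: has_weak_gradient_def)
  show "integrable (lebesgue_on K) (\<lambda>x. g x + s *\<^sub>R g' x)" if "compact K \<and> K \<subseteq> \<Omega>" for K
    using g g' that by (auto simp: has_weak_gradient_def)
  fix \<phi> h assume \<phi>: "test_function \<Omega> \<phi>"
  have "(LINT x|lebesgue_on \<Omega>. (u x + s * v x) * frechet_derivative \<phi> (at x) h)
      = (LINT x|lebesgue_on \<Omega>. u x * frechet_derivative \<phi> (at x) h + s * (v x * frechet_derivative \<phi> (at x) h))"
    by (simp add: algebra_simps)
  also have "\<dots> = (LINT x|lebesgue_on \<Omega>. u x * frechet_derivative \<phi> (at x) h)
      + s * (LINT x|lebesgue_on \<Omega>. v x * frechet_derivative \<phi> (at x) h)"
    using test_function_derivative_integrable[OF \<Omega> cont(1) \<phi>, of h] test_function_derivative_integrable[OF \<Omega> cont(2) \<phi>, of h]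
    by simp
  also have "\<dots> = - ((LINT x|lebesgue_on \<Omega>. (g x \<bullet> h) * \<phi> x) + s * (LINT x|lebesgue_on \<Omega>. (g' x \<bullet> h) * \<phi> x))"
    using g g' \<phi> by (auto simp: has_weak_gradient_def)
  also have "\<dots> = - (LINT x|lebesgue_on \<Omega>. (g x \<bullet> h) * \<phi> x + s * ((g' x \<bullet> h) * \<phi> x))"
    using has_weak_gradient_test_integrable[OF \<Omega> g \<phi>, of h] has_weak_gradient_test_integrable[OF \<Omega> g' \<phi>, of h] by simp
  finally show "(LINT x|lebesgue_on \<Omega>. (u x + s * v x) * frechet_derivative \<phi> (at x) h)
      = - (LINT x|lebesgue_on \<Omega>. ((g x + s *\<^sub>R g' x) \<bullet> h) * \<phi> x)"
    by (simp add: inner_add_left algebra_simps)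
qed

section \<open>Functions with zero weak gradient\<close>

lemma lborel_integral_shift:
  fixes f :: "'a::euclidean_space \<Rightarrow> real"
  assumes "f \<in> borel_measurable borel"
  shows "(LINT x|lborel. f (c + x)) = (LINT x|lborel. f x)"
proof -
  have "(LINT x|lborel. f x) = (LINT x|distr lborel borel ((+) c). f x)"
    by (simp add: lborel_distr_plus)
  also have "\<dots> = (LINT x|lborel. f (c + x))"
    using assms by (subst integral_distr) auto
  finally show ?thesis by simp
qed

lemma LINT_continuous_compact_support:
  fixes f :: "'a::euclidean_space \<Rightarrow> real"
  assumes f: "continuous_on UNIV f" "\<And>x. x \<notin> cbox p q \<Longrightarrow> f x = 0"
  shows "integrable lborel f" "(LINT x|lborel. f x) = integral (cbox p q) f"
proof -
  have eq: "(\<lambda>x. indicator (cbox p q) x *\<^sub>R f x) = f"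
    using f(2) by (intro ext) (auto simp: indicator_def)
  show i: "integrable lborel f"
    using borel_integrable_compact[OF compact_cbox continuous_on_subset[OF f(1) subset_UNIV], of p q]
    by (simp only: eq)
  have "integral UNIV (\<lambda>x. if x \<in> cbox p q then f x else 0) = integral (cbox p q) f"
    by (rule Henstock_Kurzweil_Integration.integral_restrict_UNIV)
  moreover have "(\<lambda>x. if x \<in> cbox p q then f x else 0) = f" using f(2) by (intro ext) auto
  ultimately show "(LINT x|lborel. f x) = integral (cbox p q) f"
    using integral_lborel[OF i] by simp
qed

text \<open>
  Compare the weighted averages of \<open>u\<close> around \<open>a\<close> and around \<open>y\<close>, with a small bump \<open>k\<close> as
  weight. Moving the centre of the bump from \<open>a\<close> to \<open>y\<close> along the segment changes the average at
  the rate \<open>- \<integral> u \<partial>k\<close>, where \<open>\<partial>k\<close> is the derivative of the translated bump along \<open>y - a\<close>; this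
  is zero because the translated bump is a test function. So the averages agree, which rules out
  \<open>u a < u y\<close> once the bump is so small that \<open>u\<close> near \<open>y\<close> exceeds \<open>u\<close> near \<open>a\<close>.
\<close>

lemma no_increase_if_weak_gradient_zero:
  fixes u :: "'a::euclidean_space \<Rightarrow> real"
  assumes \<Omega>: "open \<Omega>" and u: "continuous_on \<Omega> u"
    and zero: "\<And>\<phi> h. test_function \<Omega> \<phi> \<Longrightarrow>
        (LINT x|lebesgue_on \<Omega>. u x * frechet_derivative \<phi> (at x) h) = 0"
    and ball: "cball a (2 * R) \<subseteq> \<Omega>" and y: "dist a y < R"
  shows "\<not> u a < u y"
proof
  assume less: "u a < u y"
  have R: "0 < R" using y zero_le_dist[of a y] by linarith
  \<comment> \<open>A continuous extension of \<open>u\<close> makes all integrands below continuous on the whole space, so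
    that differentiation under the integral sign applies.\<close>
  obtain U where U: "continuous_on UNIV U" "\<And>x. x \<in> cball a (2 * R) \<Longrightarrow> U x = u x"
    using Tietze_unbounded[of "cball a (2 * R)" u UNIV] continuous_on_subset[OF u ball] by auto
  have y2: "y \<in> cball a (2 * R)" using y R by auto
  have "continuous_on UNIV (\<lambda>x. U (y + x) - U (a + x))"
    by (intro continuous_intros continuous_on_compose2[OF U(1)]) auto
  then have "isCont (\<lambda>x. U (y + x) - U (a + x)) 0"
    using continuous_on_eq_continuous_at[OF open_UNIV] by blast
  note lim = isContD[OF this]
  have "0 < U (y + 0) - U (a + 0)"
    using less U(2)[of a] U(2)[OF y2] R by simp
  with lim have "\<forall>\<^sub>F x in at 0. 0 < U (y + x) - U (a + x)"
    by (rule order_tendstoD(1))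
  then obtain d where d: "0 < d" "\<And>x. x \<noteq> 0 \<Longrightarrow> norm x < d \<Longrightarrow> 0 < U (y + x) - U (a + x)"
    by (auto simp: eventually_at dist_norm)
  have d0: "0 < U (y + x) - U (a + x)" if "norm x < d" for x
    using d(2)[OF _ that] less U(2)[of a] U(2)[OF y2] R by (cases "x = 0") auto
  define \<epsilon> where "\<epsilon> = min (d / 2) R"
  have \<epsilon>: "0 < \<epsilon>" "\<epsilon> < d" "\<epsilon> \<le> R" using d(1) R by (auto simp: \<epsilon>_def min_def)
  \<comment> \<open>The bump must have radius at most \<open>R\<close> for its translates to stay inside the ball of radius
    \<open>2 * R\<close>, and less than \<open>d\<close> for the comparison of the values of \<open>u\<close>.\<close>
  define k where "k x = smooth_step (\<epsilon>\<^sup>2 - x \<bullet> x)" for x :: 'a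
  have "C1_map (\<lambda>x::'a. x \<bullet> x)"
    by (subst euclidean_inner) (intro C1_map_sum C1_map_mult C1_map_inner_left)
  then have kC1: "C1_map k"
    unfolding k_def by (intro C1_map_smooth_step C1_map_diff C1_map_const)
  have k0: "k x = 0" if "\<epsilon> \<le> norm x" for x
    using that \<epsilon>(1) by (auto simp: k_def dot_square_norm intro!: smooth_step_eq_0 power_mono)
  have kpos: "0 < k x" if "norm x < \<epsilon>" for x
    using that by (auto simp: k_def dot_square_norm intro!: smooth_step_pos power_strict_mono)
  have kcont: "continuous_on S k" for S using C1_map_continuous_on[OF kC1] .
  let ?D = "\<lambda>x h. frechet_derivative k (at x) h"
  define h where "h = y - a"
  let ?c = "\<lambda>s. a + s *\<^sub>R h"
  have near: "norm (x - a) < 2 * R" if "s \<in> {0..1}" "norm (x - ?c s) < \<epsilon>" for x s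
  proof -
    have "norm (x - a) = norm ((x - ?c s) + s *\<^sub>R h)" by simp
    also have "\<dots> \<le> norm (x - ?c s) + \<bar>s\<bar> * norm h"
      by (metis norm_scaleR norm_triangle_ineq)
    also have "\<dots> < \<epsilon> + R"
    proof -
      have "\<bar>s\<bar> * norm h \<le> 1 * norm h" using that(1) by (intro mult_right_mono) auto
      then show ?thesis using that(2) y by (simp add: h_def dist_norm norm_minus_commute)
    qed
    finally show ?thesis using \<epsilon>(3) by simp
  qed
  obtain p q where pq: "cball a (2 * R) \<subseteq> cbox p q"
    using bounded_subset_cbox_symmetric[OF bounded_cball] by metis
  have off: "U x * k (x - ?c s) = 0" if "s \<in> {0..1}" "x \<notin> cball a (2 * R)" for x s
    using near[OF that(1), of x] that(2) k0[of "x - ?c s"] by (force simp: dist_norm norm_minus_commute)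
  define f where "f s = integral (cbox p q) (\<lambda>x. U x * k (x - ?c s))" for s :: real
  have contI: "continuous_on UNIV (\<lambda>x. U x * k (x - w))" for w
    by (intro continuous_intros U continuous_on_compose2[OF kcont[of UNIV]]) auto
  have f_eq: "f s = (LINT x|lborel. U (?c s + x) * k x)" if "s \<in> {0..1}" for s
  proof -
    have "f s = (LINT x|lborel. U x * k (x - ?c s))"
      unfolding f_def using off[OF that] pq
      by (intro LINT_continuous_compact_support(2)[symmetric] contI) blast
    also have "\<dots> = (LINT x|lborel. U (?c s + x) * k (?c s + x - ?c s))"
      by (rule lborel_integral_shift[symmetric]) (intro borel_measurable_continuous_onI contI)
    finally show ?thesis by simp
  qed
  have der: "(f has_real_derivative 0) (at s within {0..1})" if s: "s \<in> {0..1}" for s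
  proof -
    have "((\<lambda>s. integral (cbox p q) (\<lambda>x. U x * k (x - ?c s))) has_field_derivative
        integral (cbox p q) (\<lambda>x. U x * (- ?D (x - ?c s) h))) (at s within {0..1})"
    proof (rule leibniz_rule_field_derivative[where fx = "\<lambda>s x. U x * (- ?D (x - ?c s) h)"])
      show "((\<lambda>s. U x * k (x - ?c s)) has_real_derivative U x * (- ?D (x - ?c s) h)) (at s within {0..1})"
        for s x
      proof -
        have "((\<lambda>s. x - ?c s) has_derivative (\<lambda>r. - (r *\<^sub>R h))) (at s within {0..1})"
          by (auto intro!: derivative_eq_intros)
        from has_derivative_compose[OF this C1_map_has_derivative[OF kC1]]
        have "((\<lambda>s. k (x - ?c s)) has_derivative (\<lambda>r. ?D (x - ?c s) (- (r *\<^sub>R h)))) (at s within {0..1})" .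
        moreover have "?D z (- (r *\<^sub>R h)) = - ?D z h * r" for r z
        proof -
          have "linear (?D z)"
            using kC1 by (intro linear_frechet_derivative) (simp add: C1_map_def)
          then show ?thesis by (simp add: linear_neg linear_scale mult.commute)
        qed
        ultimately have "((\<lambda>s. k (x - ?c s)) has_real_derivative - ?D (x - ?c s) h) (at s within {0..1})"
          unfolding has_field_derivative_def by (elim has_derivative_eq_rhs) (simp add: fun_eq_iff)
        then show ?thesis by (rule DERIV_cmult)
      qed
      show "(\<lambda>x. U x * k (x - ?c s)) integrable_on cbox p q" for s
        by (intro integrable_continuous continuous_on_subset[OF contI]) auto
      show "continuous_on ({0..1} \<times> cbox p q) (\<lambda>(s, x). U x * (- ?D (x - ?c s) h))"
        unfolding split_beta
        by (intro continuous_intros continuous_on_compose2[OF U(1)]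
            continuous_on_compose2[OF C1_map_continuous_derivative[OF kC1]]) auto
    qed (use s in auto)
    moreover have "integral (cbox p q) (\<lambda>x. U x * (- ?D (x - ?c s) h)) = 0"
    proof -
      define \<phi> where "\<phi> x = k (x - ?c s)" for x
      have \<phi>': "(\<phi> has_derivative ?D (x - ?c s)) (at x)" for x
      proof -
        have "((\<lambda>x. x - ?c s) has_derivative (\<lambda>x. x)) (at x)" by (auto intro!: derivative_eq_intros)
        from has_derivative_compose[OF this C1_map_has_derivative[OF kC1]] show ?thesis
          by (simp add: \<phi>_def[abs_def])
      qed
      have \<phi>D: "frechet_derivative \<phi> (at x) = ?D (x - ?c s)" for x
        using frechet_derivative_at[OF \<phi>'] by simp
      have "C1_map \<phi>"
        by (rule C1_mapI[OF \<phi>'])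
           (intro continuous_on_compose2[OF C1_map_continuous_derivative[OF kC1]] continuous_intros; simp)
      moreover have \<phi>0: "\<phi> x = 0" if "x \<notin> cball a (2 * R)" for x
        using near[OF s, of x] that k0[of "x - ?c s"]
        by (force simp: dist_norm norm_minus_commute \<phi>_def)
      ultimately have \<phi>: "test_function \<Omega> \<phi>"
        using ball unfolding test_function_def
        by (intro conjI exI[of _ "cball a (2 * R)"] allI impI) simp_all
      have D0: "?D (x - ?c s) h = 0" if "x \<notin> cball a (2 * R)" for x
        using frechet_derivative_eq_0_outside[of "cball a (2 * R)" \<phi> x] \<phi>0 that by (simp add: \<phi>D)
      have cont: "continuous_on UNIV (\<lambda>x. U x * ?D (x - ?c s) h)"
        by (intro continuous_intros U(1)
            continuous_on_compose2[OF C1_map_continuous_derivative[OF kC1]]) auto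
      have "0 = (LINT x|lebesgue_on \<Omega>. u x * ?D (x - ?c s) h)"
        using zero[OF \<phi>, of h] by (simp add: \<phi>D)
      also have "\<dots> = (LINT x|lebesgue. (if x \<in> \<Omega> then u x * ?D (x - ?c s) h else 0))"
        using \<Omega> by (intro Lebesgue_Measure.integral_restrict_UNIV[symmetric]) auto
      also have "\<dots> = (LINT x|lebesgue. U x * ?D (x - ?c s) h)"
      proof (intro Bochner_Integration.integral_cong refl)
        show "(if x \<in> \<Omega> then u x * ?D (x - ?c s) h else 0) = U x * ?D (x - ?c s) h" for x
          using D0[of x] ball U(2)[of x] by (cases "x \<in> cball a (2 * R)") auto
      qed
      also have "\<dots> = (LINT x|lborel. U x * ?D (x - ?c s) h)"
        using borel_measurable_continuous_onI[OF cont] by (intro integral_completion) simp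
      also have "\<dots> = integral (cbox p q) (\<lambda>x. U x * ?D (x - ?c s) h)"
        by (intro LINT_continuous_compact_support(2) cont) (metis D0 mult_zero_right pq subsetD)
      finally show ?thesis by simp
    qed
    ultimately show ?thesis by (simp add: f_def[abs_def])
  qed
  have "f 1 = f 0"
    using has_field_derivative_zero_constant[of "{0..1::real}" f] der by force
  then have eq: "(LINT x|lborel. U (y + x) * k x) = (LINT x|lborel. U (a + x) * k x)"
    using f_eq[of 0] f_eq[of 1] by (simp add: h_def)
  obtain r s where rs: "cball (0::'a) \<epsilon> \<subseteq> cbox r s"
    using bounded_subset_cbox_symmetric[OF bounded_cball] by metis
  have cont2: "continuous_on UNIV (\<lambda>x. U (w + x) * k x)" for w
    by (intro continuous_intros kcont continuous_on_compose2[OF U(1)]) auto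
  have k00: "k x = 0" if "x \<notin> cbox r s" for x
    using rs that k0[of x] by (force simp: not_le)
  let ?g = "\<lambda>x. U (y + x) * k x - U (a + x) * k x"
  have gcont: "continuous_on UNIV ?g" by (intro continuous_on_diff cont2)
  have "integral (cbox r s) ?g = (LINT x|lborel. ?g x)"
    using k00 by (intro LINT_continuous_compact_support(2)[symmetric] gcont) auto
  also have "\<dots> = 0"
    using eq LINT_continuous_compact_support(1)[OF cont2, of r s] k00 by simp
  finally have "(?g has_integral 0) (cbox r s)"
    using integrable_integral[OF integrable_continuous[OF continuous_on_subset[OF gcont subset_UNIV], of r s]] by simp
  moreover have "0 \<le> ?g x" for x
    using d0[of x] k0[of x] kpos[of x] \<epsilon>(2)
    by (cases "norm x < \<epsilon>") (auto simp flip: left_diff_distrib)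
  moreover have "0 \<in> cbox r s" "box r s \<noteq> {}"
  proof -
    show "0 \<in> cbox r s" using rs \<epsilon>(1) by force
    have "ball 0 \<epsilon> \<subseteq> interior (cbox r s)"
      using rs by (intro interior_maximal) (auto simp: subset_iff)
    then show "box r s \<noteq> {}" using \<epsilon>(1) by force
  qed
  ultimately have "?g 0 = 0"
    using has_integral_0_cbox_imp_0[of r s ?g 0] continuous_on_subset[OF gcont] by blast
  then show False using d0[of 0] kpos[of 0] d(1) \<epsilon>(1) by (simp flip: left_diff_distrib)
qed

lemma constant_on_if_weak_gradient_zero:
  fixes u :: "'a::euclidean_space \<Rightarrow> real"
  assumes \<Omega>: "open \<Omega>" "connected \<Omega>" and u: "continuous_on \<Omega> u"
    and zero: "\<And>\<phi> h. test_function \<Omega> \<phi> \<Longrightarrow>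
        (LINT x|lebesgue_on \<Omega>. u x * frechet_derivative \<phi> (at x) h) = 0"
  shows "u constant_on \<Omega>"
proof (rule locally_constant_imp_constant[OF \<Omega>(2)])
  fix a assume "a \<in> \<Omega>"
  then obtain e where e: "0 < e" "cball a e \<subseteq> \<Omega>"
    using \<Omega>(1) open_contains_cball by blast
  have 1: "\<not> u a < u y" if "dist a y < e / 2" for y
    using no_increase_if_weak_gradient_zero[OF \<Omega>(1) u zero, of a "e / 2" y] e that by simp
  have 2: "\<not> - u a < - u y" if "dist a y < e / 2" for y
    using no_increase_if_weak_gradient_zero[OF \<Omega>(1) continuous_on_minus[OF u], of a "e / 2" y]
      zero e that by simp
  have "ball a (e / 2) \<subseteq> \<Omega>" using e by (force simp: subset_iff)
  then show "\<exists>T. openin (top_of_set \<Omega>) T \<and> a \<in> T \<and> (\<forall>x\<in>T. u x = u a)"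
    using 1 2 e(1) by (intro exI[of _ "ball a (e / 2)"])
      (auto simp: openin_open_eq[OF \<Omega>(1)] not_less intro!: antisym)
qed

section \<open>Goursat averaging of divergence-free fields\<close>

text \<open>
  The outward flux of the field \<open>(f, g)\<close> through the boundary of the square with lower left
  corner \<open>(a, b)\<close> and side \<open>h\<close>.
\<close>

definition square_flux :: "(real \<times> real \<Rightarrow> real) \<Rightarrow> (real \<times> real \<Rightarrow> real) \<Rightarrow> real \<Rightarrow> real \<Rightarrow> real \<Rightarrow> real" where
  "square_flux f g a b h = integral {b..b+h} (\<lambda>r. f (a + h, r) - f (a, r))
     + integral {a..a+h} (\<lambda>s. g (s, b + h) - g (s, b))"

lemma continuous_on_slices:
  fixes f :: "real \<times> real \<Rightarrow> real"
  assumes "continuous_on UNIV f"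
  shows "continuous_on S (\<lambda>r. f (a, r))" "continuous_on S (\<lambda>s. f (s, b))"
  by (intro continuous_on_compose2[OF assms] continuous_intros; simp)+

text \<open>The fluxes through the edges shared by two of the four smaller squares cancel.\<close>

lemma square_flux_subdivide:
  assumes f: "continuous_on UNIV f" and g: "continuous_on UNIV g" and h: "0 \<le> h"
  shows "square_flux f g a b (2 * h) = square_flux f g a b h + square_flux f g (a + h) b h
    + square_flux f g a (b + h) h + square_flux f g (a + h) (b + h) h"
proof -
  note [continuous_intros] = continuous_on_slices[OF f] continuous_on_slices[OF g]
  have split: "integral {p..p + 2 * h} q = integral {p..p+h} q + integral {p+h..p+h+h} q"
    if "continuous_on UNIV q" for p and q :: "real \<Rightarrow> real"
    using Henstock_Kurzweil_Integration.integral_combine[of p "p + h" "p + 2 * h" q] h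
      integrable_continuous_real[OF continuous_on_subset[OF that]]
    by (simp add: algebra_simps)
  have diff: "integral {p..p'} (\<lambda>r. k1 r - k3 r)
      = integral {p..p'} (\<lambda>r. k1 r - k2 r) + integral {p..p'} (\<lambda>r. k2 r - k3 r)"
    if "continuous_on UNIV k1" "continuous_on UNIV k2" "continuous_on UNIV k3"
    for p p' and k1 k2 k3 :: "real \<Rightarrow> real"
    by (subst Henstock_Kurzweil_Integration.integral_add[symmetric])
       (auto intro!: integrable_continuous_real continuous_intros continuous_on_subset[OF that(1)]
         continuous_on_subset[OF that(2)] continuous_on_subset[OF that(3)])
  have "integral {b..b + 2 * h} (\<lambda>r. f (a + 2 * h, r) - f (a, r))
      = integral {b..b+h} (\<lambda>r. f (a + h + h, r) - f (a + h, r)) + integral {b..b+h} (\<lambda>r. f (a + h, r) - f (a, r))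
      + (integral {b+h..b+h+h} (\<lambda>r. f (a + h + h, r) - f (a + h, r))
        + integral {b+h..b+h+h} (\<lambda>r. f (a + h, r) - f (a, r)))"
  proof -
    have e: "a + 2 * h = a + h + h" by simp
    have "continuous_on UNIV (\<lambda>r. f (a + h + h, r) - f (a, r))"
      by (intro continuous_on_diff continuous_on_slices f)
    from split[OF this, of b]
    show ?thesis unfolding e
      by (simp only: diff[of "\<lambda>r. f (a + h + h, r)" "\<lambda>r. f (a + h, r)" "\<lambda>r. f (a, r)"] continuous_on_slices[OF f])
  qed
  moreover have "integral {a..a + 2 * h} (\<lambda>r. g (r, b + 2 * h) - g (r, b))
      = integral {a..a+h} (\<lambda>r. g (r, b + h + h) - g (r, b + h)) + integral {a..a+h} (\<lambda>r. g (r, b + h) - g (r, b))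
      + (integral {a+h..a+h+h} (\<lambda>r. g (r, b + h + h) - g (r, b + h))
        + integral {a+h..a+h+h} (\<lambda>r. g (r, b + h) - g (r, b)))"
  proof -
    have e: "b + 2 * h = b + h + h" by simp
    have "continuous_on UNIV (\<lambda>r. g (r, b + h + h) - g (r, b))"
      by (intro continuous_on_diff continuous_on_slices g)
    from split[OF this, of a]
    show ?thesis unfolding e
      by (simp only: diff[of "\<lambda>r. g (r, b + h + h)" "\<lambda>r. g (r, b + h)" "\<lambda>r. g (r, b)"] continuous_on_slices[OF g])
  qed
  ultimately show ?thesis by (simp add: square_flux_def add.assoc)
qed

text \<open>
  The affine part of the field at \<open>p\<close> has flux \<open>(f' (1, 0) + g' (0, 1)) h\<^sup>2 = 0\<close>. The remainder
  is at most \<open>2 e h\<close> in size, and it is integrated over four edges of length \<open>h\<close>.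
\<close>

lemma square_flux_bound:
  assumes f: "continuous_on UNIV f" and g: "continuous_on UNIV g" and h: "0 \<le> h" and e: "0 \<le> e"
    and p: "p \<in> cbox (a, b) (a + h, b + h)"
    and f': "linear f'" "\<And>y. y \<in> cbox (a, b) (a + h, b + h) \<Longrightarrow> \<bar>f y - f p - f' (y - p)\<bar> \<le> e * norm (y - p)"
    and g': "linear g'" "\<And>y. y \<in> cbox (a, b) (a + h, b + h) \<Longrightarrow> \<bar>g y - g p - g' (y - p)\<bar> \<le> e * norm (y - p)"
    and div: "f' (1, 0) + g' (0, 1) = 0"
  shows "\<bar>square_flux f g a b h\<bar> \<le> 8 * e * h\<^sup>2"
proof -
  note [continuous_intros] = continuous_on_slices[OF f] continuous_on_slices[OF g]
  have diam: "norm (y - p) \<le> 2 * h" if "y \<in> cbox (a, b) (a + h, b + h)" for y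
  proof -
    have "norm (y - p) \<le> \<bar>fst y - fst p\<bar> + \<bar>snd y - snd p\<bar>"
      using norm_Pair_le[of "fst (y - p)" "snd (y - p)"] by (simp only: prod.collapse) simp
    also have "\<dots> \<le> h + h" using that p by (cases y; cases p; auto simp: cbox_Pair_eq)
    finally show ?thesis by simp
  qed
  have rem: "\<bar>f y - f p - f' (y - p)\<bar> \<le> e * (2 * h)" "\<bar>g y - g p - g' (y - p)\<bar> \<le> e * (2 * h)"
    if "y \<in> cbox (a, b) (a + h, b + h)" for y
    using f'(2)[OF that] g'(2)[OF that] mult_left_mono[OF diam[OF that] e] by linarith+
  have f1: "\<bar>integral {b..b+h} (\<lambda>r. f (a + h, r) - f (a, r)) - f' (1, 0) * h * h\<bar> \<le> 4 * e * h * h"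
  proof -
    have "integral {b..b+h} (\<lambda>r. f (a + h, r) - f (a, r)) - f' (1, 0) * h * h
        = integral {b..b+h} (\<lambda>r. f (a + h, r) - f (a, r) - f' (1, 0) * h)"
      using h by (subst Henstock_Kurzweil_Integration.integral_diff)
        (auto intro!: integrable_continuous_real continuous_intros)
    also have "norm \<dots> \<le> (4 * e * h) * (b + h - b)"
    proof (rule integral_bound)
      fix r assume r: "r \<in> {b..b+h}"
      have "f' ((a + h, r) - p) - f' ((a, r) - p) = f' (((a + h, r) - p) - ((a, r) - p))"
        by (simp only: linear_diff[OF f'(1)])
      also have "\<dots> = f' (h *\<^sub>R (1, 0))" by simp
      also have "\<dots> = f' (1, 0) * h" by (simp only: linear_scale[OF f'(1)]) simp
      finally have "f' ((a + h, r) - p) - f' ((a, r) - p) = f' (1, 0) * h" .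
      then show "norm (f (a + h, r) - f (a, r) - f' (1, 0) * h) \<le> 4 * e * h"
        using rem(1)[of "(a + h, r)"] rem(1)[of "(a, r)"] r h by (auto simp: cbox_Pair_eq abs_le_iff)
    qed (use h in \<open>auto intro!: continuous_intros\<close>)
    finally show ?thesis by simp
  qed
  have g1: "\<bar>integral {a..a+h} (\<lambda>r. g (r, b + h) - g (r, b)) - g' (0, 1) * h * h\<bar> \<le> 4 * e * h * h"
  proof -
    have "integral {a..a+h} (\<lambda>r. g (r, b + h) - g (r, b)) - g' (0, 1) * h * h
        = integral {a..a+h} (\<lambda>r. g (r, b + h) - g (r, b) - g' (0, 1) * h)"
      using h by (subst Henstock_Kurzweil_Integration.integral_diff)
        (auto intro!: integrable_continuous_real continuous_intros)
    also have "norm \<dots> \<le> (4 * e * h) * (a + h - a)"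
    proof (rule integral_bound)
      fix r assume r: "r \<in> {a..a+h}"
      have "g' ((r, b + h) - p) - g' ((r, b) - p) = g' (((r, b + h) - p) - ((r, b) - p))"
        by (simp only: linear_diff[OF g'(1)])
      also have "\<dots> = g' (h *\<^sub>R (0, 1))" by simp
      also have "\<dots> = g' (0, 1) * h" by (simp only: linear_scale[OF g'(1)]) simp
      finally have "g' ((r, b + h) - p) - g' ((r, b) - p) = g' (0, 1) * h" .
      then show "norm (g (r, b + h) - g (r, b) - g' (0, 1) * h) \<le> 4 * e * h"
        using rem(2)[of "(r, b + h)"] rem(2)[of "(r, b)"] r h by (auto simp: cbox_Pair_eq abs_le_iff)
    qed (use h in \<open>auto intro!: continuous_intros\<close>)
    finally show ?thesis by simp
  qed
  have "f' (1, 0) * h * h + g' (0, 1) * h * h = 0"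
    using div by (simp flip: distrib_right)
  then show ?thesis
    using f1 g1 by (auto simp: square_flux_def abs_le_iff power2_eq_square)
qed

text \<open>
  Goursat's argument: if the flux were nonzero, repeated bisection would produce nested squares
  whose flux stays above a fixed multiple \<open>\<kappa>\<close> of their area. They shrink to a point \<open>p\<close>, where
  differentiability alone contradicts this by the preceding bound.
\<close>

lemma square_flux_zero:
  assumes f: "continuous_on UNIV f" and g: "continuous_on UNIV g" and h: "0 < h"
    and der: "\<And>p. p \<in> cbox (a, b) (a + h, b + h) \<Longrightarrow>
      \<exists>f' g'. (f has_derivative f') (at p) \<and> (g has_derivative g') (at p) \<and> f' (1, 0) + g' (0, 1) = 0"
  shows "square_flux f g a b h = 0"
proof (rule ccontr)
  assume nz: "square_flux f g a b h \<noteq> 0"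
  define \<kappa> where "\<kappa> = \<bar>square_flux f g a b h\<bar> / h\<^sup>2"
  have \<kappa>: "0 < \<kappa>" using nz h by (simp add: \<kappa>_def)
  define l where "l n = h / 2 ^ n" for n :: nat
  have l: "0 < l n" "l n = 2 * l (Suc n)" for n using h by (auto simp: l_def)
  define Q where "Q n c = cbox (fst c, snd c) (fst c + l n, snd c + l n)" for n :: nat and c :: "real \<times> real"
  have "\<exists>c. \<forall>n. (\<kappa> * (l n)\<^sup>2 \<le> \<bar>square_flux f g (fst (c n)) (snd (c n)) (l n)\<bar> \<and> Q n (c n) \<subseteq> cbox (a, b) (a + h, b + h))
      \<and> Q (Suc n) (c (Suc n)) \<subseteq> Q n (c n)"
  proof (rule dependent_nat_choice)
    show "\<exists>c. \<kappa> * (l 0)\<^sup>2 \<le> \<bar>square_flux f g (fst c) (snd c) (l 0)\<bar> \<and> Q 0 c \<subseteq> cbox (a, b) (a + h, b + h)"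
      using h by (intro exI[of _ "(a, b)"]) (auto simp: l_def \<kappa>_def Q_def)
  next
    fix c :: "real \<times> real" and n
    assume c: "\<kappa> * (l n)\<^sup>2 \<le> \<bar>square_flux f g (fst c) (snd c) (l n)\<bar> \<and> Q n c \<subseteq> cbox (a, b) (a + h, b + h)"
    obtain x y where xy: "c = (x, y)" by force
    let ?l = "l (Suc n)"
    have "square_flux f g x y (2 * ?l) = square_flux f g x y ?l + square_flux f g (x + ?l) y ?l
      + square_flux f g x (y + ?l) ?l + square_flux f g (x + ?l) (y + ?l) ?l"
      by (rule square_flux_subdivide[OF f g]) (use l(1)[of "Suc n"] in simp)
    moreover have "4 * (\<kappa> * ?l\<^sup>2) \<le> \<bar>square_flux f g x y (2 * ?l)\<bar>"
      using c xy l(2)[of n] by (simp add: power_mult_distrib)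
    ultimately have "\<exists>c'\<in>{(x, y), (x + ?l, y), (x, y + ?l), (x + ?l, y + ?l)}.
        \<kappa> * ?l\<^sup>2 \<le> \<bar>square_flux f g (fst c') (snd c') ?l\<bar>"
      by (auto simp: abs_if split: if_splits)
    then obtain c' where c': "c' \<in> {(x, y), (x + ?l, y), (x, y + ?l), (x + ?l, y + ?l)}"
        "\<kappa> * ?l\<^sup>2 \<le> \<bar>square_flux f g (fst c') (snd c') ?l\<bar>" by blast
    moreover have "Q (Suc n) c' \<subseteq> Q n c"
      using c'(1) l(1)[of "Suc n"] xy by (auto simp: Q_def cbox_Pair_eq l(2)[of n])
    ultimately show "\<exists>c'. (\<kappa> * ?l\<^sup>2 \<le> \<bar>square_flux f g (fst c') (snd c') ?l\<bar>
        \<and> Q (Suc n) c' \<subseteq> cbox (a, b) (a + h, b + h)) \<and> Q (Suc n) c' \<subseteq> Q n c"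
      using c by blast
  qed
  then obtain c where c: "\<And>n. \<kappa> * (l n)\<^sup>2 \<le> \<bar>square_flux f g (fst (c n)) (snd (c n)) (l n)\<bar>"
      "\<And>n. Q n (c n) \<subseteq> cbox (a, b) (a + h, b + h)" "\<And>n. Q (Suc n) (c (Suc n)) \<subseteq> Q n (c n)"
    by blast
  have "\<Inter> (range (\<lambda>n. Q n (c n))) \<noteq> {}"
  proof (rule compact_nest)
    show "Q n (c n) \<subseteq> Q m (c m)" if "m \<le> n" for m n
      using that by (rule lift_Suc_antimono_le[of "\<lambda>n. Q n (c n)", rotated]) (rule c(3))
    show "Q n (c n) \<noteq> {}" for n
    proof -
      have "c n \<in> Q n (c n)" using l(1)[of n] by (cases "c n") (simp add: Q_def cbox_Pair_eq)
      then show ?thesis by blast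
    qed
  qed (auto simp: Q_def)
  then obtain p where p: "\<And>n. p \<in> Q n (c n)" by blast
  then obtain f' g' where d: "(f has_derivative f') (at p)" "(g has_derivative g') (at p)" "f' (1, 0) + g' (0, 1) = 0"
    using der c(2) by blast
  \<comment> \<open>With this choice the bound \<open>8 e l\<^sup>2\<close> on the flux is half of \<open>\<kappa> l\<^sup>2\<close>.\<close>
  define e where "e = \<kappa> / 16"
  have e: "0 < e" using \<kappa> by (simp add: e_def)
  obtain d1 where d1: "0 < d1" "\<And>y. norm (y - p) < d1 \<Longrightarrow> \<bar>f y - f p - f' (y - p)\<bar> \<le> e * norm (y - p)"
    using d(1) e unfolding has_derivative_at_alt by (metis real_norm_def)
  obtain d2 where d2: "0 < d2" "\<And>y. norm (y - p) < d2 \<Longrightarrow> \<bar>g y - g p - g' (y - p)\<bar> \<le> e * norm (y - p)"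
    using d(2) e unfolding has_derivative_at_alt by (metis real_norm_def)
  obtain n where n: "2 * h / min d1 d2 < 2 ^ n"
    using real_arch_pow[of 2 "2 * h / min d1 d2"] by auto
  define m where "m = min d1 d2"
  have "0 < m" using d1(1) d2(1) by (simp add: m_def)
  then have "2 * l n < m"
    using n unfolding m_def[symmetric] by (simp add: l_def pos_divide_less_eq mult.commute)
  then have small: "2 * l n < min d1 d2" by (simp add: m_def)
  obtain x y where xy: "c n = (x, y)" by force
  have near: "norm (z - p) < min d1 d2" if "z \<in> cbox (x, y) (x + l n, y + l n)" for z
  proof -
    have "norm (z - p) \<le> \<bar>fst z - fst p\<bar> + \<bar>snd z - snd p\<bar>"
      using norm_Pair_le[of "fst (z - p)" "snd (z - p)"] by (simp only: prod.collapse) simp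
    also have "\<dots> \<le> l n + l n"
      using that p[of n] xy by (cases z; cases p; auto simp: cbox_Pair_eq Q_def)
    finally show ?thesis using small by simp
  qed
  have "\<bar>square_flux f g x y (l n)\<bar> \<le> 8 * e * (l n)\<^sup>2"
  proof (rule square_flux_bound[OF f g, where p = p and f' = f' and g' = g'])
    show "p \<in> cbox (x, y) (x + l n, y + l n)" using p[of n] xy by (simp add: Q_def)
    show "linear f'" "linear g'" using d(1,2) has_derivative_linear by blast+
  qed (use l(1)[of n] e d(3) d1(2) d2(2) near in \<open>auto\<close>)
  moreover have "8 * e * (l n)\<^sup>2 < \<kappa> * (l n)\<^sup>2"
    using l(1)[of n] \<kappa> by (simp add: e_def)
  ultimately show False using c(1)[of n] xy by simp
qed

definition square_integral :: "(real \<times> real \<Rightarrow> real) \<Rightarrow> real \<Rightarrow> real \<Rightarrow> real \<Rightarrow> real" where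
  "square_integral f \<epsilon> a b = integral {-\<epsilon>..\<epsilon>} (\<lambda>r. integral {-\<epsilon>..\<epsilon>} (\<lambda>s. f (a + s, b + r)))"

lemma integral_shift_symmetric:
  fixes q :: "real \<Rightarrow> real"
  shows "integral {-\<epsilon>..\<epsilon>} (\<lambda>s. q (a + s)) = integral {a-\<epsilon>..a+\<epsilon>} q"
  using integral_shift_Icc_real[of "-\<epsilon>" \<epsilon> q a] by (simp add: o_def add.commute)

lemma moving_window_derivative:
  fixes q :: "real \<Rightarrow> real"
  assumes q: "continuous_on UNIV q" and \<epsilon>: "0 < \<epsilon>"
  shows "((\<lambda>a. integral {-\<epsilon>..\<epsilon>} (\<lambda>s. q (a + s))) has_real_derivative q (a + \<epsilon>) - q (a - \<epsilon>)) (at a)"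
proof -
  \<comment> \<open>An antiderivative based to the left of all windows \<open>{x - \<epsilon>..x + \<epsilon>}\<close> for \<open>x\<close> near \<open>a\<close>.\<close>
  define Q where "Q x = integral {a - 2 * \<epsilon>..x} q" for x
  have int: "q integrable_on {x..y}" for x y
    by (intro integrable_continuous_real continuous_on_subset[OF q]) auto
  have dQ: "(Q has_real_derivative q x) (at x)" if "a - 2 * \<epsilon> < x" for x
  proof -
    have "(Q has_real_derivative q x) (at x within {a - 2 * \<epsilon>..x + 1})"
      unfolding Q_def using that
      by (intro integral_has_real_derivative continuous_on_subset[OF q]) auto
    moreover have "at x within {a - 2 * \<epsilon>..x + 1} = at x"
      using that by (intro at_within_interior) auto
    ultimately show ?thesis by simp
  qed
  have "((\<lambda>a. Q (a + \<epsilon>) - Q (a - \<epsilon>)) has_real_derivative q (a + \<epsilon>) * 1 - q (a - \<epsilon>) * 1) (at a)"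
    using \<epsilon> by (intro DERIV_diff DERIV_chain2[OF dQ]) (auto intro!: derivative_eq_intros)
  then have "((\<lambda>a. Q (a + \<epsilon>) - Q (a - \<epsilon>)) has_real_derivative q (a + \<epsilon>) - q (a - \<epsilon>)) (at a)"
    by simp
  then show ?thesis
  proof (rule has_field_derivative_transform_within_open)
    show "open {a - \<epsilon> / 2<..<a + \<epsilon> / 2}" "a \<in> {a - \<epsilon> / 2<..<a + \<epsilon> / 2}" using \<epsilon> by auto
    fix x assume x: "x \<in> {a - \<epsilon> / 2<..<a + \<epsilon> / 2}"
    have "integral {a - 2 * \<epsilon>..x - \<epsilon>} q + integral {x - \<epsilon>..x + \<epsilon>} q = integral {a - 2 * \<epsilon>..x + \<epsilon>} q"
      by (intro Henstock_Kurzweil_Integration.integral_combine int) (use x \<epsilon> in auto)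
    then show "Q (x + \<epsilon>) - Q (x - \<epsilon>) = integral {-\<epsilon>..\<epsilon>} (\<lambda>s. q (x + s))"
      by (simp add: Q_def integral_shift_symmetric)
  qed
qed

lemma has_derivative_if_continuous_partials:
  fixes G G1 G2 :: "real \<Rightarrow> real \<Rightarrow> real"
  assumes 1: "\<And>a b. ((\<lambda>a. G a b) has_real_derivative G1 a b) (at a)"
    and 2: "\<And>a b. ((\<lambda>b. G a b) has_real_derivative G2 a b) (at b)"
    and cont: "continuous_on UNIV (\<lambda>(a, b). G2 a b)"
  shows "((\<lambda>(a, b). G a b) has_derivative (\<lambda>(s, r). G1 a b * s + G2 a b * r)) (at (a, b))"
proof -
  have "((\<lambda>(a, b). G a b) has_derivative (\<lambda>(s, r). G1 a b * s + blinfun_mult_right (G2 a b) r))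
      (at (a, b) within UNIV \<times> UNIV)"
  proof (rule has_derivative_partialsI)
    show "((\<lambda>a. G a b) has_derivative (*) (G1 a b)) (at a within UNIV)"
      using 1[of b a] by (simp add: has_field_derivative_def)
    show "((\<lambda>y. G x y) has_derivative blinfun_apply (blinfun_mult_right (G2 x y))) (at y within UNIV)" for x y
      using 2[of x y] by (simp add: has_field_derivative_def)
    have "continuous_on UNIV (\<lambda>z. blinfun_mult_right (case z of (x, y) \<Rightarrow> G2 x y))"
      by (intro bounded_linear.continuous_on[OF bounded_linear_blinfun_mult_right] cont)
    then show "continuous (at (a, b) within UNIV \<times> UNIV) (\<lambda>(x, y). blinfun_mult_right (G2 x y))"
      by (simp add: continuous_on_eq_continuous_at split_beta')
  qed auto
  then show ?thesis by simp
qed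

text \<open>
  Differentiating an average over a moving square in one coordinate direction leaves the
  difference of the integrals over two opposite edges. This is continuous even though \<open>f\<close> need
  not be differentiable.
\<close>

lemma square_integral_derivative:
  assumes f: "continuous_on UNIV f" and \<epsilon>: "0 < \<epsilon>"
  defines "G1 \<equiv> \<lambda>a b. integral {-\<epsilon>..\<epsilon>} (\<lambda>r. f (a + \<epsilon>, b + r) - f (a - \<epsilon>, b + r))"
    and "G2 \<equiv> \<lambda>a b. integral {-\<epsilon>..\<epsilon>} (\<lambda>s. f (a + s, b + \<epsilon>) - f (a + s, b - \<epsilon>))"
  shows "((\<lambda>(a, b). square_integral f \<epsilon> a b) has_derivative (\<lambda>(s, r). G1 a b * s + G2 a b * r)) (at (a, b))"
    and "continuous_on UNIV (\<lambda>(a, b). G1 a b)" and "continuous_on UNIV (\<lambda>(a, b). G2 a b)"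
proof -
  define A where "A a b = integral {-\<epsilon>..\<epsilon>} (\<lambda>s. f (a + s, b))" for a b
  have fc: "continuous_on S (\<lambda>x. f (p x, q x))" if "continuous_on S p" "continuous_on S q"
    for S :: "'z::topological_space set" and p q
    by (rule continuous_on_compose2[OF f continuous_on_Pair[OF that]]) simp
  have "continuous_on UNIV (\<lambda>z. integral (cbox (-\<epsilon>) \<epsilon>) (\<lambda>s. f (fst z + s, snd z)))"
    by (rule integral_continuous_on_param) (auto simp: split_beta intro!: fc continuous_intros)
  then have Acont: "continuous_on UNIV (\<lambda>z. A (fst z) (snd z))" by (simp add: A_def)
  have Ac: "continuous_on S (\<lambda>x. A (p x) (q x))" if "continuous_on S p" "continuous_on S q"
    for S :: "'z::topological_space set" and p q
    using continuous_on_compose2[OF Acont continuous_on_Pair[OF that]] by simp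
  have "continuous_on UNIV (\<lambda>z. integral (cbox (-\<epsilon>) \<epsilon>) (\<lambda>r. f (fst z + \<epsilon>, snd z + r) - f (fst z - \<epsilon>, snd z + r)))"
    by (rule integral_continuous_on_param) (auto simp: split_beta intro!: fc continuous_intros)
  then show G1c: "continuous_on UNIV (\<lambda>(a, b). G1 a b)" by (simp add: G1_def split_beta')
  have "continuous_on UNIV (\<lambda>z. integral (cbox (-\<epsilon>) \<epsilon>) (\<lambda>r. f (fst z + r, snd z + \<epsilon>) - f (fst z + r, snd z - \<epsilon>)))"
    by (rule integral_continuous_on_param) (auto simp: split_beta intro!: fc continuous_intros)
  then show G2c: "continuous_on UNIV (\<lambda>(a, b). G2 a b)" by (simp add: G2_def split_beta')
  show "((\<lambda>(a, b). square_integral f \<epsilon> a b) has_derivative (\<lambda>(s, r). G1 a b * s + G2 a b * r)) (at (a, b))"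
  proof (rule has_derivative_if_continuous_partials[OF _ _ G2c])
    fix a b
    have dA: "((\<lambda>a. A a b) has_real_derivative f (a + \<epsilon>, b) - f (a - \<epsilon>, b)) (at a)" for a b
      unfolding A_def by (rule moving_window_derivative[of "\<lambda>s. f (s, b)", OF _ \<epsilon>]) (intro fc continuous_intros)
    have "((\<lambda>a. integral (cbox (-\<epsilon>) \<epsilon>) (\<lambda>r. A a (b + r))) has_field_derivative
        integral (cbox (-\<epsilon>) \<epsilon>) (\<lambda>r. f (a + \<epsilon>, b + r) - f (a - \<epsilon>, b + r))) (at a within UNIV)"
      by (rule leibniz_rule_field_derivative[where fx = "\<lambda>a r. f (a + \<epsilon>, b + r) - f (a - \<epsilon>, b + r)"])
         (auto simp: split_beta dA intro!: integrable_continuous_real Ac fc continuous_intros)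
    then show "((\<lambda>a. square_integral f \<epsilon> a b) has_real_derivative G1 a b) (at a)"
      by (simp add: square_integral_def A_def G1_def)
    have "((\<lambda>b. integral {-\<epsilon>..\<epsilon>} (\<lambda>r. A a (b + r))) has_real_derivative A a (b + \<epsilon>) - A a (b - \<epsilon>)) (at b)"
      by (rule moving_window_derivative[of "\<lambda>s. A a s", OF _ \<epsilon>]) (intro Ac continuous_intros)
    moreover have "A a (b + \<epsilon>) - A a (b - \<epsilon>) = G2 a b"
      unfolding A_def G2_def
      by (intro Henstock_Kurzweil_Integration.integral_diff[symmetric] integrable_continuous_real fc continuous_intros)
    ultimately show "((\<lambda>b. square_integral f \<epsilon> a b) has_real_derivative G2 a b) (at b)"
      by (simp add: square_integral_def A_def)
  qed
qed

lemma square_integral_approx: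
  assumes f: "continuous_on UNIV f" and \<epsilon>: "0 < \<epsilon>"
    and e: "\<And>s r. \<bar>s\<bar> \<le> \<epsilon> \<Longrightarrow> \<bar>r\<bar> \<le> \<epsilon> \<Longrightarrow> \<bar>f (a + s, b + r) - k\<bar> \<le> e"
  shows "\<bar>square_integral f \<epsilon> a b / (4 * \<epsilon>\<^sup>2) - k\<bar> \<le> e"
proof -
  have fc: "continuous_on S (\<lambda>x. f (p x, q x))" if "continuous_on S p" "continuous_on S q"
    for S :: "'z::topological_space set" and p q
    by (rule continuous_on_compose2[OF f continuous_on_Pair[OF that]]) simp
  have inner: "\<bar>integral {-\<epsilon>..\<epsilon>} (\<lambda>s. f (a + s, b + r)) - 2 * \<epsilon> * k\<bar> \<le> e * (2 * \<epsilon>)" if "\<bar>r\<bar> \<le> \<epsilon>" for r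
  proof -
    have "integral {-\<epsilon>..\<epsilon>} (\<lambda>s. f (a + s, b + r)) - 2 * \<epsilon> * k
        = integral {-\<epsilon>..\<epsilon>} (\<lambda>s. f (a + s, b + r) - k)"
      using \<epsilon> by (subst Henstock_Kurzweil_Integration.integral_diff)
        (auto intro!: integrable_continuous_real fc continuous_intros)
    also have "norm \<dots> \<le> e * (\<epsilon> - (- \<epsilon>))"
      by (rule integral_bound) (use \<epsilon> e that in \<open>auto intro!: fc continuous_intros\<close>)
    finally show ?thesis by simp
  qed
  have "continuous_on UNIV (\<lambda>r. integral (cbox (-\<epsilon>) \<epsilon>) (\<lambda>s. f (a + s, b + r)))"
    by (rule integral_continuous_on_param) (auto simp: split_beta intro!: fc continuous_intros)
  then have c: "continuous_on S (\<lambda>r. integral {-\<epsilon>..\<epsilon>} (\<lambda>s. f (a + s, b + r)))" for S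
    by (auto intro: continuous_on_subset)
  have "square_integral f \<epsilon> a b - 2 * \<epsilon> * (2 * \<epsilon> * k)
      = integral {-\<epsilon>..\<epsilon>} (\<lambda>r. integral {-\<epsilon>..\<epsilon>} (\<lambda>s. f (a + s, b + r)) - 2 * \<epsilon> * k)"
    unfolding square_integral_def using \<epsilon>
    by (subst Henstock_Kurzweil_Integration.integral_diff)
       (auto intro!: integrable_continuous_real c)
  also have "norm \<dots> \<le> (e * (2 * \<epsilon>)) * (\<epsilon> - (- \<epsilon>))"
    by (rule integral_bound) (use \<epsilon> inner in \<open>auto intro!: c continuous_intros\<close>)
  finally have "\<bar>square_integral f \<epsilon> a b - 4 * \<epsilon>\<^sup>2 * k\<bar> \<le> e * (4 * \<epsilon>\<^sup>2)"
    by (simp add: power2_eq_square)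
  moreover have "\<bar>square_integral f \<epsilon> a b / (4 * \<epsilon>\<^sup>2) - k\<bar>
      = \<bar>square_integral f \<epsilon> a b - 4 * \<epsilon>\<^sup>2 * k\<bar> / (4 * \<epsilon>\<^sup>2)"
  proof -
    have "square_integral f \<epsilon> a b / (4 * \<epsilon>\<^sup>2) - k = (square_integral f \<epsilon> a b - 4 * \<epsilon>\<^sup>2 * k) / (4 * \<epsilon>\<^sup>2)"
      using \<epsilon> by (simp add: field_simps)
    then show ?thesis using \<epsilon> by (simp add: abs_divide)
  qed
  ultimately show ?thesis using \<epsilon> by (simp add: pos_divide_le_eq)
qed

lemma divergence_zero_dim_1_constant:
  fixes \<tau> :: "'a::euclidean_space \<Rightarrow> 'a"
  assumes "DIM('a) = 1" "open \<Omega>" "connected \<Omega>"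
    and \<tau>: "\<And>x. x \<in> \<Omega> \<Longrightarrow> \<tau> differentiable (at x) \<and> divergence \<tau> x = 0"
  obtains k where "\<And>x. x \<in> \<Omega> \<Longrightarrow> \<tau> x = k"
proof -
  obtain e :: 'a where e: "Basis = {e}" using assms(1) card_1_singletonE by blast
  have rep: "x = (x \<bullet> e) *\<^sub>R e" for x :: 'a
    using euclidean_representation[of x] unfolding e by simp
  have "(\<tau> has_derivative (\<lambda>h. 0)) (at x)" if "x \<in> \<Omega>" for x
  proof -
    let ?D = "frechet_derivative \<tau> (at x)"
    have d: "(\<tau> has_derivative ?D) (at x)" using \<tau>[OF that] by (simp add: frechet_derivative_works)
    have "?D e \<bullet> e = 0" using \<tau>[OF that] by (simp add: divergence_def e)
    then have "?D e = 0" using rep[of "?D e"] by simp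
    then have "?D h = 0" for h
      using linear_scale[OF has_derivative_linear[OF d], of "h \<bullet> e" e] rep[of h] by simp
    then have "?D = (\<lambda>h. 0)" by blast
    then show ?thesis using d by simp
  qed
  then obtain k where "\<And>x. x \<in> \<Omega> \<Longrightarrow> \<tau> x = k"
    using has_derivative_zero_unique_connected[OF assms(2,3), of \<tau>] by metis
  then show ?thesis using that by blast
qed

text \<open>
  In the plane, \<open>T\<close> is the average of \<open>\<tau>\<close> over squares of side \<open>2 * \<epsilon>\<close>: its divergence at \<open>x\<close> is
  the flux of \<open>\<tau>\<close> through the square around \<open>x\<close> divided by the area, which vanishes by Goursat's
  argument. On the line, \<open>\<tau>\<close> itself is constant.
\<close>

lemma divergence_free_C1_approximation:
  fixes \<tau> :: "'a::euclidean_space \<Rightarrow> 'a"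
  assumes dim: "DIM('a) = 1 \<or> DIM('a) = 2" and \<Omega>: "open \<Omega>" "connected \<Omega>"
    and cont: "continuous_on (closure \<Omega>) \<tau>"
    and \<tau>: "\<And>x. x \<in> \<Omega> \<Longrightarrow> \<tau> differentiable (at x) \<and> divergence \<tau> x = 0"
    and K: "compact K" "K \<subseteq> \<Omega>" and e: "0 < e"
  obtains T where "C1_map T" "\<And>x. x \<in> K \<Longrightarrow> norm (T x - \<tau> x) \<le> e" "\<And>x. x \<in> K \<Longrightarrow> divergence T x = 0"
proof (cases "DIM('a) = 1")
  case True
  then obtain k where "\<And>x. x \<in> \<Omega> \<Longrightarrow> \<tau> x = k"
    using divergence_zero_dim_1_constant[OF _ \<Omega> \<tau>] by blast
  then show ?thesis
    using K e by (intro that[of "\<lambda>x. k"]) (auto simp: divergence_def subset_iff)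
next
  case False
  then have "card (Basis :: 'a set) = 2" using dim by simp
  then obtain e1 e2 :: 'a where B: "Basis = {e1, e2}" "e1 \<noteq> e2" by (auto simp: card_2_iff)
  then have eB: "e1 \<in> Basis" "e2 \<in> Basis" by auto
  have ip: "e1 \<bullet> e1 = 1" "e2 \<bullet> e2 = 1" "e1 \<bullet> e2 = 0" "e2 \<bullet> e1 = 0"
    using eB B(2) by (auto simp: inner_Basis)
  have rep: "x = (x \<bullet> e1) *\<^sub>R e1 + (x \<bullet> e2) *\<^sub>R e2" for x :: 'a
  proof -
    have "x = (\<Sum>b\<in>Basis. (x \<bullet> b) *\<^sub>R b)" by (simp only: euclidean_representation)
    also have "\<dots> = (x \<bullet> e1) *\<^sub>R e1 + (x \<bullet> e2) *\<^sub>R e2" using B(2) unfolding B(1) by simp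
    finally show ?thesis .
  qed
  \<comment> \<open>A continuous extension to the whole plane, so that the averages are defined everywhere.\<close>
  obtain F where F: "continuous_on UNIV F" "\<And>x. x \<in> closure \<Omega> \<Longrightarrow> F x = \<tau> x"
    using Tietze_unbounded[of "closure \<Omega>" \<tau> UNIV] cont by auto
  define pt where "pt z = fst z *\<^sub>R e1 + snd z *\<^sub>R e2" for z :: "real \<times> real"
  have pt_lin: "bounded_linear pt"
    unfolding pt_def by (intro bounded_linear_intros bounded_linear_fst bounded_linear_snd)
  define f where "f i z = F (pt z) \<bullet> i" for i :: 'a and z
  have fcont: "continuous_on UNIV (f i)" for i
    unfolding f_def
    by (intro continuous_intros continuous_on_compose2[OF F(1)] linear_continuous_on pt_lin) auto
  obtain d where d: "0 < d" "\<And>x. x \<in> K \<Longrightarrow> cball x d \<subseteq> \<Omega>"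
    using compact_subset_open_imp_cball_epsilon_subset[OF K(1) \<Omega>(1) K(2)] by (metis UN_subset_iff)
  obtain R where R: "\<And>x. x \<in> K \<Longrightarrow> norm x \<le> R" using compact_imp_bounded[OF K(1)] by (auto simp: bounded_iff)
  have "uniformly_continuous_on (cball 0 (R + d)) F"
    by (intro compact_uniformly_continuous continuous_on_subset[OF F(1)]) auto
  then obtain d' where d': "0 < d'" "\<And>x y. x \<in> cball 0 (R + d) \<Longrightarrow> y \<in> cball 0 (R + d) \<Longrightarrow> dist x y < d' \<Longrightarrow> dist (F x) (F y) < e / 2"
    using e unfolding uniformly_continuous_on_def by (metis half_gt_zero dist_commute)
  define \<epsilon> where "\<epsilon> = min d (d' / 2) / 2"
  have \<epsilon>: "0 < \<epsilon>" "2 * \<epsilon> \<le> d" "2 * \<epsilon> < d'"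
    using d(1) d'(1) by (auto simp: \<epsilon>_def min_def)
  have near: "norm (pt z - x) \<le> 2 * \<epsilon>"
    if "\<bar>fst z - x \<bullet> e1\<bar> \<le> \<epsilon>" "\<bar>snd z - x \<bullet> e2\<bar> \<le> \<epsilon>" for z and x :: 'a
  proof -
    have "pt z - x = (fst z - x \<bullet> e1) *\<^sub>R e1 + (snd z - x \<bullet> e2) *\<^sub>R e2"
    proof -
      have "pt z - ((x \<bullet> e1) *\<^sub>R e1 + (x \<bullet> e2) *\<^sub>R e2)
          = (fst z - x \<bullet> e1) *\<^sub>R e1 + (snd z - x \<bullet> e2) *\<^sub>R e2"
        by (simp add: pt_def scaleR_diff_left)
      then show ?thesis by (simp only: rep[symmetric])
    qed
    also have "norm \<dots> \<le> \<bar>fst z - x \<bullet> e1\<bar> + \<bar>snd z - x \<bullet> e2\<bar>"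
      using norm_triangle_ineq[of "(fst z - x \<bullet> e1) *\<^sub>R e1" "(snd z - x \<bullet> e2) *\<^sub>R e2"] eB by simp
    finally show ?thesis using that by simp
  qed
  define G1 where "G1 i a b = integral {-\<epsilon>..\<epsilon>} (\<lambda>r. f i (a + \<epsilon>, b + r) - f i (a - \<epsilon>, b + r))" for i a b
  define G2 where "G2 i a b = integral {-\<epsilon>..\<epsilon>} (\<lambda>s. f i (a + s, b + \<epsilon>) - f i (a + s, b - \<epsilon>))" for i a b
  define m where "m i x = square_integral (f i) \<epsilon> (x \<bullet> e1) (x \<bullet> e2) / (4 * \<epsilon>\<^sup>2)" for i x
  define m' where "m' i x h = (G1 i (x \<bullet> e1) (x \<bullet> e2) * (h \<bullet> e1) + G2 i (x \<bullet> e1) (x \<bullet> e2) * (h \<bullet> e2)) / (4 * \<epsilon>\<^sup>2)" for i x h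
  have dm: "(m i has_derivative m' i x) (at x)" for i x
  proof -
    have "((\<lambda>x. (x \<bullet> e1, x \<bullet> e2)) has_derivative (\<lambda>h. (h \<bullet> e1, h \<bullet> e2))) (at x)"
      by (auto intro!: derivative_eq_intros)
    from has_derivative_compose[OF this square_integral_derivative(1)[OF fcont \<epsilon>(1)]]
    have "((\<lambda>x. square_integral (f i) \<epsilon> (x \<bullet> e1) (x \<bullet> e2)) has_derivative
        (\<lambda>h. G1 i (x \<bullet> e1) (x \<bullet> e2) * (h \<bullet> e1) + G2 i (x \<bullet> e1) (x \<bullet> e2) * (h \<bullet> e2))) (at x)"
      by (simp add: G1_def G2_def)
    from bounded_linear.has_derivative[OF bounded_linear_divide this, of "4 * \<epsilon>\<^sup>2"] show ?thesis
      by (simp add: m_def[abs_def] m'_def[abs_def])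
  qed
  have coord: "continuous_on UNIV (\<lambda>x. (x \<bullet> e1, x \<bullet> e2))"
    by (intro continuous_intros)
  have Gcont: "continuous_on UNIV (\<lambda>x. G1 i (x \<bullet> e1) (x \<bullet> e2))" "continuous_on UNIV (\<lambda>x. G2 i (x \<bullet> e1) (x \<bullet> e2))" for i
    using continuous_on_compose2[OF square_integral_derivative(2)[OF fcont \<epsilon>(1)] coord]
      continuous_on_compose2[OF square_integral_derivative(3)[OF fcont \<epsilon>(1)] coord]
    by (auto simp: G1_def G2_def)
  have m_C1: "C1_map (m i)" for i
    by (rule C1_mapI[OF dm]) (unfold m'_def divide_inverse, intro continuous_intros Gcont)
  define T where "T x = m e1 x *\<^sub>R e1 + m e2 x *\<^sub>R e2" for x
  show ?thesis
  proof (rule that)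
    show "C1_map T" unfolding T_def by (intro C1_map_add C1_map_scaleR m_C1 C1_map_const)
    fix x assume x: "x \<in> K"
    have xF: "F x = \<tau> x" using F(2)[of x] closure_subset[of \<Omega>] x K(2) by blast
    have mi: "\<bar>m i x - \<tau> x \<bullet> i\<bar> \<le> e / 2" if i: "i \<in> Basis" for i
      unfolding m_def
    proof (rule square_integral_approx[OF fcont \<epsilon>(1)])
      fix s r assume sr: "\<bar>s\<bar> \<le> \<epsilon>" "\<bar>r\<bar> \<le> \<epsilon>"
      let ?z = "(x \<bullet> e1 + s, x \<bullet> e2 + r)"
      have n: "norm (pt ?z - x) \<le> 2 * \<epsilon>" by (rule near) (use sr in auto)
      have "norm (pt ?z) \<le> norm (pt ?z - x) + norm x" by norm
      then have "dist (F (pt ?z)) (F x) < e / 2"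
        using n R[OF x] \<epsilon> d(1) by (intro d'(2)) (auto simp: dist_norm)
      then have "norm (F (pt ?z) - \<tau> x) \<le> e / 2" by (simp add: dist_norm xF)
      then show "\<bar>f i ?z - \<tau> x \<bullet> i\<bar> \<le> e / 2"
        using norm_bound_Basis_le[OF i] unfolding f_def inner_diff_left[symmetric] by blast
    qed
    have "T x - \<tau> x = (m e1 x - \<tau> x \<bullet> e1) *\<^sub>R e1 + (m e2 x - \<tau> x \<bullet> e2) *\<^sub>R e2"
    proof -
      have "T x - ((\<tau> x \<bullet> e1) *\<^sub>R e1 + (\<tau> x \<bullet> e2) *\<^sub>R e2)
          = (m e1 x - \<tau> x \<bullet> e1) *\<^sub>R e1 + (m e2 x - \<tau> x \<bullet> e2) *\<^sub>R e2"
        by (simp add: T_def scaleR_diff_left)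
      then show ?thesis by (simp only: rep[symmetric])
    qed
    also have "norm \<dots> \<le> \<bar>m e1 x - \<tau> x \<bullet> e1\<bar> + \<bar>m e2 x - \<tau> x \<bullet> e2\<bar>"
      using norm_triangle_ineq[of "(m e1 x - \<tau> x \<bullet> e1) *\<^sub>R e1" "(m e2 x - \<tau> x \<bullet> e2) *\<^sub>R e2"] eB by simp
    finally show "norm (T x - \<tau> x) \<le> e" using mi[OF eB(1)] mi[OF eB(2)] by simp
    define a b where "a = x \<bullet> e1 - \<epsilon>" and "b = x \<bullet> e2 - \<epsilon>"
    have "(T has_derivative (\<lambda>h. m' e1 x h *\<^sub>R e1 + m' e2 x h *\<^sub>R e2)) (at x)"
      unfolding T_def by (intro has_derivative_add has_derivative_scaleR_left dm)
    then have "divergence T x = m' e1 x e1 + m' e2 x e2"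
      using B(2) by (simp add: divergence_eq inner_add_left) (unfold B(1), simp add: ip)
    also have "\<dots> = square_flux (f e1) (f e2) a b (2 * \<epsilon>) / (4 * \<epsilon>\<^sup>2)"
    proof -
      have "G1 e1 (x \<bullet> e1) (x \<bullet> e2) = integral {b..b + 2 * \<epsilon>} (\<lambda>r. f e1 (a + 2 * \<epsilon>, r) - f e1 (a, r))"
        using integral_shift_symmetric[of \<epsilon> "\<lambda>r. f e1 (a + 2 * \<epsilon>, r) - f e1 (a, r)" "x \<bullet> e2"]
        by (simp add: G1_def a_def b_def algebra_simps)
      moreover have "G2 e2 (x \<bullet> e1) (x \<bullet> e2) = integral {a..a + 2 * \<epsilon>} (\<lambda>s. f e2 (s, b + 2 * \<epsilon>) - f e2 (s, b))"
        using integral_shift_symmetric[of \<epsilon> "\<lambda>s. f e2 (s, b + 2 * \<epsilon>) - f e2 (s, b)" "x \<bullet> e1"]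
        by (simp add: G2_def a_def b_def algebra_simps)
      ultimately show ?thesis by (simp add: m'_def ip square_flux_def add_divide_distrib)
    qed
    also have "square_flux (f e1) (f e2) a b (2 * \<epsilon>) = 0"
    proof (rule square_flux_zero[OF fcont fcont])
      fix p assume "p \<in> cbox (a, b) (a + 2 * \<epsilon>, b + 2 * \<epsilon>)"
      then have "norm (pt p - x) \<le> 2 * \<epsilon>"
        by (intro near; cases p) (auto simp: cbox_Pair_eq a_def b_def abs_le_iff)
      then have p\<Omega>: "pt p \<in> \<Omega>" using d(2)[OF x] \<epsilon>(2) by (auto simp: dist_norm norm_minus_commute)
      let ?D = "frechet_derivative \<tau> (at (pt p))"
      have "(\<tau> has_derivative ?D) (at (pt p))"
        using \<tau>[OF p\<Omega>] by (simp add: frechet_derivative_works)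
      then have "(F has_derivative ?D) (at (pt p))"
        using \<Omega>(1) p\<Omega>
        by (rule has_derivative_transform_within_open) (metis F(2) closure_subset subsetD)
      from has_derivative_compose[OF bounded_linear_imp_has_derivative[OF pt_lin] this]
      have "(f i has_derivative (\<lambda>h. ?D (pt h) \<bullet> i)) (at p)" for i
        unfolding f_def by (intro has_derivative_inner_left)
      moreover have "?D (pt (1, 0)) \<bullet> e1 + ?D (pt (0, 1)) \<bullet> e2 = 0"
        using \<tau>[OF p\<Omega>] B(2) unfolding divergence_def B(1) by (simp add: pt_def)
      ultimately show "\<exists>f' g'. (f e1 has_derivative f') (at p) \<and> (f e2 has_derivative g') (at p)
          \<and> f' (1, 0) + g' (0, 1) = 0" by blast
    qed (use \<epsilon> in auto)
    finally show "divergence T x = 0" by simp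
  qed
qed

section \<open>The product rule for weak gradients\<close>

lemma has_weak_gradientD:
  "has_weak_gradient \<Omega> u g \<Longrightarrow> test_function \<Omega> \<phi> \<Longrightarrow>
    (LINT x|lebesgue_on \<Omega>. u x * frechet_derivative \<phi> (at x) h)
      = - (LINT x|lebesgue_on \<Omega>. (g x \<bullet> h) * \<phi> x)"
  by (simp add: has_weak_gradient_def)

lemma zero_if_le_all_multiples:
  fixes A :: real
  assumes "\<And>e. 0 < e \<Longrightarrow> \<bar>A\<bar> \<le> e * C" shows "A = 0"
proof (rule ccontr)
  assume "A \<noteq> 0"
  have "\<bar>A\<bar> \<le> \<bar>A\<bar> / (2 * (\<bar>C\<bar> + 1)) * C" using assms[of "\<bar>A\<bar> / (2 * (\<bar>C\<bar> + 1))"] \<open>A \<noteq> 0\<close> by simp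
  also have "\<dots> \<le> \<bar>A\<bar> / (2 * (\<bar>C\<bar> + 1)) * (\<bar>C\<bar> + 1)" by (intro mult_left_mono) auto
  also have "\<dots> = \<bar>A\<bar> / 2" by (simp add: field_simps add_nonneg_eq_0_iff)
  finally show False using \<open>A \<noteq> 0\<close> by simp
qed

lemma integrable_inner_bounded:
  fixes g \<tau> :: "'a::euclidean_space \<Rightarrow> 'b::euclidean_space"
  assumes S: "S \<in> sets lebesgue" and g: "integrable (lebesgue_on S) g"
    and \<tau>: "continuous_on S \<tau>" and B: "\<And>x. x \<in> S \<Longrightarrow> norm (\<tau> x) \<le> B"
  shows "integrable (lebesgue_on S) (\<lambda>x. g x \<bullet> \<tau> x)"
proof (rule Bochner_Integration.integrable_bound)
  show "integrable (lebesgue_on S) (\<lambda>x. norm (g x) * B)" using g by auto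
  show "(\<lambda>x. g x \<bullet> \<tau> x) \<in> borel_measurable (lebesgue_on S)"
    using g continuous_imp_measurable_on_sets_lebesgue[OF \<tau> S]
    by (intro borel_measurable_inner) auto
  show "AE x in lebesgue_on S. norm (g x \<bullet> \<tau> x) \<le> norm (norm (g x) * B)"
  proof (rule AE_I2)
    fix x assume "x \<in> space (lebesgue_on S)"
    then have "norm (\<tau> x) \<le> B" using B by simp
    then have "norm (g x) * norm (\<tau> x) \<le> norm (g x) * B" by (intro mult_left_mono) auto
    then show "norm (g x \<bullet> \<tau> x) \<le> norm (norm (g x) * B)"
      using Cauchy_Schwarz_ineq2[of "g x" "\<tau> x"] by simp
  qed
qed

lemma integrable_inner_continuous:
  fixes g \<tau> :: "'a::euclidean_space \<Rightarrow> 'b::euclidean_space"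
  assumes K: "compact K" and g: "integrable (lebesgue_on K) g" and \<tau>: "continuous_on K \<tau>"
  shows "integrable (lebesgue_on K) (\<lambda>x. g x \<bullet> \<tau> x)"
proof -
  have "bounded (\<tau> ` K)" by (intro compact_imp_bounded compact_continuous_image assms)
  then obtain B where "\<And>x. x \<in> K \<Longrightarrow> norm (\<tau> x) \<le> B" by (auto simp: bounded_iff)
  then show ?thesis
    using K by (intro integrable_inner_bounded[OF _ g \<tau>]) (simp_all add: borel_compact)
qed

lemma linear_norm_le_sum_Basis:
  fixes L :: "'a::euclidean_space \<Rightarrow> real"
  assumes "linear L" shows "\<bar>L h\<bar> \<le> (\<Sum>b\<in>Basis. \<bar>L b\<bar>) * norm h"
proof -
  have "L h = L (\<Sum>b\<in>Basis. (h \<bullet> b) *\<^sub>R b)" by (simp only: euclidean_representation)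
  also have "\<dots> = (\<Sum>b\<in>Basis. (h \<bullet> b) * L b)"
    by (simp add: linear_sum[OF assms] linear_scale[OF assms])
  also have "\<bar>\<dots>\<bar> \<le> (\<Sum>b\<in>Basis. norm h * \<bar>L b\<bar>)"
    by (intro order_trans[OF sum_abs] sum_mono) (auto simp: abs_mult intro!: mult_right_mono Basis_le_norm)
  finally show ?thesis by (simp add: mult.commute flip: sum_distrib_left)
qed

lemma test_function_mult:
  fixes f :: "'a::euclidean_space \<Rightarrow> real"
  assumes "test_function \<Omega> \<phi>" "C1_map f"
  shows "test_function \<Omega> (\<lambda>x. \<phi> x * f x)"
  using assms unfolding test_function_def by (auto intro!: C1_map_mult)

lemma weak_divergence_integrable:
  fixes u :: "'a::euclidean_space \<Rightarrow> real"
  assumes \<Omega>: "open \<Omega>" and u: "continuous_on \<Omega> u" and g: "has_weak_gradient \<Omega> u g"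
    and F: "continuous_on \<Omega> F" and \<phi>: "test_function \<Omega> \<phi>"
  shows "integrable (lebesgue_on \<Omega>) (\<lambda>x. u x * frechet_derivative \<phi> (at x) (F x))"
    and "integrable (lebesgue_on \<Omega>) (\<lambda>x. (g x \<bullet> F x) * \<phi> x)"
proof -
  obtain K where K: "compact K" "K \<subseteq> \<Omega>" "\<And>x. x \<notin> K \<Longrightarrow> \<phi> x = 0" and C1: "C1_map \<phi>"
    using \<phi> by (auto simp: test_function_def)
  have lin: "linear (frechet_derivative \<phi> (at x))" for x
    using C1 by (intro linear_frechet_derivative) (simp add: C1_map_def)
  have "integrable (lebesgue_on \<Omega>) (\<lambda>x. \<Sum>b\<in>Basis. (u x * (F x \<bullet> b)) * frechet_derivative \<phi> (at x) b)"
    by (intro Bochner_Integration.integrable_sum test_function_derivative_integrable[OF \<Omega> _ \<phi>] continuous_intros u F)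
  also have "(\<lambda>x. \<Sum>b\<in>Basis. (u x * (F x \<bullet> b)) * frechet_derivative \<phi> (at x) b)
      = (\<lambda>x. u x * frechet_derivative \<phi> (at x) (\<Sum>b\<in>Basis. (F x \<bullet> b) *\<^sub>R b))"
    by (intro ext) (simp only: linear_sum[OF lin] linear_scale[OF lin] sum_distrib_left real_scaleR_def mult.assoc)
  finally show "integrable (lebesgue_on \<Omega>) (\<lambda>x. u x * frechet_derivative \<phi> (at x) (F x))"
    by (simp add: euclidean_representation)
  have "integrable (lebesgue_on \<Omega>) (\<lambda>x. \<phi> x *\<^sub>R (g x \<bullet> F x))"
    by (rule integrable_mult_compact_support[OF _ K(1,2) integrable_inner_continuous])
       (use \<Omega> g K C1 F in \<open>auto simp: has_weak_gradient_def intro: C1_map_continuous_on continuous_on_subset\<close>)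
  then show "integrable (lebesgue_on \<Omega>) (\<lambda>x. (g x \<bullet> F x) * \<phi> x)" by (simp add: mult.commute)
qed

text \<open>
  Apply the definition of the weak gradient to the test functions \<open>\<phi> (T \<bullet> b)\<close> in the directions
  \<open>b\<close> and add up: the sum of the partial derivatives is the divergence of \<open>\<phi> T\<close>, that is, the
  derivative of \<open>\<phi>\<close> along \<open>T\<close>.
\<close>

lemma weak_product_rule_C1:
  fixes u :: "'a::euclidean_space \<Rightarrow> real"
  assumes \<Omega>: "open \<Omega>" and u: "continuous_on \<Omega> u" and g: "has_weak_gradient \<Omega> u g"
    and T: "C1_map T" and \<phi>: "test_function \<Omega> \<phi>"
    and div: "\<And>x. \<phi> x \<noteq> 0 \<Longrightarrow> divergence T x = 0"
  shows "(LINT x|lebesgue_on \<Omega>. u x * frechet_derivative \<phi> (at x) (T x))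
    = - (LINT x|lebesgue_on \<Omega>. (g x \<bullet> T x) * \<phi> x)"
proof -
  have C1: "C1_map \<phi>" using \<phi> by (simp add: test_function_def)
  have tf: "test_function \<Omega> (\<lambda>x. \<phi> x * (T x \<bullet> b))" for b
    by (intro test_function_mult \<phi> C1_map_inner_const T)
  have "u x * frechet_derivative \<phi> (at x) (T x)
      = (\<Sum>b\<in>Basis. u x * frechet_derivative (\<lambda>x. \<phi> x * (T x \<bullet> b)) (at x) b)" for x
  proof -
    have "frechet_derivative (\<lambda>x. \<phi> x * (T x \<bullet> b)) (at x) b = frechet_derivative (\<lambda>x. \<phi> x *\<^sub>R T x) (at x) b \<bullet> b" for b
    proof -
      have "((\<lambda>x. \<phi> x *\<^sub>R T x) has_derivative frechet_derivative (\<lambda>x. \<phi> x *\<^sub>R T x) (at x)) (at x)"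
        by (intro C1_map_has_derivative C1_map_scaleR C1 T)
      from has_derivative_inner_left[OF this, of b] show ?thesis
        by (simp add: frechet_derivative_at[symmetric])
    qed
    moreover have "divergence (\<lambda>x. \<phi> x *\<^sub>R T x) x = frechet_derivative \<phi> (at x) (T x)"
      using divergence_scaleR[of \<phi> x T] C1 T div[of x] by (auto simp: C1_map_def)
    ultimately show ?thesis by (simp add: divergence_def flip: sum_distrib_left)
  qed
  then have "(LINT x|lebesgue_on \<Omega>. u x * frechet_derivative \<phi> (at x) (T x))
      = (\<Sum>b\<in>Basis. (LINT x|lebesgue_on \<Omega>. u x * frechet_derivative (\<lambda>x. \<phi> x * (T x \<bullet> b)) (at x) b))"
    by (simp add: Bochner_Integration.integral_sum test_function_derivative_integrable[OF \<Omega> u tf])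
  also have "\<dots> = (\<Sum>b\<in>Basis. - (LINT x|lebesgue_on \<Omega>. (g x \<bullet> b) * (\<phi> x * (T x \<bullet> b))))"
    by (intro sum.cong refl has_weak_gradientD[OF g tf])
  also have "\<dots> = - (LINT x|lebesgue_on \<Omega>. (\<Sum>b\<in>Basis. (g x \<bullet> b) * (\<phi> x * (T x \<bullet> b))))"
    by (simp add: Bochner_Integration.integral_sum has_weak_gradient_test_integrable[OF \<Omega> g tf] sum_negf)
  also have "(\<lambda>x. \<Sum>b\<in>Basis. (g x \<bullet> b) * (\<phi> x * (T x \<bullet> b))) = (\<lambda>x. (g x \<bullet> T x) * \<phi> x)"
  proof
    fix x
    have "(g x \<bullet> T x) * \<phi> x = (\<Sum>b\<in>Basis. (g x \<bullet> b) * (T x \<bullet> b)) * \<phi> x"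
      by (simp only: euclidean_inner[of "g x" "T x"])
    also have "\<dots> = (\<Sum>b\<in>Basis. (g x \<bullet> b) * (\<phi> x * (T x \<bullet> b)))"
      by (simp add: sum_distrib_left mult_ac)
    finally show "(\<Sum>b\<in>Basis. (g x \<bullet> b) * (\<phi> x * (T x \<bullet> b))) = (g x \<bullet> T x) * \<phi> x" ..
  qed
  finally show ?thesis .
qed

text \<open>
  Neither side involves derivatives of \<open>\<tau>\<close>, so the rule for \<open>C\<^sup>1\<close> fields carries over by uniform
  approximation on the support of \<open>\<phi>\<close>.
\<close>

lemma weak_product_rule:
  fixes \<tau> :: "'a::euclidean_space \<Rightarrow> 'a" and u :: "'a \<Rightarrow> real"
  assumes dim: "DIM('a) = 1 \<or> DIM('a) = 2" and \<Omega>: "open \<Omega>" "connected \<Omega>"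
    and cont: "continuous_on (closure \<Omega>) \<tau>"
    and \<tau>: "\<And>x. x \<in> \<Omega> \<Longrightarrow> \<tau> differentiable (at x) \<and> divergence \<tau> x = 0"
    and u: "continuous_on \<Omega> u" and g: "has_weak_gradient \<Omega> u g"
    and \<phi>: "test_function \<Omega> \<phi>"
  shows "(LINT x|lebesgue_on \<Omega>. u x * frechet_derivative \<phi> (at x) (\<tau> x))
    = - (LINT x|lebesgue_on \<Omega>. (g x \<bullet> \<tau> x) * \<phi> x)"
proof -
  obtain K where K: "compact K" "K \<subseteq> \<Omega>" "\<And>x. x \<notin> K \<Longrightarrow> \<phi> x = 0" and C1: "C1_map \<phi>"
    using \<phi> by (auto simp: test_function_def)
  have lin: "linear (frechet_derivative \<phi> (at x))" for x
    using C1 by (intro linear_frechet_derivative) (simp add: C1_map_def)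
  have \<tau>c: "continuous_on \<Omega> \<tau>" using continuous_on_subset[OF cont closure_subset] .
  let ?I = "\<lambda>F. \<lambda>x. u x * frechet_derivative \<phi> (at x) (F x) + (g x \<bullet> F x) * \<phi> x"
  have int: "integrable (lebesgue_on \<Omega>) (?I F)" if "continuous_on \<Omega> F" for F
    using weak_divergence_integrable[OF \<Omega>(1) u g that \<phi>] by simp
  \<comment> \<open>An error of \<open>e\<close> in the field changes the integrand by at most \<open>e * W\<close>.\<close>
  define W where "W x = \<bar>u x\<bar> * (\<Sum>b\<in>Basis. \<bar>frechet_derivative \<phi> (at x) b\<bar>) + norm (g x) * \<bar>\<phi> x\<bar>" for x
  have W: "integrable (lebesgue_on \<Omega>) W"
  proof -
    have "integrable (lebesgue_on \<Omega>) (\<lambda>x. norm (\<phi> x *\<^sub>R g x))"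
      by (intro integrable_norm integrable_mult_compact_support[OF _ K(1,2) _ _ K(3)])
         (use \<Omega> g K C1 in \<open>auto simp: has_weak_gradient_def intro: C1_map_continuous_on\<close>)
    moreover have "integrable (lebesgue_on \<Omega>) (\<lambda>x. \<Sum>b\<in>Basis. \<bar>u x * frechet_derivative \<phi> (at x) b\<bar>)"
      by (intro Bochner_Integration.integrable_sum integrable_abs test_function_derivative_integrable[OF \<Omega>(1) u \<phi>])
    ultimately have "integrable (lebesgue_on \<Omega>) (\<lambda>x. (\<Sum>b\<in>Basis. \<bar>u x * frechet_derivative \<phi> (at x) b\<bar>) + norm (\<phi> x *\<^sub>R g x))"
      by simp
    then show ?thesis by (simp add: W_def[abs_def] abs_mult sum_distrib_left mult.commute)
  qed
  have bound: "\<bar>LINT x|lebesgue_on \<Omega>. ?I \<tau> x\<bar> \<le> e * (LINT x|lebesgue_on \<Omega>. W x)" if e: "0 < e" for e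
  proof -
    obtain T where T: "C1_map T" "\<And>x. x \<in> K \<Longrightarrow> norm (T x - \<tau> x) \<le> e" "\<And>x. x \<in> K \<Longrightarrow> divergence T x = 0"
      using divergence_free_C1_approximation[OF dim \<Omega> cont \<tau> K(1,2) e] by blast
    have Tc: "continuous_on \<Omega> T" using T(1) by (rule C1_map_continuous_on)
    have "divergence T x = 0" if "\<phi> x \<noteq> 0" for x
      using that T(3) K(3) by blast
    then have "(LINT x|lebesgue_on \<Omega>. ?I T x) = 0"
      using weak_product_rule_C1[OF \<Omega>(1) u g T(1) \<phi>] weak_divergence_integrable[OF \<Omega>(1) u g Tc \<phi>]
      by (subst Bochner_Integration.integral_add) auto
    then have "(LINT x|lebesgue_on \<Omega>. ?I \<tau> x) = (LINT x|lebesgue_on \<Omega>. ?I \<tau> x - ?I T x)"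
      using int[OF \<tau>c] int[OF Tc] by (subst Bochner_Integration.integral_diff) auto
    also have "norm \<dots> \<le> (LINT x|lebesgue_on \<Omega>. e * W x)"
    proof (rule Bochner_Integration.integral_norm_bound_integral)
      show "integrable (lebesgue_on \<Omega>) (\<lambda>x. ?I \<tau> x - ?I T x)" using int[OF \<tau>c] int[OF Tc] by auto
      fix x
      let ?D = "frechet_derivative \<phi> (at x)"
      have "?I \<tau> x - ?I T x = u x * ?D (\<tau> x - T x) + (g x \<bullet> (\<tau> x - T x)) * \<phi> x"
        by (simp add: linear_diff[OF lin] algebra_simps)
      moreover have "\<bar>u x * ?D (\<tau> x - T x) + (g x \<bullet> (\<tau> x - T x)) * \<phi> x\<bar> \<le> e * W x"
      proof (cases "x \<in> K")
        case True
        then have n: "norm (\<tau> x - T x) \<le> e" using T(2) by (simp add: norm_minus_commute)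
        have "\<bar>?D (\<tau> x - T x)\<bar> \<le> (\<Sum>b\<in>Basis. \<bar>?D b\<bar>) * e"
          by (rule order_trans[OF linear_norm_le_sum_Basis[OF lin]]) (intro mult_left_mono n sum_nonneg, auto)
        then have "\<bar>u x * ?D (\<tau> x - T x)\<bar> \<le> \<bar>u x\<bar> * ((\<Sum>b\<in>Basis. \<bar>?D b\<bar>) * e)"
          unfolding abs_mult by (intro mult_left_mono) auto
        moreover have "\<bar>g x \<bullet> (\<tau> x - T x)\<bar> \<le> norm (g x) * e"
          by (rule order_trans[OF Cauchy_Schwarz_ineq2]) (intro mult_left_mono n, auto)
        then have "\<bar>(g x \<bullet> (\<tau> x - T x)) * \<phi> x\<bar> \<le> (norm (g x) * e) * \<bar>\<phi> x\<bar>"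
          unfolding abs_mult by (intro mult_right_mono) auto
        ultimately show ?thesis by (auto simp: W_def algebra_simps intro: order_trans[OF abs_triangle_ineq])
      next
        case False
        then have "?D (\<tau> x - T x) = 0"
          using frechet_derivative_eq_0_outside[OF compact_imp_closed[OF K(1)] K(3)] by simp
        then show ?thesis using K(3)[OF False] e by (auto simp: W_def intro!: mult_nonneg_nonneg sum_nonneg)
      qed
      ultimately show "norm (?I \<tau> x - ?I T x) \<le> e * W x" by simp
    qed (use W in auto)
    finally show ?thesis by simp
  qed
  have "(LINT x|lebesgue_on \<Omega>. ?I \<tau> x) = 0"
    by (rule zero_if_le_all_multiples[OF bound])
  then show ?thesis
    using weak_divergence_integrable[OF \<Omega>(1) u g \<tau>c \<phi>] by simp
qed

section \<open>Boundary measure\<close>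

lemma nice_regionD:
  assumes "nice_region \<Omega> N"
  shows "open \<Omega>" "connected \<Omega>" "bounded \<Omega>" "\<Omega> \<noteq> {}" "\<Omega> \<in> sets lebesgue"
    "compact (frontier \<Omega>)" "compact (closure \<Omega>)" "closure \<Omega> = \<Omega> \<union> frontier \<Omega>" "\<Omega> \<inter> frontier \<Omega> = {}"
    "emeasure lebesgue \<Omega> < \<infinity>" "finite_measure (lebesgue_on \<Omega>)"
proof -
  show o: "open \<Omega>" and "connected \<Omega>" and b: "bounded \<Omega>" and "\<Omega> \<noteq> {}"
    using assms by (auto simp: nice_region_def)
  then show m: "\<Omega> \<in> sets lebesgue" by auto
  show "compact (frontier \<Omega>)" using b by (simp add: compact_frontier_bounded)
  show "compact (closure \<Omega>)" using b by simp
  show "closure \<Omega> = \<Omega> \<union> frontier \<Omega>" "\<Omega> \<inter> frontier \<Omega> = {}"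
    using o closure_subset[of \<Omega>] by (auto simp: frontier_def interior_open)
  show fin: "emeasure lebesgue \<Omega> < \<infinity>"
    using emeasure_bounded_finite[OF b] o by simp
  show "finite_measure (lebesgue_on \<Omega>)"
    using fin m by (intro finite_measureI) (auto simp: emeasure_restrict_space)
qed

lemma nice_region_divergence_theorem:
  assumes "nice_region \<Omega> N" "C1_map F"
  shows "(LINT x|lebesgue_on \<Omega>. divergence F x) = (LINT x:frontier \<Omega>|surface_measure. F x \<bullet> N x)"
  using assms by (simp add: nice_region_def)

lemma sets_hausdorff [simp]: "sets (hausdorff k) = sets borel"
  using sigma_algebra.sigma_sets_eq[OF sets.sigma_algebra_axioms[of borel]]
  by (simp add: hausdorff_def sets_measure_of_conv)

lemma space_hausdorff [simp]: "space (hausdorff k) = UNIV"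
  by (simp add: hausdorff_def space_measure_of_conv)

lemma integral_divergence_pos:
  fixes \<Omega> :: "'a::euclidean_space set"
  assumes "nice_region \<Omega> N"
  shows "0 < (LINT x|lebesgue_on \<Omega>. divergence (\<lambda>x. x) x)"
proof -
  have "divergence (\<lambda>x. x) x = real DIM('a)" for x :: 'a
    by (simp add: divergence_def)
  moreover have "measure (lebesgue_on \<Omega>) \<Omega> > 0"
  proof -
    obtain a r where ar: "0 < r" "ball a r \<subseteq> \<Omega>"
      using nice_regionD(1,4)[OF assms] open_contains_ball by (metis ex_in_conv)
    have "0 < measure lebesgue (ball a r)" using ar(1) by (simp add: content_ball_pos)
    also have "\<dots> \<le> measure lebesgue \<Omega>"
      using ar(2) nice_regionD(10,5)[OF assms] by (intro measure_mono_fmeasurable) (auto intro: fmeasurableI)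
    finally show ?thesis using nice_regionD(5)[OF assms] by (simp add: measure_restrict_space)
  qed
  ultimately show ?thesis by simp
qed

text \<open>
  The operation \<open>measure_of\<close> yields the zero measure when it is given a set function that is not
  countably additive. For the surface measure this cannot happen: the divergence theorem for the
  field \<open>F x = x\<close> would equate the positive number \<open>DIM('a) * |\<Omega>|\<close> with zero.
\<close>

lemma emeasure_surface_measure:
  fixes \<Omega> :: "'a::euclidean_space set"
  assumes nice: "nice_region \<Omega> N" and A: "A \<in> sets borel"
  shows "emeasure (surface_measure :: 'a measure) A
    = (SUP \<delta>\<in>{0<..}. hausdorff_pre (DIM('a) - 1) \<delta> A)"
proof (cases "measure_space UNIV (sets borel) (\<lambda>A. SUP \<delta>\<in>{0<..}. hausdorff_pre (DIM('a) - 1) \<delta> (A :: 'a set))")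
  case True
  then show ?thesis
    using A sigma_algebra.sigma_sets_eq[OF sets.sigma_algebra_axioms[of "borel :: 'a measure"]]
    by (simp add: hausdorff_def emeasure_measure_of_conv)
next
  case False
  then have "emeasure (surface_measure :: 'a measure) UNIV = 0"
    using sigma_algebra.sigma_sets_eq[OF sets.sigma_algebra_axioms[of "borel :: 'a measure"]]
    by (simp add: hausdorff_def emeasure_measure_of_conv)
  then have "AE x in (surface_measure :: 'a measure). False"
    by (intro AE_I[where N = UNIV]) auto
  then have "(LINT x:frontier \<Omega>|surface_measure. x \<bullet> N x) = 0"
    unfolding set_lebesgue_integral_def by (intro integral_eq_zero_AE) (auto elim: eventually_mono)
  then have False
    using integral_divergence_pos[OF nice] nice_region_divergence_theorem[OF nice, of "\<lambda>x. x"]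
      C1_map_bounded_linear[OF bounded_linear_ident] by simp
  then show ?thesis ..
qed

lemma sum_le_nn_integral_count_space:
  assumes "finite D" "D \<subseteq> C" and that: "\<And>S. 0 \<le> f S"
  shows "ennreal (\<Sum>S\<in>D. f S) \<le> (\<integral>\<^sup>+ S. ennreal (f S) \<partial>count_space C)"
proof -
  have "ennreal (\<Sum>S\<in>D. f S) = (\<integral>\<^sup>+ S. ennreal (f S) \<partial>count_space D)"
    using assms(1) that by (simp add: nn_integral_count_space_finite)
  also have "\<dots> = (\<integral>\<^sup>+ S. ennreal (f S) * indicator D S \<partial>count_space C)"
    using assms(2) by (subst (1 2) nn_integral_count_space_indicator)
      (auto intro!: nn_integral_cong simp: indicator_def)
  also have "\<dots> \<le> (\<integral>\<^sup>+ S. ennreal (f S) \<partial>count_space C)"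
    by (intro nn_integral_mono) (auto simp: indicator_def)
  finally show ?thesis .
qed

text \<open>
  Each set \<open>S\<close> of an almost optimal cover is enlarged to a ball around one of its points with
  radius \<open>diameter S + \<epsilon> S\<close>, and compactness leaves finitely many balls. With
  \<open>DIM('a) - 1 \<in> {0, 1}\<close> the sum of the powers of the radii exceeds the Hausdorff sum of the
  cover by at most the sum of the \<open>\<epsilon> S\<close>, which is kept below \<open>1\<close>.
\<close>

lemma frontier_ball_cover:
  fixes \<Omega> :: "'a::euclidean_space set"
  assumes dim: "DIM('a) = 1 \<or> DIM('a) = 2" and nice: "nice_region \<Omega> N"
  obtains C0 where "\<And>\<delta>. 0 < \<delta> \<Longrightarrow> \<exists>D (a :: 'a set \<Rightarrow> 'a) r. finite D \<and> frontier \<Omega> \<subseteq> (\<Union>S\<in>D. ball (a S) (r S))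
    \<and> (\<forall>S\<in>D. 0 < r S \<and> r S \<le> \<delta> \<and> ball (a S) (r S) \<inter> frontier \<Omega> \<noteq> {})
    \<and> (\<Sum>S\<in>D. r S ^ (DIM('a) - 1)) \<le> C0"
proof -
  let ?k = "DIM('a) - 1"
  have fr: "frontier \<Omega> \<in> sets borel" by simp
  have fin: "emeasure (surface_measure :: 'a measure) (frontier \<Omega>) < \<infinity>"
    using nice by (simp add: nice_region_def)
  then obtain H where H: "0 \<le> H" "emeasure (surface_measure :: 'a measure) (frontier \<Omega>) = ennreal H"
    by (cases "emeasure (surface_measure :: 'a measure) (frontier \<Omega>)" rule: ennreal_cases) auto
  show ?thesis
  proof (rule that[of "H + 2"])
    fix \<delta> :: real assume \<delta>: "0 < \<delta>"
    have "hausdorff_pre ?k (\<delta> / 2) (frontier \<Omega>) \<le> emeasure (surface_measure :: 'a measure) (frontier \<Omega>)"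
      unfolding emeasure_surface_measure[OF nice fr] using \<delta> by (intro SUP_upper) auto
    also have "\<dots> < ennreal (H + 1)" using H by (simp add: ennreal_lessI)
    finally obtain C where C: "countable C" "\<And>S. S \<in> C \<Longrightarrow> S \<noteq> {} \<and> bounded S \<and> diameter S \<le> \<delta> / 2"
        "frontier \<Omega> \<subseteq> \<Union>C"
        "(\<integral>\<^sup>+ S. ennreal (unit_ball_vol (real ?k) * (diameter S / 2) ^ ?k) \<partial>count_space C) < ennreal (H + 1)"
      unfolding hausdorff_pre_def INF_less_iff by blast
    define \<delta>' where "\<delta>' = min \<delta> 1 / 2"
    have \<delta>': "0 < \<delta>'" "\<delta>' \<le> \<delta> / 2" "\<delta>' \<le> 1 / 2" using \<delta> by (auto simp: \<delta>'_def min_def)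
    define a where "a S = (SOME x. x \<in> S)" for S :: "'a set"
    \<comment> \<open>The enlargement keeps singletons from giving balls of radius zero. Along an enumeration of
      the cover it decreases geometrically, so its total is at most \<open>2 * \<delta>' \<le> 1\<close>.\<close>
    define \<epsilon> where "\<epsilon> S = \<delta>' * (1 / 2) ^ to_nat_on C S" for S :: "'a set"
    define r where "r S = diameter S + \<epsilon> S" for S
    have aS: "a S \<in> S" if "S \<in> C" for S
      unfolding a_def using C(2)[OF that] by (metis some_in_eq)
    have \<epsilon>: "0 < \<epsilon> S" "\<epsilon> S \<le> \<delta>'" for S
      using \<delta>' by (auto simp: \<epsilon>_def mult_le_cancel_left1 power_le_one)
    have r: "0 < r S" "r S \<le> \<delta>" "S \<subseteq> ball (a S) (r S)" if "S \<in> C" for S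
    proof -
      have d0: "0 \<le> diameter S" using C(2)[OF that] diameter_ge_0 by blast
      show "0 < r S" using d0 \<epsilon>(1)[of S] by (simp add: r_def)
      show "r S \<le> \<delta>" using C(2)[OF that] \<epsilon>(2)[of S] \<delta>'(2) by (simp add: r_def)
      have "dist (a S) y < r S" if "y \<in> S" for y
        using diameter_bounded_bound[of S "a S" y] C(2)[OF \<open>S \<in> C\<close>] aS[OF \<open>S \<in> C\<close>] that \<epsilon>(1)[of S]
        by (simp add: r_def)
      then show "S \<subseteq> ball (a S) (r S)" by auto
    qed
    have "frontier \<Omega> \<subseteq> (\<Union>S\<in>C. ball (a S) (r S))" using C(3) r(3) by blast
    then obtain D0 where D0: "D0 \<subseteq> C" "finite D0" "frontier \<Omega> \<subseteq> (\<Union>S\<in>D0. ball (a S) (r S))"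
      using compactE_image[OF nice_regionD(6)[OF nice], of C "\<lambda>S. ball (a S) (r S)"] by auto
    define D where "D = {S \<in> D0. ball (a S) (r S) \<inter> frontier \<Omega> \<noteq> {}}"
    have D: "D \<subseteq> C" "finite D" using D0 by (auto simp: D_def)
    have Dcov: "frontier \<Omega> \<subseteq> (\<Union>S\<in>D. ball (a S) (r S))"
      using D0(3) unfolding D_def by blast
    have d0: "0 \<le> diameter S" if "S \<in> D" for S using that D(1) C(2) diameter_ge_0 by blast
    let ?f = "\<lambda>S. \<bar>unit_ball_vol (real ?k) * (diameter S / 2) ^ ?k\<bar>"
    have abs: "?f S = unit_ball_vol (real ?k) * (diameter S / 2) ^ ?k" if "S \<in> C" for S
      using C(2)[OF that] diameter_ge_0[of S] by (simp add: abs_mult)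
    have "ennreal (\<Sum>S\<in>D. ?f S) \<le> (\<integral>\<^sup>+ S. ennreal (?f S) \<partial>count_space C)"
      by (rule sum_le_nn_integral_count_space[OF D(2,1)]) simp
    also have "\<dots> = (\<integral>\<^sup>+ S. ennreal (unit_ball_vol (real ?k) * (diameter S / 2) ^ ?k) \<partial>count_space C)"
      using abs by (intro nn_integral_cong) simp
    also note C(4)
    finally have "(\<Sum>S\<in>D. ?f S) < H + 1"
      by (subst (asm) ennreal_less_iff) (auto intro: sum_nonneg)
    then have sum: "(\<Sum>S\<in>D. unit_ball_vol (real ?k) * (diameter S / 2) ^ ?k) < H + 1"
      using abs D(1) by (simp add: subset_iff cong: sum.cong)
    have "(\<Sum>S\<in>D. \<epsilon> S) \<le> 1"
    proof -
      have "(\<Sum>S\<in>D. (1 / 2 :: real) ^ to_nat_on C S) = (\<Sum>n\<in>to_nat_on C ` D. (1 / 2) ^ n)"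
        using inj_on_to_nat_on[OF C(1)] D(1) by (subst sum.reindex) (auto intro: inj_on_subset)
      also have "\<dots> \<le> (\<Sum>n. (1 / 2) ^ n)"
        using D(2) by (intro sum_le_suminf summable_geometric) auto
      also have "\<dots> = 2" by (subst suminf_geometric) auto
      finally have "(\<Sum>S\<in>D. \<epsilon> S) \<le> \<delta>' * 2"
        unfolding \<epsilon>_def sum_distrib_left[symmetric] using \<delta>'(1) by (intro mult_left_mono) auto
      then show ?thesis using \<delta>'(3) by simp
    qed
    then have "(\<Sum>S\<in>D. r S ^ ?k) \<le> H + 2"
      using dim sum by (auto simp: r_def sum.distrib)
    then show "\<exists>D (a :: 'a set \<Rightarrow> 'a) r. finite D \<and> frontier \<Omega> \<subseteq> (\<Union>S\<in>D. ball (a S) (r S))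
      \<and> (\<forall>S\<in>D. 0 < r S \<and> r S \<le> \<delta> \<and> ball (a S) (r S) \<inter> frontier \<Omega> \<noteq> {})
      \<and> (\<Sum>S\<in>D. r S ^ ?k) \<le> H + 2"
      using D Dcov r by (intro exI[of _ D] exI[of _ a] exI[of _ r]) (auto simp: D_def subset_iff)
  qed
qed

section \<open>The Gauss-Green formula\<close>

text \<open>
  A \<open>C\<^sup>1\<close> function with values between \<open>0\<close> and \<open>1\<close> that vanishes on the ball of radius \<open>r\<close> and
  equals \<open>1\<close> outside the ball of radius \<open>2 r\<close>.
\<close>

definition ball_cutoff :: "'a::euclidean_space \<Rightarrow> real \<Rightarrow> 'a \<Rightarrow> real" where
  "ball_cutoff a r x = smooth_step ((x - a) \<bullet> (x - a) / r\<^sup>2 - 1)"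

definition ball_cutoff' :: "'a::euclidean_space \<Rightarrow> real \<Rightarrow> 'a \<Rightarrow> 'a \<Rightarrow> real" where
  "ball_cutoff' a r x h = smooth_step' ((x - a) \<bullet> (x - a) / r\<^sup>2 - 1) * (2 * ((x - a) \<bullet> h) / r\<^sup>2)"

lemma ball_cutoff_has_derivative: "(ball_cutoff a r has_derivative ball_cutoff' a r x) (at x)"
proof -
  have "((\<lambda>x. (x - a) \<bullet> (x - a) / r\<^sup>2 - 1) has_derivative (\<lambda>h. 2 * ((x - a) \<bullet> h) / r\<^sup>2)) (at x)"
    by (auto intro!: derivative_eq_intros simp: inner_commute divide_inverse)
  from has_derivative_compose[OF this smooth_step_has_real_derivative[unfolded has_field_derivative_def]]
  show ?thesis by (simp add: ball_cutoff_def[abs_def] ball_cutoff'_def[abs_def])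
qed

lemma C1_map_ball_cutoff: "C1_map (ball_cutoff a r)"
  by (rule C1_mapI[OF ball_cutoff_has_derivative])
     (unfold ball_cutoff'_def divide_inverse, intro continuous_intros
       continuous_on_compose2[OF continuous_on_smooth_step'[of UNIV]], auto)

lemma ball_cutoff_bounds: "0 \<le> ball_cutoff a r x" "ball_cutoff a r x \<le> 1"
  by (simp_all add: ball_cutoff_def smooth_step_bounds)

lemma ball_cutoff_eq_0: "0 < r \<Longrightarrow> x \<in> ball a r \<Longrightarrow> ball_cutoff a r x = 0"
  unfolding ball_cutoff_def dot_square_norm
  by (rule smooth_step_eq_0) (auto simp: dist_norm norm_minus_commute intro!: power_mono)

lemma ball_cutoff_far:
  assumes "0 < r" "2 * r \<le> dist a x"
  shows "ball_cutoff a r x = 1" "ball_cutoff' a r x h = 0"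
proof -
  have four_eq: "(4::real) = 2\<^sup>2" by simp
  have "(2 * r)\<^sup>2 \<le> (norm (x - a))\<^sup>2"
    using assms by (intro power_mono) (auto simp: dist_norm norm_minus_commute)
  then have "2 * r\<^sup>2 \<le> (norm (x - a))\<^sup>2"
    using zero_le_power2[of r] by (simp only: power_mult_distrib flip: four_eq)
  then have *: "2 \<le> (norm (x - a))\<^sup>2 / r\<^sup>2"
    using assms(1) by (simp add: pos_le_divide_eq)
  then show "ball_cutoff a r x = 1"
    by (simp add: ball_cutoff_def dot_square_norm smooth_step_eq_1)
  have "1 \<le> pos_square t" if "1 \<le> t" for t :: real
    using that by (simp add: pos_square_def max_def)
  then have "smooth_step' t = 0" if "1 \<le> t" for t :: real
    using that by (simp add: smooth_step'_def)
  then show "ball_cutoff' a r x h = 0"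
    using * by (simp add: ball_cutoff'_def dot_square_norm)
qed

lemma ball_cutoff'_bound:
  assumes "0 < r"
  shows "\<bar>ball_cutoff' a r x h\<bar> \<le> 16 / r * indicator (cball a (2 * r)) x * norm h"
proof (cases "x \<in> cball a (2 * r)")
  case True
  have "\<bar>(x - a) \<bullet> h\<bar> \<le> (2 * r) * norm h"
    using True by (intro order_trans[OF Cauchy_Schwarz_ineq2] mult_right_mono)
      (auto simp: dist_norm norm_minus_commute)
  then have "\<bar>2 * ((x - a) \<bullet> h) / r\<^sup>2\<bar> \<le> 4 / r * norm h"
    using assms by (simp add: abs_mult divide_le_eq power2_eq_square field_simps)
  then have "\<bar>ball_cutoff' a r x h\<bar> \<le> 4 * (4 / r * norm h)"
    unfolding ball_cutoff'_def abs_mult[of "smooth_step' _"]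
    by (intro mult_mono) (use smooth_step'_bounds in auto)
  then show ?thesis using True by simp
next
  case False
  then show ?thesis using ball_cutoff_far(2)[OF assms, of a x h] by simp
qed

text \<open>
  Near the boundary one of the factors vanishes, hence the product has compact support in \<open>\<Omega>\<close>.
  In the product rule every factor that is not differentiated is at most \<open>1\<close>, so the gradients
  of the individual cutoffs simply add up.
\<close>

lemma frontier_cutoff:
  fixes \<Omega> :: "'a::euclidean_space set" and a :: "'i \<Rightarrow> 'a"
  assumes nice: "nice_region \<Omega> N" and D: "finite D" and rD: "\<forall>S\<in>D. 0 < r S"
    and cover: "frontier \<Omega> \<subseteq> (\<Union>S\<in>D. ball (a S) (r S))"
  defines "\<phi> \<equiv> \<lambda>x. if x \<in> \<Omega> then \<Prod>S\<in>D. ball_cutoff (a S) (r S) x else 0"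
  shows "test_function \<Omega> \<phi>"
    and "x \<in> \<Omega> \<Longrightarrow> \<bar>frechet_derivative \<phi> (at x) h\<bar>
      \<le> (\<Sum>S\<in>D. 16 / r S * indicator (cball (a S) (2 * r S)) x) * norm h"
proof -
  note \<Omega> = nice_regionD[OF nice]
  have r: "\<And>S. S \<in> D \<Longrightarrow> 0 < r S" using rD by blast
  define p where "p x = (\<Prod>S\<in>D. ball_cutoff (a S) (r S) x)" for x
  define p' where "p' x h = (\<Sum>S\<in>D. ball_cutoff' (a S) (r S) x h * (\<Prod>j\<in>D - {S}. ball_cutoff (a j) (r j) x))" for x h
  have dp: "(p has_derivative p' x) (at x)" for x
    unfolding p_def p'_def by (intro has_derivative_prod ball_cutoff_has_derivative)
  have C1p: "C1_map p" unfolding p_def by (intro C1_map_prod C1_map_ball_cutoff)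
  have p'_eq: "frechet_derivative p (at x) = p' x" for x
    using frechet_derivative_at[OF dp] by simp
  define K where "K = closure \<Omega> - (\<Union>S\<in>D. ball (a S) (r S))"
  have K: "compact K" "K \<subseteq> \<Omega>"
    unfolding K_def using \<Omega>(7,8) cover by (auto intro!: compact_diff)
  have off: "\<phi> x = 0" if "x \<notin> K" for x
  proof (cases "x \<in> \<Omega>")
    case True
    then have "x \<in> closure \<Omega>" using \<Omega>(8) by blast
    with \<open>x \<notin> K\<close> have "x \<in> (\<Union>S\<in>D. ball (a S) (r S))" by (simp add: K_def)
    then obtain S where S: "S \<in> D" "x \<in> ball (a S) (r S)" by blast
    then have "p x = 0" unfolding p_def using D ball_cutoff_eq_0[OF r[OF S(1)] S(2)] by (intro prod_zero) auto
    then show ?thesis by (simp add: \<phi>_def p_def)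
  qed (simp add: \<phi>_def)
  have d\<phi>: "(\<phi> has_derivative p' x) (at x)" if "x \<in> \<Omega>" for x
    by (rule has_derivative_transform_within_open[OF dp \<Omega>(1) that]) (simp add: \<phi>_def p_def)
  have "C1_map \<phi>"
  proof (rule C1_map_zero_extension[OF \<Omega>(1) compact_imp_closed[OF K(1)] K(2) off d\<phi>])
    show "continuous_on \<Omega> (\<lambda>x. p' x h)" for h
      using continuous_on_subset[OF C1_map_continuous_derivative[OF C1p, of h]] by (simp add: p'_eq)
  qed
  then show "test_function \<Omega> \<phi>" unfolding test_function_def using K off by blast
  assume x: "x \<in> \<Omega>"
  have "\<bar>p' x h\<bar> \<le> (\<Sum>S\<in>D. \<bar>ball_cutoff' (a S) (r S) x h\<bar>)"
    unfolding p'_def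
  proof (intro order_trans[OF sum_abs] sum_mono)
    fix S
    have "\<bar>\<Prod>j\<in>D - {S}. ball_cutoff (a j) (r j) x\<bar> \<le> 1"
      by (simp add: abs_prod) (intro prod_le_1, auto simp: ball_cutoff_bounds)
    then show "\<bar>ball_cutoff' (a S) (r S) x h * (\<Prod>j\<in>D - {S}. ball_cutoff (a j) (r j) x)\<bar>
        \<le> \<bar>ball_cutoff' (a S) (r S) x h\<bar>"
      unfolding abs_mult by (rule mult_left_le) simp
  qed
  also have "\<dots> \<le> (\<Sum>S\<in>D. 16 / r S * indicator (cball (a S) (2 * r S)) x * norm h)"
    by (intro sum_mono ball_cutoff'_bound r)
  finally show "\<bar>frechet_derivative \<phi> (at x) h\<bar>
      \<le> (\<Sum>S\<in>D. 16 / r S * indicator (cball (a S) (2 * r S)) x) * norm h"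
    using frechet_derivative_at[OF d\<phi>[OF x]] by (simp add: sum_distrib_right)
qed

lemma integral_indicator_cball_le:
  fixes \<Omega> :: "'a::euclidean_space set"
  assumes "\<Omega> \<in> sets lebesgue" "0 \<le> r"
  shows "integrable (lebesgue_on \<Omega>) (indicator (cball a r) :: 'a \<Rightarrow> real)"
    and "(LINT x|lebesgue_on \<Omega>. indicator (cball a r) x) \<le> unit_ball_vol (real DIM('a)) * r ^ DIM('a)"
proof -
  have i: "integrable lebesgue (indicator (cball a r) :: 'a \<Rightarrow> real)"
    using lmeasurable_cball[of a r] by (auto simp: fmeasurable_def integrable_indicator_iff)
  then have i2: "integrable lebesgue (\<lambda>x. indicator \<Omega> x *\<^sub>R indicator (cball a r) x :: real)"
    using assms(1) by (intro integrable_mult_indicator) auto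
  then show "integrable (lebesgue_on \<Omega>) (indicator (cball a r) :: 'a \<Rightarrow> real)"
    using assms(1) by (subst integrable_restrict_space) auto
  have "(LINT x|lebesgue_on \<Omega>. indicator (cball a r) x) = (LINT x|lebesgue. indicator \<Omega> x *\<^sub>R indicator (cball a r) x :: real)"
    using assms(1) by (subst integral_restrict_space) auto
  also have "\<dots> \<le> (LINT x|lebesgue. indicator (cball a r) x)"
    by (intro integral_mono i i2) (auto simp: indicator_def)
  also have "\<dots> = unit_ball_vol (real DIM('a)) * r ^ DIM('a)"
    using content_cball[OF assms(2), of a] by simp
  finally show "(LINT x|lebesgue_on \<Omega>. indicator (cball a r) x) \<le> unit_ball_vol (real DIM('a)) * r ^ DIM('a)" .
qed

text \<open>
  Integrating by parts, the weak product rule for \<open>u \<tau>\<close> and the divergence theorem for \<open>\<phi> P\<close>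
  leave the integral of the derivative of \<open>\<phi>\<close> along \<open>P - u \<tau>\<close>. Each ball contributes at most
  \<open>16 / r\<close> times the volume of the ball of radius \<open>2 r\<close>, which is a constant times
  \<open>r ^ (DIM('a) - 1)\<close>; the bound depends on the cover only through the sum \<open>C0\<close> of these powers.
\<close>

lemma cutoff_integral_bound:
  fixes \<tau> :: "'a::euclidean_space \<Rightarrow> 'a" and u :: "'a \<Rightarrow> real" and a :: "'i \<Rightarrow> 'a"
  assumes dim: "DIM('a) = 1 \<or> DIM('a) = 2" and nice: "nice_region \<Omega> N"
    and \<tau>c: "continuous_on (closure \<Omega>) \<tau>"
    and \<tau>: "\<And>x. x \<in> \<Omega> \<Longrightarrow> \<tau> differentiable (at x) \<and> divergence \<tau> x = 0"
    and u: "continuous_on (closure \<Omega>) u" and g: "has_weak_gradient \<Omega> u g"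
    and P: "C1_map P" "\<And>x. x \<in> \<Omega> \<Longrightarrow> norm (P x - u x *\<^sub>R \<tau> x) \<le> e" and e: "0 \<le> e"
    and D: "finite D" and rD: "\<forall>S\<in>D. 0 < r S"
    and cover: "frontier \<Omega> \<subseteq> (\<Union>S\<in>D. ball (a S) (r S))"
    and sum: "(\<Sum>S\<in>D. r S ^ (DIM('a) - 1)) \<le> C0"
  defines "\<phi> \<equiv> \<lambda>x. if x \<in> \<Omega> then \<Prod>S\<in>D. ball_cutoff (a S) (r S) x else 0"
  shows "\<bar>LINT x|lebesgue_on \<Omega>. (g x \<bullet> \<tau> x - divergence P x) * \<phi> x\<bar>
    \<le> e * (16 * unit_ball_vol (real DIM('a)) * 2 ^ DIM('a) * C0)"
proof -
  note \<Omega> = nice_regionD[OF nice]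
  have r: "\<And>S. S \<in> D \<Longrightarrow> 0 < r S" using rD by blast
  note cut = frontier_cutoff[OF nice D rD cover, folded \<phi>_def]
  have C1: "C1_map \<phi>" using cut(1) by (simp add: test_function_def)
  have lin: "linear (frechet_derivative \<phi> (at x))" for x
    using C1 by (intro linear_frechet_derivative) (simp add: C1_map_def)
  have uc: "continuous_on \<Omega> u" and \<tau>c': "continuous_on \<Omega> \<tau>"
    using u \<tau>c \<Omega>(8) by (auto elim: continuous_on_subset)
  have Pc: "continuous_on \<Omega> P" using P(1) by (rule C1_map_continuous_on)
  obtain K where K: "compact K" "K \<subseteq> \<Omega>" "\<And>x. x \<notin> K \<Longrightarrow> \<phi> x = 0"
    using cut(1) by (auto simp: test_function_def)
  note i1 = weak_divergence_integrable[OF \<Omega>(1) uc g \<tau>c' cut(1)]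
  have i2: "integrable (lebesgue_on \<Omega>) (\<lambda>x. frechet_derivative \<phi> (at x) (P x))"
  proof -
    have "integrable (lebesgue_on \<Omega>) (\<lambda>x. \<Sum>b\<in>Basis. (P x \<bullet> b) * frechet_derivative \<phi> (at x) b)"
      by (intro Bochner_Integration.integrable_sum test_function_derivative_integrable[OF \<Omega>(1) _ cut(1)] continuous_intros Pc)
    also have "(\<lambda>x. \<Sum>b\<in>Basis. (P x \<bullet> b) * frechet_derivative \<phi> (at x) b)
        = (\<lambda>x. frechet_derivative \<phi> (at x) (\<Sum>b\<in>Basis. (P x \<bullet> b) *\<^sub>R b))"
      by (intro ext) (simp only: linear_sum[OF lin] linear_scale[OF lin] sum_distrib_left real_scaleR_def mult.assoc)
    finally show ?thesis by (simp add: euclidean_representation)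
  qed
  have i3: "integrable (lebesgue_on \<Omega>) (\<lambda>x. divergence P x * \<phi> x)"
  proof -
    have "integrable (lebesgue_on \<Omega>) (\<lambda>x. \<phi> x *\<^sub>R divergence P x)"
      by (rule integrable_mult_compact_support[OF \<Omega>(5) K(1,2) continuous_on_imp_integrable_compact[OF K(1)] _ K(3)])
         (intro continuous_on_divergence P C1_map_continuous_on C1)+
    then show ?thesis by (simp add: mult.commute)
  qed
  have "(LINT x|lebesgue_on \<Omega>. frechet_derivative \<phi> (at x) (P x) + divergence P x * \<phi> x) = 0"
  proof -
    have "(LINT x|lebesgue_on \<Omega>. frechet_derivative \<phi> (at x) (P x) + divergence P x * \<phi> x)
        = (LINT x|lebesgue_on \<Omega>. divergence (\<lambda>x. \<phi> x *\<^sub>R P x) x)"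
      using C1 P(1) by (intro Bochner_Integration.integral_cong refl) (simp add: divergence_scaleR C1_map_def)
    also have "\<dots> = (LINT x:frontier \<Omega>|surface_measure. (\<phi> x *\<^sub>R P x) \<bullet> N x)"
      by (rule nice_region_divergence_theorem[OF nice C1_map_scaleR[OF C1 P(1)]])
    also have "\<dots> = 0"
    proof -
      have "(\<lambda>x. indicator (frontier \<Omega>) x *\<^sub>R ((\<phi> x *\<^sub>R P x) \<bullet> N x)) = (\<lambda>x. 0)"
        using \<Omega>(9) by (auto simp: \<phi>_def indicator_def fun_eq_iff)
      then show ?thesis by (simp add: set_lebesgue_integral_def)
    qed
    finally show ?thesis .
  qed
  then have "(LINT x|lebesgue_on \<Omega>. divergence P x * \<phi> x) = - (LINT x|lebesgue_on \<Omega>. frechet_derivative \<phi> (at x) (P x))"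
    using i2 i3 by simp
  moreover have "(LINT x|lebesgue_on \<Omega>. (g x \<bullet> \<tau> x) * \<phi> x)
      = - (LINT x|lebesgue_on \<Omega>. u x * frechet_derivative \<phi> (at x) (\<tau> x))"
    using weak_product_rule[OF dim \<Omega>(1,2) \<tau>c \<tau> uc g cut(1)] by simp
  ultimately have "(LINT x|lebesgue_on \<Omega>. (g x \<bullet> \<tau> x - divergence P x) * \<phi> x)
      = (LINT x|lebesgue_on \<Omega>. frechet_derivative \<phi> (at x) (P x) - u x * frechet_derivative \<phi> (at x) (\<tau> x))"
    using i1 i2 i3 by (simp add: left_diff_distrib)
  also have "norm \<dots> \<le> (LINT x|lebesgue_on \<Omega>. (\<Sum>S\<in>D. 16 / r S * indicator (cball (a S) (2 * r S)) x) * e)"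
  proof (rule Bochner_Integration.integral_norm_bound_integral)
    show "integrable (lebesgue_on \<Omega>) (\<lambda>x. (\<Sum>S\<in>D. 16 / r S * indicator (cball (a S) (2 * r S)) x) * e)"
      using r by (intro integrable_mult_left Bochner_Integration.integrable_sum integrable_mult_right integral_indicator_cball_le(1) \<Omega>) (auto simp: less_imp_le)
    fix x assume "x \<in> space (lebesgue_on \<Omega>)"
    then have x: "x \<in> \<Omega>" by simp
    have "frechet_derivative \<phi> (at x) (P x) - u x * frechet_derivative \<phi> (at x) (\<tau> x)
        = frechet_derivative \<phi> (at x) (P x - u x *\<^sub>R \<tau> x)"
      by (simp add: linear_diff[OF lin] linear_scale[OF lin])
    also have "norm \<dots> \<le> (\<Sum>S\<in>D. 16 / r S * indicator (cball (a S) (2 * r S)) x) * norm (P x - u x *\<^sub>R \<tau> x)"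
      using cut(2)[OF x] by simp
    also have "\<dots> \<le> (\<Sum>S\<in>D. 16 / r S * indicator (cball (a S) (2 * r S)) x) * e"
      using r by (intro mult_left_mono P(2)[OF x] sum_nonneg) (auto simp: less_imp_le)
    finally show "norm (frechet_derivative \<phi> (at x) (P x) - u x * frechet_derivative \<phi> (at x) (\<tau> x))
      \<le> (\<Sum>S\<in>D. 16 / r S * indicator (cball (a S) (2 * r S)) x) * e" .
  qed (use i1 i2 in auto)
  also have "\<dots> = (\<Sum>S\<in>D. 16 / r S * (LINT x|lebesgue_on \<Omega>. indicator (cball (a S) (2 * r S)) x)) * e"
    using r integral_indicator_cball_le(1)[OF \<Omega>(5)]
    by (simp add: Bochner_Integration.integral_sum less_imp_le)
  also have "\<dots> \<le> (\<Sum>S\<in>D. 16 / r S * (unit_ball_vol (real DIM('a)) * (2 * r S) ^ DIM('a))) * e"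
    using r e by (intro mult_right_mono sum_mono mult_left_mono integral_indicator_cball_le(2) \<Omega>) (auto simp: less_imp_le)
  also have "(\<Sum>S\<in>D. 16 / r S * (unit_ball_vol (real DIM('a)) * (2 * r S) ^ DIM('a)))
      = 16 * unit_ball_vol (real DIM('a)) * 2 ^ DIM('a) * (\<Sum>S\<in>D. r S ^ (DIM('a) - 1))"
    unfolding sum_distrib_left
  proof (intro sum.cong refl)
    fix S assume "S \<in> D"
    then have "0 < r S" by (rule r)
    moreover have "r S ^ DIM('a) = r S * r S ^ (DIM('a) - 1)"
      using DIM_positive[where 'a='a] by (metis power_eq_if less_irrefl)
    ultimately show "16 / r S * (unit_ball_vol (real DIM('a)) * (2 * r S) ^ DIM('a))
        = 16 * unit_ball_vol (real DIM('a)) * 2 ^ DIM('a) * r S ^ (DIM('a) - 1)"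
      by (simp add: power_mult_distrib)
  qed
  also have "\<dots> * e \<le> (16 * unit_ball_vol (real DIM('a)) * 2 ^ DIM('a) * C0) * e"
    using e sum by (intro mult_right_mono mult_left_mono) auto
  finally show ?thesis by (simp add: mult.commute)
qed

text \<open>
  Both sides are compared with those for a polynomial field \<open>P\<close> within \<open>e\<close> of \<open>u \<tau>\<close>, for which
  the divergence theorem is available. The interior error \<open>g \<bullet> \<tau> - divergence P\<close> is bounded
  after multiplication by cutoffs, uniformly as the cutoffs tend to \<open>1\<close>, and \<open>e\<close> is arbitrary.
\<close>

theorem Gauss_Green:
  fixes \<tau> :: "'a::euclidean_space \<Rightarrow> 'a" and u :: "'a \<Rightarrow> real"
  assumes dim: "DIM('a) = 1 \<or> DIM('a) = 2" and nice: "nice_region \<Omega> N"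
    and \<tau>c: "continuous_on (closure \<Omega>) \<tau>"
    and \<tau>: "\<And>x. x \<in> \<Omega> \<Longrightarrow> \<tau> differentiable (at x) \<and> divergence \<tau> x = 0"
    and u: "continuous_on (closure \<Omega>) u" and g: "has_weak_gradient \<Omega> u g"
    and gi: "integrable (lebesgue_on \<Omega>) g"
  shows "(LINT x|lebesgue_on \<Omega>. g x \<bullet> \<tau> x) = (LINT x:frontier \<Omega>|surface_measure. (u x *\<^sub>R \<tau> x) \<bullet> N x)"
proof -
  note \<Omega> = nice_regionD[OF nice]
  define M where "M = (surface_measure :: 'a measure)"
  have [simp]: "sets M = sets borel" "space M = UNIV" by (simp_all add: M_def)
  have Mfin: "emeasure M (frontier \<Omega>) < \<infinity>" and "N \<in> borel_measurable borel"
    and N1: "AE x in M. x \<in> frontier \<Omega> \<longrightarrow> norm (N x) = 1"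
    using nice unfolding nice_region_def M_def by blast+
  then have Nm: "N \<in> borel_measurable M" by (simp cong: measurable_cong_sets)
  obtain F where F: "continuous_on UNIV F" "\<And>x. x \<in> closure \<Omega> \<Longrightarrow> F x = u x *\<^sub>R \<tau> x"
    using Tietze_unbounded[of "closure \<Omega>" "\<lambda>x. u x *\<^sub>R \<tau> x" UNIV] continuous_on_scaleR[OF u \<tau>c] by auto
  let ?B = "\<lambda>G x. indicator (frontier \<Omega>) x *\<^sub>R (G x \<bullet> N x) :: real"
  have ind: "integrable M (\<lambda>x. B * indicator (frontier \<Omega>) x :: real)" for B
    using Mfin by (intro integrable_mult_right) (auto simp: integrable_indicator_iff)
  have bdry_m: "?B G \<in> borel_measurable M" if "continuous_on UNIV G" for G
  proof -
    have "G \<in> borel_measurable M"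
      using borel_measurable_continuous_onI[OF that] by (simp cong: measurable_cong_sets)
    then show ?thesis using Nm by (intro borel_measurable_scaleR borel_measurable_inner borel_measurable_indicator) auto
  qed
  have bdry_b: "integrable M (?B G)" "\<bar>LINT x|M. ?B G x\<bar> \<le> B * measure M (frontier \<Omega>)"
    if G: "continuous_on UNIV G" and B: "\<And>x. x \<in> frontier \<Omega> \<Longrightarrow> norm (G x) \<le> B" "0 \<le> B" for G B
  proof -
    have le: "AE x in M. norm (?B G x) \<le> B * indicator (frontier \<Omega>) x"
      using N1
    proof eventually_elim
      fix x assume n: "x \<in> frontier \<Omega> \<longrightarrow> norm (N x) = 1"
      show "norm (?B G x) \<le> B * indicator (frontier \<Omega>) x"
        using n B(1)[of x] Cauchy_Schwarz_ineq2[of "G x" "N x"] by (cases "x \<in> frontier \<Omega>") auto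
    qed
    show i: "integrable M (?B G)"
      by (rule Bochner_Integration.integrable_bound[OF ind[of B] bdry_m[OF G]]) (use le B(2) in \<open>auto elim!: eventually_mono\<close>)
    have "norm (LINT x|M. ?B G x) \<le> (LINT x|M. norm (?B G x))" by (rule integral_norm_bound)
    also have "\<dots> \<le> (LINT x|M. B * indicator (frontier \<Omega>) x)"
      by (intro integral_mono_AE integrable_norm i ind le)
    also have "\<dots> = B * measure M (frontier \<Omega>)" by simp
    finally show "\<bar>LINT x|M. ?B G x\<bar> \<le> B * measure M (frontier \<Omega>)" by simp
  qed
  have bdry_i: "integrable M (?B G)" if G: "continuous_on UNIV G" for G
  proof -
    have "bounded (G ` frontier \<Omega>)"
      by (intro compact_imp_bounded compact_continuous_image continuous_on_subset[OF G] \<Omega>) auto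
    then obtain B where "0 < B" "\<forall>y\<in>G ` frontier \<Omega>. norm y \<le> B" by (auto simp: bounded_pos)
    then show ?thesis by (intro bdry_b[OF G, of B]) auto
  qed
  have "bounded (\<tau> ` closure \<Omega>)" by (intro compact_imp_bounded compact_continuous_image \<tau>c \<Omega>)
  then obtain B\<tau> where "\<And>x. x \<in> closure \<Omega> \<Longrightarrow> norm (\<tau> x) \<le> B\<tau>" by (auto simp: bounded_iff)
  then have g\<tau>i: "integrable (lebesgue_on \<Omega>) (\<lambda>x. g x \<bullet> \<tau> x)"
    using \<Omega>(8) by (intro integrable_inner_bounded[OF \<Omega>(5) gi, of _ B\<tau>] continuous_on_subset[OF \<tau>c]) auto
  obtain C0 where C0: "\<And>\<delta>. 0 < \<delta> \<Longrightarrow> \<exists>D (a :: 'a set \<Rightarrow> 'a) r. finite D \<and> frontier \<Omega> \<subseteq> (\<Union>S\<in>D. ball (a S) (r S))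
    \<and> (\<forall>S\<in>D. 0 < r S \<and> r S \<le> \<delta> \<and> ball (a S) (r S) \<inter> frontier \<Omega> \<noteq> {})
    \<and> (\<Sum>S\<in>D. r S ^ (DIM('a) - 1)) \<le> C0"
    using frontier_ball_cover[OF dim nice] by blast
  define C1 where "C1 = 16 * unit_ball_vol (real DIM('a)) * 2 ^ DIM('a) * C0"
  have main: "\<bar>(LINT x|lebesgue_on \<Omega>. g x \<bullet> \<tau> x) - (LINT x|M. ?B F x)\<bar> \<le> e * (C1 + measure M (frontier \<Omega>))"
    if e: "0 < e" for e
  proof -
    obtain P where P: "polynomial_function P" "\<And>x. x \<in> closure \<Omega> \<Longrightarrow> norm (F x - P x) < e"
      using Stone_Weierstrass_polynomial_function[OF \<Omega>(7) continuous_on_subset[OF F(1)] e] by blast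
    have PC1: "C1_map P" by (rule C1_map_polynomial_function[OF P(1)])
    have Pu: "norm (P x - u x *\<^sub>R \<tau> x) \<le> e" if "x \<in> \<Omega>" for x
      using P(2)[of x] F(2)[of x] that \<Omega>(8) by (simp add: norm_minus_commute)
    let ?h = "\<lambda>x. g x \<bullet> \<tau> x - divergence P x"
    have divP: "integrable (lebesgue_on \<Omega>) (divergence P)"
    proof -
      have "bounded (divergence P ` closure \<Omega>)"
        by (intro compact_imp_bounded compact_continuous_image continuous_on_divergence PC1 \<Omega>)
      then obtain B where "\<And>x. x \<in> closure \<Omega> \<Longrightarrow> norm (divergence P x) \<le> B" by (auto simp: bounded_iff)
      then show ?thesis
        using \<Omega>(8) by (intro finite_measure.integrable_const_bound[OF \<Omega>(11), of _ B] AE_I2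
          continuous_imp_measurable_on_sets_lebesgue continuous_on_divergence PC1 \<Omega>(5)) auto
    qed
    have h: "integrable (lebesgue_on \<Omega>) ?h" using g\<tau>i divP by simp
    define good where "good n \<phi> \<longleftrightarrow> (\<exists>D (a :: 'a set \<Rightarrow> 'a) r. finite D \<and> frontier \<Omega> \<subseteq> (\<Union>S\<in>D. ball (a S) (r S))
      \<and> (\<forall>S\<in>D. 0 < r S \<and> r S \<le> inverse (real (Suc n)) \<and> ball (a S) (r S) \<inter> frontier \<Omega> \<noteq> {})
      \<and> (\<Sum>S\<in>D. r S ^ (DIM('a) - 1)) \<le> C0 \<and> \<phi> = (\<lambda>x. if x \<in> \<Omega> then \<Prod>S\<in>D. ball_cutoff (a S) (r S) x else 0))" for n \<phi>
    have "\<exists>\<phi>. good n \<phi>" for n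
      using C0[of "inverse (real (Suc n))"] unfolding good_def by (simp, blast)
    then obtain \<phi> where \<phi>: "\<And>n. good n (\<phi> n)" by metis
    have bound: "\<bar>LINT x|lebesgue_on \<Omega>. ?h x * \<phi> n x\<bar> \<le> e * C1" for n
      using \<phi>[of n] unfolding good_def C1_def
      by (elim exE conjE) (auto intro!: cutoff_integral_bound[OF dim nice \<tau>c \<tau> u g PC1 Pu less_imp_le[OF e]])
    have tf: "test_function \<Omega> (\<phi> n)" "0 \<le> \<phi> n x" "\<phi> n x \<le> 1" for n x
      using \<phi>[of n] unfolding good_def by (auto intro!: frontier_cutoff(1)[OF nice] prod_nonneg prod_le_1 simp: ball_cutoff_bounds)
    have one: "\<forall>\<^sub>F n in sequentially. \<phi> n x = 1" if x: "x \<in> \<Omega>" for x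
    proof -
      obtain \<rho> where \<rho>: "0 < \<rho>" "ball x \<rho> \<subseteq> \<Omega>" using \<Omega>(1) x open_contains_ball by blast
      have "\<forall>\<^sub>F n in sequentially. inverse (real (Suc n)) < \<rho> / 3"
        \<comment> \<open>A ball of radius \<open>r < \<rho> / 3\<close> that meets the boundary has its centre at distance at
          least \<open>\<rho> - r \<ge> 2 r\<close> from \<open>x\<close>, so its cutoff is \<open>1\<close> at \<open>x\<close>.\<close>
        using \<rho>(1) LIMSEQ_inverse_real_of_nat by (intro order_tendstoD(2)[of _ 0]) auto
      then show ?thesis
      proof eventually_elim
        case (elim n)
        obtain D and a :: "'a set \<Rightarrow> 'a" and r where D:
          "\<And>S. S \<in> D \<Longrightarrow> 0 < r S \<and> r S \<le> inverse (real (Suc n)) \<and> ball (a S) (r S) \<inter> frontier \<Omega> \<noteq> {}"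
          "\<phi> n = (\<lambda>x. if x \<in> \<Omega> then \<Prod>S\<in>D. ball_cutoff (a S) (r S) x else 0)"
          using \<phi>[of n] unfolding good_def by blast
        have "ball_cutoff (a S) (r S) x = 1" if S: "S \<in> D" for S
        proof -
          obtain y where y: "dist (a S) y < r S" "y \<in> frontier \<Omega>" using D(1)[OF S] by auto
          have "y \<notin> \<Omega>" using y(2) \<Omega>(9) by blast
          then have "\<rho> \<le> dist x y" using \<rho>(2) by (metis mem_ball not_le subsetD)
          also have "\<dots> \<le> dist (a S) x + dist (a S) y" by (metis dist_commute dist_triangle)
          finally show ?thesis
            using D(1)[OF S] elim y(1) by (intro ball_cutoff_far(1)) auto
        qed
        then show ?case using D(2) x by simp
      qed
    qed
    have "(\<lambda>n. LINT x|lebesgue_on \<Omega>. ?h x * \<phi> n x) \<longlonglongrightarrow> (LINT x|lebesgue_on \<Omega>. ?h x)"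
    proof (rule integral_dominated_convergence[where w = "\<lambda>x. \<bar>?h x\<bar>"])
      show "(\<lambda>x. ?h x * \<phi> n x) \<in> borel_measurable (lebesgue_on \<Omega>)" for n
      proof (rule borel_measurable_times)
        show "\<phi> n \<in> borel_measurable (lebesgue_on \<Omega>)"
          using tf(1)[of n] by (intro continuous_imp_measurable_on_sets_lebesgue \<Omega>) (auto simp: test_function_def C1_map_continuous_on)
      qed (use h in auto)
      show "AE x in lebesgue_on \<Omega>. (\<lambda>n. ?h x * \<phi> n x) \<longlonglongrightarrow> ?h x"
      proof (rule AE_I2)
        fix x assume "x \<in> space (lebesgue_on \<Omega>)"
        then have "\<forall>\<^sub>F n in sequentially. ?h x * \<phi> n x = ?h x"
          using one[of x] by (auto elim: eventually_mono)
        then show "(\<lambda>n. ?h x * \<phi> n x) \<longlonglongrightarrow> ?h x" by (rule tendsto_eventually)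
      qed
      show "AE x in lebesgue_on \<Omega>. norm (?h x * \<phi> n x) \<le> \<bar>?h x\<bar>" for n
        using tf(2,3) by (intro AE_I2) (auto simp: abs_mult intro: mult_left_le)
    qed (use h in auto)
    then have "\<bar>LINT x|lebesgue_on \<Omega>. ?h x\<bar> \<le> e * C1"
      using bound by (intro LIMSEQ_le_const2[OF tendsto_rabs]) auto
    moreover have "(LINT x|lebesgue_on \<Omega>. ?h x) = (LINT x|lebesgue_on \<Omega>. g x \<bullet> \<tau> x) - (LINT x|M. ?B P x)"
      using nice_region_divergence_theorem[OF nice PC1] g\<tau>i divP
      by (simp add: set_lebesgue_integral_def M_def)
    moreover have "\<bar>(LINT x|M. ?B P x) - (LINT x|M. ?B F x)\<bar> \<le> e * measure M (frontier \<Omega>)"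
    proof -
      have Pc: "continuous_on UNIV P" by (rule C1_map_continuous_on[OF PC1])
      have "(LINT x|M. ?B P x) - (LINT x|M. ?B F x) = (LINT x|M. ?B P x - ?B F x)"
        by (intro Bochner_Integration.integral_diff[symmetric] bdry_i Pc F)
      also have "\<dots> = (LINT x|M. ?B (\<lambda>x. P x - F x) x)"
        by (simp add: inner_diff_left right_diff_distrib)
      finally show ?thesis
        using bdry_b(2)[OF continuous_on_diff[OF Pc F(1)], of e] P(2) \<Omega>(8) e
        by (auto simp: norm_minus_commute less_imp_le)
    qed
    ultimately show ?thesis by (simp add: algebra_simps abs_le_iff)
  qed
  have "(LINT x|lebesgue_on \<Omega>. g x \<bullet> \<tau> x) - (LINT x|M. ?B F x) = 0"
    by (rule zero_if_le_all_multiples[OF main])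
  moreover have "(LINT x|M. ?B F x) = (LINT x:frontier \<Omega>|surface_measure. (u x *\<^sub>R \<tau> x) \<bullet> N x)"
    unfolding set_lebesgue_integral_def M_def
    using F(2) \<Omega>(8) by (intro Bochner_Integration.integral_cong) (auto simp: indicator_def)
  ultimately show ?thesis by simp
qed

section \<open>Cardano's formulas\<close>

lemma cubic_psi_cube:
  "cubic_psi \<alpha> c s ^ 3 = complex_of_real (- 16 * \<alpha>^3 + 27 * c\<^sup>2 * s\<^sup>2)
      + 3 * complex_of_real (sqrt 3 * s)
          * csqrt (complex_of_real (- 32 * \<alpha>^3 * c\<^sup>2 + 27 * c^4 * s\<^sup>2))"
proof -
  have "(z powr (1/3)) ^ 3 = z" for z :: complex
  proof (cases "z = 0")
    case False
    have "(z powr (1/3)) ^ 3 = exp (3 * (1/3 * ln z))"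
      using False by (simp add: powr_def exp_of_nat_mult[of 3, symmetric] del: exp_of_nat_mult)
    then show ?thesis using False by simp
  qed simp
  then show ?thesis by (simp add: cubic_psi_def)
qed

text \<open>
  Up to the shift by \<open>\<alpha> / (3 c)\<close> the roots are \<open>q + p\<close>, \<open>\<omega> q + \<omega>\<^sup>2 p\<close> and \<open>\<omega>\<^sup>2 q + \<omega> p\<close> for a
  primitive third root of unity \<open>\<omega>\<close>.
\<close>

definition cubic_p :: "real \<Rightarrow> real \<Rightarrow> real \<Rightarrow> complex" where
  "cubic_p \<alpha> c s = cubic_psi \<alpha> c s / of_real (3 * 2 powr (4/3) * c)"

definition cubic_q :: "real \<Rightarrow> real \<Rightarrow> real \<Rightarrow> complex" where
  "cubic_q \<alpha> c s = of_real (2 powr (4/3) * \<alpha>\<^sup>2) / (3 * of_real c * cubic_psi \<alpha> c s)"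

definition omega :: complex where "omega = Complex (-1/2) (sqrt 3 / 2)"

lemma omega_alt: "omega = (- 1 + \<i> * of_real (sqrt 3)) / 2" "cnj omega = (- 1 - \<i> * of_real (sqrt 3)) / 2"
  by (simp_all add: omega_def complex_eq_iff)

lemma omega_relations: "omega * cnj omega = 1" "omega + cnj omega = -1" "omega * omega = cnj omega" "cnj omega * cnj omega = omega"
  by (simp_all add: omega_def complex_eq_iff field_simps)

lemma two_powr_third: "(2::real) powr (4/3) = 2 * 2 powr (1/3)" "((2::real) powr (1/3)) ^ 3 = 2" "0 < (2::real) powr (1/3)"
  using powr_add[of "2::real" 1 "1/3"] by (simp_all add: powr_power)

lemma cubic_root_pq:
  "cubic_root1 \<alpha> c s = - of_real (\<alpha> / (3 * c)) + (cubic_q \<alpha> c s + cubic_p \<alpha> c s)"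
  "cubic_root2 \<alpha> c s = - of_real (\<alpha> / (3 * c)) + (omega * cubic_q \<alpha> c s + cnj omega * cubic_p \<alpha> c s)"
  "cubic_root3 \<alpha> c s = - of_real (\<alpha> / (3 * c)) + (cnj omega * cubic_q \<alpha> c s + omega * cubic_p \<alpha> c s)"
proof -
  show "cubic_root1 \<alpha> c s = - of_real (\<alpha> / (3 * c)) + (cubic_q \<alpha> c s + cubic_p \<alpha> c s)"
    by (simp add: cubic_root1_def cubic_p_def cubic_q_def Let_def)
  have q: "of_real (2 powr (1/3) * \<alpha>\<^sup>2) * w / (3 * of_real c * cubic_psi \<alpha> c s) = cubic_q \<alpha> c s * (w / 2)" for w
    by (simp add: cubic_q_def two_powr_third(1) mult_ac)
  have p: "w * cubic_psi \<alpha> c s / of_real (12 * 2 powr (1/3) * c) = cubic_p \<alpha> c s * (w / 2)" for w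
    by (simp add: cubic_p_def two_powr_third(1) mult_ac)
  show "cubic_root2 \<alpha> c s = - of_real (\<alpha> / (3 * c)) + (omega * cubic_q \<alpha> c s + cnj omega * cubic_p \<alpha> c s)"
    unfolding cubic_root2_def Let_def q p omega_alt by (simp add: field_simps)
  show "cubic_root3 \<alpha> c s = - of_real (\<alpha> / (3 * c)) + (cnj omega * cubic_q \<alpha> c s + omega * cubic_p \<alpha> c s)"
    unfolding cubic_root3_def Let_def q p omega_alt by (simp add: field_simps)
qed

text \<open>
  With \<open>X = A + B\<close>, where \<open>B\<close> is the term with the square root, \<open>2 A - X = A - B\<close> is the
  conjugate quantity, and \<open>A\<^sup>2 - B\<^sup>2\<close> simplifies.
\<close>

lemma cubic_psi_conjugate:
  fixes \<alpha> c s :: real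
  defines "X \<equiv> cubic_psi \<alpha> c s ^ 3" and "A \<equiv> complex_of_real (- 16 * \<alpha>^3 + 27 * c\<^sup>2 * s\<^sup>2)"
  shows "X * (2 * A - X) = of_real (256 * \<alpha> ^ 6)"
proof -
  define D where "D = complex_of_real (- 32 * \<alpha>^3 * c\<^sup>2 + 27 * c^4 * s\<^sup>2)"
  define B where "B = 3 * complex_of_real (sqrt 3 * s) * csqrt D"
  have X: "X = A + B" by (simp add: X_def A_def B_def D_def cubic_psi_cube)
  have "(complex_of_real (sqrt 3))\<^sup>2 = 3" by (simp flip: of_real_power)
  then have "B\<^sup>2 = of_real (27 * s\<^sup>2) * (csqrt D)\<^sup>2"
    by (simp add: B_def power_mult_distrib)
  also have "\<dots> = of_real (27 * s\<^sup>2 * (- 32 * \<alpha>^3 * c\<^sup>2 + 27 * c^4 * s\<^sup>2))"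
    by (simp add: D_def)
  finally have B2: "B\<^sup>2 = of_real (27 * s\<^sup>2 * (- 32 * \<alpha>^3 * c\<^sup>2 + 27 * c^4 * s\<^sup>2))" .
  have "X * (2 * A - X) = A\<^sup>2 - B\<^sup>2" by (simp add: X power2_eq_square algebra_simps)
  also have "\<dots> = of_real ((- 16 * \<alpha>^3 + 27 * c\<^sup>2 * s\<^sup>2)\<^sup>2 - 27 * s\<^sup>2 * (- 32 * \<alpha>^3 * c\<^sup>2 + 27 * c^4 * s\<^sup>2))"
    unfolding B2 A_def by simp
  also have "(- 16 * \<alpha>^3 + 27 * c\<^sup>2 * s\<^sup>2)\<^sup>2 - 27 * s\<^sup>2 * (- 32 * \<alpha>^3 * c\<^sup>2 + 27 * c^4 * s\<^sup>2) = 256 * \<alpha> ^ 6"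
    by algebra
  finally show ?thesis .
qed

text \<open>
  The formulas divide by \<open>cubic_psi\<close>. In the only case where it vanishes all coefficients but
  the leading one are zero, and \<open>x / 0 = 0\<close> then yields the correct triple root.
\<close>

lemma cubic_psi_eq_0:
  assumes "0 < c" "0 \<le> s" "cubic_psi \<alpha> c s = 0"
  shows "\<alpha> = 0" "s = 0"
proof -
  show a: "\<alpha> = 0" using cubic_psi_conjugate[of \<alpha> c s] assms(3) by simp
  have cs: "csqrt (of_real (27 * c ^ 4 * s\<^sup>2)) = of_real (sqrt (27 * c ^ 4 * s\<^sup>2))"
    by (subst csqrt_of_real_nonneg) auto
  have "0 = complex_of_real (27 * c\<^sup>2 * s\<^sup>2) + 3 * complex_of_real (sqrt 3 * s) * of_real (sqrt (27 * c ^ 4 * s\<^sup>2))"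
    using cubic_psi_cube[of \<alpha> c s] assms(3) a cs by simp
  also have "\<dots> = of_real (27 * c\<^sup>2 * s\<^sup>2 + 3 * (sqrt 3 * s) * sqrt (27 * c ^ 4 * s\<^sup>2))"
    by simp
  finally have "27 * c\<^sup>2 * s\<^sup>2 + 3 * (sqrt 3 * s) * sqrt (27 * c ^ 4 * s\<^sup>2) = 0"
    by (metis of_real_eq_0_iff)
  moreover have "0 \<le> 3 * (sqrt 3 * s) * sqrt (27 * c ^ 4 * s\<^sup>2)" "0 \<le> 27 * c\<^sup>2 * s\<^sup>2" using assms by auto
  ultimately have "27 * c\<^sup>2 * s\<^sup>2 = 0" by linarith
  then show "s = 0" using assms(1) by simp
qed

text \<open>
  These values make \<open>y ^ 3 - 3 p q y - (p ^ 3 + q ^ 3)\<close> the depressed form of the cubic.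
\<close>

lemma cubic_pq_relations:
  fixes \<alpha> c s :: real
  assumes c: "0 < c" and s: "0 \<le> s"
  defines "p \<equiv> cubic_p \<alpha> c s" and "q \<equiv> cubic_q \<alpha> c s"
  shows "p * q = of_real (\<alpha>\<^sup>2 / (9 * c\<^sup>2))"
    and "p ^ 3 + q ^ 3 = of_real (- 2 * \<alpha> ^ 3 / (27 * c ^ 3) + s\<^sup>2 / (8 * c))"
proof -
  define \<psi> where "\<psi> = cubic_psi \<alpha> c s"
  define k where "k = (2::real) powr (4/3)"
  have k: "k ^ 3 = 16" "0 < k" by (simp_all add: k_def two_powr_third power_mult_distrib)
  have pq: "p = \<psi> / of_real (3 * k * c)" "q = of_real (k * \<alpha>\<^sup>2) / (3 * of_real c * \<psi>)"
    by (simp_all add: p_def q_def cubic_p_def cubic_q_def k_def \<psi>_def)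
  show 1: "p * q = of_real (\<alpha>\<^sup>2 / (9 * c\<^sup>2))"
    using cubic_psi_eq_0[OF c s, of \<alpha>] c k(2)
    by (cases "\<psi> = 0") (auto simp: pq \<psi>_def power2_eq_square)
  show "p ^ 3 + q ^ 3 = of_real (- 2 * \<alpha> ^ 3 / (27 * c ^ 3) + s\<^sup>2 / (8 * c))"
  proof (cases "\<psi> = 0")
    case True
    then show ?thesis using cubic_psi_eq_0[OF c s, of \<alpha>] by (simp add: pq \<psi>_def)
  next
    case False
    define A where "A = - 16 * \<alpha>^3 + 27 * c\<^sup>2 * s\<^sup>2"
    define X where "X = \<psi> ^ 3"
    have X: "X * (2 * of_real A - X) = of_real (256 * \<alpha> ^ 6)" "X \<noteq> 0"
      using cubic_psi_conjugate[of \<alpha> c s] False by (auto simp: A_def X_def \<psi>_def)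
    have "p ^ 3 = X / of_real (432 * c ^ 3)"
      by (simp add: pq power_divide power_mult_distrib X_def k flip: of_real_power)
    moreover have q3: "q ^ 3 = of_real (256 * \<alpha> ^ 6) / (X * of_real (432 * c ^ 3))"
      by (simp add: pq power_divide power_mult_distrib X_def k flip: of_real_power power_mult)
    have "q ^ 3 = (2 * of_real A - X) / of_real (432 * c ^ 3)"
      unfolding q3 X(1)[symmetric] using X(2) by simp
    ultimately have "p ^ 3 + q ^ 3 = of_real (2 * A / (432 * c ^ 3))"
      by (simp add: add_divide_distrib[symmetric])
    also have "2 * A / (432 * c ^ 3) = - 2 * \<alpha> ^ 3 / (27 * c ^ 3) + s\<^sup>2 / (8 * c)"
      using c by (simp add: A_def field_simps eval_nat_numeral)
    finally show ?thesis .
  qed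
qed

lemma cubic_roots_set:
  assumes c: "0 < c" and s: "0 \<le> s"
  shows "{z. 8 * z\<^sup>2 * (of_real c * z + of_real \<alpha>) = of_real (s\<^sup>2)}
    = {cubic_root1 \<alpha> c s, cubic_root2 \<alpha> c s, cubic_root3 \<alpha> c s}"
proof -
  define p q where "p = cubic_p \<alpha> c s" and "q = cubic_q \<alpha> c s"
  note rel = cubic_pq_relations[OF c s, of \<alpha>, folded p_def q_def]
  have "8 * z\<^sup>2 * (of_real c * z + of_real \<alpha>) - of_real (s\<^sup>2)
    = 8 * of_real c * ((z - cubic_root1 \<alpha> c s) * (z - cubic_root2 \<alpha> c s) * (z - cubic_root3 \<alpha> c s))" for z
  proof -
    \<comment> \<open>In terms of \<open>y\<close> the product of the three linear factors is
      \<open>y ^ 3 - 3 p q y - (p ^ 3 + q ^ 3)\<close>.\<close>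
    define y where "y = z + of_real (\<alpha> / (3 * c))"
    have "(z - cubic_root1 \<alpha> c s) * (z - cubic_root2 \<alpha> c s) * (z - cubic_root3 \<alpha> c s)
        = (y - (q + p)) * (y - (omega * q + cnj omega * p)) * (y - (cnj omega * q + omega * p))"
      by (simp add: cubic_root_pq y_def p_def q_def algebra_simps)
    also have "\<dots> = y ^ 3 - 3 * (p * q) * y - (p ^ 3 + q ^ 3)"
    proof -
      define w v where "w = omega" and "v = cnj omega"
      have "w * v = 1" "v = - 1 - w" using omega_relations(1,2) by (simp_all add: w_def v_def algebra_simps add_eq_0_iff)
      then show ?thesis unfolding v_def[symmetric] unfolding w_def[symmetric] by algebra
    qed
    also have "\<dots> = y ^ 3 - of_real (\<alpha>\<^sup>2 / (3 * c\<^sup>2)) * y - of_real (- 2 * \<alpha> ^ 3 / (27 * c ^ 3) + s\<^sup>2 / (8 * c))"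
      unfolding rel by simp
    finally have eq: "(z - cubic_root1 \<alpha> c s) * (z - cubic_root2 \<alpha> c s) * (z - cubic_root3 \<alpha> c s)
        = y ^ 3 - of_real (\<alpha>\<^sup>2 / (3 * c\<^sup>2)) * y - of_real (- 2 * \<alpha> ^ 3 / (27 * c ^ 3) + s\<^sup>2 / (8 * c))" .
    show ?thesis
      unfolding eq y_def using c by (simp add: field_simps eval_nat_numeral)
  qed
  then have "8 * z\<^sup>2 * (of_real c * z + of_real \<alpha>) = of_real (s\<^sup>2)
    \<longleftrightarrow> z = cubic_root1 \<alpha> c s \<or> z = cubic_root2 \<alpha> c s \<or> z = cubic_root3 \<alpha> c s" for z
    using c by (metis (no_types, lifting) eq_iff_diff_eq_0 mult_eq_0_iff of_real_eq_0_iff less_irrefl zero_neq_numeral)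
  then show ?thesis by blast
qed

lemma cubic_discriminant: "- 32 * \<alpha>^3 * c\<^sup>2 + 27 * c^4 * s\<^sup>2 = c\<^sup>2 * (27 * c\<^sup>2 * s\<^sup>2 - 32 * \<alpha> ^ 3)" for \<alpha> c s :: real
  by algebra

text \<open>
  The radicand under the cube root is a nonnegative real: if \<open>\<alpha> > 0\<close>, the bound on \<open>s\<close> makes
  \<open>27 c\<^sup>2 s\<^sup>2 - 16 \<alpha> ^ 3\<close> nonnegative. The principal cube root is then the real one.
\<close>

lemma cubic_psi_real:
  assumes c: "0 < c" and s: "0 \<le> s" and D: "32 * \<alpha> ^ 3 \<le> 27 * c\<^sup>2 * s\<^sup>2"
  obtains P where "cubic_psi \<alpha> c s = of_real P" "0 \<le> P"
    "P ^ 3 = - 16 * \<alpha>^3 + 27 * c\<^sup>2 * s\<^sup>2 + 3 * sqrt 3 * s * (c * sqrt (27 * c\<^sup>2 * s\<^sup>2 - 32 * \<alpha> ^ 3))"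
proof -
  define d where "d = c * sqrt (27 * c\<^sup>2 * s\<^sup>2 - 32 * \<alpha> ^ 3)"
  have d: "0 \<le> d" using c D by (simp add: d_def)
  have d_eq: "csqrt (complex_of_real (- 32 * \<alpha>^3 * c\<^sup>2 + 27 * c^4 * s\<^sup>2)) = of_real d"
    unfolding cubic_discriminant d_def using c D by (subst csqrt_of_real_nonneg) (auto simp: real_sqrt_mult)
  define X where "X = - 16 * \<alpha>^3 + 27 * c\<^sup>2 * s\<^sup>2 + 3 * sqrt 3 * s * d"
  have "0 \<le> - 16 * \<alpha>^3 + 27 * c\<^sup>2 * s\<^sup>2"
  proof (cases "0 \<le> \<alpha>")
    case True then show ?thesis using D zero_le_power[OF True, of 3] by linarith
  next
    case False
    then have "\<alpha> ^ 3 \<le> 0" by (simp add: power_le_zero_eq)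
    moreover have "0 \<le> 27 * c\<^sup>2 * s\<^sup>2" by simp
    ultimately show ?thesis by linarith
  qed
  then have X: "0 \<le> X" using d s by (simp add: X_def)
  have arg: "complex_of_real (- 16 * \<alpha>^3 + 27 * c\<^sup>2 * s\<^sup>2) + 3 * complex_of_real (sqrt 3 * s) * of_real d = of_real X"
    by (simp add: X_def)
  have "cubic_psi \<alpha> c s = of_real X powr of_real (1/3)"
    by (simp only: cubic_psi_def d_eq arg) simp
  also have "\<dots> = of_real (X powr (1/3))" using X by (rule powr_of_real)
  finally have "cubic_psi \<alpha> c s = of_real (X powr (1/3))" .
  moreover have "(X powr (1/3)) ^ 3 = X" using X by (cases "X = 0") (simp_all add: powr_power)
  ultimately show ?thesis using that[of "X powr (1/3)"] by (simp add: X_def d_def)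
qed

lemma Re_Im_cubic_roots:
  assumes "cubic_p \<alpha> c s = of_real p" "cubic_q \<alpha> c s = of_real q"
  shows "cubic_root1 \<alpha> c s = of_real (q + p - \<alpha> / (3 * c))"
    "Im (cubic_root2 \<alpha> c s) = sqrt 3 / 2 * (q - p)" "Im (cubic_root3 \<alpha> c s) = sqrt 3 / 2 * (p - q)"
  by (simp_all add: cubic_root_pq assms omega_def algebra_simps)

text \<open>
  The last clause is what makes the second and third root nonreal when \<open>s > 0\<close> and the
  discriminant is positive, as their imaginary parts are multiples of \<open>p - q\<close>.
\<close>

lemma cubic_pq_real:
  assumes c: "0 < c" and s: "0 \<le> s" and D: "32 * \<alpha> ^ 3 \<le> 27 * c\<^sup>2 * s\<^sup>2"
  obtains p q where "cubic_p \<alpha> c s = of_real p" "cubic_q \<alpha> c s = of_real q" "0 \<le> p" "0 \<le> q"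
    "p * q = \<alpha>\<^sup>2 / (9 * c\<^sup>2)"
    "p = q \<Longrightarrow> s = 0 \<or> 27 * c\<^sup>2 * s\<^sup>2 = 32 * \<alpha> ^ 3"
proof -
  define d where "d = c * sqrt (27 * c\<^sup>2 * s\<^sup>2 - 32 * \<alpha> ^ 3)"
  obtain P where P: "cubic_psi \<alpha> c s = of_real P" "0 \<le> P"
    "P ^ 3 = - 16 * \<alpha>^3 + 27 * c\<^sup>2 * s\<^sup>2 + 3 * sqrt 3 * s * d"
    using cubic_psi_real[OF c s D] unfolding d_def by metis
  define k where "k = (2::real) powr (4/3)"
  have k: "k ^ 3 = 16" "0 < k" by (simp_all add: k_def two_powr_third power_mult_distrib)
  define p q where "p = P / (3 * k * c)" and "q = k * \<alpha>\<^sup>2 / (3 * c * P)"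
  have pq: "cubic_p \<alpha> c s = of_real p" "cubic_q \<alpha> c s = of_real q"
    by (simp_all add: cubic_p_def cubic_q_def P(1) p_def q_def k_def)
  have "complex_of_real (p * q) = of_real (\<alpha>\<^sup>2 / (9 * c\<^sup>2))"
    using cubic_pq_relations(1)[OF c s, of \<alpha>] by (simp add: pq)
  then have prod: "p * q = \<alpha>\<^sup>2 / (9 * c\<^sup>2)" by (simp only: of_real_eq_iff)
  have "s = 0 \<or> 27 * c\<^sup>2 * s\<^sup>2 = 32 * \<alpha> ^ 3" if "p = q"
  proof (cases "P = 0")
    case True
    then show ?thesis using cubic_psi_eq_0(2)[OF c s] P(1) by simp
  next
    case False
    have "P * P = k\<^sup>2 * \<alpha>\<^sup>2" using that c k(2) False by (simp add: p_def q_def field_simps power2_eq_square)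
    then have "(P * P) ^ 3 = (k ^ 3)\<^sup>2 * \<alpha> ^ 6" by (simp add: power_mult_distrib flip: power_mult)
    then have "P ^ 3 * P ^ 3 = 256 * \<alpha> ^ 6" by (simp add: k power_mult_distrib)
    moreover have "P ^ 3 * (2 * (- 16 * \<alpha>^3 + 27 * c\<^sup>2 * s\<^sup>2) - P ^ 3) = 256 * \<alpha> ^ 6"
    proof -
      have "complex_of_real (P ^ 3 * (2 * (- 16 * \<alpha>^3 + 27 * c\<^sup>2 * s\<^sup>2) - P ^ 3)) = of_real (256 * \<alpha> ^ 6)"
        using cubic_psi_conjugate[of \<alpha> c s] by (simp add: P(1))
      then show ?thesis by (simp only: of_real_eq_iff)
    qed
    ultimately have "P ^ 3 * (2 * (- 16 * \<alpha>^3 + 27 * c\<^sup>2 * s\<^sup>2) - P ^ 3) = P ^ 3 * P ^ 3" by simp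
    moreover have "P ^ 3 \<noteq> 0" using False by simp
    ultimately have "2 * (- 16 * \<alpha>^3 + 27 * c\<^sup>2 * s\<^sup>2) - P ^ 3 = P ^ 3" using mult_left_cancel by blast
    moreover have "B = 0" if "2 * A - X = X" "X = A + B" for A B X :: real
      using that by linarith
    ultimately have "3 * sqrt 3 * s * d = 0" using P(3) by blast
    then show ?thesis using c by (auto simp: d_def)
  qed
  then show ?thesis using that[OF pq _ _ prod] P(2) c k(2) by (simp add: p_def q_def)
qed

text \<open>
  Here \<open>cubic_psi ^ 3\<close> has modulus \<open>16 \<alpha> ^ 3\<close> and nonnegative imaginary part, hence an argument
  \<open>3 \<theta>\<close> in \<open>{0..pi}\<close>. The principal cube root has argument \<open>\<theta>\<close>, which puts \<open>p\<close> and \<open>q\<close> at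
  \<open>\<alpha> / (3 c)\<close> times \<open>cis \<theta>\<close> and \<open>cis (- \<theta>)\<close>.
\<close>

lemma cubic_roots_trigonometric:
  assumes c: "0 < c" and s: "0 \<le> s" and \<alpha>: "0 < \<alpha>" and D: "27 * c\<^sup>2 * s\<^sup>2 \<le> 32 * \<alpha> ^ 3"
  obtains \<theta> where "0 \<le> \<theta>" "\<theta> \<le> pi / 3"
    "cubic_root1 \<alpha> c s = of_real (\<alpha> / (3 * c) * (2 * cos \<theta> - 1))"
    "cubic_root2 \<alpha> c s = of_real (\<alpha> / (3 * c) * (2 * cos (2 * pi / 3 - \<theta>) - 1))"
    "cubic_root3 \<alpha> c s = of_real (\<alpha> / (3 * c) * (2 * cos (2 * pi / 3 + \<theta>) - 1))"
proof -
  define A where "A = - 16 * \<alpha>^3 + 27 * c\<^sup>2 * s\<^sup>2"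
  define R where "R = 16 * \<alpha> ^ 3"
  define d where "d = c * sqrt (32 * \<alpha> ^ 3 - 27 * c\<^sup>2 * s\<^sup>2)"
  define b where "b = 3 * (sqrt 3 * s) * d"
  have R: "0 < R" using \<alpha> by (simp add: R_def)
  have b: "0 \<le> b" using c s D by (simp add: b_def d_def)
  have d_eq: "csqrt (complex_of_real (- 32 * \<alpha>^3 * c\<^sup>2 + 27 * c^4 * s\<^sup>2)) = \<i> * of_real d"
    unfolding cubic_discriminant d_def using c D
    by (subst csqrt_of_real_nonpos) (auto simp: real_sqrt_mult abs_mult mult_nonneg_nonpos)
  have "b\<^sup>2 = 27 * s\<^sup>2 * (c\<^sup>2 * (32 * \<alpha> ^ 3 - 27 * c\<^sup>2 * s\<^sup>2))"
    using D by (simp add: b_def d_def power_mult_distrib)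
  then have Ab: "A\<^sup>2 + b\<^sup>2 = R\<^sup>2"
    unfolding A_def R_def by algebra
  then have "(A / R)\<^sup>2 + (b / R)\<^sup>2 = 1"
    using R by (simp add: power_divide flip: add_divide_distrib)
  then obtain \<theta>' where \<theta>': "0 \<le> \<theta>'" "\<theta>' \<le> pi" "A / R = cos \<theta>'" "b / R = sin \<theta>'"
    using sincos_total_pi[of "b / R" "A / R"] b R by auto
  define \<theta> where "\<theta> = \<theta>' / 3"
  define k where "k = (2::real) powr (4/3)"
  have k: "k ^ 3 = 16" "0 < k" by (simp_all add: k_def two_powr_third power_mult_distrib)
  have arg: "complex_of_real (- 16 * \<alpha>^3 + 27 * c\<^sup>2 * s\<^sup>2) + 3 * complex_of_real (sqrt 3 * s) * (\<i> * of_real d)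
      = of_real R * cis \<theta>'"
  proof -
    have "A = R * cos \<theta>'" "b = R * sin \<theta>'" using R \<theta>'(3,4) by (simp_all add: field_simps)
    then have "Complex A b = of_real R * cis \<theta>'" by (simp add: complex_eq_iff)
    moreover have "complex_of_real (- 16 * \<alpha>^3 + 27 * c\<^sup>2 * s\<^sup>2)
        + 3 * complex_of_real (sqrt 3 * s) * (\<i> * of_real d) = Complex A b"
      by (simp add: complex_eq_iff A_def b_def)
    ultimately show ?thesis by simp
  qed
  have "Ln (of_real R * cis \<theta>') = of_real (ln R) + \<i> * of_real \<theta>'"
    using R \<theta>'(2) less_le_trans[OF _ \<theta>'(1), of "- pi"] by (intro Ln_unique) (auto simp: exp_add cis_conv_exp exp_of_real)
  then have "cubic_psi \<alpha> c s = exp (1/3 * (of_real (ln R) + \<i> * of_real \<theta>'))"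
    using R unfolding cubic_psi_def d_eq arg by (simp add: powr_def)
  also have "\<dots> = exp (of_real (ln R / 3)) * cis \<theta>"
    by (simp add: \<theta>_def cis_conv_exp algebra_simps flip: exp_add)
  also have "exp (complex_of_real (ln R / 3)) = of_real (k * \<alpha>)"
  proof -
    have "R = (k * \<alpha>) ^ 3" by (simp add: R_def power_mult_distrib k(1))
    then have "ln R = 3 * ln (k * \<alpha>)" using k(2) \<alpha> by (simp add: ln_realpow)
    then show ?thesis using k \<alpha> by (simp add: exp_of_real)
  qed
  finally have \<psi>: "cubic_psi \<alpha> c s = of_real (k * \<alpha>) * cis \<theta>" .
  have p: "cubic_p \<alpha> c s = of_real (\<alpha> / (3 * c)) * cis \<theta>"
    using k(2) c by (simp add: cubic_p_def \<psi> k_def[symmetric])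
  have q: "cubic_q \<alpha> c s = of_real (\<alpha> / (3 * c)) * cis (- \<theta>)"
  proof -
    have "inverse (cis \<theta>) = cis (- \<theta>)" by simp
    moreover have "of_real (k * \<alpha>\<^sup>2) / (3 * of_real c * (of_real (k * \<alpha>) * z)) = of_real (\<alpha> / (3 * c)) * inverse z" for z :: complex
      using k(2) c \<alpha> by (cases "z = 0") (simp_all add: power2_eq_square field_simps)
    ultimately show ?thesis unfolding cubic_q_def \<psi> k_def[symmetric] by metis
  qed
  have om: "omega = cis (2 * pi / 3)" "cnj omega = cis (- (2 * pi / 3))"
    by (simp_all add: omega_def complex_eq_iff cos_120 sin_120)
  have m: "cis x * (of_real r * cis y) = of_real r * cis (x + y)" for x y r
    by (simp add: cis_mult[symmetric])
  have sum: "cis x + cis (- x) = of_real (2 * cos x)" for x by (simp add: complex_eq_iff)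
  show ?thesis
  proof (rule that)
    show "0 \<le> \<theta>" "\<theta> \<le> pi / 3" using \<theta>'(1,2) by (simp_all add: \<theta>_def)
    have "cubic_q \<alpha> c s + cubic_p \<alpha> c s = of_real (\<alpha> / (3 * c)) * (cis \<theta> + cis (- \<theta>))"
      by (simp only: p q distrib_left add.commute)
    then show "cubic_root1 \<alpha> c s = of_real (\<alpha> / (3 * c) * (2 * cos \<theta> - 1))"
      by (simp only: cubic_root_pq sum) (simp add: algebra_simps)
    have "omega * cubic_q \<alpha> c s + cnj omega * cubic_p \<alpha> c s
        = of_real (\<alpha> / (3 * c)) * (cis (2 * pi / 3 - \<theta>) + cis (- (2 * pi / 3 - \<theta>)))"
      unfolding om(2) unfolding p q om(1) m distrib_left by (simp only: diff_conv_add_uminus minus_add_distrib minus_minus)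
    then show "cubic_root2 \<alpha> c s = of_real (\<alpha> / (3 * c) * (2 * cos (2 * pi / 3 - \<theta>) - 1))"
      by (simp only: cubic_root_pq sum) (simp add: algebra_simps)
    have "cnj omega * cubic_q \<alpha> c s + omega * cubic_p \<alpha> c s
        = of_real (\<alpha> / (3 * c)) * (cis (2 * pi / 3 + \<theta>) + cis (- (2 * pi / 3 + \<theta>)))"
      unfolding om(2) unfolding p q om(1) m distrib_left
      by (simp only: diff_conv_add_uminus minus_add_distrib minus_minus add.commute)
    then show "cubic_root3 \<alpha> c s = of_real (\<alpha> / (3 * c) * (2 * cos (2 * pi / 3 + \<theta>) - 1))"
      by (simp only: cubic_root_pq sum) (simp add: algebra_simps)
  qed
qed

text \<open>
  If \<open>p\<close> and \<open>q\<close> are real, this is the inequality between the arithmetic and the geometric mean,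
  \<open>p + q \<ge> 2 |\<alpha>| / (3 c)\<close>; otherwise \<open>cos \<theta> \<ge> 1 / 2\<close> in the trigonometric form.
\<close>

lemma cubic_root1_real:
  assumes c: "0 < c" and s: "0 \<le> s"
  shows "cubic_root1 \<alpha> c s \<in> \<real>" "0 \<le> Re (cubic_root1 \<alpha> c s)" "- \<alpha> / c \<le> Re (cubic_root1 \<alpha> c s)"
proof -
  have "cubic_root1 \<alpha> c s \<in> \<real> \<and> 0 \<le> Re (cubic_root1 \<alpha> c s) \<and> - \<alpha> / c \<le> Re (cubic_root1 \<alpha> c s)"
  proof (cases "32 * \<alpha> ^ 3 \<le> 27 * c\<^sup>2 * s\<^sup>2")
    case True
    obtain p q where pq: "cubic_p \<alpha> c s = of_real p" "cubic_q \<alpha> c s = of_real q" "0 \<le> p" "0 \<le> q"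
        "p * q = \<alpha>\<^sup>2 / (9 * c\<^sup>2)"
      using cubic_pq_real[OF c s True] by metis
    have "(2 * \<bar>\<alpha>\<bar> / (3 * c))\<^sup>2 = 4 * (p * q)"
      using c by (simp add: pq(5) power_divide power_mult_distrib)
    also have "\<dots> \<le> (p + q)\<^sup>2" using zero_le_power2[of "p - q"] by (simp add: power2_eq_square algebra_simps)
    finally have "2 * \<bar>\<alpha>\<bar> / (3 * c) \<le> p + q"
      by (rule power2_le_imp_le) (use pq(3,4) in simp)
    then have "2 * \<bar>\<alpha>\<bar> \<le> 3 * c * (p + q)" using c by (simp add: field_simps)
    then have "\<alpha> \<le> 3 * c * (p + q)" "- 2 * \<alpha> \<le> 3 * c * (p + q)" by linarith+
    then have "0 \<le> q + p - \<alpha> / (3 * c)" "- \<alpha> / c \<le> q + p - \<alpha> / (3 * c)"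
      using c by (simp_all add: field_simps)
    then show ?thesis using Re_Im_cubic_roots(1)[OF pq(1,2)] by simp
  next
    case False
    then have less: "27 * c\<^sup>2 * s\<^sup>2 < 32 * \<alpha> ^ 3" by simp
    moreover have "0 \<le> 27 * c\<^sup>2 * s\<^sup>2" by simp
    ultimately have "0 < \<alpha> ^ 3" by linarith
    then have \<alpha>: "0 < \<alpha>" by (simp add: zero_less_power_eq)
    obtain \<theta> where \<theta>: "0 \<le> \<theta>" "\<theta> \<le> pi / 3"
      "cubic_root1 \<alpha> c s = of_real (\<alpha> / (3 * c) * (2 * cos \<theta> - 1))"
      using cubic_roots_trigonometric[OF c s \<alpha> less_imp_le[OF less]] by metis
    have "cos (pi / 3) \<le> cos \<theta>" using \<theta>(1,2) by (intro cos_monotone_0_pi_le) auto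
    then have "0 \<le> \<alpha> / (3 * c) * (2 * cos \<theta> - 1)" using \<alpha> c by (intro mult_nonneg_nonneg) (auto simp: cos_60)
    moreover have "- \<alpha> / c \<le> 0" using \<alpha> c by simp
    ultimately show ?thesis unfolding \<theta>(3) by auto
  qed
  then show "cubic_root1 \<alpha> c s \<in> \<real>" "0 \<le> Re (cubic_root1 \<alpha> c s)" "- \<alpha> / c \<le> Re (cubic_root1 \<alpha> c s)"
    by auto
qed

lemma cubic_roots23_real:
  assumes c: "0 < c" and s: "0 \<le> s" and \<alpha>: "0 < \<alpha>" and D: "27 * c\<^sup>2 * s\<^sup>2 \<le> 32 * \<alpha> ^ 3"
  shows "cubic_root2 \<alpha> c s \<in> \<real>" "- 2 * \<alpha> / (3 * c) \<le> Re (cubic_root2 \<alpha> c s)" "Re (cubic_root2 \<alpha> c s) \<le> 0"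
    "cubic_root3 \<alpha> c s \<in> \<real>" "- \<alpha> / c \<le> Re (cubic_root3 \<alpha> c s)" "Re (cubic_root3 \<alpha> c s) \<le> - 2 * \<alpha> / (3 * c)"
proof -
  obtain \<theta> where \<theta>: "0 \<le> \<theta>" "\<theta> \<le> pi / 3"
    "cubic_root2 \<alpha> c s = of_real (\<alpha> / (3 * c) * (2 * cos (2 * pi / 3 - \<theta>) - 1))"
    "cubic_root3 \<alpha> c s = of_real (\<alpha> / (3 * c) * (2 * cos (2 * pi / 3 + \<theta>) - 1))"
    using cubic_roots_trigonometric[OF c s \<alpha> D] by metis
  have k: "0 < \<alpha> / (3 * c)" using \<alpha> c by simp
  have "cos (2 * pi / 3) \<le> cos (2 * pi / 3 - \<theta>)" "cos (2 * pi / 3 - \<theta>) \<le> cos (pi / 3)"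
    "cos (2 * pi / 3 + \<theta>) \<le> cos (2 * pi / 3)"
    using \<theta>(1,2) by (intro cos_monotone_0_pi_le; simp)+
  then have bounds: "- 2 \<le> 2 * cos (2 * pi / 3 - \<theta>) - 1" "2 * cos (2 * pi / 3 - \<theta>) - 1 \<le> 0"
      "2 * cos (2 * pi / 3 + \<theta>) - 1 \<le> - 2" "- 3 \<le> 2 * cos (2 * pi / 3 + \<theta>) - 1"
    unfolding cos_60 cos_120 using cos_ge_minus_one[of "2 * pi / 3 + \<theta>"] by linarith+
  note bounds[THEN mult_left_mono[OF _ less_imp_le[OF k]]]
  then show "cubic_root2 \<alpha> c s \<in> \<real>" "- 2 * \<alpha> / (3 * c) \<le> Re (cubic_root2 \<alpha> c s)" "Re (cubic_root2 \<alpha> c s) \<le> 0"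
    "cubic_root3 \<alpha> c s \<in> \<real>" "- \<alpha> / c \<le> Re (cubic_root3 \<alpha> c s)" "Re (cubic_root3 \<alpha> c s) \<le> - 2 * \<alpha> / (3 * c)"
    unfolding \<theta>(3,4) using c by simp_all
qed

lemma cubic_roots23_realD:
  assumes c: "0 < c" and s: "0 < s"
    and real: "cubic_root2 \<alpha> c s \<in> \<real> \<or> cubic_root3 \<alpha> c s \<in> \<real>"
  shows "0 < \<alpha>" "27 * c\<^sup>2 * s\<^sup>2 \<le> 32 * \<alpha> ^ 3"
proof -
  show D: "27 * c\<^sup>2 * s\<^sup>2 \<le> 32 * \<alpha> ^ 3"
  proof (rule ccontr)
    assume "\<not> 27 * c\<^sup>2 * s\<^sup>2 \<le> 32 * \<alpha> ^ 3"
    then have D: "32 * \<alpha> ^ 3 < 27 * c\<^sup>2 * s\<^sup>2" by simp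
    obtain p q where pq: "cubic_p \<alpha> c s = of_real p" "cubic_q \<alpha> c s = of_real q"
        "p = q \<Longrightarrow> s = 0 \<or> 27 * c\<^sup>2 * s\<^sup>2 = 32 * \<alpha> ^ 3"
      using cubic_pq_real[OF c less_imp_le[OF s] less_imp_le[OF D]] by metis
    have "p = q" using real Re_Im_cubic_roots(2,3)[OF pq(1,2)] by (auto simp: complex_is_Real_iff)
    then show False using pq(3) s D by simp
  qed
  have "0 < 27 * c\<^sup>2 * s\<^sup>2" using c s by simp
  then have "0 < \<alpha> ^ 3" using D by linarith
  then show "0 < \<alpha>" by (simp add: zero_less_power_eq)
qed

section \<open>Line integrals\<close>

lemma integral_over_join:
  fixes F :: "'a::euclidean_space \<Rightarrow> 'a"
  assumes i1: "((\<lambda>s. F (\<gamma>1 s) \<bullet> vector_derivative \<gamma>1 (at s within {0..1})) has_integral a) {0..1}"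
    and i2: "((\<lambda>s. F (\<gamma>2 s) \<bullet> vector_derivative \<gamma>2 (at s within {0..1})) has_integral b) {0..1}"
    and valid: "valid_path \<gamma>1" "valid_path \<gamma>2"
  shows "((\<lambda>s. F ((\<gamma>1 +++ \<gamma>2) s) \<bullet> vector_derivative (\<gamma>1 +++ \<gamma>2) (at s within {0..1})) has_integral (a + b)) {0..1}"
proof -
  have within: "vector_derivative g (at s within {0..1}) = vector_derivative g (at s)"
    if "0 < s" "s < 1" for g :: "real \<Rightarrow> 'a" and s
    by (simp add: at_within_Icc_at that)
  obtain S1 where S1: "finite S1" "\<And>x. x \<in> {0..1} - S1 \<Longrightarrow> \<gamma>1 differentiable at x"
    using valid(1) unfolding valid_path_def piecewise_C1_differentiable_on_def C1_differentiable_on_eq by metis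
  obtain S2 where S2: "finite S2" "\<And>x. x \<in> {0..1} - S2 \<Longrightarrow> \<gamma>2 differentiable at x"
    using valid(2) unfolding valid_path_def piecewise_C1_differentiable_on_def C1_differentiable_on_eq by metis
  let ?f = "\<lambda>s. F ((\<gamma>1 +++ \<gamma>2) s) \<bullet> vector_derivative (\<gamma>1 +++ \<gamma>2) (at s within {0..1})"
  have j1: "((\<lambda>s. 2 *\<^sub>R (F (\<gamma>1 (2 * s)) \<bullet> vector_derivative \<gamma>1 (at (2 * s) within {0..1}))) has_integral a) {0..1/2}"
    using has_integral_affinity01[OF i1, where m = 2 and c = 0, THEN has_integral_cmul[where c = 2]]
    by (simp_all only: image_affinity_atLeastAtMost_div_diff) simp
  have j2: "((\<lambda>s. 2 *\<^sub>R (F (\<gamma>2 (2 * s - 1)) \<bullet> vector_derivative \<gamma>2 (at (2 * s - 1) within {0..1}))) has_integral b) {1/2..1}"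
    using has_integral_affinity01[OF i2, where m = 2 and c = "-1", THEN has_integral_cmul[where c = 2]]
    by (simp_all only: image_affinity_atLeastAtMost_div_diff) simp
  have d1: "vector_derivative (\<gamma>1 +++ \<gamma>2) (at s within {0..1}) = 2 *\<^sub>R vector_derivative \<gamma>1 (at (2 * s) within {0..1})"
    if s: "0 < s" "s < 1/2" "2 * s \<notin> S1" for s
  proof -
    have "(\<gamma>1 has_vector_derivative vector_derivative \<gamma>1 (at (2 * s))) (at (2 * s))"
      using S1(2)[of "2 * s"] s by (simp add: vector_derivative_works)
    moreover have "((*) 2 has_vector_derivative 2) (at s)"
      by (simp add: has_vector_derivative_def has_derivative_def bounded_linear_mult_left)
    ultimately have "((\<lambda>s. \<gamma>1 (2 * s)) has_vector_derivative 2 *\<^sub>R vector_derivative \<gamma>1 (at (2 * s))) (at s)"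
      by (intro vector_diff_chain_at[simplified o_def])
    then have "((\<gamma>1 +++ \<gamma>2) has_vector_derivative 2 *\<^sub>R vector_derivative \<gamma>1 (at (2 * s))) (at s)"
      by (rule has_vector_derivative_transform_within_open[where S = "{..<1/2}"])
         (use s in \<open>auto simp: joinpaths_def\<close>)
    then show ?thesis using s by (simp add: within vector_derivative_at)
  qed
  have d2: "vector_derivative (\<gamma>1 +++ \<gamma>2) (at s within {0..1}) = 2 *\<^sub>R vector_derivative \<gamma>2 (at (2 * s - 1) within {0..1})"
    if s: "1/2 < s" "s < 1" "2 * s - 1 \<notin> S2" for s
  proof -
    have "(\<gamma>2 has_vector_derivative vector_derivative \<gamma>2 (at (2 * s - 1))) (at (2 * s - 1))"
      using S2(2)[of "2 * s - 1"] s by (simp add: vector_derivative_works)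
    moreover have "((\<lambda>s. 2 * s - 1) has_vector_derivative 2) (at s)"
      by (simp add: has_vector_derivative_def has_derivative_def bounded_linear_mult_left)
    ultimately have "((\<lambda>s. \<gamma>2 (2 * s - 1)) has_vector_derivative 2 *\<^sub>R vector_derivative \<gamma>2 (at (2 * s - 1))) (at s)"
      by (intro vector_diff_chain_at[simplified o_def])
    then have "((\<gamma>1 +++ \<gamma>2) has_vector_derivative 2 *\<^sub>R vector_derivative \<gamma>2 (at (2 * s - 1))) (at s)"
      by (rule has_vector_derivative_transform_within_open[where S = "{1/2<..}"])
         (use s in \<open>auto simp: joinpaths_def\<close>)
    then show ?thesis using s by (simp add: within vector_derivative_at)
  qed
  have "(?f has_integral a) {0..1/2}"
  proof (rule has_integral_spike_finite[OF _ _ j1])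
    show "finite ({0, 1/2} \<union> (*) 2 -` S1)"
      using S1(1) by (intro finite_UnI finite_vimageI) (auto intro: inj_onI)
    fix s :: real assume "s \<in> {0..1/2} - ({0, 1/2} \<union> (*) 2 -` S1)"
    then have "0 < s" "s < 1/2" "2 * s \<notin> S1" by auto
    then show "?f s = 2 *\<^sub>R (F (\<gamma>1 (2 * s)) \<bullet> vector_derivative \<gamma>1 (at (2 * s) within {0..1}))"
      by (simp add: d1) (simp add: joinpaths_def)
  qed
  moreover have "(?f has_integral b) {1/2..1}"
  proof (rule has_integral_spike_finite[OF _ _ j2])
    show "finite ({1, 1/2} \<union> (\<lambda>s. 2 * s - 1) -` S2)"
      using S2(1) by (intro finite_UnI finite_vimageI) (auto intro: inj_onI)
    fix s :: real assume "s \<in> {1/2..1} - ({1, 1/2} \<union> (\<lambda>s. 2 * s - 1) -` S2)"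
    then have "1/2 < s" "s < 1" "2 * s - 1 \<notin> S2" by auto
    then show "?f s = 2 *\<^sub>R (F (\<gamma>2 (2 * s - 1)) \<bullet> vector_derivative \<gamma>2 (at (2 * s - 1) within {0..1}))"
      by (simp add: d2) (simp add: joinpaths_def)
  qed
  ultimately show ?thesis by (rule has_integral_combine[of 0 "1/2" 1, rotated 2]) auto
qed

text \<open>
  Any path to \<open>x\<close> can be prolonged by the segment from \<open>x\<close> to \<open>y\<close>, so \<open>u y - u x\<close> is the
  integral of \<open>F\<close> along that segment.
\<close>

lemma line_integral_has_derivative:
  fixes F :: "'a::euclidean_space \<Rightarrow> 'a"
  assumes \<Omega>: "open \<Omega>" and u: "line_integral_from \<Omega> x0 F u" and F: "continuous_on \<Omega> F" and x: "x \<in> \<Omega>"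
  shows "(u has_derivative (\<lambda>h. F x \<bullet> h)) (at x)"
  unfolding has_derivative_at_alt
proof (intro conjI allI impI bounded_linear_inner_right)
  fix e :: real assume e: "0 < e"
  obtain \<gamma> where \<gamma>: "path_in \<Omega> x0 x \<gamma>" using u x by (auto simp: line_integral_from_def)
  have "continuous (at x) F" using F \<Omega> x by (simp add: continuous_on_eq_continuous_at)
  then obtain d1 where d1: "0 < d1" "\<And>y. dist y x < d1 \<Longrightarrow> dist (F y) (F x) < e"
    using e unfolding continuous_at_eps_delta by blast
  obtain d2 where d2: "0 < d2" "ball x d2 \<subseteq> \<Omega>" using \<Omega> x open_contains_ball by blast
  show "\<exists>d>0. \<forall>y. norm (y - x) < d \<longrightarrow> norm (u y - u x - F x \<bullet> (y - x)) \<le> e * norm (y - x)"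
  proof (intro exI[of _ "min d1 d2"] conjI allI impI)
    fix y assume y: "norm (y - x) < min d1 d2"
    have seg: "dist (linepath x y s) x < min d1 d2" if "s \<in> {0..1}" for s
    proof -
      have "linepath x y s - x = s *\<^sub>R (y - x)" by (simp add: linepath_def algebra_simps)
      then have "dist (linepath x y s) x = \<bar>s\<bar> * norm (y - x)" by (simp add: dist_norm)
      also have "\<dots> \<le> 1 * norm (y - x)" using that by (intro mult_right_mono) auto
      finally show ?thesis using y by simp
    qed
    then have in\<Omega>: "linepath x y s \<in> \<Omega>" if "s \<in> {0..1}" for s
      using that d2(2) by (force simp: dist_commute)
    have y\<Omega>: "y \<in> \<Omega>" using in\<Omega>[of 1] by (simp add: linepath_def)
    have Fc: "continuous_on {0..1} (\<lambda>s. F (linepath x y s))"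
      by (rule continuous_on_compose2[OF F]) (auto intro: in\<Omega> continuous_intros)
    define I where "I = integral {0..1} (\<lambda>s. F (linepath x y s) \<bullet> (y - x))"
    have I: "((\<lambda>s. F (linepath x y s) \<bullet> (y - x)) has_integral I) {0..1}"
      unfolding I_def by (intro integrable_integral integrable_continuous_real continuous_intros Fc)
    have "path_in \<Omega> x0 y (\<gamma> +++ linepath x y)"
      unfolding path_in_def
    proof (intro conjI)
      show "valid_path (\<gamma> +++ linepath x y)" using \<gamma> by (intro valid_path_join) (auto simp: path_in_def)
      show "(\<gamma> +++ linepath x y) ` {0<..<1} \<subseteq> \<Omega>"
      proof safe
        fix s :: real assume s: "s \<in> {0<..<1}"
        show "(\<gamma> +++ linepath x y) s \<in> \<Omega>"
        proof (cases "s < 1/2")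
          case True
          then have "2 * s \<in> {0<..<1}" using s by auto
          then show ?thesis using \<gamma> True by (auto simp: path_in_def joinpaths_def)
        next
          case False
          have "(\<gamma> +++ linepath x y) s = linepath x y (2 * s - 1)"
          proof (cases "s = 1/2")
            case True
            show ?thesis using \<gamma> unfolding True by (simp add: path_in_def joinpaths_def pathfinish_def linepath_def)
          qed (use False in \<open>simp add: joinpaths_def\<close>)
          then show ?thesis using in\<Omega>[of "2 * s - 1"] s False by auto
        qed
      qed
    qed (use \<gamma> in \<open>auto simp: path_in_def\<close>)
    then have "((\<lambda>s. F ((\<gamma> +++ linepath x y) s) \<bullet> vector_derivative (\<gamma> +++ linepath x y) (at s within {0..1})) has_integral u y) {0..1}"
      using u y\<Omega> closure_subset[of \<Omega>] unfolding line_integral_from_def by blast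
    moreover have "((\<lambda>s. F ((\<gamma> +++ linepath x y) s) \<bullet> vector_derivative (\<gamma> +++ linepath x y) (at s within {0..1})) has_integral (u x + I)) {0..1}"
    proof (rule integral_over_join)
      show "((\<lambda>s. F (\<gamma> s) \<bullet> vector_derivative \<gamma> (at s within {0..1})) has_integral u x) {0..1}"
        using u x \<gamma> closure_subset[of \<Omega>] unfolding line_integral_from_def by blast
      show "((\<lambda>s. F (linepath x y s) \<bullet> vector_derivative (linepath x y) (at s within {0..1})) has_integral I) {0..1}"
        using I by (rule has_integral_eq[rotated]) (simp add: vector_derivative_linepath_within)
    qed (use \<gamma> in \<open>auto simp: path_in_def\<close>)
    ultimately have "u y = u x + I" by (rule has_integral_unique)
    then have "u y - u x - F x \<bullet> (y - x) = I - F x \<bullet> (y - x)" by simp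
    also have "\<dots> = integral {0..1} (\<lambda>s. F (linepath x y s) \<bullet> (y - x) - F x \<bullet> (y - x))"
      by (subst Henstock_Kurzweil_Integration.integral_diff[OF has_integral_integrable[OF I]]) (simp_all add: I_def integrable_const_ivl)
    also have "norm \<dots> \<le> (e * norm (y - x)) * (1 - 0)"
    proof (rule integral_bound)
      show "continuous_on {0..1} (\<lambda>s. F (linepath x y s) \<bullet> (y - x) - F x \<bullet> (y - x))"
        by (intro continuous_intros Fc)
      fix s :: real assume s: "s \<in> {0..1}"
      have "norm (F (linepath x y s) \<bullet> (y - x) - F x \<bullet> (y - x)) \<le> norm (F (linepath x y s) - F x) * norm (y - x)"
        using Cauchy_Schwarz_ineq2[of "F (linepath x y s) - F x" "y - x"] by (simp add: inner_diff_left)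
      also have "\<dots> \<le> e * norm (y - x)"
        using d1(2)[of "linepath x y s"] seg[OF s] by (intro mult_right_mono) (auto simp: dist_norm)
      finally show "norm (F (linepath x y s) \<bullet> (y - x) - F x \<bullet> (y - x)) \<le> e * norm (y - x)" .
    qed simp
    finally show "norm (u y - u x - F x \<bullet> (y - x)) \<le> e * norm (y - x)" by simp
  qed (use d1 d2 in auto)
qed

text \<open>
  For a test function \<open>\<phi>\<close> the product \<open>u \<phi>\<close>, extended by zero, is \<open>C\<^sup>1\<close> on the whole space and
  vanishes on the boundary. The divergence theorem for the field \<open>(u \<phi>) h\<close> is the required
  identity.
\<close>

lemma has_weak_gradient_if_has_derivative:
  fixes F :: "'a::euclidean_space \<Rightarrow> 'a"
  assumes nice: "nice_region \<Omega> N" and F: "continuous_on \<Omega> F"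
    and u: "\<And>x. x \<in> \<Omega> \<Longrightarrow> (u has_derivative (\<lambda>h. F x \<bullet> h)) (at x)"
  shows "has_weak_gradient \<Omega> u F"
  unfolding has_weak_gradient_def
proof (intro conjI allI impI)
  note \<Omega> = nice_regionD[OF nice]
  show "F \<in> borel_measurable (lebesgue_on \<Omega>)"
    by (rule continuous_imp_measurable_on_sets_lebesgue[OF F \<Omega>(5)])
  show "integrable (lebesgue_on K) F" if "compact K \<and> K \<subseteq> \<Omega>" for K
    using that by (intro continuous_on_imp_integrable_compact continuous_on_subset[OF F]) auto
  fix \<phi> h assume \<phi>: "test_function \<Omega> \<phi>"
  obtain K where K: "compact K" "K \<subseteq> \<Omega>" "\<And>x. x \<notin> K \<Longrightarrow> \<phi> x = 0" and C1: "C1_map \<phi>"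
    using \<phi> by (auto simp: test_function_def)
  have uc: "continuous_on \<Omega> u"
    by (intro continuous_at_imp_continuous_on ballI has_derivative_continuous[OF u])
  let ?D = "\<lambda>x k. u x * frechet_derivative \<phi> (at x) k + (F x \<bullet> k) * \<phi> x"
  have d: "((\<lambda>x. u x * \<phi> x) has_derivative ?D x) (at x)" if "x \<in> \<Omega>" for x
    by (rule has_derivative_mult[OF u[OF that] C1_map_has_derivative[OF C1]])
  have C1u: "C1_map (\<lambda>x. u x * \<phi> x)"
  proof (rule C1_map_zero_extension[OF \<Omega>(1) compact_imp_closed[OF K(1)] K(2) _ d])
    show "continuous_on \<Omega> (\<lambda>x. ?D x k)" for k
      by (intro continuous_intros uc F continuous_on_subset[OF C1_map_continuous_derivative[OF C1] subset_UNIV]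
          C1_map_continuous_on[OF C1])
  qed (use K(3) in auto)
  have "0 = (LINT x:frontier \<Omega>|surface_measure. ((u x * \<phi> x) *\<^sub>R h) \<bullet> N x)"
  proof -
    have "\<phi> x = 0" if "x \<in> frontier \<Omega>" for x using K(2,3) \<Omega>(9) that by blast
    then have "(\<lambda>x. indicator (frontier \<Omega>) x *\<^sub>R (((u x * \<phi> x) *\<^sub>R h) \<bullet> N x)) = (\<lambda>x. 0)"
      by (auto simp: indicator_def fun_eq_iff)
    then show ?thesis by (simp add: set_lebesgue_integral_def)
  qed
  also have "\<dots> = (LINT x|lebesgue_on \<Omega>. divergence (\<lambda>x. (u x * \<phi> x) *\<^sub>R h) x)"
    by (rule nice_region_divergence_theorem[OF nice, symmetric]) (intro C1_map_scaleR C1u C1_map_const)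
  also have "\<dots> = (LINT x|lebesgue_on \<Omega>. ?D x h)"
  proof (intro Bochner_Integration.integral_cong refl)
    fix x assume "x \<in> space (lebesgue_on \<Omega>)"
    then have x: "x \<in> \<Omega>" by simp
    have "divergence (\<lambda>x. (u x * \<phi> x) *\<^sub>R h) x = frechet_derivative (\<lambda>x. u x * \<phi> x) (at x) h"
      using C1u by (subst divergence_scaleR) (auto simp: C1_map_def divergence_def)
    then show "divergence (\<lambda>x. (u x * \<phi> x) *\<^sub>R h) x = ?D x h"
      using frechet_derivative_at[OF d[OF x]] by metis
  qed
  also have "\<dots> = (LINT x|lebesgue_on \<Omega>. u x * frechet_derivative \<phi> (at x) h) + (LINT x|lebesgue_on \<Omega>. (F x \<bullet> h) * \<phi> x)"
  proof (rule Bochner_Integration.integral_add)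
    show "integrable (lebesgue_on \<Omega>) (\<lambda>x. u x * frechet_derivative \<phi> (at x) h)"
      by (rule test_function_derivative_integrable[OF \<Omega>(1) uc \<phi>])
    have "integrable (lebesgue_on \<Omega>) (\<lambda>x. \<phi> x *\<^sub>R (F x \<bullet> h))"
      by (rule integrable_mult_compact_support[OF \<Omega>(5) K(1,2) _ C1_map_continuous_on[OF C1] K(3)])
         (intro continuous_on_imp_integrable_compact K(1) continuous_intros continuous_on_subset[OF F K(2)])
    then show "integrable (lebesgue_on \<Omega>) (\<lambda>x. (F x \<bullet> h) * \<phi> x)" by (simp add: mult.commute)
  qed
  finally show "(LINT x|lebesgue_on \<Omega>. u x * frechet_derivative \<phi> (at x) h) = - (LINT x|lebesgue_on \<Omega>. (F x \<bullet> h) * \<phi> x)"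
    by simp
qed

section \<open>The dual density\<close>

definition dual_density :: "real \<Rightarrow> real \<Rightarrow> real \<Rightarrow> real \<Rightarrow> real" where
  "dual_density \<alpha> c T z = T / (4 * z) + 1/2 * c * z\<^sup>2 + \<alpha> * z"

abbreviation (input) dual_root :: "real \<Rightarrow> real \<Rightarrow> real \<Rightarrow> real \<Rightarrow> bool" where
  "dual_root \<alpha> c T r \<equiv> 4 * r\<^sup>2 * (c * r + \<alpha>) = T"

lemma dual_root_slope: "dual_root \<alpha> c T r \<Longrightarrow> T / (4 * r) = c * r\<^sup>2 + \<alpha> * r"
  by (cases "r = 0") (auto simp: field_simps power2_eq_square)

text \<open>
  For \<open>r \<noteq> 0\<close> the dual algebraic equation says that the derivative of the density vanishes at
  \<open>r\<close>, so the difference has a double zero at \<open>z = r\<close>.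
\<close>

lemma dual_density_diff:
  assumes "dual_root \<alpha> c T r" "z \<noteq> 0"
  shows "dual_density \<alpha> c T z - dual_density \<alpha> c T r = (z - r)\<^sup>2 * (2 * \<alpha> + 2 * c * r + c * z) / (2 * z)"
  unfolding dual_density_def dual_root_slope[OF assms(1)] unfolding assms(1)[symmetric]
  using assms(2) by (simp add: field_simps power2_eq_square)

text \<open>
  On this range \<open>c r + \<alpha>\<close> and \<open>z\<close> are nonnegative, so the quotient in \<open>dual_density_diff\<close> is
  too. The point \<open>z = 0\<close> is possible only for \<open>T = 0\<close>; the density there is \<open>0\<close>, by \<open>0 / 0 = 0\<close>.
\<close>

lemma dual_density_min_positive:
  assumes "0 < c" and r: "dual_root \<alpha> c T r" "0 \<le> r" "- \<alpha> / c \<le> r"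
    and z: "0 \<le> z" "z = 0 \<Longrightarrow> T = 0"
  shows "dual_density \<alpha> c T r \<le> dual_density \<alpha> c T z"
proof (cases "z = 0")
  case True
  then have "r = 0 \<or> c * r = - \<alpha>" using r(1) z(2) by (auto simp: add_eq_0_iff)
  then show ?thesis
  proof
    assume "c * r = - \<alpha>"
    have "c * r\<^sup>2 + 2 * \<alpha> * r = (c * r + \<alpha>) * r + \<alpha> * r" by (simp add: power2_eq_square algebra_simps)
    also have "\<dots> = - (c * r) * r" using \<open>c * r = - \<alpha>\<close> by simp
    also have "\<dots> \<le> 0" using assms(1) r(2) by (simp add: mult_nonneg_nonneg)
    finally show ?thesis using True z(2) by (simp add: dual_density_def)
  qed (use True z(2) in \<open>simp add: dual_density_def\<close>)
next
  case False
  have "0 \<le> \<alpha> + c * r" using r(3) assms(1) by (simp add: field_simps)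
  then have "0 \<le> (z - r)\<^sup>2 * (2 * \<alpha> + 2 * c * r + c * z) / (2 * z)"
    using z(1) assms(1) by (intro divide_nonneg_nonneg mult_nonneg_nonneg) (auto intro!: add_nonneg_nonneg)
  then show ?thesis using dual_density_diff[OF r(1) False] by linarith
qed

text \<open>
  Both \<open>c r\<close> and \<open>c z\<close> are at most \<open>- 2 \<alpha> / 3\<close>, so \<open>2 \<alpha> + 2 c r + c z\<close> and \<open>2 z\<close> are both
  nonpositive.
\<close>

lemma dual_density_min_negative:
  assumes "0 < c" "0 < \<alpha>" and r: "dual_root \<alpha> c T r" "r \<le> - 2 * \<alpha> / (3 * c)"
    and z: "z \<le> - 2 * \<alpha> / (3 * c)"
  shows "dual_density \<alpha> c T r \<le> dual_density \<alpha> c T z"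
proof -
  have neg: "z < 0" using z assms(1,2) by (meson divide_neg_pos le_less_trans mult_neg_pos mult_pos_pos neg_less_0_iff_less zero_less_numeral)
  have "c * r \<le> - 2 * \<alpha> / 3" "c * z \<le> - 2 * \<alpha> / 3" using r(2) z assms(1) by (simp_all add: field_simps)
  then have "2 * \<alpha> + 2 * c * r + c * z \<le> 0" by linarith
  then have "0 \<le> (z - r)\<^sup>2 * (2 * \<alpha> + 2 * c * r + c * z) / (2 * z)"
    using neg by (intro divide_nonpos_neg mult_nonneg_nonpos) auto
  then show ?thesis using dual_density_diff[OF r(1), of z] neg by linarith
qed

text \<open>Now \<open>2 \<alpha> + 2 c r + c z\<close> is nonnegative while \<open>2 z\<close> is negative.\<close>

lemma dual_density_max_negative:
  assumes "0 < c" and r: "dual_root \<alpha> c T r" "- 2 * \<alpha> / (3 * c) \<le> r"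
    and z: "- 2 * \<alpha> / (3 * c) \<le> z" "z < 0"
  shows "dual_density \<alpha> c T z \<le> dual_density \<alpha> c T r"
proof -
  have "- 2 * \<alpha> / 3 \<le> c * r" "- 2 * \<alpha> / 3 \<le> c * z" using r(2) z assms(1) by (simp_all add: field_simps)
  then have "0 \<le> 2 * \<alpha> + 2 * c * r + c * z" by linarith
  then have "(z - r)\<^sup>2 * (2 * \<alpha> + 2 * c * r + c * z) / (2 * z) \<le> 0"
    using z(2) by (intro divide_nonneg_neg mult_nonneg_nonneg) auto
  then show ?thesis using dual_density_diff[OF r(1), of z] z(2) by linarith
qed

lemma has_derivative_if_quadratic_remainder:
  fixes f :: "real \<Rightarrow> real"
  assumes "\<And>s. \<bar>s\<bar> \<le> 1/2 \<Longrightarrow> \<bar>f s - f 0 - s * d\<bar> \<le> s\<^sup>2 * C"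
  shows "(f has_real_derivative d) (at 0)"
  unfolding DERIV_def
proof (rule LIM_zero_cancel)
  show "((\<lambda>h. (f (0 + h) - f 0) / h - d) \<longlongrightarrow> 0) (at 0)"
  proof (rule Lim_null_comparison)
    have "\<forall>\<^sub>F h in at (0::real). \<bar>h\<bar> \<le> 1/2 \<and> h \<noteq> 0"
      unfolding eventually_at by (intro exI[of _ "1/2"]) auto
    then show "\<forall>\<^sub>F h in at 0. norm ((f (0 + h) - f 0) / h - d) \<le> \<bar>h\<bar> * C"
    proof eventually_elim
      case (elim h)
      then have "(f (0 + h) - f 0) / h - d = (f h - f 0 - h * d) / h" by (simp add: field_simps)
      then have "norm ((f (0 + h) - f 0) / h - d) = \<bar>f h - f 0 - h * d\<bar> / \<bar>h\<bar>" by (simp add: abs_divide)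
      also have "\<dots> \<le> (h\<^sup>2 * C) / \<bar>h\<bar>" using assms[of h] elim by (intro divide_right_mono) auto
      also have "\<dots> = \<bar>h\<bar> * C"
      proof -
        have "h\<^sup>2 * C = \<bar>h\<bar> * (\<bar>h\<bar> * C)" by (simp add: power2_eq_square flip: mult.assoc)
        then show ?thesis using elim by (simp only:) simp
      qed
      finally show ?case .
    qed
    show "((\<lambda>h. \<bar>h\<bar> * C) \<longlongrightarrow> 0) (at (0::real))" by (rule tendsto_eq_intros refl | simp)+
  qed
qed

text \<open>
  In terms of the relative variation \<open>\<kappa> = v / z\<close>, of modulus at most \<open>1\<close>, the singular term
  becomes \<open>T / (4 z)\<close> divided by \<open>1 + s \<kappa> \<ge> 1 / 2\<close>. This makes the remainder integrable whenever
  the density is.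
\<close>

lemma dual_density_expansion:
  assumes v: "\<bar>v\<bar> \<le> \<bar>z\<bar>" and s: "\<bar>s\<bar> \<le> 1/2"
  shows "\<bar>dual_density \<alpha> c T (z + s * v) - dual_density \<alpha> c T z - s * ((c * z\<^sup>2 + \<alpha> * z - T / (4 * z)) * (v / z))\<bar>
    \<le> s\<^sup>2 * (2 * \<bar>T / (4 * z)\<bar> + \<bar>c\<bar> * z\<^sup>2)"
proof (cases "z = 0")
  case True then show ?thesis using v by (simp add: dual_density_def)
next
  case False
  define \<kappa> where "\<kappa> = v / z"
  have v_eq: "v = z * \<kappa>" using False by (simp add: \<kappa>_def)
  have \<kappa>: "\<bar>\<kappa>\<bar> \<le> 1" using v False by (simp add: \<kappa>_def abs_divide)
  have "\<bar>s * \<kappa>\<bar> \<le> 1/2 * 1" unfolding abs_mult using s \<kappa> by (intro mult_mono) auto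
  then have half: "1/2 \<le> 1 + s * \<kappa>" by (simp add: abs_le_iff)
  have ne: "1 + s * \<kappa> \<noteq> 0" using half by linarith
  have "dual_density \<alpha> c T (z + s * v) - dual_density \<alpha> c T z - s * ((c * z\<^sup>2 + \<alpha> * z - T / (4 * z)) * (v / z))
      = s\<^sup>2 * (T / (4 * z) * (\<kappa>\<^sup>2 / (1 + s * \<kappa>)) + 1/2 * c * z\<^sup>2 * \<kappa>\<^sup>2)"
  proof -
    define A B where "A = T / (4 * z)" and "B = \<kappa>\<^sup>2 / (1 + s * \<kappa>)"
    have e1: "z + s * v = z * (1 + s * \<kappa>)" by (simp add: v_eq algebra_simps)
    have e2: "v / z = \<kappa>" by (simp add: \<kappa>_def)
    have e3: "T / (4 * (z * (1 + s * \<kappa>))) = T / (4 * z) * (1 - s * \<kappa> + s\<^sup>2 * (\<kappa>\<^sup>2 / (1 + s * \<kappa>)))"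
      using False ne by (simp add: field_simps power2_eq_square)
    show ?thesis
      unfolding dual_density_def e1 e2 e3 unfolding A_def[symmetric] B_def[symmetric] by algebra
  qed
  moreover have "\<bar>T / (4 * z) * (\<kappa>\<^sup>2 / (1 + s * \<kappa>)) + 1/2 * c * z\<^sup>2 * \<kappa>\<^sup>2\<bar> \<le> 2 * \<bar>T / (4 * z)\<bar> + \<bar>c\<bar> * z\<^sup>2"
  proof -
    have \<kappa>2: "0 \<le> \<kappa>\<^sup>2" "\<kappa>\<^sup>2 \<le> 1" using \<kappa> by (auto simp: abs_square_le_1)
    have "0 \<le> \<kappa>\<^sup>2 / (1 + s * \<kappa>)" "\<kappa>\<^sup>2 / (1 + s * \<kappa>) \<le> 2"
      using half \<kappa>2 by (auto simp: divide_le_eq)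
    then have "\<bar>\<kappa>\<^sup>2 / (1 + s * \<kappa>)\<bar> \<le> 2" by (simp only: abs_of_nonneg)
    then have "\<bar>T / (4 * z) * (\<kappa>\<^sup>2 / (1 + s * \<kappa>))\<bar> \<le> \<bar>T / (4 * z)\<bar> * 2"
      unfolding abs_mult[of "T / (4 * z)"] by (rule mult_left_mono) simp
    moreover have "\<bar>1/2 * c * z\<^sup>2 * \<kappa>\<^sup>2\<bar> \<le> (\<bar>c\<bar> * z\<^sup>2) * 1"
    proof -
      have "\<bar>1/2 * c * z\<^sup>2 * \<kappa>\<^sup>2\<bar> = (1/2 * (\<bar>c\<bar> * z\<^sup>2)) * \<kappa>\<^sup>2" by (simp add: abs_mult)
      also have "\<dots> \<le> (\<bar>c\<bar> * z\<^sup>2) * 1"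
      proof (rule mult_mono)
        have X: "0 \<le> \<bar>c\<bar> * z\<^sup>2" by simp
        show "1/2 * (\<bar>c\<bar> * z\<^sup>2) \<le> \<bar>c\<bar> * z\<^sup>2" using X by linarith
      qed (use \<kappa>2 in auto)
      finally show ?thesis .
    qed
    ultimately show ?thesis
      using abs_triangle_ineq[of "T / (4 * z) * (\<kappa>\<^sup>2 / (1 + s * \<kappa>))" "1/2 * c * z\<^sup>2 * \<kappa>\<^sup>2"] by linarith
  qed
  ultimately show ?thesis by (simp add: abs_mult mult_left_mono)
qed

section \<open>The dual functional\<close>

lemma integrable_if_square_integrable:
  fixes \<zeta> :: "'a \<Rightarrow> real"
  assumes "finite_measure M" "\<zeta> \<in> borel_measurable M" "integrable M (\<lambda>x. (\<zeta> x)\<^sup>2)"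
  shows "integrable M \<zeta>"
proof -
  interpret finite_measure M by (rule assms(1))
  show ?thesis
  proof (rule Bochner_Integration.integrable_bound)
    show "integrable M (\<lambda>x. 1 + (\<zeta> x)\<^sup>2)" using assms(3) by simp
    have "\<bar>a\<bar> \<le> 1 + a\<^sup>2" for a :: real
      using zero_le_power2[of "\<bar>a\<bar> - 1"] by (simp add: power2_diff)
    then show "AE x in M. norm (\<zeta> x) \<le> norm (1 + (\<zeta> x)\<^sup>2)" by simp
  qed (use assms in auto)
qed

locale shear_field =
  fixes \<Omega> :: "'a::euclidean_space set" and N \<tau> :: "'a \<Rightarrow> 'a" and \<alpha> c \<beta>o :: real
  assumes nice: "nice_region \<Omega> N" and \<tau>c: "continuous_on (closure \<Omega>) \<tau>" and c: "0 < c"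
begin

interpretation finite_measure "lebesgue_on \<Omega>" by (rule nice_regionD(11)[OF nice])

abbreviation (input) "T x \<equiv> (norm (\<tau> x))\<^sup>2"

lemma \<tau>_measurable: "\<tau> \<in> borel_measurable (lebesgue_on \<Omega>)"
  using nice_regionD(5,8)[OF nice]
  by (intro continuous_imp_measurable_on_sets_lebesgue continuous_on_subset[OF \<tau>c]) auto

lemma \<tau>_bounded: obtains B where "0 \<le> B" "\<And>x. x \<in> closure \<Omega> \<Longrightarrow> norm (\<tau> x) \<le> B"
proof -
  have "bounded (\<tau> ` closure \<Omega>)"
    by (intro compact_imp_bounded compact_continuous_image \<tau>c nice_regionD(7)[OF nice])
  then obtain B where "0 < B" "\<forall>y\<in>\<tau> ` closure \<Omega>. norm y \<le> B" by (auto simp: bounded_pos)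
  then show ?thesis using that[of B] by auto
qed

lemma dual_domainD:
  assumes "\<zeta> \<in> dual_domain \<Omega> \<tau>"
  shows "\<zeta> \<in> borel_measurable (lebesgue_on \<Omega>)" "integrable (lebesgue_on \<Omega>) (\<lambda>x. (\<zeta> x)\<^sup>2)"
    "integrable (lebesgue_on \<Omega>) \<zeta>" "AE x in lebesgue_on \<Omega>. \<zeta> x = 0 \<longrightarrow> \<tau> x = 0"
    "integrable (lebesgue_on \<Omega>) (\<lambda>x. T x / (4 * \<zeta> x))"
    "integrable (lebesgue_on \<Omega>) (\<lambda>x. dual_density \<alpha> c (T x) (\<zeta> x))"
proof -
  show m: "\<zeta> \<in> borel_measurable (lebesgue_on \<Omega>)" and sq: "integrable (lebesgue_on \<Omega>) (\<lambda>x. (\<zeta> x)\<^sup>2)"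
    and "AE x in lebesgue_on \<Omega>. \<zeta> x = 0 \<longrightarrow> \<tau> x = 0"
    using assms by (auto simp: dual_domain_def L2_fun_def quotient_integrable_def)
  show i: "integrable (lebesgue_on \<Omega>) \<zeta>"
    by (rule integrable_if_square_integrable[OF finite_measure_axioms m sq])
  have "integrable (lebesgue_on \<Omega>) (\<lambda>x. T x / \<zeta> x * (1/4))"
    using assms by (intro integrable_mult_left) (auto simp: dual_domain_def quotient_integrable_def)
  then show q: "integrable (lebesgue_on \<Omega>) (\<lambda>x. T x / (4 * \<zeta> x))" by (simp add: mult.commute)
  show "integrable (lebesgue_on \<Omega>) (\<lambda>x. dual_density \<alpha> c (T x) (\<zeta> x))"
    unfolding dual_density_def
    by (intro Bochner_Integration.integrable_add q integrable_mult_right sq i)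
qed

lemma dual_functional_eq:
  assumes "\<zeta> \<in> dual_domain \<Omega> \<tau>"
  shows "dual_functional \<Omega> \<tau> \<alpha> c \<beta>o \<zeta>
    = - (LINT x|lebesgue_on \<Omega>. dual_density \<alpha> c (T x) (\<zeta> x)) - \<beta>o * measure lebesgue \<Omega>"
proof -
  have "dual_functional \<Omega> \<tau> \<alpha> c \<beta>o \<zeta> = - (LINT x|lebesgue_on \<Omega>. dual_density \<alpha> c (T x) (\<zeta> x) + \<beta>o)"
    by (simp add: dual_functional_def dual_density_def)
  also have "\<dots> = - (LINT x|lebesgue_on \<Omega>. dual_density \<alpha> c (T x) (\<zeta> x)) - \<beta>o * measure lebesgue \<Omega>"
    using dual_domainD(6)[OF assms] nice_regionD(5)[OF nice]
    by (subst Bochner_Integration.integral_add) (simp_all add: measure_restrict_space)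
  finally show ?thesis .
qed

lemma dual_functional_mono:
  assumes "\<zeta> \<in> dual_domain \<Omega> \<tau>" "\<xi> \<in> dual_domain \<Omega> \<tau>"
    and "AE x in lebesgue_on \<Omega>. dual_density \<alpha> c (T x) (\<xi> x) \<le> dual_density \<alpha> c (T x) (\<zeta> x)"
  shows "dual_functional \<Omega> \<tau> \<alpha> c \<beta>o \<zeta> \<le> dual_functional \<Omega> \<tau> \<alpha> c \<beta>o \<xi>"
  using integral_mono_AE[OF dual_domainD(6)[OF assms(2)] dual_domainD(6)[OF assms(1)] assms(3)]
  by (simp add: dual_functional_eq assms(1,2))

text \<open>
  The perturbed function stays between \<open>|\<zeta>| / 2\<close> and \<open>2 |\<zeta>|\<close> in modulus.
\<close>

lemma dual_domain_perturb:
  assumes \<zeta>: "\<zeta> \<in> dual_domain \<Omega> \<tau>" and v: "v \<in> borel_measurable (lebesgue_on \<Omega>)" "\<And>x. x \<in> \<Omega> \<Longrightarrow> \<bar>v x\<bar> \<le> \<bar>\<zeta> x\<bar>"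
    and s: "\<bar>s\<bar> \<le> 1/2"
  shows "(\<lambda>x. \<zeta> x + s * v x) \<in> dual_domain \<Omega> \<tau>"
proof -
  note d = dual_domainD[OF \<zeta>]
  have sv: "\<bar>s * v x\<bar> \<le> \<bar>\<zeta> x\<bar> / 2" if "x \<in> \<Omega>" for x
    unfolding abs_mult using mult_mono[OF s v(2)[OF that]] by simp
  have m: "(\<lambda>x. \<zeta> x + s * v x) \<in> borel_measurable (lebesgue_on \<Omega>)" using d(1) v(1) by measurable
  have "integrable (lebesgue_on \<Omega>) (\<lambda>x. (\<zeta> x + s * v x)\<^sup>2)"
  proof (rule Bochner_Integration.integrable_bound)
    show "integrable (lebesgue_on \<Omega>) (\<lambda>x. 4 * (\<zeta> x)\<^sup>2)" using d(2) by simp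
    show "(\<lambda>x. (\<zeta> x + s * v x)\<^sup>2) \<in> borel_measurable (lebesgue_on \<Omega>)" using m by measurable
    show "AE x in lebesgue_on \<Omega>. norm ((\<zeta> x + s * v x)\<^sup>2) \<le> norm (4 * (\<zeta> x)\<^sup>2)"
    proof (rule AE_I2)
      fix x assume "x \<in> space (lebesgue_on \<Omega>)"
      then have "\<bar>\<zeta> x + s * v x\<bar> \<le> \<bar>2 * \<zeta> x\<bar>" using sv[of x] by auto
      then have "(\<zeta> x + s * v x)\<^sup>2 \<le> (2 * \<zeta> x)\<^sup>2" by (simp add: abs_le_square_iff)
      then show "norm ((\<zeta> x + s * v x)\<^sup>2) \<le> norm (4 * (\<zeta> x)\<^sup>2)" by (simp add: power_mult_distrib)
    qed
  qed
  moreover have "AE x in lebesgue_on \<Omega>. \<zeta> x + s * v x = 0 \<longrightarrow> \<tau> x = 0"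
    using d(4) AE_space
  proof eventually_elim
    case (elim x)
    then show ?case using sv[of x] by auto
  qed
  moreover have "integrable (lebesgue_on \<Omega>) (\<lambda>x. T x / (\<zeta> x + s * v x))"
  proof (rule Bochner_Integration.integrable_bound)
    show "integrable (lebesgue_on \<Omega>) (\<lambda>x. 8 * (T x / (4 * \<zeta> x)))" by (intro integrable_mult_right d(5))
    show "(\<lambda>x. T x / (\<zeta> x + s * v x)) \<in> borel_measurable (lebesgue_on \<Omega>)" using m \<tau>_measurable by measurable
    show "AE x in lebesgue_on \<Omega>. norm (T x / (\<zeta> x + s * v x)) \<le> norm (8 * (T x / (4 * \<zeta> x)))"
    proof (rule AE_I2)
      fix x assume "x \<in> space (lebesgue_on \<Omega>)"
      then have x: "x \<in> \<Omega>" by simp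
      show "norm (T x / (\<zeta> x + s * v x)) \<le> norm (8 * (T x / (4 * \<zeta> x)))"
      proof (cases "\<zeta> x = 0")
        case True then show ?thesis using v(2)[OF x] by simp
      next
        case False
        have "\<bar>\<zeta> x\<bar> / 2 \<le> \<bar>\<zeta> x + s * v x\<bar>" using sv[OF x] by linarith
        then have "T x / \<bar>\<zeta> x + s * v x\<bar> \<le> T x / (\<bar>\<zeta> x\<bar> / 2)"
          using False by (intro divide_left_mono) (auto intro!: mult_pos_pos)
        then show ?thesis by (simp add: abs_divide abs_mult mult.commute)
      qed
    qed
  qed
  ultimately show ?thesis
    using m by (simp add: dual_domain_def L2_fun_def quotient_integrable_def)
qed

lemma dual_functional_derivative:
  assumes \<zeta>: "\<zeta> \<in> dual_domain \<Omega> \<tau>" and v: "v \<in> borel_measurable (lebesgue_on \<Omega>)" "\<And>x. x \<in> \<Omega> \<Longrightarrow> \<bar>v x\<bar> \<le> \<bar>\<zeta> x\<bar>"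
  shows "((\<lambda>s. dual_functional \<Omega> \<tau> \<alpha> c \<beta>o (\<lambda>x. \<zeta> x + s * v x)) has_real_derivative
    - (LINT x|lebesgue_on \<Omega>. (c * (\<zeta> x)\<^sup>2 + \<alpha> * \<zeta> x - T x / (4 * \<zeta> x)) * (v x / \<zeta> x))) (at 0)"
proof -
  note d = dual_domainD[OF \<zeta>]
  define L where "L x = (c * (\<zeta> x)\<^sup>2 + \<alpha> * \<zeta> x - T x / (4 * \<zeta> x)) * (v x / \<zeta> x)" for x
  define W where "W x = 2 * \<bar>T x / (4 * \<zeta> x)\<bar> + \<bar>c\<bar> * (\<zeta> x)\<^sup>2" for x
  have W: "integrable (lebesgue_on \<Omega>) W"
    unfolding W_def by (intro Bochner_Integration.integrable_add integrable_mult_right integrable_abs d)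
  have L: "integrable (lebesgue_on \<Omega>) L"
  proof (rule Bochner_Integration.integrable_bound)
    show "integrable (lebesgue_on \<Omega>) (\<lambda>x. c * (\<zeta> x)\<^sup>2 + \<alpha> * \<zeta> x - T x / (4 * \<zeta> x))"
      by (intro Bochner_Integration.integrable_add Bochner_Integration.integrable_diff integrable_mult_right d)
    show "L \<in> borel_measurable (lebesgue_on \<Omega>)" unfolding L_def using d(1) v(1) \<tau>_measurable by measurable
    show "AE x in lebesgue_on \<Omega>. norm (L x) \<le> norm (c * (\<zeta> x)\<^sup>2 + \<alpha> * \<zeta> x - T x / (4 * \<zeta> x))"
    proof (rule AE_I2)
      fix x assume "x \<in> space (lebesgue_on \<Omega>)"
      then have "\<bar>v x / \<zeta> x\<bar> \<le> 1" using v(2)[of x] by (cases "\<zeta> x = 0") (auto simp: abs_divide)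
      then show "norm (L x) \<le> norm (c * (\<zeta> x)\<^sup>2 + \<alpha> * \<zeta> x - T x / (4 * \<zeta> x))"
        unfolding L_def real_norm_def abs_mult by (intro mult_left_le) auto
    qed
  qed
  show ?thesis
    unfolding L_def[symmetric]
  proof (rule has_derivative_if_quadratic_remainder)
    fix s :: real assume s: "\<bar>s\<bar> \<le> 1/2"
    have \<zeta>s: "(\<lambda>x. \<zeta> x + s * v x) \<in> dual_domain \<Omega> \<tau>" by (rule dual_domain_perturb[OF \<zeta> v s])
    let ?h = "\<lambda>z x. dual_density \<alpha> c (T x) z"
    note i = dual_domainD(6)[OF \<zeta>s] dual_domainD(6)[OF \<zeta>]
    have eq: "dual_functional \<Omega> \<tau> \<alpha> c \<beta>o (\<lambda>x. \<zeta> x + s * v x) - dual_functional \<Omega> \<tau> \<alpha> c \<beta>o (\<lambda>x. \<zeta> x + 0 * v x)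
        - s * - (LINT x|lebesgue_on \<Omega>. L x)
      = - (LINT x|lebesgue_on \<Omega>. ?h (\<zeta> x + s * v x) x - ?h (\<zeta> x) x - s * L x)"
      using i L by (simp add: dual_functional_eq[OF \<zeta>] dual_functional_eq[OF \<zeta>s])
    have "norm (LINT x|lebesgue_on \<Omega>. ?h (\<zeta> x + s * v x) x - ?h (\<zeta> x) x - s * L x) \<le> (LINT x|lebesgue_on \<Omega>. s\<^sup>2 * W x)"
    proof (rule Bochner_Integration.integral_norm_bound_integral)
      fix x assume "x \<in> space (lebesgue_on \<Omega>)"
      then show "norm (?h (\<zeta> x + s * v x) x - ?h (\<zeta> x) x - s * L x) \<le> s\<^sup>2 * W x"
        unfolding L_def W_def real_norm_def by (intro dual_density_expansion v(2) s) simp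
    qed (use i L W in auto)
    then show "\<bar>dual_functional \<Omega> \<tau> \<alpha> c \<beta>o (\<lambda>x. \<zeta> x + s * v x) - dual_functional \<Omega> \<tau> \<alpha> c \<beta>o (\<lambda>x. \<zeta> x + 0 * v x)
        - s * - (LINT x|lebesgue_on \<Omega>. L x)\<bar> \<le> s\<^sup>2 * (LINT x|lebesgue_on \<Omega>. W x)"
      unfolding eq by simp
  qed
qed

text \<open>
  Varying \<open>\<zeta>\<close> in the admissible direction \<open>\<zeta> sgn l\<close>, where \<open>l\<close> is the integrand of the
  derivative of the functional, gives \<open>\<integral> |l| = 0\<close>.
\<close>

lemma dual_critical_imp_root:
  assumes crit: "dual_critical \<Omega> \<tau> (dual_functional \<Omega> \<tau> \<alpha> c \<beta>o) \<zeta>"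
  shows "AE x in lebesgue_on \<Omega>. dual_root \<alpha> c (T x) (\<zeta> x)"
proof -
  have \<zeta>: "\<zeta> \<in> dual_domain \<Omega> \<tau>" using crit by (simp add: dual_critical_def)
  note d = dual_domainD[OF \<zeta>]
  define l where "l x = c * (\<zeta> x)\<^sup>2 + \<alpha> * \<zeta> x - T x / (4 * \<zeta> x)" for x
  have l: "integrable (lebesgue_on \<Omega>) l"
    unfolding l_def by (intro Bochner_Integration.integrable_add Bochner_Integration.integrable_diff integrable_mult_right d)
  define v where "v x = \<zeta> x * sgn (l x)" for x
  have v: "v \<in> borel_measurable (lebesgue_on \<Omega>)" "\<And>x. \<bar>v x\<bar> \<le> \<bar>\<zeta> x\<bar>"
    unfolding v_def using d(1) l by (auto simp: abs_mult sgn_real_def)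
  have "((\<lambda>s. dual_functional \<Omega> \<tau> \<alpha> c \<beta>o (\<lambda>x. \<zeta> x + s * v x)) has_real_derivative 0) (at 0)"
    using crit v by (simp add: dual_critical_def)
  from DERIV_unique[OF dual_functional_derivative[OF \<zeta> v] this]
  have "(LINT x|lebesgue_on \<Omega>. l x * (v x / \<zeta> x)) = 0" by (simp add: l_def)
  moreover have "l x * (v x / \<zeta> x) = \<bar>l x\<bar>" for x
    by (cases "\<zeta> x = 0") (auto simp: l_def v_def abs_sgn)
  ultimately have "(LINT x|lebesgue_on \<Omega>. \<bar>l x\<bar>) = 0" by simp
  then have "AE x in lebesgue_on \<Omega>. \<bar>l x\<bar> = 0"
    using l by (subst (asm) integral_nonneg_eq_0_iff_AE) auto
  then show ?thesis
    using d(4)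
  proof eventually_elim
    case (elim x)
    show ?case
    proof (cases "\<zeta> x = 0")
      case True then show ?thesis using elim(2) by simp
    next
      case False
      then have "c * (\<zeta> x)\<^sup>2 + \<alpha> * \<zeta> x = T x / (4 * \<zeta> x)" using elim(1) by (simp add: l_def)
      then show ?thesis using False by (simp add: field_simps power2_eq_square)
    qed
  qed
qed

lemma dual_root_bounded:
  obtains C where "\<And>x z. x \<in> closure \<Omega> \<Longrightarrow> dual_root \<alpha> c (T x) z \<Longrightarrow> \<bar>z\<bar> \<le> C"
proof -
  obtain B where B: "\<And>x. x \<in> closure \<Omega> \<Longrightarrow> norm (\<tau> x) \<le> B" using \<tau>_bounded by metis
  have "\<bar>z\<bar> \<le> max 1 ((B\<^sup>2 + 4 * \<bar>\<alpha>\<bar>) / (4 * c))"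
    if x: "x \<in> closure \<Omega>" and root: "dual_root \<alpha> c (T x) z" for x z
  proof (cases "\<bar>z\<bar> \<le> 1")
    case False
    then have z: "1 < \<bar>z\<bar>" by simp
    have z2: "1 < z\<^sup>2" using one_less_power[OF z, of 2] by simp
    have "T x \<le> B\<^sup>2" using B[OF x] by (intro power_mono) auto
    have "4 * z\<^sup>2 * (c * \<bar>z\<bar>) = \<bar>4 * z\<^sup>2 * (c * z)\<bar>" using c by (simp add: abs_mult)
    also have "\<dots> = \<bar>T x - 4 * z\<^sup>2 * \<alpha>\<bar>" using root by (simp add: algebra_simps)
    also have "\<dots> \<le> T x + 4 * z\<^sup>2 * \<bar>\<alpha>\<bar>" by (rule order_trans[OF abs_triangle_ineq4]) (simp add: abs_mult)
    also have "\<dots> \<le> z\<^sup>2 * B\<^sup>2 + 4 * z\<^sup>2 * \<bar>\<alpha>\<bar>"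
      using \<open>T x \<le> B\<^sup>2\<close> mult_right_mono[OF less_imp_le[OF z2], of "B\<^sup>2"] by simp
    also have "\<dots> = z\<^sup>2 * (B\<^sup>2 + 4 * \<bar>\<alpha>\<bar>)" by (simp add: algebra_simps)
    finally have "z\<^sup>2 * (4 * c * \<bar>z\<bar>) \<le> z\<^sup>2 * (B\<^sup>2 + 4 * \<bar>\<alpha>\<bar>)" by (simp add: algebra_simps)
    then have "4 * c * \<bar>z\<bar> \<le> B\<^sup>2 + 4 * \<bar>\<alpha>\<bar>" by (rule mult_left_le_imp_le) (use z2 in linarith)
    then have "\<bar>z\<bar> \<le> (B\<^sup>2 + 4 * \<bar>\<alpha>\<bar>) / (4 * c)" using c by (simp add: field_simps)
    then show ?thesis by simp
  qed simp
  then show ?thesis by (rule that)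
qed

text \<open>
  By the dual algebraic equation \<open>|\<tau>|\<^sup>2 / \<zeta> = 4 (c \<zeta>\<^sup>2 + \<alpha> \<zeta>)\<close>, so the singular quotient is as
  integrable as \<open>\<zeta>\<^sup>2\<close>, and the integrand of the derivative of the functional vanishes
  identically.
\<close>

lemma dual_root_field:
  assumes cont: "continuous_on \<Omega> \<zeta>" and root: "\<And>x. x \<in> \<Omega> \<Longrightarrow> dual_root \<alpha> c (T x) (\<zeta> x)"
  shows "bounded (\<zeta> ` \<Omega>)" "\<zeta> \<in> dual_domain \<Omega> \<tau>" "dual_critical \<Omega> \<tau> (dual_functional \<Omega> \<tau> \<alpha> c \<beta>o) \<zeta>"
proof -
  have m: "\<zeta> \<in> borel_measurable (lebesgue_on \<Omega>)"
    by (rule continuous_imp_measurable_on_sets_lebesgue[OF cont nice_regionD(5)[OF nice]])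
  obtain C where C: "\<And>x. x \<in> \<Omega> \<Longrightarrow> \<bar>\<zeta> x\<bar> \<le> C"
    using dual_root_bounded root closure_subset by (metis subsetD)
  then show "bounded (\<zeta> ` \<Omega>)" by (auto simp: bounded_iff)
  have sq: "integrable (lebesgue_on \<Omega>) (\<lambda>x. (\<zeta> x)\<^sup>2)"
  proof (rule integrable_const_bound[of _ "C\<^sup>2"])
    show "AE x in lebesgue_on \<Omega>. norm ((\<zeta> x)\<^sup>2) \<le> C\<^sup>2"
    proof (rule AE_I2)
      fix x assume "x \<in> space (lebesgue_on \<Omega>)"
      then have "\<bar>\<zeta> x\<bar>\<^sup>2 \<le> C\<^sup>2" by (intro power_mono C) auto
      then show "norm ((\<zeta> x)\<^sup>2) \<le> C\<^sup>2" by simp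
    qed
  qed (use m in measurable)
  have "integrable (lebesgue_on \<Omega>) \<zeta>" by (rule integrable_if_square_integrable[OF finite_measure_axioms m sq])
  then have "integrable (lebesgue_on \<Omega>) (\<lambda>x. 4 * (c * (\<zeta> x)\<^sup>2 + \<alpha> * \<zeta> x))" using sq by simp
  moreover have "T x / \<zeta> x = 4 * (c * (\<zeta> x)\<^sup>2 + \<alpha> * \<zeta> x)" if "x \<in> \<Omega>" for x
    using dual_root_slope[OF root[OF that]] by (simp add: field_simps)
  ultimately have "integrable (lebesgue_on \<Omega>) (\<lambda>x. T x / \<zeta> x)"
    by (elim Bochner_Integration.integrable_cong[OF refl, THEN iffD1, rotated]) simp
  moreover have "AE x in lebesgue_on \<Omega>. \<zeta> x = 0 \<longrightarrow> \<tau> x = 0"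
    using root by (intro AE_I2) force
  ultimately show \<zeta>: "\<zeta> \<in> dual_domain \<Omega> \<tau>"
    using m sq by (simp add: dual_domain_def L2_fun_def quotient_integrable_def)
  show "dual_critical \<Omega> \<tau> (dual_functional \<Omega> \<tau> \<alpha> c \<beta>o) \<zeta>"
    unfolding dual_critical_def
  proof (intro conjI ballI impI \<zeta>)
    fix v assume v: "v \<in> borel_measurable (lebesgue_on \<Omega>)" "\<forall>x\<in>\<Omega>. \<bar>v x\<bar> \<le> \<bar>\<zeta> x\<bar>"
    have "(LINT x|lebesgue_on \<Omega>. (c * (\<zeta> x)\<^sup>2 + \<alpha> * \<zeta> x - T x / (4 * \<zeta> x)) * (v x / \<zeta> x)) = (LINT x|lebesgue_on \<Omega>. 0)"
      using dual_root_slope[OF root] by (intro Bochner_Integration.integral_cong refl) simp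
    then show "((\<lambda>s. dual_functional \<Omega> \<tau> \<alpha> c \<beta>o (\<lambda>x. \<zeta> x + s * v x)) has_real_derivative 0) (at 0)"
      using dual_functional_derivative[OF \<zeta> v(1)] v(2) by simp
  qed
qed

end

section \<open>Continuity of the root branches\<close>

text \<open>The inverse of a continuous injection on a compact interval is continuous.\<close>

lemma continuous_on_injective_branch:
  fixes q :: "real \<Rightarrow> real" and f :: "'a::topological_space \<Rightarrow> real"
  assumes q: "continuous_on {l..r} q" "inj_on q {l..r}"
    and f: "\<And>x. x \<in> X \<Longrightarrow> f x \<in> {l..r}" "continuous_on X (\<lambda>x. q (f x))"
  shows "continuous_on X f"
proof -
  have "continuous_on (q ` {l..r}) (the_inv_into {l..r} q)"
    using q by (intro continuous_on_inv) (auto simp: the_inv_into_f_f)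
  then have "continuous_on X (\<lambda>x. the_inv_into {l..r} q (q (f x)))"
    by (rule continuous_on_compose2[OF _ f(2)]) (use f(1) in auto)
  then show ?thesis
    by (rule continuous_on_eq) (use q(2) f(1) in \<open>simp add: the_inv_into_f_f\<close>)
qed

definition dual_cubic :: "real \<Rightarrow> real \<Rightarrow> real \<Rightarrow> real" where
  "dual_cubic \<alpha> c z = 4 * z\<^sup>2 * (c * z + \<alpha>)"

lemma continuous_on_dual_cubic: "continuous_on S (dual_cubic \<alpha> c)"
  unfolding dual_cubic_def by (intro continuous_intros)

lemma dual_cubic_diff:
  "dual_cubic \<alpha> c z - dual_cubic \<alpha> c w = 4 * (z - w) * (z * (c * z + \<alpha>) + w * (c * w + \<alpha>) + c * z * w)"
  unfolding dual_cubic_def by algebra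

lemma dual_cubic_eqD:
  "dual_cubic \<alpha> c z = dual_cubic \<alpha> c w \<Longrightarrow> z = w \<or> z * (c * z + \<alpha>) + w * (c * w + \<alpha>) + c * z * w = 0"
  using dual_cubic_diff[of \<alpha> c z w] by simp

text \<open>
  In \<open>dual_cubic_eqD\<close> all three terms of the second factor are nonnegative, so they vanish, and
  this forces \<open>z = w\<close>.
\<close>

lemma inj_on_dual_cubic_positive:
  assumes c: "0 < c" shows "inj_on (dual_cubic \<alpha> c) {z. 0 \<le> z \<and> - \<alpha> / c \<le> z}"
proof (rule inj_onI, rule ccontr)
  fix z w assume z: "z \<in> {z. 0 \<le> z \<and> - \<alpha> / c \<le> z}" and w: "w \<in> {z. 0 \<le> z \<and> - \<alpha> / c \<le> z}"
    and eq: "dual_cubic \<alpha> c z = dual_cubic \<alpha> c w" and ne: "z \<noteq> w"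
  have "0 \<le> c * z + \<alpha>" "0 \<le> c * w + \<alpha>" using z w c by (auto simp: field_simps)
  then have "0 \<le> z * (c * z + \<alpha>)" "0 \<le> w * (c * w + \<alpha>)" "0 \<le> c * z * w" using z w c by auto
  moreover have "z * (c * z + \<alpha>) + w * (c * w + \<alpha>) + c * z * w = 0"
    using dual_cubic_eqD[OF eq] ne by simp
  ultimately have zero: "z * (c * z + \<alpha>) = 0" "w * (c * w + \<alpha>) = 0" "c * z * w = 0" by linarith+
  then have "c * z = 0 \<or> c * w = 0" using c by simp
  then show False
  proof
    assume "c * z = 0"
    then have "z = 0" "0 \<le> \<alpha>" using c \<open>0 \<le> c * z + \<alpha>\<close> by auto
    moreover have "0 < c * w" using c w ne \<open>z = 0\<close> by auto
    ultimately show False using zero(2) ne by auto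
  next
    assume "c * w = 0"
    then have "w = 0" "0 \<le> \<alpha>" using c \<open>0 \<le> c * w + \<alpha>\<close> by auto
    moreover have "0 < c * z" using c z ne \<open>w = 0\<close> by auto
    ultimately show False using zero(1) ne by auto
  qed
qed

lemma inj_on_dual_cubic_negative:
  assumes c: "0 < c" and \<alpha>: "0 < \<alpha>"
  shows "inj_on (dual_cubic \<alpha> c) {z. z \<le> - 2 * \<alpha> / (3 * c)}"
    and "inj_on (dual_cubic \<alpha> c) {z. - 2 * \<alpha> / (3 * c) \<le> z \<and> z \<le> 0}"
proof -
  \<comment> \<open>The second factor in \<open>dual_cubic_eqD\<close>, arranged so that both summands have the same sign:
    the sign of \<open>\<alpha> + 3 / 2 * c * z\<close> tells on which side of the critical point \<open>- 2 \<alpha> / (3 c)\<close>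
    lies \<open>z\<close>.\<close>
  have key: "z * (c * z + \<alpha>) + w * (c * w + \<alpha>) + c * z * w = (z + w) * (\<alpha> + 3/2 * c * z) + c * (w - z) * (w + z / 2)" for z w
    by (simp add: algebra_simps)
  have 1: "z * (c * z + \<alpha>) + w * (c * w + \<alpha>) + c * z * w > 0"
    if "z \<le> - 2 * \<alpha> / (3 * c)" "w < z" for z w
  proof -
    have "- 2 * \<alpha> / (3 * c) < 0" using \<alpha> c by (simp add: divide_neg_pos)
    then have neg: "z < 0" "w < 0" using that by linarith+
    have "\<alpha> + 3/2 * c * z \<le> 0" using that(1) c by (simp add: field_simps)
    then have "0 \<le> (z + w) * (\<alpha> + 3/2 * c * z)" using neg by (intro mult_nonpos_nonpos) auto
    moreover have "0 < c * ((w - z) * (w + z / 2))" using c that neg by (intro mult_pos_pos mult_neg_neg) auto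
    ultimately show ?thesis unfolding key by (simp add: mult.assoc)
  qed
  have 2: "z * (c * z + \<alpha>) + w * (c * w + \<alpha>) + c * z * w < 0"
    if "- 2 * \<alpha> / (3 * c) \<le> z" "z < w" "w \<le> 0" for z w
  proof -
    have neg: "z < 0" using that by linarith
    have "0 \<le> \<alpha> + 3/2 * c * z" using that(1) c by (simp add: field_simps)
    then have "(z + w) * (\<alpha> + 3/2 * c * z) \<le> 0" using neg that(3) by (intro mult_nonpos_nonneg) auto
    moreover have "c * ((w - z) * (w + z / 2)) < 0"
      using c that neg by (intro mult_pos_neg) auto
    ultimately show ?thesis unfolding key by (simp add: mult.assoc)
  qed
  show "inj_on (dual_cubic \<alpha> c) {z. z \<le> - 2 * \<alpha> / (3 * c)}"
  proof (rule inj_onI, rule ccontr)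
    fix z w assume z: "z \<in> {z. z \<le> - 2 * \<alpha> / (3 * c)}" "w \<in> {z. z \<le> - 2 * \<alpha> / (3 * c)}"
      and eq: "dual_cubic \<alpha> c z = dual_cubic \<alpha> c w" and ne: "z \<noteq> w"
    then show False using dual_cubic_eqD[OF eq] 1[of z w] 1[of w z] by (auto simp: neq_iff algebra_simps)
  qed
  show "inj_on (dual_cubic \<alpha> c) {z. - 2 * \<alpha> / (3 * c) \<le> z \<and> z \<le> 0}"
  proof (rule inj_onI, rule ccontr)
    fix z w assume z: "z \<in> {z. - 2 * \<alpha> / (3 * c) \<le> z \<and> z \<le> 0}" "w \<in> {z. - 2 * \<alpha> / (3 * c) \<le> z \<and> z \<le> 0}"
      and eq: "dual_cubic \<alpha> c z = dual_cubic \<alpha> c w" and ne: "z \<noteq> w"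
    then show False using dual_cubic_eqD[OF eq] 2[of z w] 2[of w z] by (auto simp: neq_iff algebra_simps)
  qed
qed

text \<open>
  For \<open>\<alpha> > 0\<close> the local maximum of the cubic on the negative axis is \<open>16 \<alpha> ^ 3 / (27 c\<^sup>2)\<close>,
  attained at the double root \<open>- 2 \<alpha> / (3 c)\<close> of the right-hand side; the same value recurs at
  \<open>\<alpha> / (3 c)\<close>.
\<close>

lemma dual_cubic_local_max:
  assumes "0 < c"
  shows "16 * \<alpha> ^ 3 / (27 * c\<^sup>2) - dual_cubic \<alpha> c z = 4 * c * (z + 2 * \<alpha> / (3 * c))\<^sup>2 * (\<alpha> / (3 * c) - z)"
  using assms unfolding dual_cubic_def by (simp add: field_simps eval_nat_numeral)

lemma dual_cubic_eq_large:
  assumes c: "0 < c" and \<alpha>: "0 < \<alpha>" and T: "16 * \<alpha> ^ 3 / (27 * c\<^sup>2) < dual_cubic \<alpha> c z"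
  shows "0 < z"
proof (rule ccontr)
  assume "\<not> 0 < z"
  moreover have "0 \<le> \<alpha> / (3 * c)" using c \<alpha> by simp
  ultimately have "0 \<le> \<alpha> / (3 * c) - z" by linarith
  then have "0 \<le> 4 * c * (z + 2 * \<alpha> / (3 * c))\<^sup>2 * (\<alpha> / (3 * c) - z)" using c by simp
  then show False using dual_cubic_local_max[OF c, of \<alpha> z] T by linarith
qed

lemma dual_cubic_local_max_strict:
  assumes "0 < c" "dual_cubic \<alpha> c z < 16 * \<alpha> ^ 3 / (27 * c\<^sup>2)"
  shows "z \<noteq> - 2 * \<alpha> / (3 * c)"
  using dual_cubic_local_max[OF assms(1), of \<alpha> z] assms(2) by auto

section \<open>Elastic energy\<close>

text \<open>
  The change of the stored energy minus the work of \<open>\<tau>\<close> when the strain \<open>g = \<tau> / (2 z)\<close> is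
  replaced by \<open>g + w\<close>; see \<open>excess_energy_eq\<close>.
\<close>

definition excess_energy :: "real \<Rightarrow> real \<Rightarrow> 'a::real_inner \<Rightarrow> 'a \<Rightarrow> real" where
  "excess_energy \<beta> z g w = z * (norm w)\<^sup>2 + 1/2 * \<beta> * (2 * (g \<bullet> w) + (norm w)\<^sup>2)\<^sup>2"

lemma norm_half_root:
  fixes \<tau> :: "'a::real_inner"
  assumes "dual_root \<alpha> c ((norm \<tau>)\<^sup>2) z" "z \<noteq> 0"
  shows "(norm (inverse (2 * z) *\<^sub>R \<tau>))\<^sup>2 = c * z + \<alpha>"
  using assms(2) unfolding norm_scaleR power_mult_distrib assms(1)[symmetric]
  by (simp add: power_mult_distrib power_inverse field_simps)

text \<open>
  Since \<open>|g|\<^sup>2 - \<alpha> = c z\<close> and \<open>\<tau> = 2 z g\<close>, the terms linear in \<open>w\<close> cancel.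
\<close>

lemma excess_energy_eq:
  fixes \<tau> :: "'a::real_inner"
  assumes root: "dual_root \<alpha> c ((norm \<tau>)\<^sup>2) z" and z: "z \<noteq> 0" and \<beta>: "\<beta> * c = 1"
  defines "g \<equiv> inverse (2 * z) *\<^sub>R \<tau>"
  shows "1/2 * \<beta> * ((norm v)\<^sup>2 - \<alpha>)\<^sup>2 - 1/2 * \<beta> * ((norm g)\<^sup>2 - \<alpha>)\<^sup>2 - (v - g) \<bullet> \<tau> = excess_energy \<beta> z g (v - g)"
proof -
  define w where "w = v - g"
  have v: "v = g + w" by (simp add: w_def)
  have \<tau>: "\<tau> = (2 * z) *\<^sub>R g" using z by (simp add: g_def)
  have nv: "(norm v)\<^sup>2 = (norm g)\<^sup>2 + 2 * (g \<bullet> w) + (norm w)\<^sup>2"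
    unfolding v by (simp add: power2_norm_eq_inner inner_add_left inner_add_right inner_commute)
  have ng: "(norm g)\<^sup>2 = c * z + \<alpha>" unfolding g_def by (rule norm_half_root[OF root z])
  have wt: "w \<bullet> \<tau> = 2 * z * (g \<bullet> w)" unfolding \<tau> by (simp add: inner_commute)
  have "1/2 * \<beta> * ((norm v)\<^sup>2 - \<alpha>)\<^sup>2 - 1/2 * \<beta> * ((norm g)\<^sup>2 - \<alpha>)\<^sup>2
      = \<beta> * c * z * (2 * (g \<bullet> w) + (norm w)\<^sup>2) + 1/2 * \<beta> * (2 * (g \<bullet> w) + (norm w)\<^sup>2)\<^sup>2"
    unfolding nv ng by algebra
  then show ?thesis
    unfolding w_def[symmetric] excess_energy_def wt \<beta> by (simp add: algebra_simps)
qed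

text \<open>
  Both sides follow from \<open>|g|\<^sup>2 = c z + \<alpha>\<close> and \<open>g \<bullet> \<tau> = 2 (c z\<^sup>2 + \<alpha> z)\<close>; the sign of \<open>z\<close> does
  not matter, so primal and dual values agree on all three branches.
\<close>

lemma dual_density_at_root:
  fixes \<tau> :: "'a::real_inner"
  assumes root: "dual_root \<alpha> c ((norm \<tau>)\<^sup>2) z" and z: "z \<noteq> 0" and \<beta>: "\<beta> * c = 1"
  defines "g \<equiv> inverse (2 * z) *\<^sub>R \<tau>"
  shows "1/2 * \<beta> * ((norm g)\<^sup>2 - \<alpha>)\<^sup>2 - g \<bullet> \<tau> = - dual_density \<alpha> c ((norm \<tau>)\<^sup>2) z"
proof -
  have ng: "(norm g)\<^sup>2 = c * z + \<alpha>" unfolding g_def by (rule norm_half_root[OF root z])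
  have "g \<bullet> \<tau> = 2 * ((norm \<tau>)\<^sup>2 / (4 * z))"
    unfolding g_def inner_scaleR_left power2_norm_eq_inner using z by (simp add: field_simps)
  also have "\<dots> = 2 * (c * z\<^sup>2 + \<alpha> * z)" using dual_root_slope[OF root] by simp
  finally have gt: "g \<bullet> \<tau> = 2 * (c * z\<^sup>2 + \<alpha> * z)" .
  have "1/2 * \<beta> * (c * z + \<alpha> - \<alpha>)\<^sup>2 = 1/2 * (\<beta> * c) * c * z\<^sup>2" by algebra
  then show ?thesis
    unfolding ng gt dual_density_def dual_root_slope[OF root] \<beta> by (simp add: algebra_simps)
qed

lemma excess_energy_scaleR: "excess_energy \<beta> z g (s *\<^sub>R w) = s\<^sup>2 * (z * (norm w)\<^sup>2 + 1/2 * \<beta> * (2 * (g \<bullet> w) + s * (norm w)\<^sup>2)\<^sup>2)"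
  unfolding excess_energy_def by (simp add: power_mult_distrib) algebra

text \<open>
  The modulus of \<open>2 g \<bullet> w + |w|\<^sup>2\<close> is at most \<open>|w| (2 |g| + |w|) \<le> |w| sqrt (- 2 z / \<beta>)\<close>.
\<close>

lemma excess_energy_nonpos:
  assumes \<beta>: "0 < \<beta>" and z: "z \<le> 0" and w: "norm w \<le> sqrt (- 2 * z / \<beta>) - 2 * norm g"
  shows "excess_energy \<beta> z g w \<le> 0"
proof -
  have q: "0 \<le> - 2 * z / \<beta>" using \<beta> z by (intro divide_nonneg_pos) auto
  have "\<bar>2 * (g \<bullet> w) + (norm w)\<^sup>2\<bar> \<le> 2 * (norm g * norm w) + (norm w)\<^sup>2"
    using Cauchy_Schwarz_ineq2[of g w] zero_le_power2[of "norm w"]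
    unfolding abs_le_iff by (intro conjI; linarith)
  also have "\<dots> = norm w * (2 * norm g + norm w)" by (simp add: power2_eq_square algebra_simps)
  also have "\<dots> \<le> norm w * sqrt (- 2 * z / \<beta>)" using w by (intro mult_left_mono) auto
  finally have "\<bar>2 * (g \<bullet> w) + (norm w)\<^sup>2\<bar>\<^sup>2 \<le> (norm w * sqrt (- 2 * z / \<beta>))\<^sup>2" by (intro power_mono) auto
  also have "\<dots> = (norm w)\<^sup>2 * (- 2 * z / \<beta>)" by (simp only: power_mult_distrib real_sqrt_pow2[OF q])
  finally have "1/2 * \<beta> * (2 * (g \<bullet> w) + (norm w)\<^sup>2)\<^sup>2 \<le> 1/2 * \<beta> * ((norm w)\<^sup>2 * (- 2 * z / \<beta>))"
    using \<beta> by (intro mult_left_mono) auto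
  also have "\<dots> = - z * (norm w)\<^sup>2" using \<beta> by simp
  finally show ?thesis by (simp add: excess_energy_def)
qed

text \<open>
  On the line \<open>|(2 g + w) \<bullet> w| = |2 g + w| |w|\<close>, so the estimate of \<open>excess_energy_nonpos\<close> can
  be reversed. In the plane it fails for \<open>z < 0\<close> and small \<open>w\<close> orthogonal to \<open>g\<close>.
\<close>

lemma excess_energy_nonneg_dim_1:
  fixes g w :: "'a::euclidean_space"
  assumes dim: "DIM('a) = 1" and \<beta>: "0 < \<beta>" and z: "z \<le> 0" and w: "norm w \<le> 2 * norm g - sqrt (- 2 * z / \<beta>)"
  shows "0 \<le> excess_energy \<beta> z g w"
proof -
  have q: "0 \<le> - 2 * z / \<beta>" using \<beta> z by (intro divide_nonneg_pos) auto
  obtain e :: 'a where e: "Basis = {e}" using dim card_1_singletonE by blast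
  have inner: "x \<bullet> y = (x \<bullet> e) * (y \<bullet> e)" for x y :: 'a
    using euclidean_inner[of x y] unfolding e by simp
  have abs: "\<bar>x \<bullet> y\<bar> = norm x * norm y" for x y :: 'a
  proof -
    have "\<bar>x \<bullet> y\<bar>\<^sup>2 = (norm x * norm y)\<^sup>2"
      unfolding power_mult_distrib power2_norm_eq_inner power2_abs
      by (simp only: inner[of x x] inner[of y y] inner[of x y]) (simp add: power2_eq_square mult_ac)
    then show ?thesis by (simp only: power2_eq_iff_nonneg abs_ge_zero mult_nonneg_nonneg norm_ge_zero)
  qed
  have "sqrt (- 2 * z / \<beta>) \<le> norm (2 *\<^sub>R g + w)"
    using w norm_triangle_ineq2[of "2 *\<^sub>R g" "- w"] by simp
  then have "norm w * sqrt (- 2 * z / \<beta>) \<le> norm (2 *\<^sub>R g + w) * norm w"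
    by (simp add: mult.commute mult_left_mono)
  also have "\<dots> = \<bar>2 * (g \<bullet> w) + (norm w)\<^sup>2\<bar>"
    unfolding abs[symmetric] by (simp add: inner_add_left power2_norm_eq_inner)
  finally have "(norm w * sqrt (- 2 * z / \<beta>))\<^sup>2 \<le> \<bar>2 * (g \<bullet> w) + (norm w)\<^sup>2\<bar>\<^sup>2"
    by (rule power_mono) (intro mult_nonneg_nonneg norm_ge_zero real_sqrt_ge_zero q)
  moreover have "(norm w * sqrt (- 2 * z / \<beta>))\<^sup>2 = (norm w)\<^sup>2 * (- 2 * z / \<beta>)"
    by (simp only: power_mult_distrib real_sqrt_pow2[OF q])
  ultimately have "1/2 * \<beta> * ((norm w)\<^sup>2 * (- 2 * z / \<beta>)) \<le> 1/2 * \<beta> * (2 * (g \<bullet> w) + (norm w)\<^sup>2)\<^sup>2"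
    using \<beta> by (intro mult_left_mono) auto
  moreover have "1/2 * \<beta> * ((norm w)\<^sup>2 * (- 2 * z / \<beta>)) = - z * (norm w)\<^sup>2" using \<beta> by simp
  ultimately show ?thesis by (simp add: excess_energy_def)
qed

section \<open>The primal functional\<close>

locale shear_problem = shear_field \<Omega> N \<tau> \<alpha> c \<beta>o
  for \<Omega> :: "'a::euclidean_space set" and N \<tau> :: "'a \<Rightarrow> 'a" and \<alpha> c \<beta>o :: real +
  fixes \<Gamma>u :: "'a set" and t :: "'a \<Rightarrow> real" and \<beta> :: real
  assumes dim: "DIM('a) = 1 \<or> DIM('a) = 2"
    and \<Gamma>u: "\<Gamma>u \<subseteq> frontier \<Omega>" "\<Gamma>u \<in> sets borel" "\<Gamma>u \<noteq> {}"
    and force: "set_borel_measurable borel (frontier \<Omega> - \<Gamma>u) t"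
    and tau: "\<tau> \<in> T_adm \<Omega> N \<Gamma>u t"
    and \<beta>: "\<beta> * c = 1"
begin

interpretation finite_measure "lebesgue_on \<Omega>" by (rule nice_regionD(11)[OF nice])

lemmas \<Omega> = nice_regionD[OF nice]

abbreviation (input) "U \<equiv> U_adm \<Omega> \<Gamma>u"
abbreviation (input) "P \<equiv> primal_functional \<Omega> \<Gamma>u t \<alpha> \<beta> \<beta>o"
abbreviation (input) "Pd \<equiv> dual_functional \<Omega> \<tau> \<alpha> c \<beta>o"
abbreviation (input) "grad \<equiv> weak_gradient \<Omega>"

lemma \<tau>_div: "x \<in> \<Omega> \<Longrightarrow> \<tau> differentiable (at x) \<and> divergence \<tau> x = 0"
  using tau by (simp add: T_adm_def)

lemma \<beta>_pos: "0 < \<beta>"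
  using \<beta> c by (metis less_irrefl mult_neg_pos mult_zero_left not_less_iff_gr_or_eq zero_less_one)

lemma U_admD:
  assumes "v \<in> U"
  shows "continuous_on (closure \<Omega>) v" "continuous_on \<Omega> v" "has_weak_gradient \<Omega> v (grad v)"
    "grad v \<in> borel_measurable (lebesgue_on \<Omega>)" "integrable (lebesgue_on \<Omega>) (\<lambda>x. norm (grad v x) ^ 4)"
    "integrable (lebesgue_on \<Omega>) (grad v)" "integrable (lebesgue_on \<Omega>) (\<lambda>x. (norm (grad v x))\<^sup>2)"
    "\<And>x. x \<in> \<Gamma>u \<Longrightarrow> v x = 0"
proof -
  show cl: "continuous_on (closure \<Omega>) v" and "\<And>x. x \<in> \<Gamma>u \<Longrightarrow> v x = 0"
    using assms by (auto simp: U_adm_def)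
  show "continuous_on \<Omega> v" using continuous_on_subset[OF cl closure_subset] .
  obtain g where g: "has_weak_gradient \<Omega> v g" "integrable (lebesgue_on \<Omega>) (\<lambda>x. norm (g x) ^ 4)"
    using assms by (auto simp: U_adm_def)
  show w: "has_weak_gradient \<Omega> v (grad v)" by (rule has_weak_gradient_weak_gradient[OF g(1)])
  then show m: "grad v \<in> borel_measurable (lebesgue_on \<Omega>)" by (simp add: has_weak_gradient_def)
  show i4: "integrable (lebesgue_on \<Omega>) (\<lambda>x. norm (grad v x) ^ 4)"
  proof (rule integrable_cong_AE_imp[OF g(2)])
    show "AE x in lebesgue_on \<Omega>. norm (g x) ^ 4 = norm (grad v x) ^ 4"
      using weak_gradient_eq[OF \<Omega>(1) g(1)] by eventually_elim simp
  qed (use m in measurable)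
  have le: "a\<^sup>2 \<le> 1 + a ^ 4" "a \<le> 1 + a ^ 4" if "0 \<le> a" for a :: real
  proof -
    have "2 * a\<^sup>2 \<le> 1 + a ^ 4" using zero_le_power2[of "a\<^sup>2 - 1"] by (simp add: power2_diff flip: power_mult)
    moreover have "2 * a \<le> 1 + a\<^sup>2" using zero_le_power2[of "a - 1"] by (simp add: power2_diff)
    moreover have "0 \<le> a ^ 4" by simp
    ultimately show "a\<^sup>2 \<le> 1 + a ^ 4" "a \<le> 1 + a ^ 4" using zero_le_power2[of a] that by linarith+
  qed
  have i: "integrable (lebesgue_on \<Omega>) (\<lambda>x. 1 + norm (grad v x) ^ 4)" using i4 by simp
  show "integrable (lebesgue_on \<Omega>) (grad v)"
    by (rule Bochner_Integration.integrable_bound[OF i m]) (use le(2) in \<open>auto intro!: AE_I2\<close>)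
  show "integrable (lebesgue_on \<Omega>) (\<lambda>x. (norm (grad v x))\<^sup>2)"
    by (rule Bochner_Integration.integrable_bound[OF i]) (use m le(1) in \<open>auto intro!: AE_I2\<close>)
qed

lemma U_adm_add_scaled:
  assumes u: "u \<in> U" and v: "v \<in> U"
  shows "(\<lambda>x. u x + s * v x) \<in> U"
    and "AE x in lebesgue_on \<Omega>. grad (\<lambda>x. u x + s * v x) x = grad u x + s *\<^sub>R grad v x"
proof -
  note du = U_admD[OF u] and dv = U_admD[OF v]
  have w: "has_weak_gradient \<Omega> (\<lambda>x. u x + s * v x) (\<lambda>x. grad u x + s *\<^sub>R grad v x)"
    by (rule has_weak_gradient_add_scaled[OF \<Omega>(1) du(2) dv(2) du(3) dv(3)])
  then show "AE x in lebesgue_on \<Omega>. grad (\<lambda>x. u x + s * v x) x = grad u x + s *\<^sub>R grad v x"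
    by (rule weak_gradient_eq[OF \<Omega>(1)])
  have le: "(a + b) ^ 4 \<le> 8 * (a ^ 4 + b ^ 4)" for a b :: real
  proof -
    have 1: "(x + y)\<^sup>2 \<le> 2 * (x\<^sup>2 + y\<^sup>2)" for x y :: real
      using zero_le_power2[of "x - y"] by (simp add: power2_sum power2_diff)
    have "(a + b) ^ 4 = ((a + b)\<^sup>2)\<^sup>2" by (simp flip: power_mult)
    also have "\<dots> \<le> (2 * (a\<^sup>2 + b\<^sup>2))\<^sup>2" by (intro power_mono 1) simp
    also have "\<dots> = 4 * (a\<^sup>2 + b\<^sup>2)\<^sup>2" by (simp only: power_mult_distrib) simp
    also have "\<dots> \<le> 4 * (2 * ((a\<^sup>2)\<^sup>2 + (b\<^sup>2)\<^sup>2))" by (intro mult_left_mono 1) simp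
    finally show ?thesis by (simp flip: power_mult)
  qed
  have "integrable (lebesgue_on \<Omega>) (\<lambda>x. norm (grad u x + s *\<^sub>R grad v x) ^ 4)"
  proof (rule Bochner_Integration.integrable_bound)
    show "integrable (lebesgue_on \<Omega>) (\<lambda>x. 8 * (norm (grad u x) ^ 4 + \<bar>s\<bar> ^ 4 * norm (grad v x) ^ 4))"
      using du(5) dv(5) by simp
    show "(\<lambda>x. norm (grad u x + s *\<^sub>R grad v x) ^ 4) \<in> borel_measurable (lebesgue_on \<Omega>)"
      using du(4) dv(4) by measurable
    show "AE x in lebesgue_on \<Omega>. norm (norm (grad u x + s *\<^sub>R grad v x) ^ 4)
        \<le> norm (8 * (norm (grad u x) ^ 4 + \<bar>s\<bar> ^ 4 * norm (grad v x) ^ 4))"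
    proof (rule AE_I2)
      fix x
      have "norm (grad u x + s *\<^sub>R grad v x) ^ 4 \<le> (norm (grad u x) + \<bar>s\<bar> * norm (grad v x)) ^ 4"
        by (intro power_mono order_trans[OF norm_triangle_ineq]) auto
      also have "\<dots> \<le> 8 * (norm (grad u x) ^ 4 + (\<bar>s\<bar> * norm (grad v x)) ^ 4)" by (rule le)
      finally show "norm (norm (grad u x + s *\<^sub>R grad v x) ^ 4)
        \<le> norm (8 * (norm (grad u x) ^ 4 + \<bar>s\<bar> ^ 4 * norm (grad v x) ^ 4))"
        by (simp add: power_mult_distrib)
    qed
  qed
  then show "(\<lambda>x. u x + s * v x) \<in> U"
    unfolding U_adm_def using w du(1,8) dv(1,8) by (auto intro!: continuous_intros)
qed

lemma grad_\<tau>_integrable: "v \<in> U \<Longrightarrow> integrable (lebesgue_on \<Omega>) (\<lambda>x. grad v x \<bullet> \<tau> x)"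
proof -
  assume v: "v \<in> U"
  obtain B where "\<And>x. x \<in> closure \<Omega> \<Longrightarrow> norm (\<tau> x) \<le> B" using \<tau>_bounded by metis
  then show ?thesis
    using \<Omega>(8) by (intro integrable_inner_bounded[OF \<Omega>(5) U_admD(6)[OF v], of _ B] continuous_on_subset[OF \<tau>c]) auto
qed

text \<open>
  On the loaded part of the boundary \<open>t\<close> is the normal component of \<open>\<tau>\<close>, and on the fixed part
  \<open>v\<close> vanishes; so this is the Gauss-Green formula.
\<close>

lemma traction_integral:
  assumes v: "v \<in> U"
  shows "(LINT x:(frontier \<Omega> - \<Gamma>u)|surface_measure. t x * v x) = (LINT x|lebesgue_on \<Omega>. grad v x \<bullet> \<tau> x)"
proof -
  let ?M = "surface_measure :: 'a measure"
  note dv = U_admD[OF v]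
  \<comment> \<open>Continuous extensions supply the Borel measurability of the boundary integrands.\<close>
  obtain V where V: "continuous_on UNIV V" "\<And>x. x \<in> closure \<Omega> \<Longrightarrow> V x = v x"
    using Tietze_unbounded[of "closure \<Omega>" v UNIV] dv(1) by auto
  obtain F where F: "continuous_on UNIV F" "\<And>x. x \<in> closure \<Omega> \<Longrightarrow> F x = \<tau> x"
    using Tietze_unbounded[of "closure \<Omega>" \<tau> UNIV] \<tau>c by auto
  have fr: "frontier \<Omega> \<subseteq> closure \<Omega>" using \<Omega>(8) by blast
  have meas: "f \<in> borel_measurable borel \<Longrightarrow> f \<in> borel_measurable ?M" for f :: "'a \<Rightarrow> 'b::topological_space"
    by (simp cong: measurable_cong_sets)
  have Nm: "N \<in> borel_measurable borel" using nice by (simp add: nice_region_def)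
  have "(LINT x:(frontier \<Omega> - \<Gamma>u)|?M. t x * v x) = (LINT x:frontier \<Omega>|?M. (v x *\<^sub>R \<tau> x) \<bullet> N x)"
    unfolding set_lebesgue_integral_def
  proof (rule integral_cong_AE)
    have "(\<lambda>x. (indicator (frontier \<Omega> - \<Gamma>u) x *\<^sub>R t x) * V x) \<in> borel_measurable borel"
      using force borel_measurable_continuous_onI[OF V(1)] unfolding set_borel_measurable_def by measurable
    moreover have "(\<lambda>x. (indicator (frontier \<Omega> - \<Gamma>u) x *\<^sub>R t x) * V x) = (\<lambda>x. indicator (frontier \<Omega> - \<Gamma>u) x *\<^sub>R (t x * v x))"
      using V(2) fr by (auto simp: fun_eq_iff indicator_def)
    ultimately show "(\<lambda>x. indicator (frontier \<Omega> - \<Gamma>u) x *\<^sub>R (t x * v x)) \<in> borel_measurable ?M"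
      by (metis meas)
    have "(\<lambda>x. indicator (frontier \<Omega>) x *\<^sub>R ((V x *\<^sub>R F x) \<bullet> N x)) \<in> borel_measurable borel"
      using borel_measurable_continuous_onI[OF V(1)] borel_measurable_continuous_onI[OF F(1)] Nm by measurable
    moreover have "(\<lambda>x. indicator (frontier \<Omega>) x *\<^sub>R ((V x *\<^sub>R F x) \<bullet> N x)) = (\<lambda>x. indicator (frontier \<Omega>) x *\<^sub>R ((v x *\<^sub>R \<tau> x) \<bullet> N x))"
      using V(2) F(2) fr by (auto simp: fun_eq_iff indicator_def)
    ultimately show "(\<lambda>x. indicator (frontier \<Omega>) x *\<^sub>R ((v x *\<^sub>R \<tau> x) \<bullet> N x)) \<in> borel_measurable ?M"
      by (metis meas)
    have "AE x in ?M. x \<in> frontier \<Omega> - \<Gamma>u \<longrightarrow> N x \<bullet> \<tau> x = t x" using tau by (simp add: T_adm_def)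
    then show "AE x in ?M. indicator (frontier \<Omega> - \<Gamma>u) x *\<^sub>R (t x * v x)
        = indicator (frontier \<Omega>) x *\<^sub>R ((v x *\<^sub>R \<tau> x) \<bullet> N x)"
      by eventually_elim (use dv(8) in \<open>auto simp: indicator_def inner_commute\<close>)
  qed
  also have "\<dots> = (LINT x|lebesgue_on \<Omega>. grad v x \<bullet> \<tau> x)"
    by (rule Gauss_Green[OF dim nice \<tau>c \<tau>_div dv(1,3,6), symmetric])
  finally show ?thesis .
qed

definition energy :: "'a \<Rightarrow> real" where "energy g = 1/2 * \<beta> * ((norm g)\<^sup>2 - \<alpha>)\<^sup>2"

lemma energy_integrable:
  assumes v: "v \<in> U" shows "integrable (lebesgue_on \<Omega>) (\<lambda>x. energy (grad v x))"
proof -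
  note dv = U_admD[OF v]
  have "integrable (lebesgue_on \<Omega>) (\<lambda>x. 1/2 * \<beta> * (norm (grad v x) ^ 4 - 2 * \<alpha> * (norm (grad v x))\<^sup>2 + \<alpha>\<^sup>2))"
    using dv(5,7) by simp
  also have "(\<lambda>x. 1/2 * \<beta> * (norm (grad v x) ^ 4 - 2 * \<alpha> * (norm (grad v x))\<^sup>2 + \<alpha>\<^sup>2)) = (\<lambda>x. energy (grad v x))"
    unfolding energy_def fun_eq_iff by algebra
  finally show ?thesis .
qed

lemma primal_eq:
  assumes v: "v \<in> U"
  shows "P v = (LINT x|lebesgue_on \<Omega>. energy (grad v x) - grad v x \<bullet> \<tau> x) - \<beta>o * measure lebesgue \<Omega>"
proof -
  have "P v = (LINT x|lebesgue_on \<Omega>. energy (grad v x) - \<beta>o) - (LINT x|lebesgue_on \<Omega>. grad v x \<bullet> \<tau> x)"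
    unfolding primal_functional_def traction_integral[OF v] energy_def ..
  then show ?thesis
    using energy_integrable[OF v] grad_\<tau>_integrable[OF v] \<Omega>(5) by (simp add: measure_restrict_space)
qed

text \<open>
  The property of the line integrals of \<open>\<tau> / (2 \<zeta>)\<close> on which all energy comparisons rest.
\<close>

definition equilibrium :: "('a \<Rightarrow> real) \<Rightarrow> ('a \<Rightarrow> real) \<Rightarrow> bool" where
  "equilibrium \<zeta> u \<longleftrightarrow> continuous_on \<Omega> \<zeta> \<and> (\<forall>x\<in>\<Omega>. dual_root \<alpha> c ((norm (\<tau> x))\<^sup>2) (\<zeta> x) \<and> \<zeta> x \<noteq> 0)
     \<and> u \<in> U \<and> (AE x in lebesgue_on \<Omega>. grad u x = inverse (2 * \<zeta> x) *\<^sub>R \<tau> x)"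

lemma dual_displacement_derivative:
  assumes u: "dual_displacement \<Omega> \<Gamma>u x0 \<tau> Z u" and cont: "continuous_on \<Omega> (\<lambda>x. Re (Z x))" and x: "x \<in> \<Omega>"
  shows "(u has_derivative (\<lambda>h. (inverse (2 * Re (Z x)) *\<^sub>R \<tau> x) \<bullet> h)) (at x)"
proof -
  have nz: "Re (Z x) \<noteq> 0" if "x \<in> \<Omega>" for x
    using u that by (auto simp: dual_displacement_def complex_is_Real_iff complex_eq_iff)
  have "continuous_on \<Omega> (\<lambda>x. inverse (2 * Re (Z x)) *\<^sub>R \<tau> x)"
    using nz by (intro continuous_intros cont continuous_on_subset[OF \<tau>c closure_subset]) auto
  then show ?thesis
    using u by (intro line_integral_has_derivative[OF \<Omega>(1) _ _ x]) (auto simp: dual_displacement_def)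
qed

lemma equilibrium_if_dual_displacement:
  assumes u: "dual_displacement \<Omega> \<Gamma>u x0 \<tau> Z u" and cont: "continuous_on \<Omega> (\<lambda>x. Re (Z x))"
    and root: "\<And>x. x \<in> \<Omega> \<Longrightarrow> dual_root \<alpha> c ((norm (\<tau> x))\<^sup>2) (Re (Z x))"
  shows "equilibrium (\<lambda>x. Re (Z x)) u"
proof -
  let ?g = "\<lambda>x. inverse (2 * Re (Z x)) *\<^sub>R \<tau> x"
  have nz: "Re (Z x) \<noteq> 0" if "x \<in> \<Omega>" for x
    using u that by (auto simp: dual_displacement_def complex_is_Real_iff complex_eq_iff)
  have gc: "continuous_on \<Omega> ?g"
    using nz by (intro continuous_intros cont continuous_on_subset[OF \<tau>c closure_subset]) auto
  have w: "has_weak_gradient \<Omega> u ?g"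
    by (rule has_weak_gradient_if_has_derivative[OF nice gc dual_displacement_derivative[OF u cont]])
  obtain C where C: "\<And>x. x \<in> \<Omega> \<Longrightarrow> \<bar>Re (Z x)\<bar> \<le> C"
    using dual_root_field(1)[OF cont root] by (auto simp: bounded_iff)
  have "integrable (lebesgue_on \<Omega>) (\<lambda>x. norm (?g x) ^ 4)"
  proof (rule integrable_const_bound)
    show "AE x in lebesgue_on \<Omega>. norm (norm (?g x) ^ 4) \<le> (c * C + \<bar>\<alpha>\<bar>)\<^sup>2"
    proof (rule AE_I2)
      fix x assume "x \<in> space (lebesgue_on \<Omega>)"
      then have x: "x \<in> \<Omega>" by simp
      have n: "(norm (?g x))\<^sup>2 = c * Re (Z x) + \<alpha>" by (rule norm_half_root[OF root[OF x] nz[OF x]])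
      have "\<bar>c * Re (Z x)\<bar> \<le> c * C" using C[OF x] c by (simp add: abs_mult)
      then have "(norm (?g x))\<^sup>2 \<le> c * C + \<bar>\<alpha>\<bar>" unfolding n by linarith
      then have "((norm (?g x))\<^sup>2)\<^sup>2 \<le> (c * C + \<bar>\<alpha>\<bar>)\<^sup>2" by (rule power_mono) simp
      moreover have "norm (?g x) ^ 4 = ((norm (?g x))\<^sup>2)\<^sup>2" by (simp flip: power_mult)
      ultimately show "norm (norm (?g x) ^ 4) \<le> (c * C + \<bar>\<alpha>\<bar>)\<^sup>2" by simp
    qed
    show "(\<lambda>x. norm (?g x) ^ 4) \<in> borel_measurable (lebesgue_on \<Omega>)"
      using continuous_imp_measurable_on_sets_lebesgue[OF gc \<Omega>(5)] by measurable
  qed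
  then have "u \<in> U"
    using u w unfolding U_adm_def dual_displacement_def by blast
  then show ?thesis
    using cont root nz weak_gradient_eq[OF \<Omega>(1) w] by (simp add: equilibrium_def)
qed

text \<open>
  Both load terms are integrals of gradients against \<open>\<tau>\<close>, so the difference of the functionals
  is the integral of the pointwise excess energy.
\<close>

lemma primal_diff:
  assumes eq: "equilibrium \<zeta> u" and v: "v \<in> U"
  defines "E \<equiv> \<lambda>x. excess_energy \<beta> (\<zeta> x) (grad u x) (grad v x - grad u x)"
  shows "integrable (lebesgue_on \<Omega>) E" "P v - P u = (LINT x|lebesgue_on \<Omega>. E x)"
proof -
  have u: "u \<in> U" using eq by (simp add: equilibrium_def)
  let ?D = "\<lambda>x. (energy (grad v x) - grad v x \<bullet> \<tau> x) - (energy (grad u x) - grad u x \<bullet> \<tau> x)"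
  have D: "integrable (lebesgue_on \<Omega>) ?D"
    using energy_integrable[OF u] energy_integrable[OF v] grad_\<tau>_integrable[OF u] grad_\<tau>_integrable[OF v] by simp
  have gu: "AE x in lebesgue_on \<Omega>. grad u x = inverse (2 * \<zeta> x) *\<^sub>R \<tau> x" using eq by (simp add: equilibrium_def)
  have AE: "AE x in lebesgue_on \<Omega>. ?D x = E x"
    using gu AE_space
  proof eventually_elim
    case (elim x)
    then have "dual_root \<alpha> c ((norm (\<tau> x))\<^sup>2) (\<zeta> x)" "\<zeta> x \<noteq> 0" using eq by (auto simp: equilibrium_def)
    from excess_energy_eq[OF this \<beta>, of "grad v x"] show ?case
      unfolding E_def energy_def elim(1) by (simp add: inner_diff_left)
  qed
  have m: "E \<in> borel_measurable (lebesgue_on \<Omega>)"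
    unfolding E_def excess_energy_def
    using U_admD(4)[OF u] U_admD(4)[OF v] eq continuous_imp_measurable_on_sets_lebesgue[OF _ \<Omega>(5), of \<zeta>]
    by (auto simp: equilibrium_def intro!: borel_measurable_add borel_measurable_times borel_measurable_power borel_measurable_norm borel_measurable_inner borel_measurable_diff)
  show "integrable (lebesgue_on \<Omega>) E" by (rule integrable_cong_AE_imp[OF D m AE])
  have "P v - P u = (LINT x|lebesgue_on \<Omega>. ?D x)"
    using energy_integrable[OF u] energy_integrable[OF v] grad_\<tau>_integrable[OF u] grad_\<tau>_integrable[OF v]
    by (simp add: primal_eq[OF u] primal_eq[OF v])
  also have "\<dots> = (LINT x|lebesgue_on \<Omega>. E x)"
    using D m AE by (intro integral_cong_AE) auto
  finally show "P v - P u = (LINT x|lebesgue_on \<Omega>. E x)" .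
qed

lemma equilibrium_dual_domain:
  assumes "equilibrium \<zeta> u" shows "\<zeta> \<in> dual_domain \<Omega> \<tau>" "bounded (\<zeta> ` \<Omega>)"
  using assms dual_root_field[of \<zeta>] by (auto simp: equilibrium_def)

lemma primal_eq_dual:
  assumes eq: "equilibrium \<zeta> u"
  shows "P u = Pd \<zeta>"
proof -
  have u: "u \<in> U" using eq by (simp add: equilibrium_def)
  have "(LINT x|lebesgue_on \<Omega>. energy (grad u x) - grad u x \<bullet> \<tau> x)
      = (LINT x|lebesgue_on \<Omega>. - dual_density \<alpha> c ((norm (\<tau> x))\<^sup>2) (\<zeta> x))"
  proof (rule integral_cong_AE)
    have "AE x in lebesgue_on \<Omega>. grad u x = inverse (2 * \<zeta> x) *\<^sub>R \<tau> x" using eq by (simp add: equilibrium_def)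
    then show "AE x in lebesgue_on \<Omega>. energy (grad u x) - grad u x \<bullet> \<tau> x = - dual_density \<alpha> c ((norm (\<tau> x))\<^sup>2) (\<zeta> x)"
      using AE_space
    proof eventually_elim
      case (elim x)
      then have "dual_root \<alpha> c ((norm (\<tau> x))\<^sup>2) (\<zeta> x)" "\<zeta> x \<noteq> 0" using eq by (auto simp: equilibrium_def)
      from dual_density_at_root[OF this \<beta>] show ?case unfolding energy_def elim(1) .
    qed
  qed (use energy_integrable[OF u] grad_\<tau>_integrable[OF u] dual_domainD(6)[OF equilibrium_dual_domain(1)[OF eq]] in auto)
  then show ?thesis
    by (simp add: primal_eq[OF u] dual_functional_eq[OF equilibrium_dual_domain(1)[OF eq]])
qed

text \<open>
  The excess energy of \<open>s *\<^sub>R w\<close> is \<open>s\<^sup>2\<close> times a quantity with an integrable bound independent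
  of \<open>s\<close>, since the strain \<open>g\<close> is bounded.
\<close>

lemma primal_critical_equilibrium:
  assumes eq: "equilibrium \<zeta> u"
  shows "primal_critical P U u"
  unfolding primal_critical_def
proof (intro conjI ballI)
  show u: "u \<in> U" using eq by (simp add: equilibrium_def)
  fix \<phi> assume \<phi>: "\<phi> \<in> U"
  obtain C where C: "\<And>x. x \<in> \<Omega> \<Longrightarrow> \<bar>\<zeta> x\<bar> \<le> C" using equilibrium_dual_domain(2)[OF eq] by (auto simp: bounded_iff)
  define g where "g x = norm (grad u x)" for x
  define w where "w x = norm (grad \<phi> x)" for x
  define W where "W x = C * (w x)\<^sup>2 + \<beta> * (4 * (c * C + \<bar>\<alpha>\<bar>) * (w x)\<^sup>2 + w x ^ 4)" for x
  have W: "integrable (lebesgue_on \<Omega>) W"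
    unfolding W_def w_def by (intro Bochner_Integration.integrable_add integrable_mult_right U_admD(5,7)[OF \<phi>])
  show "((\<lambda>s. P (\<lambda>x. u x + s * \<phi> x)) has_real_derivative 0) (at 0)"
  proof (rule has_derivative_if_quadratic_remainder)
    fix s :: real assume s: "\<bar>s\<bar> \<le> 1/2"
    let ?v = "\<lambda>x. u x + s * \<phi> x"
    have v: "?v \<in> U" by (rule U_adm_add_scaled(1)[OF u \<phi>])
    let ?E = "\<lambda>x. excess_energy \<beta> (\<zeta> x) (grad u x) (grad ?v x - grad u x)"
    have "P ?v - P (\<lambda>x. u x + 0 * \<phi> x) - s * 0 = (LINT x|lebesgue_on \<Omega>. ?E x)"
      using primal_diff(2)[OF eq v] by simp
    moreover have "\<bar>LINT x|lebesgue_on \<Omega>. ?E x\<bar> \<le> (LINT x|lebesgue_on \<Omega>. s\<^sup>2 * W x)"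
    proof -
      have "\<bar>LINT x|lebesgue_on \<Omega>. ?E x\<bar> \<le> (LINT x|lebesgue_on \<Omega>. \<bar>?E x\<bar>)" by (rule integral_abs_bound)
      also have "\<dots> \<le> (LINT x|lebesgue_on \<Omega>. s\<^sup>2 * W x)"
      proof (rule integral_mono_AE)
        have gu: "AE x in lebesgue_on \<Omega>. grad u x = inverse (2 * \<zeta> x) *\<^sub>R \<tau> x" using eq by (simp add: equilibrium_def)
        show "AE x in lebesgue_on \<Omega>. \<bar>?E x\<bar> \<le> s\<^sup>2 * W x"
          using gu U_adm_add_scaled(2)[OF u \<phi>, of s] AE_space
        proof eventually_elim
          case (elim x)
          then have x: "x \<in> \<Omega>" by simp
          have r: "dual_root \<alpha> c ((norm (\<tau> x))\<^sup>2) (\<zeta> x)" "\<zeta> x \<noteq> 0" using eq x by (auto simp: equilibrium_def)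
          have "(g x)\<^sup>2 = c * \<zeta> x + \<alpha>" unfolding g_def elim(1) by (rule norm_half_root[OF r])
          moreover have "\<bar>c * \<zeta> x\<bar> \<le> c * C" using C[OF x] c by (simp add: abs_mult)
          ultimately have g2: "(g x)\<^sup>2 \<le> c * C + \<bar>\<alpha>\<bar>" by linarith
          have "?E x = s\<^sup>2 * (\<zeta> x * (w x)\<^sup>2 + 1/2 * \<beta> * (2 * (grad u x \<bullet> grad \<phi> x) + s * (w x)\<^sup>2)\<^sup>2)"
            unfolding elim(2) w_def by (simp add: excess_energy_scaleR)
          moreover have "\<bar>\<zeta> x * (w x)\<^sup>2 + 1/2 * \<beta> * (2 * (grad u x \<bullet> grad \<phi> x) + s * (w x)\<^sup>2)\<^sup>2\<bar> \<le> W x"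
          proof -
            have sq: "(a + b)\<^sup>2 \<le> 2 * (a\<^sup>2 + b\<^sup>2)" for a b :: real
              using zero_le_power2[of "a - b"] by (simp add: power2_sum power2_diff)
            have "(grad u x \<bullet> grad \<phi> x)\<^sup>2 \<le> (g x)\<^sup>2 * (w x)\<^sup>2"
              using Cauchy_Schwarz_ineq[of "grad u x" "grad \<phi> x"] by (simp add: g_def w_def power2_norm_eq_inner)
            also have "\<dots> \<le> (c * C + \<bar>\<alpha>\<bar>) * (w x)\<^sup>2" using g2 by (intro mult_right_mono) auto
            finally have "4 * (grad u x \<bullet> grad \<phi> x)\<^sup>2 \<le> 4 * ((c * C + \<bar>\<alpha>\<bar>) * (w x)\<^sup>2)" by simp
            then have a: "(2 * (grad u x \<bullet> grad \<phi> x))\<^sup>2 \<le> 4 * (c * C + \<bar>\<alpha>\<bar>) * (w x)\<^sup>2"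
              by (simp only: power_mult_distrib mult.assoc) simp
            have "s\<^sup>2 \<le> 1" using s by (simp add: abs_square_le_1)
            then have "s\<^sup>2 * w x ^ 4 \<le> 1 * w x ^ 4" by (intro mult_right_mono) (auto simp: w_def)
            then have b: "(s * (w x)\<^sup>2)\<^sup>2 \<le> w x ^ 4" by (simp add: power_mult_distrib flip: power_mult)
            have "1/2 * \<beta> * (2 * (grad u x \<bullet> grad \<phi> x) + s * (w x)\<^sup>2)\<^sup>2
                \<le> 1/2 * \<beta> * (2 * (4 * (c * C + \<bar>\<alpha>\<bar>) * (w x)\<^sup>2 + w x ^ 4))"
              using \<beta>_pos a b by (intro mult_left_mono order_trans[OF sq]) auto
            also have "\<dots> = \<beta> * (4 * (c * C + \<bar>\<alpha>\<bar>) * (w x)\<^sup>2 + w x ^ 4)" by simp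
            finally have "1/2 * \<beta> * (2 * (grad u x \<bullet> grad \<phi> x) + s * (w x)\<^sup>2)\<^sup>2
                \<le> \<beta> * (4 * (c * C + \<bar>\<alpha>\<bar>) * (w x)\<^sup>2 + w x ^ 4)" .
            moreover have "\<bar>\<zeta> x * (w x)\<^sup>2\<bar> \<le> C * (w x)\<^sup>2" using C[OF x] by (simp add: abs_mult mult_right_mono)
            moreover have "0 \<le> 1/2 * \<beta> * (2 * (grad u x \<bullet> grad \<phi> x) + s * (w x)\<^sup>2)\<^sup>2" using \<beta>_pos by simp
            ultimately show ?thesis unfolding W_def by linarith
          qed
          ultimately show ?case by (simp add: abs_mult mult_left_mono)
        qed
      qed (use primal_diff(1)[OF eq v] W in auto)
      finally show ?thesis .
    qed
    ultimately show "\<bar>P ?v - P (\<lambda>x. u x + 0 * \<phi> x) - s * 0\<bar> \<le> s\<^sup>2 * (LINT x|lebesgue_on \<Omega>. W x)"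
      by simp
  qed
qed

text \<open>
  For \<open>\<zeta> > 0\<close> the excess energy is at least \<open>\<zeta> |w|\<^sup>2\<close>. A second minimizer thus has the same weak
  gradient; the difference is constant on the connected region and vanishes on the fixed part of
  the boundary.
\<close>

lemma equilibrium_minimizer:
  assumes eq: "equilibrium \<zeta> u" and pos: "\<And>x. x \<in> \<Omega> \<Longrightarrow> 0 < \<zeta> x" and v: "v \<in> U"
  shows "P u \<le> P v" and "P v = P u \<Longrightarrow> x \<in> closure \<Omega> \<Longrightarrow> v x = u x"
proof -
  have u: "u \<in> U" using eq by (simp add: equilibrium_def)
  let ?E = "\<lambda>x. excess_energy \<beta> (\<zeta> x) (grad u x) (grad v x - grad u x)"
  note E = primal_diff[OF eq v]
  have lower: "\<zeta> x * (norm w)\<^sup>2 \<le> excess_energy \<beta> (\<zeta> x) g w" for x and g w :: 'a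
    using \<beta>_pos by (simp add: excess_energy_def)
  have nonneg: "0 \<le> ?E x" if "x \<in> \<Omega>" for x
    by (rule order_trans[OF _ lower]) (use pos[OF that] in simp)
  have "0 \<le> (LINT x|lebesgue_on \<Omega>. ?E x)"
    by (rule Bochner_Integration.integral_nonneg) (simp add: nonneg)
  then show "P u \<le> P v" using E(2) by simp
  assume "P v = P u" and x: "x \<in> closure \<Omega>"
  then have "(LINT x|lebesgue_on \<Omega>. ?E x) = 0" using E(2) by simp
  then have "AE x in lebesgue_on \<Omega>. ?E x = 0"
    using E(1) nonneg by (subst (asm) integral_nonneg_eq_0_iff_AE) auto
  then have same: "AE x in lebesgue_on \<Omega>. grad v x = grad u x"
    using AE_space
  proof eventually_elim
    case (elim x)
    then have "\<zeta> x * (norm (grad v x - grad u x))\<^sup>2 \<le> 0" using lower[of x "grad v x - grad u x" "grad u x"] by simp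
    then show ?case using pos[of x] elim(2) by (simp add: mult_le_0_iff)
  qed
  define d where "d x = v x + (-1) * u x" for x
  have dU: "d \<in> U" unfolding d_def by (rule U_adm_add_scaled(1)[OF v u])
  have "AE x in lebesgue_on \<Omega>. grad d x = 0"
    using U_adm_add_scaled(2)[OF v u, of "-1"] same unfolding d_def[symmetric] by eventually_elim simp
  then have zero: "(LINT x|lebesgue_on \<Omega>. (grad d x \<bullet> h) * \<phi> x) = 0" for \<phi> h
    by (intro integral_eq_zero_AE) (auto elim: eventually_mono)
  have "d constant_on \<Omega>"
  proof (rule constant_on_if_weak_gradient_zero[OF \<Omega>(1,2) U_admD(2)[OF dU]])
    show "(LINT x|lebesgue_on \<Omega>. d x * frechet_derivative \<phi> (at x) h) = 0" if "test_function \<Omega> \<phi>" for \<phi> h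
      using has_weak_gradientD[OF U_admD(3)[OF dU] that, of h] zero by simp
  qed
  then obtain k where k: "\<And>x. x \<in> \<Omega> \<Longrightarrow> d x = k" by (auto simp: constant_on_def)
  have k': "d x = k" if "x \<in> closure \<Omega>" for x
    using continuous_constant_on_closure[OF U_admD(1)[OF dU] k that] .
  obtain y where y: "y \<in> \<Gamma>u" using \<Gamma>u(3) by blast
  then have "y \<in> closure \<Omega>" using \<Gamma>u(1) \<Omega>(8) by blast
  then have "k = 0" using k'[of y] U_admD(8)[OF dU y] by simp
  then show "v x = u x" using k'[OF x] by (simp add: d_def)
qed

lemma equilibrium_local:
  assumes eq: "equilibrium \<zeta> u" and v: "v \<in> gradient_nbhd \<Omega> \<Gamma>u \<delta> u"
  shows "(\<And>x w. x \<in> \<Omega> \<Longrightarrow> norm w < \<delta> x \<Longrightarrow> excess_energy \<beta> (\<zeta> x) (inverse (2 * \<zeta> x) *\<^sub>R \<tau> x) w \<le> 0) \<Longrightarrow> P v \<le> P u"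
    and "(\<And>x w. x \<in> \<Omega> \<Longrightarrow> norm w < \<delta> x \<Longrightarrow> 0 \<le> excess_energy \<beta> (\<zeta> x) (inverse (2 * \<zeta> x) *\<^sub>R \<tau> x) w) \<Longrightarrow> P u \<le> P v"
proof -
  have vU: "v \<in> U" and near: "AE x in lebesgue_on \<Omega>. norm (grad v x - grad u x) < \<delta> x"
    using v by (auto simp: gradient_nbhd_def)
  have gu: "AE x in lebesgue_on \<Omega>. grad u x = inverse (2 * \<zeta> x) *\<^sub>R \<tau> x" using eq by (simp add: equilibrium_def)
  let ?E = "\<lambda>x. excess_energy \<beta> (\<zeta> x) (grad u x) (grad v x - grad u x)"
  note E = primal_diff[OF eq vU]
  show "P v \<le> P u"
    if le: "\<And>x w. x \<in> \<Omega> \<Longrightarrow> norm w < \<delta> x \<Longrightarrow> excess_energy \<beta> (\<zeta> x) (inverse (2 * \<zeta> x) *\<^sub>R \<tau> x) w \<le> 0"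
  proof -
    have "AE x in lebesgue_on \<Omega>. ?E x \<le> 0"
      using near gu AE_space
    proof eventually_elim
      case (elim x)
      then show ?case using le[OF _ elim(1)] by simp
    qed
    from integral_mono_AE[OF E(1) _ this] have "(LINT x|lebesgue_on \<Omega>. ?E x) \<le> 0" by simp
    then show ?thesis using E(2) by simp
  qed
  show "P u \<le> P v"
    if ge: "\<And>x w. x \<in> \<Omega> \<Longrightarrow> norm w < \<delta> x \<Longrightarrow> 0 \<le> excess_energy \<beta> (\<zeta> x) (inverse (2 * \<zeta> x) *\<^sub>R \<tau> x) w"
  proof -
    have "AE x in lebesgue_on \<Omega>. 0 \<le> ?E x"
      using near gu AE_space
    proof eventually_elim
      case (elim x)
      then show ?case using ge[OF _ elim(1)] by simp
    qed
    from integral_nonneg_AE[OF this] show ?thesis using E(2) by simp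
  qed
qed

end

section \<open>Extrema of the dual functional\<close>

lemma is_arg_maxI: "Q x \<Longrightarrow> (\<And>y. Q y \<Longrightarrow> f y \<le> f x) \<Longrightarrow> is_arg_max f Q x"
  for f :: "'b \<Rightarrow> real"
  by (force simp: is_arg_max_def)

lemma is_arg_minI: "Q x \<Longrightarrow> (\<And>y. Q y \<Longrightarrow> f x \<le> f y) \<Longrightarrow> is_arg_min f Q x"
  for f :: "'b \<Rightarrow> real"
  by (force simp: is_arg_min_def)

lemma SUP_eq_attained: "x \<in> A \<Longrightarrow> (\<And>y. y \<in> A \<Longrightarrow> f y \<le> f x) \<Longrightarrow> (SUP y\<in>A. f y) = f x"
  for f :: "'b \<Rightarrow> real"
  by (intro cSup_eq_maximum) auto

lemma INF_eq_attained: "x \<in> A \<Longrightarrow> (\<And>y. y \<in> A \<Longrightarrow> f x \<le> f y) \<Longrightarrow> (INF y\<in>A. f y) = f x"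
  for f :: "'b \<Rightarrow> real"
  by (intro cInf_eq_minimum) auto

context shear_field
begin

lemma dual_maximizer_on_S:
  assumes cont: "continuous_on \<Omega> \<zeta>" and root: "\<And>x. x \<in> \<Omega> \<Longrightarrow> dual_root \<alpha> c (T x) (\<zeta> x)"
    and pos: "\<And>x. x \<in> \<Omega> \<Longrightarrow> 0 \<le> \<zeta> x \<and> - \<alpha> / c \<le> \<zeta> x" and \<beta>: "\<beta> * c = 1"
  shows "\<zeta> \<in> S_adm \<Omega> \<tau> \<alpha> \<beta>" and "\<xi> \<in> S_adm \<Omega> \<tau> \<alpha> \<beta> \<Longrightarrow> dual_functional \<Omega> \<tau> \<alpha> c \<beta>o \<xi> \<le> dual_functional \<Omega> \<tau> \<alpha> c \<beta>o \<zeta>"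
proof -
  have ab: "- \<alpha> * \<beta> = - \<alpha> / c" using \<beta> c by (simp add: field_simps)
  note \<zeta> = dual_root_field[OF cont root]
  show "\<zeta> \<in> S_adm \<Omega> \<tau> \<alpha> \<beta>"
    using \<zeta>(2) pos unfolding S_adm_def E_adm_def dual_domain_def ab by auto
  assume \<xi>: "\<xi> \<in> S_adm \<Omega> \<tau> \<alpha> \<beta>"
  then have \<xi>d: "\<xi> \<in> dual_domain \<Omega> \<tau>" and \<xi>0: "\<And>x. x \<in> \<Omega> \<Longrightarrow> 0 \<le> \<xi> x"
    by (auto simp: S_adm_def E_adm_def dual_domain_def)
  show "dual_functional \<Omega> \<tau> \<alpha> c \<beta>o \<xi> \<le> dual_functional \<Omega> \<tau> \<alpha> c \<beta>o \<zeta>"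
  proof (rule dual_functional_mono[OF \<xi>d \<zeta>(2)])
    show "AE x in lebesgue_on \<Omega>. dual_density \<alpha> c (T x) (\<zeta> x) \<le> dual_density \<alpha> c (T x) (\<xi> x)"
      using dual_domainD(4)[OF \<xi>d] AE_space
    proof eventually_elim
      case (elim x)
      then have "x \<in> \<Omega>" by simp
      then show ?case
        using elim(1) root pos \<xi>0 by (intro dual_density_min_positive[OF c]) auto
    qed
  qed
qed

lemma dual_maximizer_negative:
  assumes cont: "continuous_on \<Omega> \<zeta>" and root: "\<And>x. x \<in> \<Omega> \<Longrightarrow> dual_root \<alpha> c (T x) (\<zeta> x)"
    and \<alpha>: "0 < \<alpha>" and \<zeta>: "\<And>x. x \<in> \<Omega> \<Longrightarrow> \<zeta> x \<le> - 2 * \<alpha> / (3 * c)"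
    and \<xi>: "\<xi> \<in> dual_domain \<Omega> \<tau>" "\<And>x. x \<in> \<Omega> \<Longrightarrow> \<xi> x \<le> - 2 * \<alpha> / (3 * c)"
  shows "dual_functional \<Omega> \<tau> \<alpha> c \<beta>o \<xi> \<le> dual_functional \<Omega> \<tau> \<alpha> c \<beta>o \<zeta>"
  using root \<zeta> \<xi>(2)
  by (intro dual_functional_mono[OF \<xi>(1) dual_root_field(2)[OF cont root]] AE_I2 dual_density_min_negative[OF c \<alpha>]) auto

lemma dual_minimizer_negative:
  assumes cont: "continuous_on \<Omega> \<zeta>" and root: "\<And>x. x \<in> \<Omega> \<Longrightarrow> dual_root \<alpha> c (T x) (\<zeta> x)"
    and \<zeta>: "\<And>x. x \<in> \<Omega> \<Longrightarrow> - 2 * \<alpha> / (3 * c) \<le> \<zeta> x"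
    and \<xi>: "\<xi> \<in> dual_domain \<Omega> \<tau>" "\<And>x. x \<in> \<Omega> \<Longrightarrow> - 2 * \<alpha> / (3 * c) \<le> \<xi> x \<and> \<xi> x < 0"
  shows "dual_functional \<Omega> \<tau> \<alpha> c \<beta>o \<zeta> \<le> dual_functional \<Omega> \<tau> \<alpha> c \<beta>o \<xi>"
  using root \<zeta> \<xi>(2)
  by (intro dual_functional_mono[OF dual_root_field(2)[OF cont root] \<xi>(1)] AE_I2 dual_density_max_negative[OF c]) auto

text \<open>
  Where \<open>\<tau>\<close> vanishes, \<open>\<zeta>\<close> takes the excluded end value \<open>- \<alpha> / c\<close>, so the supremum over the open
  range of values need not be attained. It is approached by moving \<open>\<zeta>\<close> a fraction \<open>k\<close> of the way
  to the midpoint \<open>m\<close> of the range, which costs only \<open>O(k\<^sup>2)\<close> by \<open>dual_density_diff\<close>.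
\<close>

lemma dual_SUP_negative:
  assumes cont: "continuous_on \<Omega> \<zeta>" and root: "\<And>x. x \<in> \<Omega> \<Longrightarrow> dual_root \<alpha> c (T x) (\<zeta> x)"
    and \<alpha>: "0 < \<alpha>" and \<zeta>: "\<And>x. x \<in> \<Omega> \<Longrightarrow> - \<alpha> / c \<le> \<zeta> x \<and> \<zeta> x < - 2 * \<alpha> / (3 * c)"
  defines "S3 \<equiv> {\<xi> \<in> dual_domain \<Omega> \<tau>. \<forall>x\<in>\<Omega>. - \<alpha> / c < \<xi> x \<and> \<xi> x < - 2 * \<alpha> / (3 * c)}"
  shows "bdd_above (dual_functional \<Omega> \<tau> \<alpha> c \<beta>o ` S3)"
    and "(SUP \<xi>\<in>S3. dual_functional \<Omega> \<tau> \<alpha> c \<beta>o \<xi>) = dual_functional \<Omega> \<tau> \<alpha> c \<beta>o \<zeta>"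
proof -
  interpret finite_measure "lebesgue_on \<Omega>" by (rule nice_regionD(11)[OF nice])
  let ?D = "dual_functional \<Omega> \<tau> \<alpha> c \<beta>o"
  let ?l = "- \<alpha> / c" and ?r = "- 2 * \<alpha> / (3 * c)"
  have le: "?D \<xi> \<le> ?D \<zeta>" if "\<xi> \<in> S3" for \<xi>
    using that \<zeta> unfolding S3_def
    by (intro dual_maximizer_negative[OF cont root \<alpha>]) (auto simp: less_imp_le)
  show "bdd_above (?D ` S3)" using le by (intro bdd_aboveI2[of _ _ "?D \<zeta>"]) auto
  have lr: "?l < ?r" "?r < 0" using \<alpha> c by (simp_all add: field_simps)
  define m where "m = (?l + ?r) / 2"
  have m: "?l < m" "m < ?r" using lr by (simp_all add: m_def field_simps)
  define \<xi> where "\<xi> k x = \<zeta> x + k * (m - \<zeta> x)" for k x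
  have \<xi>_range: "?l < \<xi> k x \<and> \<xi> k x < ?r" if k: "0 < k" "k < 1" and x: "x \<in> \<Omega>" for k x
  proof -
    have "\<xi> k x = (1 - k) * \<zeta> x + k * m" by (simp add: \<xi>_def algebra_simps)
    moreover have "(1 - k) * ?l + k * ?l < (1 - k) * \<zeta> x + k * m"
      using k m \<zeta>[OF x] by (intro add_le_less_mono mult_left_mono mult_strict_left_mono) auto
    moreover have "(1 - k) * \<zeta> x + k * m < (1 - k) * ?r + k * ?r"
      using k m \<zeta>[OF x] by (intro add_strict_mono mult_strict_left_mono) auto
    moreover have conv: "(1 - k) * w + k * w = w" for w by (simp add: algebra_simps)
    ultimately show ?thesis unfolding conv by simp
  qed
  note \<zeta>d = dual_root_field(2)[OF cont root]
  have \<xi>_S3: "\<xi> k \<in> S3" if k: "0 < k" "k < 1" for k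
  proof -
    have c\<xi>: "continuous_on \<Omega> (\<xi> k)" unfolding \<xi>_def by (intro continuous_intros cont)
    have meas: "\<xi> k \<in> borel_measurable (lebesgue_on \<Omega>)"
      by (rule continuous_imp_measurable_on_sets_lebesgue[OF c\<xi> nice_regionD(5)[OF nice]])
    have abs: "\<bar>\<xi> k x\<bar> \<le> - ?l" "- ?r \<le> \<bar>\<xi> k x\<bar>" if "x \<in> \<Omega>" for x
      using \<xi>_range[OF k that] lr by auto
    have "integrable (lebesgue_on \<Omega>) (\<lambda>x. (\<xi> k x)\<^sup>2)"
    proof (rule integrable_const_bound[of _ "?l\<^sup>2"])
      show "AE x in lebesgue_on \<Omega>. norm ((\<xi> k x)\<^sup>2) \<le> ?l\<^sup>2"
      proof (rule AE_I2)
        fix x assume "x \<in> space (lebesgue_on \<Omega>)"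
        then have "\<bar>\<xi> k x\<bar>\<^sup>2 \<le> (- ?l)\<^sup>2" using abs(1)[of x] by (intro power_mono) auto
        then show "norm ((\<xi> k x)\<^sup>2) \<le> ?l\<^sup>2" by simp
      qed
    qed (use meas in measurable)
    moreover obtain B where B: "0 \<le> B" "\<And>x. x \<in> closure \<Omega> \<Longrightarrow> norm (\<tau> x) \<le> B" using \<tau>_bounded by metis
    have "integrable (lebesgue_on \<Omega>) (\<lambda>x. T x / \<xi> k x)"
    proof (rule integrable_const_bound[of _ "B\<^sup>2 / - ?r"])
      show "AE x in lebesgue_on \<Omega>. norm (T x / \<xi> k x) \<le> B\<^sup>2 / - ?r"
      proof (rule AE_I2)
        fix x assume "x \<in> space (lebesgue_on \<Omega>)"
        then have x: "x \<in> \<Omega>" by simp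
        have "T x \<le> B\<^sup>2" using B(2)[of x] x closure_subset[of \<Omega>] by (intro power_mono) auto
        then have "T x / \<bar>\<xi> k x\<bar> \<le> B\<^sup>2 / - ?r" using abs(2)[OF x] lr(2) by (intro frac_le) auto
        then show "norm (T x / \<xi> k x) \<le> B\<^sup>2 / - ?r" by (simp add: abs_divide)
      qed
    qed (use meas \<tau>_measurable in measurable)
    moreover have "AE x in lebesgue_on \<Omega>. \<xi> k x = 0 \<longrightarrow> \<tau> x = 0"
      using \<xi>_range[OF k] lr(2) by (intro AE_I2) force
    ultimately have "\<xi> k \<in> dual_domain \<Omega> \<tau>"
      using meas by (simp add: dual_domain_def L2_fun_def quotient_integrable_def)
    then show ?thesis using \<xi>_range[OF k] by (simp add: S3_def)
  qed
  \<comment> \<open>Bounds for the two factors of \<open>dual_density_diff\<close>: the shift is at most \<open>k \<alpha> / c\<close>, and the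
    quotient is at most \<open>5 \<alpha> / (4 \<alpha> / (3 c)) = 15 c / 4\<close>.\<close>
  define C where "C = (\<alpha> / c)\<^sup>2 * (15 * c / 4)"
  have C: "0 < C" using \<alpha> c by (simp add: C_def)
  define V where "V = measure (lebesgue_on \<Omega>) \<Omega>"
  have V: "0 \<le> V" by (simp add: V_def)
  have approx: "?D \<zeta> - ?D (\<xi> k) \<le> k\<^sup>2 * C * V" if k: "0 < k" "k < 1" for k
  proof -
    have \<xi>d: "\<xi> k \<in> dual_domain \<Omega> \<tau>" using \<xi>_S3[OF k] by (simp add: S3_def)
    have "?D \<zeta> - ?D (\<xi> k) = (LINT x|lebesgue_on \<Omega>. dual_density \<alpha> c (T x) (\<xi> k x) - dual_density \<alpha> c (T x) (\<zeta> x))"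
      using dual_domainD(6)[OF \<xi>d] dual_domainD(6)[OF \<zeta>d] by (simp add: dual_functional_eq[OF \<xi>d] dual_functional_eq[OF \<zeta>d])
    also have "\<dots> \<le> (LINT x|lebesgue_on \<Omega>. k\<^sup>2 * C)"
    proof (rule integral_mono)
      fix x assume "x \<in> space (lebesgue_on \<Omega>)"
      then have x: "x \<in> \<Omega>" by simp
      define z r where "z = \<xi> k x" and "r = \<zeta> x"
      have z: "?l < z" "z < ?r" and r: "?l \<le> r" "r < ?r" using \<xi>_range[OF k x] \<zeta>[OF x] by (auto simp: z_def r_def)
      have z0: "z < 0" using z lr by linarith
      have "dual_density \<alpha> c (T x) z - dual_density \<alpha> c (T x) r = (z - r)\<^sup>2 * ((2 * \<alpha> + 2 * c * r + c * z) / (2 * z))"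
        using dual_density_diff[OF root[OF x], of z] z0 by (simp add: r_def)
      also have "\<dots> \<le> (k\<^sup>2 * (\<alpha> / c)\<^sup>2) * (15 * c / 4)"
      proof (rule mult_mono)
        have "z - r = k * (m - r)" by (simp add: z_def r_def \<xi>_def)
        moreover have "\<bar>m - r\<bar> \<le> \<alpha> / c" using m r lr by (simp add: abs_le_iff)
        then have "\<bar>m - r\<bar>\<^sup>2 \<le> (\<alpha> / c)\<^sup>2" by (rule power_mono) simp
        ultimately show "(z - r)\<^sup>2 \<le> k\<^sup>2 * (\<alpha> / c)\<^sup>2" by (simp add: power_mult_distrib mult_left_mono)
        have cr: "- \<alpha> \<le> c * r" "- \<alpha> \<le> c * z" "c * z \<le> - 2 * \<alpha> / 3" "c * r \<le> - 2 * \<alpha> / 3"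
          using z r c by (simp_all add: field_simps)
        have "(2 * \<alpha> + 2 * c * r + c * z) / (2 * z) = - ((2 * \<alpha> + 2 * c * r + c * z)) / (- 2 * z)"
          using z0 by (simp add: field_simps)
        also have "\<dots> \<le> 5 * \<alpha> / (4 * \<alpha> / (3 * c))"
        proof (rule frac_le)
          show "4 * \<alpha> / (3 * c) \<le> - 2 * z" using z(2) by simp
          show "0 < 4 * \<alpha> / (3 * c)" using \<alpha> c by simp
        qed (use cr \<alpha> in linarith)+
        also have "\<dots> = 15 * c / 4" using \<alpha> c by (simp add: field_simps)
        finally show "(2 * \<alpha> + 2 * c * r + c * z) / (2 * z) \<le> 15 * c / 4" .
        show "0 \<le> (2 * \<alpha> + 2 * c * r + c * z) / (2 * z)"
          using cr z0 by (intro divide_nonpos_neg) linarith+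
      qed auto
      also have "\<dots> = k\<^sup>2 * C" by (simp add: C_def)
      finally show "dual_density \<alpha> c (T x) (\<xi> k x) - dual_density \<alpha> c (T x) (\<zeta> x) \<le> k\<^sup>2 * C" by (simp add: z_def r_def)
    qed (use dual_domainD(6)[OF \<xi>d] dual_domainD(6)[OF \<zeta>d] in auto)
    also have "\<dots> = k\<^sup>2 * C * V" by (simp add: V_def)
    finally show ?thesis .
  qed
  show "(SUP \<xi>\<in>S3. ?D \<xi>) = ?D \<zeta>"
  proof (rule cSup_eq_non_empty)
    show "?D ` S3 \<noteq> {}" using \<xi>_S3[of "1/2"] by auto
    show "y \<le> ?D \<zeta>" if "y \<in> ?D ` S3" for y using that le by auto
    fix y assume y: "\<And>d. d \<in> ?D ` S3 \<Longrightarrow> d \<le> y"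
    show "?D \<zeta> \<le> y"
    proof (rule field_le_epsilon)
      fix e :: real assume e: "0 < e"
      \<comment> \<open>Small enough for \<open>k\<^sup>2 * C * V \<le> e\<close>, and below \<open>1\<close>; the summand \<open>1\<close> avoids division by
        zero.\<close>
      define k where "k = min (1/2) (e / (C * V + 1))"
      have CV: "0 \<le> C * V" using C V by simp
      have k: "0 < k" "k < 1" "k \<le> e / (C * V + 1)" using e CV by (auto simp: k_def)
      have "k\<^sup>2 * C * V = k * (k * (C * V))" by (simp add: power2_eq_square)
      also have "\<dots> \<le> 1 * (e / (C * V + 1) * (C * V + 1))"
        using k CV e by (intro mult_mono) auto
      also have "\<dots> = e" using CV by simp
      finally have "?D \<zeta> - ?D (\<xi> k) \<le> e" using approx[OF k(1,2)] by linarith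
      moreover have "?D (\<xi> k) \<le> y" using y \<xi>_S3[OF k(1,2)] by blast
      ultimately show "?D \<zeta> \<le> y + e" by linarith
    qed
  qed
qed

end

section \<open>Real branches of Cardano's formulas\<close>

text \<open>
  Cardano's formulas solve \<open>8 z\<^sup>2 (c z + \<alpha>) = s\<^sup>2\<close>; for \<open>s\<^sup>2 = 2 n\<^sup>2\<close> this is twice the dual
  algebraic equation.
\<close>

lemma dual_roots_set:
  assumes c: "0 < c" and n: "0 \<le> n"
  shows "{z. 4 * z\<^sup>2 * (of_real c * z + of_real \<alpha>) = of_real (n\<^sup>2)}
    = {cubic_root1 \<alpha> c (sqrt 2 * n), cubic_root2 \<alpha> c (sqrt 2 * n), cubic_root3 \<alpha> c (sqrt 2 * n)}"
proof -
  have "4 * z\<^sup>2 * (of_real c * z + of_real \<alpha>) = of_real (n\<^sup>2)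
    \<longleftrightarrow> 8 * z\<^sup>2 * (of_real c * z + of_real \<alpha>) = of_real ((sqrt 2 * n)\<^sup>2)" for z :: complex
  proof -
    have "8 * z\<^sup>2 * (of_real c * z + of_real \<alpha>) = 2 * (4 * z\<^sup>2 * (of_real c * z + of_real \<alpha>))" by simp
    moreover have "complex_of_real ((sqrt 2 * n)\<^sup>2) = 2 * of_real (n\<^sup>2)" by (simp only: power_mult_distrib) simp
    ultimately show ?thesis by (simp add: mult.assoc)
  qed
  then show ?thesis using cubic_roots_set[OF c, of "sqrt 2 * n" \<alpha>] n by simp
qed

lemma dual_root_Re:
  assumes c: "0 < c" and n: "0 \<le> n" and w: "w \<in> \<real>"
    "w \<in> {cubic_root1 \<alpha> c (sqrt 2 * n), cubic_root2 \<alpha> c (sqrt 2 * n), cubic_root3 \<alpha> c (sqrt 2 * n)}"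
  shows "dual_root \<alpha> c (n\<^sup>2) (Re w)"
proof -
  have "4 * w\<^sup>2 * (of_real c * w + of_real \<alpha>) = of_real (n\<^sup>2)"
    using w(2) dual_roots_set[OF c n, of \<alpha>] by blast
  moreover have "w = of_real (Re w)" using w(1) by simp
  ultimately have "complex_of_real (4 * (Re w)\<^sup>2 * (c * Re w + \<alpha>)) = of_real (n\<^sup>2)"
    by (metis of_real_add of_real_mult of_real_numeral of_real_power)
  then show ?thesis by (simp only: of_real_eq_iff)
qed

lemma discriminant_iff:
  assumes "0 < c"
  shows "27 * c\<^sup>2 * (sqrt 2 * n)\<^sup>2 \<le> 32 * \<alpha> ^ 3 \<longleftrightarrow> n\<^sup>2 \<le> 16 * \<alpha> ^ 3 / (27 * c\<^sup>2)"
  using assms by (simp add: power_mult_distrib pos_le_divide_eq mult_ac)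

context shear_field
begin

lemma continuous_on_T: "X \<subseteq> closure \<Omega> \<Longrightarrow> continuous_on X (\<lambda>x. T x)"
  by (intro continuous_intros continuous_on_subset[OF \<tau>c])

text \<open>
  The cubic of the branch is the continuous function \<open>|\<tau>|\<^sup>2\<close>, and the branch stays in an
  interval on which the cubic is injective.
\<close>

lemma positive_branch_continuous:
  "continuous_on (closure \<Omega>) (\<lambda>x. Re (cubic_root1 \<alpha> c (sqrt 2 * norm (\<tau> x))))"
proof -
  let ?f = "\<lambda>x. Re (cubic_root1 \<alpha> c (sqrt 2 * norm (\<tau> x)))"
  have root: "dual_root \<alpha> c (T x) (?f x)" for x
    by (intro dual_root_Re c cubic_root1_real) auto
  obtain C where C: "\<And>x. x \<in> closure \<Omega> \<Longrightarrow> \<bar>?f x\<bar> \<le> C" using dual_root_bounded root by metis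
  show ?thesis
  proof (rule continuous_on_injective_branch[where q = "dual_cubic \<alpha> c" and l = "max 0 (- \<alpha> / c)" and r = C])
    show "inj_on (dual_cubic \<alpha> c) {max 0 (- \<alpha> / c)..C}"
      by (rule inj_on_subset[OF inj_on_dual_cubic_positive[OF c]]) auto
    show "?f x \<in> {max 0 (- \<alpha> / c)..C}" if "x \<in> closure \<Omega>" for x
      using C[OF that] cubic_root1_real(2,3)[OF c, of "sqrt 2 * norm (\<tau> x)" \<alpha>] by auto
    show "continuous_on (closure \<Omega>) (\<lambda>x. dual_cubic \<alpha> c (?f x))"
      unfolding dual_cubic_def root by (rule continuous_on_T) simp
  qed (rule continuous_on_dual_cubic)
qed

lemma negative_branches:
  assumes \<alpha>: "0 < \<alpha>" and x: "T x \<le> 16 * \<alpha> ^ 3 / (27 * c\<^sup>2)"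
  defines "w2 \<equiv> cubic_root2 \<alpha> c (sqrt 2 * norm (\<tau> x))" and "w3 \<equiv> cubic_root3 \<alpha> c (sqrt 2 * norm (\<tau> x))"
  shows "w2 \<in> \<real>" "dual_root \<alpha> c (T x) (Re w2)" "- 2 * \<alpha> / (3 * c) \<le> Re w2" "Re w2 \<le> 0"
    and "w3 \<in> \<real>" "dual_root \<alpha> c (T x) (Re w3)" "- \<alpha> / c \<le> Re w3" "Re w3 \<le> - 2 * \<alpha> / (3 * c)"
proof -
  have D: "27 * c\<^sup>2 * (sqrt 2 * norm (\<tau> x))\<^sup>2 \<le> 32 * \<alpha> ^ 3" using discriminant_iff[OF c] x by blast
  note r = cubic_roots23_real[OF c _ \<alpha> D, folded w2_def w3_def, simplified]
  show w: "w2 \<in> \<real>" "w3 \<in> \<real>" using r by auto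
  show "dual_root \<alpha> c (T x) (Re w2)" "dual_root \<alpha> c (T x) (Re w3)"
    using w by (intro dual_root_Re c; simp add: w2_def w3_def)+
  show "- 2 * \<alpha> / (3 * c) \<le> Re w2" "Re w2 \<le> 0" "- \<alpha> / c \<le> Re w3" "Re w3 \<le> - 2 * \<alpha> / (3 * c)"
    using cubic_roots23_real[OF c _ \<alpha> D] by (simp_all add: w2_def w3_def)
qed

lemma negative_branches_continuous:
  assumes \<alpha>: "0 < \<alpha>" and X: "X \<subseteq> closure \<Omega>" "\<And>x. x \<in> X \<Longrightarrow> T x \<le> 16 * \<alpha> ^ 3 / (27 * c\<^sup>2)"
  shows "continuous_on X (\<lambda>x. Re (cubic_root2 \<alpha> c (sqrt 2 * norm (\<tau> x))))"
    and "continuous_on X (\<lambda>x. Re (cubic_root3 \<alpha> c (sqrt 2 * norm (\<tau> x))))"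
proof -
  note b = negative_branches[OF \<alpha> X(2)]
  show "continuous_on X (\<lambda>x. Re (cubic_root2 \<alpha> c (sqrt 2 * norm (\<tau> x))))"
  proof (rule continuous_on_injective_branch[where q = "dual_cubic \<alpha> c" and l = "- 2 * \<alpha> / (3 * c)" and r = 0])
    show "inj_on (dual_cubic \<alpha> c) {- 2 * \<alpha> / (3 * c)..0}"
      by (rule inj_on_subset[OF inj_on_dual_cubic_negative(2)[OF c \<alpha>]]) auto
    show "continuous_on X (\<lambda>x. dual_cubic \<alpha> c (Re (cubic_root2 \<alpha> c (sqrt 2 * norm (\<tau> x)))))"
      by (rule continuous_on_eq[OF continuous_on_T[OF X(1)]]) (simp only: dual_cubic_def b(2))
  qed (use b(3,4) in \<open>auto intro: continuous_on_dual_cubic\<close>)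
  show "continuous_on X (\<lambda>x. Re (cubic_root3 \<alpha> c (sqrt 2 * norm (\<tau> x))))"
  proof (rule continuous_on_injective_branch[where q = "dual_cubic \<alpha> c" and l = "- \<alpha> / c" and r = "- 2 * \<alpha> / (3 * c)"])
    show "inj_on (dual_cubic \<alpha> c) {- \<alpha> / c..- 2 * \<alpha> / (3 * c)}"
      by (rule inj_on_subset[OF inj_on_dual_cubic_negative(1)[OF c \<alpha>]]) auto
    show "continuous_on X (\<lambda>x. dual_cubic \<alpha> c (Re (cubic_root3 \<alpha> c (sqrt 2 * norm (\<tau> x)))))"
      by (rule continuous_on_eq[OF continuous_on_T[OF X(1)]]) (simp only: dual_cubic_def b(6))
  qed (use b(7,8) in \<open>auto intro: continuous_on_dual_cubic\<close>)
qed

text \<open>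
  The second or third formula is real at a point where \<open>\<tau>\<close> is nonzero only if \<open>\<alpha> > 0\<close> and
  \<open>|\<tau>|\<^sup>2\<close> is at most \<open>16 \<alpha> ^ 3 / (27 c\<^sup>2)\<close> there. Since \<open>\<tau>\<close> is nonzero somewhere, \<open>\<alpha> > 0\<close>, and
  then the bound also holds where \<open>\<tau>\<close> vanishes; so the branch lies in one of the negative ranges
  throughout.
\<close>

lemma real_root_fields:
  assumes nz: "\<not> (\<forall>x\<in>\<Omega>. \<tau> x = 0)"
    and Z: "Z \<in> {\<lambda>x. cubic_root1 \<alpha> c (sqrt 2 * norm (\<tau> x)), \<lambda>x. cubic_root2 \<alpha> c (sqrt 2 * norm (\<tau> x)),
      \<lambda>x. cubic_root3 \<alpha> c (sqrt 2 * norm (\<tau> x))}"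
    and real: "\<And>x. x \<in> \<Omega> \<Longrightarrow> Z x \<in> \<real>"
  shows "continuous_on \<Omega> (\<lambda>x. Re (Z x))" and "x \<in> \<Omega> \<Longrightarrow> dual_root \<alpha> c (T x) (Re (Z x))"
proof -
  show "dual_root \<alpha> c (T x) (Re (Z x))" if "x \<in> \<Omega>"
    using real[OF that] Z by (intro dual_root_Re c) auto
  show "continuous_on \<Omega> (\<lambda>x. Re (Z x))"
  proof (cases "Z = (\<lambda>x. cubic_root1 \<alpha> c (sqrt 2 * norm (\<tau> x)))")
    case True
    then show ?thesis using continuous_on_subset[OF positive_branch_continuous closure_subset] by simp
  next
    case False
    then have r: "cubic_root2 \<alpha> c (sqrt 2 * norm (\<tau> x)) \<in> \<real> \<or> cubic_root3 \<alpha> c (sqrt 2 * norm (\<tau> x)) \<in> \<real>"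
      if "x \<in> \<Omega>" for x
      using Z real[OF that] by auto
    obtain y where y: "y \<in> \<Omega>" "\<tau> y \<noteq> 0" using nz by blast
    then have \<alpha>: "0 < \<alpha>" using cubic_roots23_realD(1)[OF c _ r[OF y(1)]] by simp
    have "T x \<le> 16 * \<alpha> ^ 3 / (27 * c\<^sup>2)" if "x \<in> \<Omega>" for x
    proof (cases "\<tau> x = 0")
      case True then show ?thesis using \<alpha> by simp
    next
      case False
      then show ?thesis using cubic_roots23_realD(2)[OF c _ r[OF that]] discriminant_iff[OF c] by simp
    qed
    then show ?thesis using negative_branches_continuous[OF \<alpha> closure_subset] Z False by auto
  qed
qed

end

section \<open>Canonical duality for the anti-plane shear problem\<close>

theorem theorem7:
  fixes \<Omega> \<Gamma>u :: "'a::euclidean_space set"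
    and N \<tau> :: "'a \<Rightarrow> 'a"
    and t u1 u2 u3 :: "'a \<Rightarrow> real"
    and x0 :: 'a
    and \<mu> b \<epsilon> \<alpha> \<beta> \<beta>o c \<eta> :: real
    and Z1 Z2 Z3 :: "'a \<Rightarrow> complex"
    and \<zeta>1 \<zeta>2 \<zeta>3 :: "'a \<Rightarrow> real"
    and P Pd :: "('a \<Rightarrow> real) \<Rightarrow> real"
    and U S :: "('a \<Rightarrow> real) set"
  assumes dim: "DIM('a) = 1 \<or> DIM('a) = 2"
    and region: "nice_region \<Omega> N"
    and boundary: "\<Gamma>u \<subseteq> frontier \<Omega>" "\<Gamma>u \<in> sets borel" "x0 \<in> \<Gamma>u"
    and force: "set_borel_measurable borel (frontier \<Omega> - \<Gamma>u) t"
    and constants: "0 < \<mu>" "0 < b" "\<alpha> = \<epsilon> - 2 / b" "\<beta> = \<mu> * b / 4" "\<beta>o = \<mu> / (2 * b)"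
      "c = 4 / (\<mu> * b)" "\<eta> = 16 * \<alpha>^3 / (27 * c\<^sup>2)"
    and U: "U = U_adm \<Omega> \<Gamma>u"
    and S: "S = S_adm \<Omega> \<tau> \<alpha> \<beta>"
    and primal: "P = primal_functional \<Omega> \<Gamma>u t \<alpha> \<beta> \<beta>o"
    and dual: "Pd = dual_functional \<Omega> \<tau> \<alpha> c \<beta>o"
    and tau: "\<tau> \<in> T_adm \<Omega> N \<Gamma>u t"
    and tau_nonzero: "\<not> (\<forall>x\<in>\<Omega>. \<tau> x = 0)"
    and Z1: "Z1 = (\<lambda>x. cubic_root1 \<alpha> c (sqrt 2 * norm (\<tau> x)))"
    and Z2: "Z2 = (\<lambda>x. cubic_root2 \<alpha> c (sqrt 2 * norm (\<tau> x)))"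
    and Z3: "Z3 = (\<lambda>x. cubic_root3 \<alpha> c (sqrt 2 * norm (\<tau> x)))"
    and zeta: "\<zeta>1 = (\<lambda>x. Re (Z1 x))" "\<zeta>2 = (\<lambda>x. Re (Z2 x))" "\<zeta>3 = (\<lambda>x. Re (Z3 x))"
  shows
    "((\<forall>x\<in>\<Omega>. {z. 4 * z\<^sup>2 * (of_real c * z + of_real \<alpha>) = of_real ((norm (\<tau> x))\<^sup>2)}
                   = {Z1 x, Z2 x, Z3 x})
          \<and> (\<forall>\<zeta>. dual_critical \<Omega> \<tau> Pd \<zeta> \<longrightarrow>
               (AE x in lebesgue_on \<Omega>. of_real (\<zeta> x) \<in> {Z1 x, Z2 x, Z3 x}))
          \<and> (\<forall>Z\<in>{Z1, Z2, Z3}. (\<forall>x\<in>\<Omega>. Z x \<in> \<real>) \<longrightarrow> dual_critical \<Omega> \<tau> Pd (\<lambda>x. Re (Z x))))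
     \<and>
     (\<forall>(Z, u) \<in> {(Z1, u1), (Z2, u2), (Z3, u3)}.
            dual_displacement \<Omega> \<Gamma>u x0 \<tau> Z u \<longrightarrow> primal_critical P U u)
     \<and>
     ((\<forall>x\<in>\<Omega>. Z1 x \<in> \<real>)
          \<and> is_arg_max Pd (\<lambda>\<zeta>. \<zeta> \<in> S) \<zeta>1 \<and> (SUP \<zeta>\<in>S. Pd \<zeta>) = Pd \<zeta>1
          \<and> (dual_displacement \<Omega> \<Gamma>u x0 \<tau> Z1 u1 \<longrightarrow>
               is_arg_min P (\<lambda>u. u \<in> U) u1
               \<and> P u1 = (INF u\<in>U. P u) \<and> (INF u\<in>U. P u) = (SUP \<zeta>\<in>S. Pd \<zeta>)))
     \<and>
     ((\<forall>x\<in>\<Omega>. (norm (\<tau> x))\<^sup>2 < \<eta>) \<longrightarrow>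
            (let S3 = {\<zeta> \<in> dual_domain \<Omega> \<tau>. \<forall>x\<in>\<Omega>. - \<alpha> * \<beta> < \<zeta> x \<and> \<zeta> x < - 2 * \<alpha> * \<beta> / 3} in
             (\<forall>x\<in>\<Omega>. Z3 x \<in> \<real>)
             \<and> is_arg_max Pd (\<lambda>\<zeta>. \<zeta> \<in> dual_domain \<Omega> \<tau> \<and>
                   (\<forall>x\<in>\<Omega>. - \<alpha> * \<beta> \<le> \<zeta> x \<and> \<zeta> x < - 2 * \<alpha> * \<beta> / 3)) \<zeta>3
             \<and> ((\<forall>x\<in>\<Omega>. \<tau> x \<noteq> 0) \<longrightarrow> is_arg_max Pd (\<lambda>\<zeta>. \<zeta> \<in> S3) \<zeta>3)
             \<and> bdd_above (Pd ` S3) \<and> (SUP \<zeta>\<in>S3. Pd \<zeta>) = Pd \<zeta>3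
             \<and> (dual_displacement \<Omega> \<Gamma>u x0 \<tau> Z3 u3 \<longrightarrow>
                 (\<exists>\<delta>. continuous_on \<Omega> \<delta> \<and> (\<forall>x\<in>\<Omega>. 0 < \<delta> x)
                    \<and> ((\<forall>x\<in>closure \<Omega>. (norm (\<tau> x))\<^sup>2 < \<eta>) \<longrightarrow> (\<exists>d>0. \<forall>x\<in>\<Omega>. d \<le> \<delta> x))
                    \<and> (let U3 = gradient_nbhd \<Omega> \<Gamma>u \<delta> u3 in
                        is_arg_max P (\<lambda>u. u \<in> U3) u3
                        \<and> P u3 = (SUP u\<in>U3. P u) \<and> (SUP u\<in>U3. P u) = (SUP \<zeta>\<in>S3. Pd \<zeta>))))))
     \<and>
     (DIM('a) = 1 \<and> (\<forall>x\<in>\<Omega>. (norm (\<tau> x))\<^sup>2 < \<eta>) \<longrightarrow>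
            (let S2 = {\<zeta> \<in> dual_domain \<Omega> \<tau>. \<forall>x\<in>\<Omega>. - 2 * \<alpha> * \<beta> / 3 < \<zeta> x \<and> \<zeta> x < 0} in
             (\<forall>x\<in>\<Omega>. Z2 x \<in> \<real>)
             \<and> is_arg_min Pd (\<lambda>\<zeta>. \<zeta> \<in> S2) \<zeta>2 \<and> (INF \<zeta>\<in>S2. Pd \<zeta>) = Pd \<zeta>2
             \<and> (dual_displacement \<Omega> \<Gamma>u x0 \<tau> Z2 u2 \<longrightarrow>
                 (\<exists>d>0. let U2 = gradient_nbhd \<Omega> \<Gamma>u (\<lambda>x. d) u2 in
                    is_arg_min P (\<lambda>u. u \<in> U2) u2
                    \<and> P u2 = (INF u\<in>U2. P u) \<and> (INF u\<in>U2. P u) = (INF \<zeta>\<in>S2. Pd \<zeta>)))))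
     \<and>
     (0 < \<eta> \<and> (\<forall>x\<in>\<Omega>. \<eta> < (norm (\<tau> x))\<^sup>2) \<longrightarrow>
            (\<forall>x\<in>\<Omega>. \<forall>z::real. 4 * z\<^sup>2 * (c * z + \<alpha>) = (norm (\<tau> x))\<^sup>2 \<longleftrightarrow> z = \<zeta>1 x)
            \<and> dual_critical \<Omega> \<tau> Pd \<zeta>1
            \<and> (\<forall>\<zeta>. dual_critical \<Omega> \<tau> Pd \<zeta> \<longrightarrow> (AE x in lebesgue_on \<Omega>. \<zeta> x = \<zeta>1 x))
            \<and> (dual_displacement \<Omega> \<Gamma>u x0 \<tau> Z1 u1 \<longrightarrow>
                 is_arg_min P (\<lambda>u. u \<in> U) u1
                 \<and> (\<forall>v. is_arg_min P (\<lambda>u. u \<in> U) v \<longrightarrow> (\<forall>x\<in>closure \<Omega>. v x = u1 x))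
                 \<and> (\<exists>g. continuous_on (closure \<Omega>) g \<and>
                       (\<forall>x\<in>\<Omega>. (u1 has_derivative (\<lambda>h. g x \<bullet> h)) (at x)))))"
proof -
  define s where "s x = sqrt 2 * norm (\<tau> x)" for x
  have c: "0 < c" and \<beta>: "\<beta> * c = 1" using constants by simp_all
  have \<tau>c: "continuous_on (closure \<Omega>) \<tau>" using tau by (simp add: T_adm_def)
  interpret shear_problem \<Omega> N \<tau> \<alpha> c \<beta>o \<Gamma>u t \<beta>
    using dim region boundary force tau c \<beta> \<tau>c by unfold_locales auto
  have ab: "- \<alpha> * \<beta> = - \<alpha> / c" "- 2 * \<alpha> * \<beta> / 3 = - 2 * \<alpha> / (3 * c)"
    using \<beta> c by (simp_all add: field_simps)
  have b_eq: "\<beta> = 1 / c" using \<beta> c by (simp add: field_simps)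
  have sub: "\<Omega> \<subseteq> closure \<Omega>" by (rule closure_subset)
  obtain y0 where y0: "y0 \<in> \<Omega>" using \<Omega>(4) by blast

  have roots: "{z. 4 * z\<^sup>2 * (of_real c * z + of_real \<alpha>) = of_real ((norm (\<tau> x))\<^sup>2)} = {Z1 x, Z2 x, Z3 x}" for x
    unfolding Z1 Z2 Z3 by (rule dual_roots_set[OF c]) simp
  have branch: "continuous_on \<Omega> (\<lambda>x. Re (Z x)) \<and> (\<forall>x\<in>\<Omega>. dual_root \<alpha> c ((norm (\<tau> x))\<^sup>2) (Re (Z x)))"
    if "Z \<in> {Z1, Z2, Z3}" "\<forall>x\<in>\<Omega>. Z x \<in> \<real>" for Z
    using real_root_fields[OF tau_nonzero, of Z] that unfolding Z1 Z2 Z3 by blast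
  have equi: "equilibrium (\<lambda>x. Re (Z x)) u"
    if Z: "Z \<in> {Z1, Z2, Z3}" and u: "dual_displacement \<Omega> \<Gamma>u x0 \<tau> Z u" for Z u
  proof -
    have "\<forall>x\<in>\<Omega>. Z x \<in> \<real>" using u by (simp add: dual_displacement_def)
    from branch[OF Z this] show ?thesis by (intro equilibrium_if_dual_displacement[OF u]) auto
  qed

  have part1: "(\<forall>x\<in>\<Omega>. {z. 4 * z\<^sup>2 * (of_real c * z + of_real \<alpha>) = of_real ((norm (\<tau> x))\<^sup>2)}
                   = {Z1 x, Z2 x, Z3 x})
          \<and> (\<forall>\<zeta>. dual_critical \<Omega> \<tau> Pd \<zeta> \<longrightarrow>
               (AE x in lebesgue_on \<Omega>. of_real (\<zeta> x) \<in> {Z1 x, Z2 x, Z3 x}))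
          \<and> (\<forall>Z\<in>{Z1, Z2, Z3}. (\<forall>x\<in>\<Omega>. Z x \<in> \<real>) \<longrightarrow> dual_critical \<Omega> \<tau> Pd (\<lambda>x. Re (Z x)))"
  proof (intro conjI allI impI ballI)
    fix \<zeta> assume "dual_critical \<Omega> \<tau> Pd \<zeta>"
    then have "AE x in lebesgue_on \<Omega>. dual_root \<alpha> c ((norm (\<tau> x))\<^sup>2) (\<zeta> x)"
      unfolding dual by (rule dual_critical_imp_root)
    then show "AE x in lebesgue_on \<Omega>. of_real (\<zeta> x) \<in> {Z1 x, Z2 x, Z3 x}"
    proof eventually_elim
      case (elim x)
      have "complex_of_real (4 * (\<zeta> x)\<^sup>2 * (c * \<zeta> x + \<alpha>)) = of_real ((norm (\<tau> x))\<^sup>2)" unfolding elim ..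
      then show ?case unfolding roots[symmetric] by simp
    qed
  next
    fix Z assume "Z \<in> {Z1, Z2, Z3}" "\<forall>x\<in>\<Omega>. Z x \<in> \<real>"
    from branch[OF this] show "dual_critical \<Omega> \<tau> Pd (\<lambda>x. Re (Z x))"
      unfolding dual by (intro dual_root_field(3)) auto
  qed (rule roots)

  have part2: "\<forall>(Z, u) \<in> {(Z1, u1), (Z2, u2), (Z3, u3)}.
            dual_displacement \<Omega> \<Gamma>u x0 \<tau> Z u \<longrightarrow> primal_critical P U u"
    unfolding primal U using primal_critical_equilibrium equi by auto

  have Z1_real: "Z1 x \<in> \<real>" "0 \<le> \<zeta>1 x" "- \<alpha> / c \<le> \<zeta>1 x" for x
    using cubic_root1_real[OF c, of "sqrt 2 * norm (\<tau> x)" \<alpha>] by (simp_all add: Z1 zeta)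
  have \<zeta>1: "continuous_on \<Omega> \<zeta>1" "\<And>x. x \<in> \<Omega> \<Longrightarrow> dual_root \<alpha> c ((norm (\<tau> x))\<^sup>2) (\<zeta>1 x)"
    using branch[of Z1] Z1_real(1) unfolding zeta by auto
  have S1: "\<zeta>1 \<in> S" "\<And>\<xi>. \<xi> \<in> S \<Longrightarrow> Pd \<xi> \<le> Pd \<zeta>1"
    using dual_maximizer_on_S[OF \<zeta>1 _ \<beta>] Z1_real(2,3) unfolding S dual by blast+
  have SUP1: "(SUP \<zeta>\<in>S. Pd \<zeta>) = Pd \<zeta>1" by (rule SUP_eq_attained[of \<zeta>1 S Pd, OF S1])
  have equi1: "equilibrium \<zeta>1 u1" "\<And>x. x \<in> \<Omega> \<Longrightarrow> 0 < \<zeta>1 x" if u: "dual_displacement \<Omega> \<Gamma>u x0 \<tau> Z1 u1"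
  proof -
    show e: "equilibrium \<zeta>1 u1" using equi[OF _ u] by (simp add: zeta)
    show "0 < \<zeta>1 x" if "x \<in> \<Omega>" for x
      using e Z1_real(2)[of x] that by (auto simp: equilibrium_def less_le)
  qed
  have min1: "is_arg_min P (\<lambda>u. u \<in> U) u1" "(INF u\<in>U. P u) = P u1" "P u1 = Pd \<zeta>1"
    if u: "dual_displacement \<Omega> \<Gamma>u x0 \<tau> Z1 u1"
  proof -
    have uU: "u1 \<in> U" using equi1(1)[OF u] by (simp add: equilibrium_def U)
    have le: "P u1 \<le> P v" if "v \<in> U" for v
      using equilibrium_minimizer(1)[OF equi1[OF u]] that unfolding primal U by blast
    show "is_arg_min P (\<lambda>u. u \<in> U) u1" by (rule is_arg_minI[of "\<lambda>u. u \<in> U" u1 P, OF uU le])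
    show "(INF u\<in>U. P u) = P u1" by (rule INF_eq_attained[of u1 U P, OF uU le])
    show "P u1 = Pd \<zeta>1" unfolding primal dual by (rule primal_eq_dual[OF equi1(1)[OF u]])
  qed
  have part3: "(\<forall>x\<in>\<Omega>. Z1 x \<in> \<real>)
          \<and> is_arg_max Pd (\<lambda>\<zeta>. \<zeta> \<in> S) \<zeta>1 \<and> (SUP \<zeta>\<in>S. Pd \<zeta>) = Pd \<zeta>1
          \<and> (dual_displacement \<Omega> \<Gamma>u x0 \<tau> Z1 u1 \<longrightarrow>
               is_arg_min P (\<lambda>u. u \<in> U) u1
               \<and> P u1 = (INF u\<in>U. P u) \<and> (INF u\<in>U. P u) = (SUP \<zeta>\<in>S. Pd \<zeta>))"
    using Z1_real(1) is_arg_maxI[of "\<lambda>\<zeta>. \<zeta> \<in> S" \<zeta>1 Pd, OF S1] SUP1 min1 by simp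

  have \<alpha>_pos: "0 < \<alpha>" if "0 < \<eta>"
  proof -
    have "0 < \<alpha> ^ 3" using that constants(7) c by (simp add: zero_less_divide_iff)
    then show ?thesis by (simp add: zero_less_power_eq)
  qed
  have \<alpha>_pos': "0 < \<alpha>" if "\<forall>x\<in>\<Omega>. (norm (\<tau> x))\<^sup>2 < \<eta>"
    using that y0 by (intro \<alpha>_pos) (meson le_less_trans zero_le_power2)
  have strict: "Z2 x \<in> \<real>" "dual_root \<alpha> c ((norm (\<tau> x))\<^sup>2) (\<zeta>2 x)" "- 2 * \<alpha> / (3 * c) < \<zeta>2 x" "\<zeta>2 x \<le> 0"
      "Z3 x \<in> \<real>" "dual_root \<alpha> c ((norm (\<tau> x))\<^sup>2) (\<zeta>3 x)" "- \<alpha> / c \<le> \<zeta>3 x" "\<zeta>3 x < - 2 * \<alpha> / (3 * c)"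
    if \<alpha>: "0 < \<alpha>" and x: "(norm (\<tau> x))\<^sup>2 < \<eta>" for x
  proof -
    have le: "(norm (\<tau> x))\<^sup>2 \<le> 16 * \<alpha> ^ 3 / (27 * c\<^sup>2)" using x constants(7) by simp
    note b = negative_branches[OF \<alpha> le]
    \<comment> \<open>The second and the third branch meet only at the critical point of the cubic, where
      \<open>|\<tau>|\<^sup>2\<close> would equal \<open>\<eta>\<close>.\<close>
    have ne: "z \<noteq> - 2 * \<alpha> / (3 * c)" if "dual_root \<alpha> c ((norm (\<tau> x))\<^sup>2) z" for z
      using dual_cubic_local_max_strict[OF c, of \<alpha> z] that x constants(7) by (simp add: dual_cubic_def)
    show "Z2 x \<in> \<real>" "dual_root \<alpha> c ((norm (\<tau> x))\<^sup>2) (\<zeta>2 x)" "\<zeta>2 x \<le> 0"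
      "Z3 x \<in> \<real>" "dual_root \<alpha> c ((norm (\<tau> x))\<^sup>2) (\<zeta>3 x)" "- \<alpha> / c \<le> \<zeta>3 x"
      using b by (simp_all add: Z2 Z3 zeta)
    show "- 2 * \<alpha> / (3 * c) < \<zeta>2 x" "\<zeta>3 x < - 2 * \<alpha> / (3 * c)"
      using b(3,8) ne[OF b(2)] ne[OF b(6)] unfolding zeta Z2 Z3 less_le by metis+
  qed
  have cont23: "continuous_on X \<zeta>2" "continuous_on X \<zeta>3"
    if "0 < \<alpha>" "X \<subseteq> closure \<Omega>" "\<forall>x\<in>X. (norm (\<tau> x))\<^sup>2 < \<eta>" for X
    using negative_branches_continuous[OF that(1,2)] that(3) constants(7) unfolding zeta Z2 Z3
    by (auto simp: less_imp_le)

  have part4: "(\<forall>x\<in>\<Omega>. (norm (\<tau> x))\<^sup>2 < \<eta>) \<longrightarrow>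
            (let S3 = {\<zeta> \<in> dual_domain \<Omega> \<tau>. \<forall>x\<in>\<Omega>. - \<alpha> * \<beta> < \<zeta> x \<and> \<zeta> x < - 2 * \<alpha> * \<beta> / 3} in
             (\<forall>x\<in>\<Omega>. Z3 x \<in> \<real>)
             \<and> is_arg_max Pd (\<lambda>\<zeta>. \<zeta> \<in> dual_domain \<Omega> \<tau> \<and>
                   (\<forall>x\<in>\<Omega>. - \<alpha> * \<beta> \<le> \<zeta> x \<and> \<zeta> x < - 2 * \<alpha> * \<beta> / 3)) \<zeta>3
             \<and> ((\<forall>x\<in>\<Omega>. \<tau> x \<noteq> 0) \<longrightarrow> is_arg_max Pd (\<lambda>\<zeta>. \<zeta> \<in> S3) \<zeta>3)
             \<and> bdd_above (Pd ` S3) \<and> (SUP \<zeta>\<in>S3. Pd \<zeta>) = Pd \<zeta>3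
             \<and> (dual_displacement \<Omega> \<Gamma>u x0 \<tau> Z3 u3 \<longrightarrow>
                 (\<exists>\<delta>. continuous_on \<Omega> \<delta> \<and> (\<forall>x\<in>\<Omega>. 0 < \<delta> x)
                    \<and> ((\<forall>x\<in>closure \<Omega>. (norm (\<tau> x))\<^sup>2 < \<eta>) \<longrightarrow> (\<exists>d>0. \<forall>x\<in>\<Omega>. d \<le> \<delta> x))
                    \<and> (let U3 = gradient_nbhd \<Omega> \<Gamma>u \<delta> u3 in
                        is_arg_max P (\<lambda>u. u \<in> U3) u3
                        \<and> P u3 = (SUP u\<in>U3. P u) \<and> (SUP u\<in>U3. P u) = (SUP \<zeta>\<in>S3. Pd \<zeta>)))))" (is "_ \<longrightarrow> ?C")
  proof
    assume small: "\<forall>x\<in>\<Omega>. (norm (\<tau> x))\<^sup>2 < \<eta>"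
    note \<alpha> = \<alpha>_pos'[OF small]
    define S3 where "S3 = {\<zeta> \<in> dual_domain \<Omega> \<tau>. \<forall>x\<in>\<Omega>. - \<alpha> / c < \<zeta> x \<and> \<zeta> x < - 2 * \<alpha> / (3 * c)}"
    have st: "Z3 x \<in> \<real>" "dual_root \<alpha> c ((norm (\<tau> x))\<^sup>2) (\<zeta>3 x)" "- \<alpha> / c \<le> \<zeta>3 x" "\<zeta>3 x < - 2 * \<alpha> / (3 * c)"
      if "x \<in> \<Omega>" for x using strict(5-8)[OF \<alpha>] small that by auto
    note cont = cont23(2)[OF \<alpha> sub small]
    note dom = dual_root_field(2)[OF cont st(2)]
    have le: "Pd \<xi> \<le> Pd \<zeta>3" if "\<xi> \<in> dual_domain \<Omega> \<tau>" "\<And>x. x \<in> \<Omega> \<Longrightarrow> \<xi> x < - 2 * \<alpha> / (3 * c)" for \<xi>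
      unfolding dual using that st(4)
      by (intro dual_maximizer_negative[OF cont st(2) \<alpha>]) (auto simp: less_imp_le)
    have max3: "is_arg_max Pd (\<lambda>\<zeta>. \<zeta> \<in> dual_domain \<Omega> \<tau> \<and>
                   (\<forall>x\<in>\<Omega>. - \<alpha> / c \<le> \<zeta> x \<and> \<zeta> x < - 2 * \<alpha> / (3 * c))) \<zeta>3"
      using dom st le by (intro is_arg_maxI) auto
    have max3': "is_arg_max Pd (\<lambda>\<zeta>. \<zeta> \<in> S3) \<zeta>3" if "\<forall>x\<in>\<Omega>. \<tau> x \<noteq> 0"
    proof (rule is_arg_maxI)
      have "- \<alpha> / c < \<zeta>3 x" if "x \<in> \<Omega>" for x
      proof -
        have "\<zeta>3 x \<noteq> - \<alpha> / c" using st(2)[OF that] \<open>\<forall>x\<in>\<Omega>. \<tau> x \<noteq> 0\<close> that c by auto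
        then show ?thesis using st(3)[OF that] by simp
      qed
      then show "\<zeta>3 \<in> S3" using dom st by (simp add: S3_def)
      show "Pd \<xi> \<le> Pd \<zeta>3" if "\<xi> \<in> S3" for \<xi> using that le by (simp add: S3_def)
    qed
    have SUP3: "bdd_above (Pd ` S3)" "(SUP \<zeta>\<in>S3. Pd \<zeta>) = Pd \<zeta>3"
      using dual_SUP_negative[OF cont st(2) \<alpha>] st(3,4) unfolding S3_def dual by auto
    \<comment> \<open>The radius of \<open>excess_energy_nonpos\<close>, written with \<open>|g|\<^sup>2 = c \<zeta>3 + \<alpha>\<close>. It is positive
      because \<open>4 (c \<zeta>3 + \<alpha>) < - 2 c \<zeta>3\<close> for \<open>\<zeta>3 < - 2 \<alpha> / (3 c)\<close>.\<close>
    define \<delta> where "\<delta> x = sqrt (- 2 * \<zeta>3 x / \<beta>) - 2 * sqrt (c * \<zeta>3 x + \<alpha>)" for x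
    have \<delta>_pos: "0 < \<delta> x" if "(norm (\<tau> x))\<^sup>2 < \<eta>" for x
    proof -
      note s3 = strict(7,8)[OF \<alpha> that]
      have "0 \<le> c * \<zeta>3 x + \<alpha>" using s3(1) c by (simp add: field_simps)
      moreover have "4 * (c * \<zeta>3 x + \<alpha>) < - 2 * \<zeta>3 x / \<beta>" using s3(2) c by (simp add: b_eq field_simps)
      ultimately have "sqrt (4 * (c * \<zeta>3 x + \<alpha>)) < sqrt (- 2 * \<zeta>3 x / \<beta>)" by (intro real_sqrt_less_mono)
      moreover have "sqrt (4 * (c * \<zeta>3 x + \<alpha>)) = 2 * sqrt (c * \<zeta>3 x + \<alpha>)" by (simp only: real_sqrt_mult) simp
      ultimately show ?thesis unfolding \<delta>_def by linarith
    qed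
    have \<delta>_cont: "continuous_on X \<delta>" if "X \<subseteq> closure \<Omega>" "\<forall>x\<in>X. (norm (\<tau> x))\<^sup>2 < \<eta>" for X
      unfolding \<delta>_def divide_inverse by (intro continuous_intros cont23(2)[OF \<alpha> that])
    have \<delta>_bound: "\<exists>d>0. \<forall>x\<in>\<Omega>. d \<le> \<delta> x" if cl: "\<forall>x\<in>closure \<Omega>. (norm (\<tau> x))\<^sup>2 < \<eta>"
    proof -
      have "closure \<Omega> \<noteq> {}" using y0 sub by blast
      then obtain y where "y \<in> closure \<Omega>" "\<forall>x\<in>closure \<Omega>. \<delta> y \<le> \<delta> x"
        using continuous_attains_inf[OF \<Omega>(7) _ \<delta>_cont[OF order_refl cl]] by blast
      then show ?thesis using \<delta>_pos[of y] cl sub by blast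
    qed
    have primal3: "is_arg_max P (\<lambda>u. u \<in> gradient_nbhd \<Omega> \<Gamma>u \<delta> u3) u3
        \<and> P u3 = (SUP u\<in>gradient_nbhd \<Omega> \<Gamma>u \<delta> u3. P u) \<and> (SUP u\<in>gradient_nbhd \<Omega> \<Gamma>u \<delta> u3. P u) = (SUP \<zeta>\<in>S3. Pd \<zeta>)"
      if u: "dual_displacement \<Omega> \<Gamma>u x0 \<tau> Z3 u3"
    proof -
      have e: "equilibrium \<zeta>3 u3" using equi[OF _ u] by (simp add: zeta)
      have mem: "u3 \<in> gradient_nbhd \<Omega> \<Gamma>u \<delta> u3"
        using e \<delta>_pos small by (auto simp: gradient_nbhd_def equilibrium_def intro!: AE_I2)
      have "P v \<le> P u3" if v: "v \<in> gradient_nbhd \<Omega> \<Gamma>u \<delta> u3" for v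
        unfolding primal
      proof (rule equilibrium_local(1)[OF e v])
        fix x w :: 'a assume x: "x \<in> \<Omega>" and w: "norm w < \<delta> x"
        have "\<zeta>3 x \<noteq> 0" "\<zeta>3 x \<le> 0" using e x st(4)[OF x] \<alpha> c by (auto simp: equilibrium_def intro: order_trans[OF less_imp_le])
        moreover have "norm (inverse (2 * \<zeta>3 x) *\<^sub>R \<tau> x) = sqrt (c * \<zeta>3 x + \<alpha>)"
          using norm_half_root[OF st(2)[OF x] \<open>\<zeta>3 x \<noteq> 0\<close>] by (metis norm_ge_zero real_sqrt_abs abs_of_nonneg)
        ultimately show "excess_energy \<beta> (\<zeta>3 x) (inverse (2 * \<zeta>3 x) *\<^sub>R \<tau> x) w \<le> 0"
          using w by (intro excess_energy_nonpos \<beta>_pos) (simp_all add: \<delta>_def)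
      qed
      note this' = SUP_eq_attained[of u3 _ P, OF mem this] is_arg_maxI[of "\<lambda>u. u \<in> gradient_nbhd \<Omega> \<Gamma>u \<delta> u3" u3 P, OF mem this]
      have "P u3 = Pd \<zeta>3" unfolding primal dual by (rule primal_eq_dual[OF e])
      then show ?thesis using this' SUP3(2) by simp
    qed
    show ?C
      unfolding ab S3_def[symmetric] Let_def
      using st(1) max3 max3' SUP3
      by (intro conjI impI exI[of _ \<delta>] ballI \<delta>_cont[OF sub small] \<delta>_bound primal3) (auto intro: \<delta>_pos small[rule_format])
  qed

  have part5: "DIM('a) = 1 \<and> (\<forall>x\<in>\<Omega>. (norm (\<tau> x))\<^sup>2 < \<eta>) \<longrightarrow>
            (let S2 = {\<zeta> \<in> dual_domain \<Omega> \<tau>. \<forall>x\<in>\<Omega>. - 2 * \<alpha> * \<beta> / 3 < \<zeta> x \<and> \<zeta> x < 0} in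
             (\<forall>x\<in>\<Omega>. Z2 x \<in> \<real>)
             \<and> is_arg_min Pd (\<lambda>\<zeta>. \<zeta> \<in> S2) \<zeta>2 \<and> (INF \<zeta>\<in>S2. Pd \<zeta>) = Pd \<zeta>2
             \<and> (dual_displacement \<Omega> \<Gamma>u x0 \<tau> Z2 u2 \<longrightarrow>
                 (\<exists>d>0. let U2 = gradient_nbhd \<Omega> \<Gamma>u (\<lambda>x. d) u2 in
                    is_arg_min P (\<lambda>u. u \<in> U2) u2
                    \<and> P u2 = (INF u\<in>U2. P u) \<and> (INF u\<in>U2. P u) = (INF \<zeta>\<in>S2. Pd \<zeta>))))" (is "_ \<longrightarrow> ?C")
  proof (intro impI, elim conjE)
    assume dim1: "DIM('a) = 1" and small: "\<forall>x\<in>\<Omega>. (norm (\<tau> x))\<^sup>2 < \<eta>"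
    note \<alpha> = \<alpha>_pos'[OF small]
    obtain k where k: "\<And>x. x \<in> \<Omega> \<Longrightarrow> \<tau> x = k"
      using divergence_zero_dim_1_constant[OF dim1 \<Omega>(1,2) \<tau>_div] by metis
    have k0: "k \<noteq> 0" using tau_nonzero k by auto
    have st: "Z2 x \<in> \<real>" "dual_root \<alpha> c ((norm (\<tau> x))\<^sup>2) (\<zeta>2 x)" "- 2 * \<alpha> / (3 * c) < \<zeta>2 x" "\<zeta>2 x < 0"
      if x: "x \<in> \<Omega>" for x
    proof -
      note s2 = strict(1-4)[OF \<alpha> small[rule_format, OF x]]
      show "Z2 x \<in> \<real>" "dual_root \<alpha> c ((norm (\<tau> x))\<^sup>2) (\<zeta>2 x)" "- 2 * \<alpha> / (3 * c) < \<zeta>2 x" using s2 by auto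
      have "\<zeta>2 x \<noteq> 0" using s2(2) k[OF x] k0 by auto
      then show "\<zeta>2 x < 0" using s2(4) by simp
    qed
    define S2 where "S2 = {\<zeta> \<in> dual_domain \<Omega> \<tau>. \<forall>x\<in>\<Omega>. - 2 * \<alpha> / (3 * c) < \<zeta> x \<and> \<zeta> x < 0}"
    note cont = cont23(1)[OF \<alpha> sub small]
    have mem: "\<zeta>2 \<in> S2" using dual_root_field(2)[OF cont st(2)] st by (simp add: S2_def)
    have le: "Pd \<zeta>2 \<le> Pd \<xi>" if "\<xi> \<in> S2" for \<xi>
      unfolding dual using that st(3)
      by (intro dual_minimizer_negative[OF cont st(2)]) (auto simp: S2_def less_imp_le)
    \<comment> \<open>In dimension one \<open>\<tau>\<close>, and with it \<open>\<zeta>2\<close>, is constant, so the radius of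
      \<open>excess_energy_nonneg_dim_1\<close> is the same at every point.\<close>
    define d where "d = 2 * sqrt (c * \<zeta>2 y0 + \<alpha>) - sqrt (- 2 * \<zeta>2 y0 / \<beta>)"
    have d: "0 < d"
    proof -
      have "0 \<le> - 2 * \<zeta>2 y0 / \<beta>" using st(4)[OF y0] \<beta>_pos by (intro divide_nonneg_pos) auto
      moreover have "- 2 * \<zeta>2 y0 / \<beta> < 4 * (c * \<zeta>2 y0 + \<alpha>)" using st(3)[OF y0] c by (simp add: b_eq field_simps)
      ultimately have "sqrt (- 2 * \<zeta>2 y0 / \<beta>) < sqrt (4 * (c * \<zeta>2 y0 + \<alpha>))" by (intro real_sqrt_less_mono)
      moreover have "sqrt (4 * (c * \<zeta>2 y0 + \<alpha>)) = 2 * sqrt (c * \<zeta>2 y0 + \<alpha>)" by (simp only: real_sqrt_mult) simp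
      ultimately show ?thesis unfolding d_def by linarith
    qed
    have primal2: "is_arg_min P (\<lambda>u. u \<in> gradient_nbhd \<Omega> \<Gamma>u (\<lambda>x. d) u2) u2
        \<and> P u2 = (INF u\<in>gradient_nbhd \<Omega> \<Gamma>u (\<lambda>x. d) u2. P u) \<and> (INF u\<in>gradient_nbhd \<Omega> \<Gamma>u (\<lambda>x. d) u2. P u) = (INF \<zeta>\<in>S2. Pd \<zeta>)"
      if u: "dual_displacement \<Omega> \<Gamma>u x0 \<tau> Z2 u2"
    proof -
      have e: "equilibrium \<zeta>2 u2" using equi[OF _ u] by (simp add: zeta)
      have m: "u2 \<in> gradient_nbhd \<Omega> \<Gamma>u (\<lambda>x. d) u2"
        using e d by (auto simp: gradient_nbhd_def equilibrium_def)
      have "P u2 \<le> P v" if v: "v \<in> gradient_nbhd \<Omega> \<Gamma>u (\<lambda>x. d) u2" for v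
        unfolding primal
      proof (rule equilibrium_local(2)[OF e v])
        fix x w :: 'a assume x: "x \<in> \<Omega>" and w: "norm w < d"
        have same: "\<zeta>2 x = \<zeta>2 y0" by (simp add: zeta Z2 k[OF x] k[OF y0])
        have "norm (inverse (2 * \<zeta>2 x) *\<^sub>R \<tau> x) = sqrt (c * \<zeta>2 x + \<alpha>)"
          using norm_half_root[OF st(2)[OF x]] st(4)[OF x] by (metis norm_ge_zero real_sqrt_abs abs_of_nonneg less_irrefl)
        then show "0 \<le> excess_energy \<beta> (\<zeta>2 x) (inverse (2 * \<zeta>2 x) *\<^sub>R \<tau> x) w"
          using w st(4)[OF x] by (intro excess_energy_nonneg_dim_1 dim1 \<beta>_pos) (simp_all add: d_def same)
      qed
      note this' = INF_eq_attained[of u2 _ P, OF m this] is_arg_minI[of "\<lambda>u. u \<in> gradient_nbhd \<Omega> \<Gamma>u (\<lambda>x. d) u2" u2 P, OF m this]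
      have "P u2 = Pd \<zeta>2" unfolding primal dual by (rule primal_eq_dual[OF e])
      then show ?thesis using this' INF_eq_attained[of \<zeta>2 S2 Pd, OF mem le] by simp
    qed
    show ?C
      unfolding ab S2_def[symmetric] Let_def
      by (intro conjI impI exI[of _ d] ballI d primal2 st(1) INF_eq_attained[of \<zeta>2 S2 Pd, OF mem le]
          is_arg_minI[of "\<lambda>\<zeta>. \<zeta> \<in> S2" \<zeta>2 Pd, OF mem le])
  qed

  have part6: "0 < \<eta> \<and> (\<forall>x\<in>\<Omega>. \<eta> < (norm (\<tau> x))\<^sup>2) \<longrightarrow>
            (\<forall>x\<in>\<Omega>. \<forall>z::real. 4 * z\<^sup>2 * (c * z + \<alpha>) = (norm (\<tau> x))\<^sup>2 \<longleftrightarrow> z = \<zeta>1 x)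
            \<and> dual_critical \<Omega> \<tau> Pd \<zeta>1
            \<and> (\<forall>\<zeta>. dual_critical \<Omega> \<tau> Pd \<zeta> \<longrightarrow> (AE x in lebesgue_on \<Omega>. \<zeta> x = \<zeta>1 x))
            \<and> (dual_displacement \<Omega> \<Gamma>u x0 \<tau> Z1 u1 \<longrightarrow>
                 is_arg_min P (\<lambda>u. u \<in> U) u1
                 \<and> (\<forall>v. is_arg_min P (\<lambda>u. u \<in> U) v \<longrightarrow> (\<forall>x\<in>closure \<Omega>. v x = u1 x))
                 \<and> (\<exists>g. continuous_on (closure \<Omega>) g \<and>
                       (\<forall>x\<in>\<Omega>. (u1 has_derivative (\<lambda>h. g x \<bullet> h)) (at x))))" (is "_ \<longrightarrow> ?C")
  proof (intro impI, elim conjE)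
    assume \<eta>: "0 < \<eta>" and large: "\<forall>x\<in>\<Omega>. \<eta> < (norm (\<tau> x))\<^sup>2"
    note \<alpha> = \<alpha>_pos[OF \<eta>]
    have unique: "4 * z\<^sup>2 * (c * z + \<alpha>) = (norm (\<tau> x))\<^sup>2 \<longleftrightarrow> z = \<zeta>1 x" if x: "x \<in> \<Omega>" for x z
    proof
      assume z: "4 * z\<^sup>2 * (c * z + \<alpha>) = (norm (\<tau> x))\<^sup>2"
      have "0 < z"
        by (rule dual_cubic_eq_large[OF c \<alpha>]) (use large x z constants(7) in \<open>simp add: dual_cubic_def\<close>)
      moreover have "- \<alpha> / c \<le> 0" using \<alpha> c by simp
      ultimately show "z = \<zeta>1 x"
        using inj_onD[OF inj_on_dual_cubic_positive[OF c, of \<alpha>], of z "\<zeta>1 x"] z \<zeta>1(2)[OF x] Z1_real(2,3)[of x]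
        by (simp add: dual_cubic_def)
    qed (use \<zeta>1(2)[OF x] in simp)
    have crit: "dual_critical \<Omega> \<tau> Pd \<zeta>1" unfolding dual by (rule dual_root_field(3)[OF \<zeta>1])
    have crit_unique: "AE x in lebesgue_on \<Omega>. \<zeta> x = \<zeta>1 x" if "dual_critical \<Omega> \<tau> Pd \<zeta>" for \<zeta>
      using dual_critical_imp_root[OF that[unfolded dual]] AE_space
      by eventually_elim (use unique in simp)
    have min_unique: "v x = u1 x" if u: "dual_displacement \<Omega> \<Gamma>u x0 \<tau> Z1 u1"
      and v: "is_arg_min P (\<lambda>u. u \<in> U) v" and x: "x \<in> closure \<Omega>" for v x
    proof (rule equilibrium_minimizer(2)[OF equi1[OF u] _ _ x])
      show vU: "v \<in> U_adm \<Omega> \<Gamma>u" using v by (simp add: is_arg_min_def U)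
      have "u1 \<in> U" using equi1(1)[OF u] by (simp add: equilibrium_def U)
      then have "\<not> P u1 < P v" "\<not> P v < P u1"
        using v min1(1)[OF u] by (auto simp: is_arg_min_def)
      then show "primal_functional \<Omega> \<Gamma>u t \<alpha> \<beta> \<beta>o v = primal_functional \<Omega> \<Gamma>u t \<alpha> \<beta> \<beta>o u1"
        unfolding primal by linarith
    qed
    have smooth: "\<exists>g. continuous_on (closure \<Omega>) g \<and> (\<forall>x\<in>\<Omega>. (u1 has_derivative (\<lambda>h. g x \<bullet> h)) (at x))"
      if u: "dual_displacement \<Omega> \<Gamma>u x0 \<tau> Z1 u1"
    proof (intro exI[of _ "\<lambda>x. inverse (2 * \<zeta>1 x) *\<^sub>R \<tau> x"] conjI ballI)
      show "(u1 has_derivative (\<lambda>h. (inverse (2 * \<zeta>1 x) *\<^sub>R \<tau> x) \<bullet> h)) (at x)" if "x \<in> \<Omega>" for x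
        using dual_displacement_derivative[OF u _ that] \<zeta>1(1) by (simp add: zeta)
      have "\<zeta>1 x \<noteq> 0" if x: "x \<in> closure \<Omega>" for x
      proof -
        have "\<eta> \<le> (norm (\<tau> x))\<^sup>2"
          using large by (intro continuous_ge_on_closure[OF continuous_on_T[OF order_refl] x]) (auto simp: less_imp_le)
        moreover have "dual_root \<alpha> c ((norm (\<tau> x))\<^sup>2) (\<zeta>1 x)"
          using Z1_real(1)[of x] unfolding zeta Z1 by (intro dual_root_Re c) auto
        ultimately show ?thesis using \<eta> by auto
      qed
      moreover have "continuous_on (closure \<Omega>) \<zeta>1"
        using positive_branch_continuous unfolding zeta Z1 .
      ultimately show "continuous_on (closure \<Omega>) (\<lambda>x. inverse (2 * \<zeta>1 x) *\<^sub>R \<tau> x)"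
        by (intro continuous_intros \<tau>c) auto
    qed
    show ?C
      using unique crit crit_unique min1(1) min_unique smooth by blast
  qed

  show ?thesis
    by (rule conjI[OF part1 conjI[OF part2 conjI[OF part3 conjI[OF part4 conjI[OF part5 part6]]]]])
qed

end
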